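(* Let $f\in\mathbb{Z}[t_1,\dots,t_n]$ ($n\geq 1$) be a nondegenerate quadratic form. Then its density $\delta(f)$ is a rational number.
   Context: $D_f\coloneqq f(\mathbb{Z}^n)\setminus\{0\}$. For $S\subset\mathbb{Z}$: $S$ is positive if it contains no negative integers, negative if it contains no positive integers, indefinite otherwise. The density of $S$ is $\lim_{N\to\infty}\#(S\cap[1,N])/N$, $\lim_{N\to\infty}\#(S\cap[-N,-1])/N$, or $\lim_{N\to\infty}\#(S\cap[-N,N])/(2N)$ according as $S$ is positive, negative or indefinite. $\delta(f)$ denotes the density of $D_f$. *)

theory Defs
  imports "HOL-Analysis.Analysis" "HOL-Library.Poly_Mapping"
begin

text \<open>
  An element of \<open>('n \<Rightarrow>\<^sub>0 nat) \<Rightarrow>\<^sub>0 int\<close> is a polynomial with integer coefficients in variables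
  \<open>t\<^sub>i\<close>, \<open>i :: 'n\<close>: it maps each exponent vector (monomial) to its coefficient. The number of
  variables is \<open>CARD('n) \<ge> 1\<close>.
\<close>

definition poly_eval :: "(('n::finite \<Rightarrow>\<^sub>0 nat) \<Rightarrow>\<^sub>0 int) \<Rightarrow> 'a::comm_ring_1 ^ 'n \<Rightarrow> 'a" where
  "poly_eval f x =
    (\<Sum>m \<in> Poly_Mapping.keys f.
       of_int (Poly_Mapping.lookup f m) * (\<Prod>i\<in>UNIV. (x $ i) ^ Poly_Mapping.lookup m i))"

definition quadratic_form :: "(('n::finite \<Rightarrow>\<^sub>0 nat) \<Rightarrow>\<^sub>0 int) \<Rightarrow> bool" where
  "quadratic_form f \<longleftrightarrow>
    (\<forall>m \<in> Poly_Mapping.keys f. (\<Sum>i\<in>UNIV. Poly_Mapping.lookup m i) = 2)"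

definition polar_form ::
  "(('n::finite \<Rightarrow>\<^sub>0 nat) \<Rightarrow>\<^sub>0 int) \<Rightarrow> rat ^ 'n \<Rightarrow> rat ^ 'n \<Rightarrow> rat" where
  "polar_form f x y = poly_eval f (x + y) - poly_eval f x - poly_eval f y"

text \<open>
  Nondegeneracy is that of the symmetric bilinear form on the rational vector space; the polar
  form is twice the form with Gram matrix that of \<open>f\<close>, which has the same radical.
\<close>

definition nondegenerate :: "(('n::finite \<Rightarrow>\<^sub>0 nat) \<Rightarrow>\<^sub>0 int) \<Rightarrow> bool" where
  "nondegenerate f \<longleftrightarrow> (\<forall>x. (\<forall>y. polar_form f x y = 0) \<longrightarrow> x = 0)"

definition nonzero_values :: "(('n::finite \<Rightarrow>\<^sub>0 nat) \<Rightarrow>\<^sub>0 int) \<Rightarrow> int set" where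
  "nonzero_values f = range (\<lambda>x :: int ^ 'n. poly_eval f x) - {0}"

definition positive_set :: "int set \<Rightarrow> bool" where
  "positive_set S \<longleftrightarrow> (\<forall>k\<in>S. \<not> k < 0)"

definition negative_set :: "int set \<Rightarrow> bool" where
  "negative_set S \<longleftrightarrow> (\<forall>k\<in>S. \<not> k > 0)"

definition density_ratio :: "int set \<Rightarrow> nat \<Rightarrow> real" where
  "density_ratio S N =
    (if positive_set S then real (card (S \<inter> {1..int N})) / real N
     else if negative_set S then real (card (S \<inter> {- int N..-1})) / real N
     else real (card (S \<inter> {- int N..int N})) / (2 * real N))"

text \<open>Meaningful only when the sequence \<open>density_ratio S\<close> converges.\<close>

definition int_density :: "int set \<Rightarrow> real" where
  "int_density S = lim (density_ratio S)"

definition form_density :: "(('n::finite \<Rightarrow>\<^sub>0 nat) \<Rightarrow>\<^sub>0 int) \<Rightarrow> real" where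
  "form_density f = int_density (nonzero_values f)"

end

theory Submission imports Defs "HOL-Number_Theory.Totient" begin

text \<open>
  Positive values are treated for the form and for its negative. The claim reduces to a dichotomy: for
  some modulus \<open>M\<close>, if \<open>s m\<^sub>0\<close> is a value, with \<open>s\<close> composed of primes dividing \<open>M\<close> and \<open>m\<^sub>0\<close> coprime
  to \<open>M\<close>, then \<open>s m\<close> is a value for all \<open>m \<equiv> m\<^sub>0\<close> modulo \<open>M\<close> outside a set of density zero. The density
  is then a sum of terms \<open>1/s\<close> over sets of \<open>s\<close> closed under multiplication by \<open>p\<^sup>2\<close>, \<open>p\<close> dividing \<open>M\<close>;
  by a chain condition such a sum is eventually geometric in every exponent, hence rational.

  For at least three variables the dichotomy follows from a second moment. Let \<open>r(d)\<close> be the number of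
  representations of \<open>d\<close> in a box of side \<open>P\<close>. For \<open>h\<close> divisible by \<open>K!\<close> and small compared with \<open>P\<^sup>2\<close> the
  correlations \<open>\<Sum> r(d) r(d)\<close> and \<open>\<Sum> r(d) r(d+h)\<close> differ by \<open>O(P\<^bsup>2n-2\<^esup>/K)\<close>: after fixing the difference
  of the two points they count lattice points on parallel hyperplanes, which can be translated into each
  other by a short vector unless the normal vector is exceptional. Hence \<open>r(d+h)\<close> is small on average over
  unrepresented \<open>d\<close>, whereas counting solutions of the congruence modulo a multiple of \<open>K!\<close> bounds its
  average over \<open>h\<close> from below.

  An isotropic binary form is \<open>x(ax+by)\<close>, and almost every \<open>m\<close> has a divisor in every class coprime to
  \<open>b\<close>. If an anisotropic binary form represents \<open>n\<close>, then interchanging the two roots of the form modulo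
  any subset of the primes exactly dividing \<open>n\<close> and applying Thue's lemma yields \<open>2\<^sup>k\<close> points in the box of
  side \<open>\<surd>n\<close> whose values are bounded multiples of \<open>n\<close>; as there are only \<open>O(N)\<close> such points, the values
  have density zero.
\<close>

section \<open>Lattice points on planes\<close>

text \<open>The obstacle is uniformity in \<open>K\<close>. The second moment saves a factor
  \<open>K\<close>, but the number of solutions modulo \<open>K!\<close> carries the factor \<phi> =
  \<open>totient Q2 / Q2\<close>, where \<open>Q2\<close> is the part of \<open>K!\<close> coprime
  to the fixed modulus, and Cauchy-Schwarz squares it; what remains is
  \<open>1 / (K \<phi>^2)\<close>. So \<phi> has to decay more slowly than \<open>K^(-1/2)\<close>.
  All primes above 3 are among the numbers \<open>6 j - 1\<close> and \<open>6 j + 1\<close>, and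
  the elementary product over these gives the exponent 1/3; this is why 2 and 3 are put into the
  modulus. The modulus \<open>48 |\<Delta>|\<close> consists of 6, of a factor 8 for lifting
  squares, and of a common denominator \<Delta> of the inverse Gram matrix, so that the form is
  nonsingular modulo all other primes. The range \<eta> P^2 of the shifts depends on
  \<open>K\<close> in an uncontrolled way; it cancels between the number of shifts and the lower
  bound for the average. For isotropic binary forms, classes of primes with convergent reciprocal
  sum are discarded, and a sieve shows that products of the remaining primes meet every unit
  class.\<close>

lemma card_le_fibres:
  assumes "finite B" "f ` A \<subseteq> B" and fib: "\<And>b. b \<in> B \<Longrightarrow> finite {a\<in>A. f a = b} \<and> real (card {a\<in>A. f a = b}) \<le> c"
  shows "finite A" "real (card A) \<le> c * real (card B)"
proof -
  have A: "A = (\<Union>b\<in>B. {a\<in>A. f a = b})" using assms(2) by auto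
  show fin: "finite A" by (subst A) (use assms fib in auto)
  have "card A \<le> (\<Sum>b\<in>B. card {a\<in>A. f a = b})"
    by (subst A, rule card_UN_le) (use assms in auto)
  hence "real (card A) \<le> (\<Sum>b\<in>B. real (card {a\<in>A. f a = b}))"
    by (metis of_nat_le_iff of_nat_sum)
  also have "\<dots> \<le> (\<Sum>b\<in>B. c)" by (rule sum_mono) (use fib in auto)
  finally show "real (card A) \<le> c * real (card B)" by (simp add: mult.commute)
qed

lemma card_congruent_le:
  fixes A :: "int set" and a b q :: int
  assumes "A \<subseteq> {a..b}" "a \<le> b" "q > 0" and cong: "\<And>x y. x \<in> A \<Longrightarrow> y \<in> A \<Longrightarrow> q dvd x - y"
  shows "real (card A) \<le> (b - a) / q + 1"
proof (cases "A = {}")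
  case True
  then show ?thesis using assms by (simp add: add_nonneg_nonneg)
next
  case False
  have fin: "finite A" using assms(1) finite_subset by blast
  define x0 where "x0 = Min A"
  have x0: "x0 \<in> A" "\<And>x. x \<in> A \<Longrightarrow> x0 \<le> x" using False fin by (auto simp: x0_def)
  have inj: "inj_on (\<lambda>x. (x - x0) div q) A"
  proof (rule inj_onI)
    fix x y assume xy: "x \<in> A" "y \<in> A" "(x - x0) div q = (y - x0) div q"
    have "q dvd x - x0" "q dvd y - x0" using cong x0 xy by auto
    then show "x = y" using xy(3) by (metis diff_add_cancel dvd_div_mult_self)
  qed
  have sub: "(\<lambda>x. (x - x0) div q) ` A \<subseteq> {0..(b - a) div q}"
  proof clarsimp
    fix x assume "x \<in> A"
    then have "0 \<le> x - x0" "x - x0 \<le> b - a" using x0 assms(1) by (auto, fastforce)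
    then show "0 \<le> (x - x0) div q \<and> (x - x0) div q \<le> (b - a) div q"
      using assms(3) by (simp add: pos_imp_zdiv_nonneg_iff zdiv_mono1)
  qed
  have "card A \<le> card {0..(b - a) div q}"
    using card_image[OF inj] card_mono[OF _ sub] by simp
  also have "\<dots> = nat ((b - a) div q + 1)" by simp
  finally have "int (card A) \<le> (b - a) div q + 1"
    using assms(2,3) pos_imp_zdiv_nonneg_iff[of q "b - a"] by linarith
  then have "real (card A) \<le> real_of_int ((b - a) div q) + 1" by linarith
  also have "real_of_int ((b - a) div q) \<le> (b - a) / q"
    using real_of_int_div4 by blast
  finally show ?thesis by simp
qed

text \<open>Since \<open>w3\<close> is nonzero, \<open>y\<close> determines \<open>z\<close>; and
  two admissible \<open>y\<close> differ by a multiple of \<open>|w3| / gcd w2 w3\<close>, which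
  leaves one residue class to count.\<close>

lemma card_line_le:
  fixes w2 w3 k P :: int
  assumes "w3 \<noteq> 0" "P \<ge> 0"
  shows "real (card {(y, z). \<bar>y\<bar> \<le> P \<and> \<bar>z\<bar> \<le> P \<and> w2 * y + w3 * z = k}) \<le> 2 * P * gcd w2 w3 / \<bar>w3\<bar> + 1"
    (is "real (card ?S) \<le> _")
proof -
  define d q where "d = gcd w2 w3" and "q = \<bar>w3\<bar> div d"
  have d: "d > 0" using assms by (simp add: d_def)
  have dq: "\<bar>w3\<bar> = d * q" unfolding q_def d_def by simp
  have q: "q > 0" using dq d assms(1) by (metis abs_ge_zero abs_eq_0 mult_pos_pos not_less less_le zero_less_mult_pos)
  have inj: "inj_on fst ?S" using assms(1) by (auto simp: inj_on_def)
  have cong: "q dvd y - y'" if "(y, z) \<in> ?S" "(y', z') \<in> ?S" for y z y' z'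
  proof -
    have "w2 * (y - y') = w3 * (z' - z)" using that by (auto simp: algebra_simps)
    then have "w3 dvd w2 * (y - y')" by simp
    then have *: "d * q dvd w2 * (y - y')" using dq by (metis abs_dvd_iff)
    obtain e where e: "w2 = d * e" unfolding d_def by (meson dvdE gcd_dvd1)
    have "q dvd e * (y - y')" using * d by (simp add: e mult.assoc)
    moreover have "coprime q e"
    proof -
      have "gcd w2 \<bar>w3\<bar> = d" by (simp add: d_def)
      then have "gcd (d * e) (d * q) = d" by (simp add: e dq)
      then have "d * gcd e q = d" using d by (simp add: gcd_mult_distrib_int[symmetric])
      then show ?thesis using d by (simp add: coprime_iff_gcd_eq_1 gcd.commute)
    qed
    ultimately show ?thesis by (simp add: coprime_dvd_mult_right_iff)
  qed
  have "real (card ?S) = real (card (fst ` ?S))" by (simp add: card_image[OF inj])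
  also have "\<dots> \<le> (P - (-P)) / q + 1"
  proof -
    have "real (card (fst ` ?S)) \<le> real_of_int (P - (-P)) / real_of_int q + 1"
      proof (rule card_congruent_le)
        fix x y assume "x \<in> fst ` ?S" "y \<in> fst ` ?S"
        then obtain p p' where p: "p \<in> ?S" "x = fst p" "p' \<in> ?S" "y = fst p'" by (elim imageE)
        then have "(x, snd p) \<in> ?S" "(y, snd p') \<in> ?S" by (simp_all only: prod.collapse)
        then show "q dvd x - y" by (rule cong)
      qed (use assms q in auto)
    then show ?thesis by simp
  qed
  also have "(P - (-P)) / q = 2 * P * d / \<bar>w3\<bar>"
  proof -
    have "real_of_int \<bar>w3\<bar> = d * q" using dq by (metis of_int_mult)
    then show ?thesis using d q by (simp add: field_simps)
  qed
  finally show ?thesis by (simp add: d_def)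
qed

lemma finite_line: "finite {(y::int, z::int). \<bar>y\<bar> \<le> P \<and> \<bar>z\<bar> \<le> P \<and> Q y z}"
  by (rule finite_subset[of _ "{-P..P} \<times> {-P..P}"]) auto

lemma card_slab_le:
  fixes w1 w2 w3 k P :: int
  assumes "w3 \<noteq> 0" "P \<ge> 0" "finite I"
  shows "real (card {(x, y, z). x \<in> I \<and> \<bar>y\<bar> \<le> P \<and> \<bar>z\<bar> \<le> P \<and> w1 * x + w2 * y + w3 * z = k})
     \<le> (2 * P * gcd w2 w3 / \<bar>w3\<bar> + 1) * card I" (is "real (card ?S) \<le> ?c * _")
proof (rule card_le_fibres(2)[where f = fst])
  fix b assume "b \<in> I"
  have eq: "{a \<in> ?S. fst a = b} = (\<lambda>(y, z). (b, y, z)) ` {(y, z). \<bar>y\<bar> \<le> P \<and> \<bar>z\<bar> \<le> P \<and> w2 * y + w3 * z = k - w1 * b}"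
    using \<open>b \<in> I\<close> by (auto simp: image_iff)
  have inj: "inj_on (\<lambda>(y, z). (b, y, z)) U" for U :: "(int \<times> int) set" by (auto simp: inj_on_def)
  show "finite {a \<in> ?S. fst a = b} \<and> real (card {a \<in> ?S. fst a = b}) \<le> ?c"
    unfolding eq card_image[OF inj] using card_line_le[OF assms(1,2)]
    by (intro conjI finite_imageI finite_line) blast
qed (use assms in auto)

text \<open>The coordinate \<open>x\<close> is confined to one class modulo
  \<open>gcd w2 w3 / g\<close>, and each \<open>x\<close> leaves one line. In the product of the two
  counts the secondary terms add up to at most \<open>5 P\<close>; the assumption
  \<open>|w3| <= c P\<close> absorbs them in the main term \<open>P^2 g / |w3|\<close>, hence the
  factor \<open>4 + 5 c\<close>.\<close>

lemma card_plane_le_ordered: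
  fixes w1 w2 w3 k P :: int
  assumes "w3 \<noteq> 0" "P \<ge> 1" "\<bar>w1\<bar> \<le> \<bar>w3\<bar>" "\<bar>w2\<bar> \<le> \<bar>w3\<bar>" "\<bar>w3\<bar> \<le> c * P" "g = gcd w1 (gcd w2 w3)"
  shows "real (card {(x, y, z). \<bar>x\<bar> \<le> P \<and> \<bar>y\<bar> \<le> P \<and> \<bar>z\<bar> \<le> P \<and> w1 * x + w2 * y + w3 * z = k})
     \<le> (4 + 5 * c) * (real_of_int P)^2 * g / \<bar>w3\<bar>" (is "real (card ?S) \<le> _")
proof -
  define d where "d = gcd w2 w3"
  define I where "I = {x. \<bar>x\<bar> \<le> P \<and> (\<exists>y z. w1 * x + w2 * y + w3 * z = k)}"
  have d: "d > 0" and g: "g > 0" using assms by (auto simp: d_def)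
  have gd: "g = gcd w1 d" using assms d_def by simp
  define q where "q = d div g"
  have dq: "d = g * q" unfolding q_def gd by simp
  have q: "q > 0" using d dq g by (metis zero_less_mult_pos)
  obtain e where e: "w1 = g * e" unfolding gd by (meson dvdE gcd_dvd1)
  have cop: "coprime q e"
  proof -
    have "gcd (g * e) (g * q) = g" using gd dq e by metis
    then have "g * gcd e q = g" using g by (simp add: gcd_mult_distrib_int[symmetric])
    then show ?thesis using g by (simp add: coprime_iff_gcd_eq_1 gcd.commute)
  qed
  have finI: "finite I" by (rule finite_subset[of _ "{-P..P}"]) (auto simp: I_def)
  have "real (card I) \<le> real_of_int (P - (-P)) / q + 1"
  proof (rule card_congruent_le)
    fix x x' assume "x \<in> I" "x' \<in> I"
    then obtain y z y' z' where "w1 * x + w2 * y + w3 * z = k" "w1 * x' + w2 * y' + w3 * z' = k"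
      by (auto simp: I_def)
    then have "w1 * (x - x') = w2 * (y' - y) + w3 * (z' - z)" by (simp add: algebra_simps)
    then have "d dvd w1 * (x - x')" by (simp add: d_def)
    then have "q dvd e * (x - x')" using g by (simp add: dq e mult.assoc)
    then show "q dvd x - x'" using cop by (simp add: coprime_dvd_mult_right_iff)
  qed (use assms q in \<open>auto simp: I_def\<close>)
  then have cI: "real (card I) \<le> 2 * P / q + 1" by simp
  have "?S = {(x, y, z). x \<in> I \<and> \<bar>y\<bar> \<le> P \<and> \<bar>z\<bar> \<le> P \<and> w1 * x + w2 * y + w3 * z = k}"
    by (auto simp: I_def)
  then have "real (card ?S) \<le> (2 * P * d / \<bar>w3\<bar> + 1) * card I"
    using card_slab_le[OF assms(1) _ finI, of P w1 w2 k] assms(2) by (simp add: d_def)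
  also have "\<dots> \<le> (2 * P * d / \<bar>w3\<bar> + 1) * (2 * P / q + 1)"
    by (rule mult_left_mono[OF cI]) (use assms d in auto)
  also have "\<dots> = 4 * (real_of_int P)^2 * g / \<bar>w3\<bar> + 2 * P * (d / \<bar>w3\<bar>) + 2 * P / q + 1"
  proof -
    have "real_of_int d = g * q" using dq by (metis of_int_mult)
    then show ?thesis using q assms(1) by (simp add: field_simps power2_eq_square)
  qed
  also have "\<dots> \<le> 4 * (real_of_int P)^2 * g / \<bar>w3\<bar> + 2 * P + 2 * P + P"
  proof -
    have "d \<le> \<bar>w3\<bar>" unfolding d_def using assms(1) by (simp add: zdvd_imp_le)
    then have a: "real_of_int d / \<bar>w3\<bar> \<le> 1" using assms(1) by (simp add: divide_le_eq)
    have b: "1 / real_of_int q \<le> 1" using q by simp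
    have "2 * P * (d / \<bar>w3\<bar>) \<le> 2 * P" using mult_left_mono[OF a, of "2*P"] assms by simp
    moreover have "2 * P / q \<le> 2 * P" using mult_left_mono[OF b, of "2*P"] assms by simp
    ultimately show ?thesis using assms(2) by linarith
  qed
  also have "\<dots> = 4 * (real_of_int P)^2 * g / \<bar>w3\<bar> + 5 * P" by simp
  also have "5 * P \<le> 5 * c * (real_of_int P)^2 * g / \<bar>w3\<bar>"
  proof -
    have w: "real_of_int \<bar>w3\<bar> \<le> c * real_of_int P" using assms(5) by (metis of_int_le_iff of_int_mult)
    also have "\<dots> \<le> c * real_of_int P * g"
    proof -
      have "c * real_of_int P \<ge> 0" using w by linarith
      then have "c * real_of_int P * 1 \<le> c * real_of_int P * g"
        by (rule mult_left_mono[rotated]) (use g in auto)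
      then show ?thesis by simp
    qed
    finally have "5 * P * real_of_int \<bar>w3\<bar> \<le> 5 * P * (c * real_of_int P * g)"
      by (rule mult_left_mono) (use assms in auto)
    then show ?thesis using assms(1) by (simp add: field_simps power2_eq_square)
  qed
  finally have "real (card ?S) \<le> 4 * (real_of_int P)^2 * g / \<bar>w3\<bar> + 5 * c * (real_of_int P)^2 * g / \<bar>w3\<bar>"
    by linarith
  then show ?thesis by (simp only: distrib_right add_divide_distrib)
qed

definition norm3 :: "int \<Rightarrow> int \<Rightarrow> int \<Rightarrow> int" where
  "norm3 a b c = max \<bar>a\<bar> (max \<bar>b\<bar> \<bar>c\<bar>)"

lemma norm3_cases: "norm3 a b c = \<bar>a\<bar> \<or> norm3 a b c = \<bar>b\<bar> \<or> norm3 a b c = \<bar>c\<bar>"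
  by (simp add: norm3_def max_def)

text \<open>Permuting the coordinates puts the entry of largest absolute value last, which is the
  situation of \<open>card_plane_le_ordered\<close>.\<close>

lemma card_plane_le:
  fixes w1 w2 w3 k P :: int
  assumes "norm3 w1 w2 w3 > 0" "P \<ge> 1" "norm3 w1 w2 w3 \<le> c * P" 
  shows "real (card {(x, y, z). \<bar>x\<bar> \<le> P \<and> \<bar>y\<bar> \<le> P \<and> \<bar>z\<bar> \<le> P \<and> w1 * x + w2 * y + w3 * z = k})
     \<le> (4 + 5 * c) * (real_of_int P)^2 * gcd w1 (gcd w2 w3) / norm3 w1 w2 w3" (is "real (card ?S) \<le> _")
proof -
  consider "norm3 w1 w2 w3 = \<bar>w3\<bar>" | "norm3 w1 w2 w3 = \<bar>w2\<bar>" | "norm3 w1 w2 w3 = \<bar>w1\<bar>"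
    using norm3_cases by metis
  then show ?thesis
  proof cases
    case 1
    then show ?thesis using card_plane_le_ordered[of w3 P w1 w2 c _ k] assms by (auto simp: norm3_def)
  next
    case 2
    have "?S = (\<lambda>(x, y, z). (x, z, y)) ` {(x, y, z). \<bar>x\<bar> \<le> P \<and> \<bar>y\<bar> \<le> P \<and> \<bar>z\<bar> \<le> P \<and> w1 * x + w3 * y + w2 * z = k}"
      by (auto simp: image_iff algebra_simps)
    moreover have "inj_on (\<lambda>(x, y, z). (x, z, y)) U" for U :: "(int \<times> int \<times> int) set" by (auto simp: inj_on_def)
    ultimately have "card ?S = card {(x, y, z). \<bar>x\<bar> \<le> P \<and> \<bar>y\<bar> \<le> P \<and> \<bar>z\<bar> \<le> P \<and> w1 * x + w3 * y + w2 * z = k}"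
      by (metis (no_types, lifting) card_image)
    moreover have "\<bar>w1\<bar> \<le> \<bar>w2\<bar>" "\<bar>w3\<bar> \<le> \<bar>w2\<bar>" using 2 unfolding norm3_def by linarith+
    ultimately show ?thesis using 2 card_plane_le_ordered[of w2 P w1 w3 c _ k] assms(2)
      assms(1,3)[unfolded 2] by (simp add: gcd.commute[of w3 w2])
  next
    case 3
    have "?S = (\<lambda>(x, y, z). (z, y, x)) ` {(x, y, z). \<bar>x\<bar> \<le> P \<and> \<bar>y\<bar> \<le> P \<and> \<bar>z\<bar> \<le> P \<and> w3 * x + w2 * y + w1 * z = k}"
      by (auto simp: image_iff algebra_simps)
    moreover have "inj_on (\<lambda>(x, y, z). (z, y, x)) U" for U :: "(int \<times> int \<times> int) set" by (auto simp: inj_on_def)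
    ultimately have "card ?S = card {(x, y, z). \<bar>x\<bar> \<le> P \<and> \<bar>y\<bar> \<le> P \<and> \<bar>z\<bar> \<le> P \<and> w3 * x + w2 * y + w1 * z = k}"
      by (metis (no_types, lifting) card_image)
    moreover have "gcd w3 (gcd w2 w1) = gcd w1 (gcd w2 w3)" by (metis gcd.left_commute gcd.commute)
    moreover have "\<bar>w3\<bar> \<le> \<bar>w1\<bar>" "\<bar>w2\<bar> \<le> \<bar>w1\<bar>" using 3 unfolding norm3_def by linarith+
    ultimately show ?thesis using 3 card_plane_le_ordered[of w1 P w3 w2 c _ k] assms(2)
      assms(1,3)[unfolded 3] by simp
  qed
qed

section \<open>Short solutions of a linear equation in three unknowns\<close>

lemma short_kernel_vector:
  fixes w1 w2 w3 R B a :: int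
  assumes w: "\<bar>w1\<bar> \<le> R" "\<bar>w2\<bar> \<le> R" "\<bar>w3\<bar> \<le> R" and a: "0 \<le> a" "a \<le> B"
    and big: "(a + 1) * (B + 1)^2 > 3 * R * B + 1"
  obtains c1 c2 c3 where "w1 * c1 + w2 * c2 + w3 * c3 = 0" "(c1, c2, c3) \<noteq> (0, 0, 0)"
    "\<bar>c1\<bar> \<le> a" "\<bar>c2\<bar> \<le> B" "\<bar>c3\<bar> \<le> B"
proof -
  \<comment> \<open>Pigeonhole as in Siegel's lemma, on a box that is narrower in the first
    direction: \<open>second_kernel_vector\<close> needs a kernel vector whose first entry stays
    below a prescribed bound. On the box the linear form takes values in an interval of length at
    most \<open>3 R B\<close>.\<close>
  define A where "A = {0..a} \<times> {0..B} \<times> {0..B}"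
  define \<phi> where "\<phi> = (\<lambda>(x, y, z). w1 * x + w2 * y + w3 * z)"
  define lo where "lo = min 0 w1 * a + min 0 w2 * B + min 0 w3 * B"
  define hi where "hi = max 0 w1 * a + max 0 w2 * B + max 0 w3 * B"
  have b: "min 0 w * m \<le> w * x \<and> w * x \<le> max 0 w * m" if "0 \<le> x" "x \<le> m" for w x m :: int
    using that mult_left_mono[of x m w] mult_left_mono_neg[of x m w] mult_nonneg_nonneg[of w x] mult_nonpos_nonneg[of w x]
    by (cases "w \<ge> 0") (auto simp: min_def max_def)
  have im: "\<phi> ` A \<subseteq> {lo..hi}"
  proof clarsimp
    fix x y z assume "(x, y, z) \<in> A"
    then show "lo \<le> \<phi> (x, y, z) \<and> \<phi> (x, y, z) \<le> hi"
      using b[of x a w1] b[of y B w2] b[of z B w3] unfolding A_def \<phi>_def lo_def hi_def by auto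
  qed
  have "hi - lo = \<bar>w1\<bar> * a + \<bar>w2\<bar> * B + \<bar>w3\<bar> * B" unfolding hi_def lo_def
    by (simp add: min_def max_def algebra_simps)
  also have "\<dots> \<le> R * B + R * B + R * B"
    by (intro add_mono mult_mono) (use w a in auto)
  finally have hl: "hi - lo \<le> 3 * R * B" by (simp add: mult.commute)
  have "int (card A) = (a + 1) * (B + 1)^2" using a
    by (simp add: A_def card_cartesian_product power2_eq_square)
  then have "int (card A) > 3 * R * B + 1" using big by simp
  moreover have "0 \<le> 3 * R * B + 1" using w(1) a by simp
  ultimately have "card A > card {lo..hi}" using hl by simp
  then have "\<not> inj_on \<phi> A" using im card_inj_on_le[of \<phi> A "{lo..hi}"] by auto
  then obtain p p' where "p \<in> A" "p' \<in> A" "p \<noteq> p'" "\<phi> p = \<phi> p'" unfolding inj_on_def by blast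
  moreover obtain x y z where "p = (x, y, z)" by (cases p)
  moreover obtain x' y' z' where "p' = (x', y', z')" by (cases p')
  ultimately have *: "(x, y, z) \<in> A" "(x', y', z') \<in> A" "(x, y, z) \<noteq> (x', y', z')"
    "\<phi> (x, y, z) = \<phi> (x', y', z')" by simp_all
  show ?thesis
    by (rule that[of "x - x'" "y - y'" "z - z'"]) (use * in \<open>auto simp: A_def \<phi>_def algebra_simps\<close>)
qed

text \<open>A kernel vector \<open>c\<close> is taken from a box whose first side is shorter than
  \<open>|b1|\<close>. Minimality of \<open>b\<close> gives \<open>norm3 c1 c2 c3 >= |b1|\<close>,
  hence both \<open>|b1| <= B\<close> and independence: a multiple of \<open>b\<close> would attain
  its norm in the first entry, which is at most \<open>|b1| - 1\<close>. The condition
  \<open>|b1| > T\<close> keeps the first side at least \<open>T\<close>, so that the pigeonhole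
  principle still applies.\<close>

lemma second_kernel_vector:
  fixes w1 w2 w3 R B T :: int
  assumes w: "\<bar>w1\<bar> \<le> R" "\<bar>w2\<bar> \<le> R" "\<bar>w3\<bar> \<le> R" and RT: "R \<ge> 1" "T \<ge> 1" "T \<le> B" "T * (B + 1) \<ge> 3 * R"
    and b: "\<bar>b2\<bar> \<le> \<bar>b1\<bar>" "\<bar>b3\<bar> \<le> \<bar>b1\<bar>" "\<bar>b1\<bar> > T"
    and min: "\<And>v1 v2 v3. w1 * v1 + w2 * v2 + w3 * v3 = 0 \<Longrightarrow> norm3 v1 v2 v3 < \<bar>b1\<bar> \<Longrightarrow> v1 = 0 \<and> v2 = 0 \<and> v3 = 0"
  shows "\<bar>b1\<bar> \<le> B \<and> (\<exists>c1 c2 c3. w1 * c1 + w2 * c2 + w3 * c3 = 0 \<and> norm3 c1 c2 c3 \<le> B \<and>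
     \<not> (b1 * c2 = b2 * c1 \<and> b1 * c3 = b3 * c1))"
proof -
  define a where "a = min (\<bar>b1\<bar> - 1) B"
  have a: "0 \<le> a" "a \<le> B" "a < \<bar>b1\<bar>" "T \<le> a" using b RT by (auto simp: a_def)
  have "3 * R * B + 1 \<le> 3 * R * (B + 1)" using RT by (simp add: algebra_simps)
  also have "\<dots> \<le> T * (B + 1) * (B + 1)" by (rule mult_right_mono) (use RT in auto)
  also have "\<dots> < (T + 1) * ((B + 1) * (B + 1))" using RT by (simp add: algebra_simps add_pos_nonneg)
  also have "\<dots> \<le> (a + 1) * (B + 1)^2" unfolding power2_eq_square
    by (rule mult_right_mono) (use a in auto)
  finally obtain c1 c2 c3 where c: "w1 * c1 + w2 * c2 + w3 * c3 = 0" "(c1, c2, c3) \<noteq> (0, 0, 0)"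
    "\<bar>c1\<bar> \<le> a" "\<bar>c2\<bar> \<le> B" "\<bar>c3\<bar> \<le> B" using short_kernel_vector[OF w a(1,2)] by metis
  have n: "norm3 c1 c2 c3 \<le> B" using c a by (auto simp: norm3_def)
  have nb: "norm3 c1 c2 c3 \<ge> \<bar>b1\<bar>" using min[OF c(1)] c(2) by force
  have "\<not> (b1 * c2 = b2 * c1 \<and> b1 * c3 = b3 * c1)"
  proof
    assume eq: "b1 * c2 = b2 * c1 \<and> b1 * c3 = b3 * c1"
    have "\<bar>b1\<bar> * \<bar>c2\<bar> \<le> \<bar>b1\<bar> * \<bar>c1\<bar>" "\<bar>b1\<bar> * \<bar>c3\<bar> \<le> \<bar>b1\<bar> * \<bar>c1\<bar>"
      using eq mult_right_mono[OF b(1), of "\<bar>c1\<bar>"] mult_right_mono[OF b(2), of "\<bar>c1\<bar>"]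
      by (simp_all add: abs_mult[symmetric])
    then have "\<bar>c2\<bar> \<le> \<bar>c1\<bar>" "\<bar>c3\<bar> \<le> \<bar>c1\<bar>" using b RT by (simp_all add: mult_le_cancel_left)
    then show False using nb c(3) a(3) by (simp add: norm3_def)
  qed
  then show ?thesis using c n nb by auto
qed

text \<open>An arbitrary solution is reduced modulo the lattice spanned by two short independent
  kernel vectors, by removing the integer parts of its coefficients. Only the first two entries can
  be expressed through \<open>b\<close> and \<open>c\<close>, since for nonzero \<open>h\<close> a
  solution lies off the kernel plane; the third entry is estimated later from the equation itself,
  where \<open>w3\<close> is large.\<close>

lemma short_solution:
  fixes w1 w2 w3 R B T h :: int
  assumes w: "\<bar>w1\<bar> \<le> R" "\<bar>w2\<bar> \<le> R" "\<bar>w3\<bar> \<le> R" and w3: "w3 \<noteq> 0"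
    and RT: "R \<ge> 1" "T \<ge> 1" "T \<le> B" "T * (B + 1) \<ge> 3 * R"
    and noshort: "\<And>v1 v2 v3. w1 * v1 + w2 * v2 + w3 * v3 = 0 \<Longrightarrow> norm3 v1 v2 v3 \<le> T \<Longrightarrow> v1 = 0 \<and> v2 = 0 \<and> v3 = 0"
    and h: "gcd w1 (gcd w2 w3) dvd h"
  obtains v1 v2 v3 where "w1 * v1 + w2 * v2 + w3 * v3 = h" "\<bar>v1\<bar> \<le> 2 * B" "\<bar>v2\<bar> \<le> 2 * B"
proof -
  define Ker where "Ker = {(v1, v2, v3). w1 * v1 + w2 * v2 + w3 * v3 = 0 \<and> (v1, v2, v3) \<noteq> (0, 0, 0)}"
  have "(w3, 0, - w1) \<in> Ker" using w3 by (simp add: Ker_def)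
  then have "\<exists>b. b \<in> Ker \<and> (\<forall>v. v \<in> Ker \<longrightarrow> (\<lambda>(x, y, z). nat (norm3 x y z)) b \<le> (\<lambda>(x, y, z). nat (norm3 x y z)) v)"
    by (rule ex_has_least_nat)
  then obtain b1 b2 b3 where bK: "(b1, b2, b3) \<in> Ker"
    and least: "\<And>v1 v2 v3. (v1, v2, v3) \<in> Ker \<Longrightarrow> nat (norm3 b1 b2 b3) \<le> nat (norm3 v1 v2 v3)" by auto
  have min: "v1 = 0 \<and> v2 = 0 \<and> v3 = 0" if "w1 * v1 + w2 * v2 + w3 * v3 = 0" "norm3 v1 v2 v3 < norm3 b1 b2 b3" for v1 v2 v3
  proof (rule ccontr)
    assume "\<not> ?thesis"
    then have "(v1, v2, v3) \<in> Ker" using that(1) unfolding Ker_def mem_Collect_eq prod.case by blast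
    moreover have "norm3 v1 v2 v3 \<ge> 0" by (simp add: norm3_def)
    ultimately show False using least[of v1 v2 v3] that(2) by linarith
  qed
  have bw: "w1 * b1 + w2 * b2 + w3 * b3 = 0" and b0: "(b1, b2, b3) \<noteq> (0, 0, 0)"
    using bK unfolding Ker_def mem_Collect_eq prod.case by blast+
  have bT: "norm3 b1 b2 b3 > T" using noshort[OF bw] b0 by (metis not_less)
  have swap: "norm3 x y z = norm3 y x z" and swap': "norm3 x y z = norm3 z y x" for x y z
    by (simp_all add: norm3_def max_def)
  have "norm3 b1 b2 b3 \<le> B \<and> (\<exists>c1 c2 c3. w1 * c1 + w2 * c2 + w3 * c3 = 0 \<and> norm3 c1 c2 c3 \<le> B \<and>
     \<not> (b1 * c2 = b2 * c1 \<and> b1 * c3 = b3 * c1 \<and> b2 * c3 = b3 * c2))"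
  proof -
    consider "norm3 b1 b2 b3 = \<bar>b1\<bar>" | "norm3 b1 b2 b3 = \<bar>b2\<bar>" | "norm3 b1 b2 b3 = \<bar>b3\<bar>"
      using norm3_cases by metis
    then show ?thesis
    proof cases
      case 1
      have le: "\<bar>b2\<bar> \<le> \<bar>b1\<bar>" "\<bar>b3\<bar> \<le> \<bar>b1\<bar>" using 1 unfolding norm3_def by linarith+
      have "\<bar>b1\<bar> \<le> B \<and> (\<exists>c1 c2 c3. w1 * c1 + w2 * c2 + w3 * c3 = 0 \<and> norm3 c1 c2 c3 \<le> B \<and>
         \<not> (b1 * c2 = b2 * c1 \<and> b1 * c3 = b3 * c1))"
        by (rule second_kernel_vector[OF w RT le bT[unfolded 1] min[unfolded 1]])
      then show ?thesis using 1 by metis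
    next
      case 2
      have le: "\<bar>b1\<bar> \<le> \<bar>b2\<bar>" "\<bar>b3\<bar> \<le> \<bar>b2\<bar>" using 2 unfolding norm3_def by linarith+
      have "\<bar>b2\<bar> \<le> B \<and> (\<exists>c1 c2 c3. w2 * c1 + w1 * c2 + w3 * c3 = 0 \<and> norm3 c1 c2 c3 \<le> B \<and>
         \<not> (b2 * c2 = b1 * c1 \<and> b2 * c3 = b3 * c1))"
      proof (rule second_kernel_vector[OF w(2,1,3) RT le])
        fix v1 v2 v3 assume "w2 * v1 + w1 * v2 + w3 * v3 = 0" "norm3 v1 v2 v3 < \<bar>b2\<bar>"
        then show "v1 = 0 \<and> v2 = 0 \<and> v3 = 0" using min[of v2 v1 v3] 2 swap[of v1 v2 v3] by (simp add: add.commute)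
      qed (use bT 2 in simp)
      then obtain c1 c2 c3 where "\<bar>b2\<bar> \<le> B" "w1 * c2 + w2 * c1 + w3 * c3 = 0" "norm3 c2 c1 c3 \<le> B"
         "\<not> (b2 * c2 = b1 * c1 \<and> b2 * c3 = b3 * c1)" using swap by (metis add.commute)
      then show ?thesis using 2 by metis
    next
      case 3
      have le: "\<bar>b2\<bar> \<le> \<bar>b3\<bar>" "\<bar>b1\<bar> \<le> \<bar>b3\<bar>" using 3 unfolding norm3_def by linarith+
      have "\<bar>b3\<bar> \<le> B \<and> (\<exists>c1 c2 c3. w3 * c1 + w2 * c2 + w1 * c3 = 0 \<and> norm3 c1 c2 c3 \<le> B \<and>
         \<not> (b3 * c2 = b2 * c1 \<and> b3 * c3 = b1 * c1))"
      proof (rule second_kernel_vector[OF w(3,2,1) RT le])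
        fix v1 v2 v3 assume "w3 * v1 + w2 * v2 + w1 * v3 = 0" "norm3 v1 v2 v3 < \<bar>b3\<bar>"
        then show "v1 = 0 \<and> v2 = 0 \<and> v3 = 0" using min[of v3 v2 v1] 3 swap'[of v1 v2 v3]
          by (simp add: add_ac)
      qed (use bT 3 in simp)
      then obtain c1 c2 c3 where "\<bar>b3\<bar> \<le> B" "w1 * c3 + w2 * c2 + w3 * c1 = 0" "norm3 c3 c2 c1 \<le> B"
         "\<not> (b3 * c2 = b2 * c1 \<and> b3 * c3 = b1 * c1)" using swap' by (metis add.commute add.left_commute)
      then show ?thesis using 3 by metis
    qed
  qed
  then obtain c1 c2 c3 where bB: "norm3 b1 b2 b3 \<le> B" and cw: "w1 * c1 + w2 * c2 + w3 * c3 = 0"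
    and cB: "norm3 c1 c2 c3 \<le> B" and indep: "\<not> (b1 * c2 = b2 * c1 \<and> b1 * c3 = b3 * c1 \<and> b2 * c3 = b3 * c2)" by auto
  \<comment> \<open>The kernel projects injectively to the first two coordinates because
    \<open>w3\<close> is nonzero, so the independence of \<open>b\<close> and \<open>c\<close>
    survives in this minor.\<close>
  define D where "D = b1 * c2 - b2 * c1"
  have D: "D \<noteq> 0"
  proof
    assume D0: "D = 0"
    have "w3 * (b1 * c3 - b3 * c1) = - w2 * D" "w3 * (b2 * c3 - b3 * c2) = w1 * D"
      using bw cw unfolding D_def by algebra+
    then show False using D0 w3 indep by (simp add: D_def)
  qed
  obtain x y where "x * w2 + y * w3 = gcd w2 w3" using bezout_int by blast
  moreover obtain x' y' where "x' * w1 + y' * gcd w2 w3 = gcd w1 (gcd w2 w3)" using bezout_int by blast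
  moreover obtain k where "h = gcd w1 (gcd w2 w3) * k" using h by (rule dvdE)
  ultimately have "h = (x' * w1 + y' * (x * w2 + y * w3)) * k" by simp
  then have "h = w1 * (x' * k) + w2 * (y' * x * k) + w3 * (y' * y * k)" by (simp add: algebra_simps)
  then obtain u1 u2 u3 where u: "w1 * u1 + w2 * u2 + w3 * u3 = h" by metis
  define \<alpha> \<beta> where "\<alpha> = real_of_int (u1 * c2 - u2 * c1) / D" and "\<beta> = real_of_int (b1 * u2 - b2 * u1) / D"
  have rep1: "u1 = \<alpha> * b1 + \<beta> * c1" and rep2: "u2 = \<alpha> * b2 + \<beta> * c2"
    unfolding \<alpha>_def \<beta>_def using D by (simp_all add: field_simps) (simp_all add: D_def algebra_simps)
  define v where "v = (\<lambda>u b c. u - \<lfloor>\<alpha>\<rfloor> * b - \<lfloor>\<beta>\<rfloor> * c)"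
  have bound: "\<bar>v u b c\<bar> \<le> 2 * B" if "u = \<alpha> * b + \<beta> * c" "\<bar>b\<bar> \<le> B" "\<bar>c\<bar> \<le> B" for u b c
  proof -
    have "real_of_int (v u b c) = frac \<alpha> * b + frac \<beta> * c"
      using that(1) by (simp add: v_def frac_def algebra_simps)
    then have "\<bar>real_of_int (v u b c)\<bar> \<le> frac \<alpha> * \<bar>b\<bar> + frac \<beta> * \<bar>c\<bar>"
      using abs_triangle_ineq[of "frac \<alpha> * b" "frac \<beta> * c"] by (simp add: abs_mult)
    also have "\<dots> \<le> 1 * real_of_int \<bar>b\<bar> + 1 * real_of_int \<bar>c\<bar>"
      by (intro add_mono mult_right_mono) (auto simp: frac_lt_1 less_imp_le)
    also have "\<dots> \<le> 2 * B" using that by linarith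
    finally show ?thesis by linarith
  qed
  show ?thesis
  proof (rule that[of "v u1 b1 c1" "v u2 b2 c2" "v u3 b3 c3"])
    show "w1 * v u1 b1 c1 + w2 * v u2 b2 c2 + w3 * v u3 b3 c3 = h"
    proof -
      have "w1 * v u1 b1 c1 + w2 * v u2 b2 c2 + w3 * v u3 b3 c3 =
        (w1 * u1 + w2 * u2 + w3 * u3) - \<lfloor>\<alpha>\<rfloor> * (w1 * b1 + w2 * b2 + w3 * b3) - \<lfloor>\<beta>\<rfloor> * (w1 * c1 + w2 * c2 + w3 * c3)"
        by (simp add: v_def algebra_simps)
      then show ?thesis by (simp add: u bw cw)
    qed
  qed (use bound[OF rep1] bound[OF rep2] bB cB in \<open>auto simp: norm3_def\<close>)
qed

section \<open>Comparing the numbers of points on parallel planes\<close>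

definition plane_points :: "int set \<Rightarrow> int set \<Rightarrow> int set \<Rightarrow> int \<Rightarrow> int \<Rightarrow> int \<Rightarrow> int \<Rightarrow> (int \<times> int \<times> int) set" where
  "plane_points I J L w1 w2 w3 k = {(x, y, z). x \<in> I \<and> y \<in> J \<and> z \<in> L \<and> w1 * x + w2 * y + w3 * z = k}"

lemma finite_plane_points: "finite I \<Longrightarrow> finite J \<Longrightarrow> finite L \<Longrightarrow> finite (plane_points I J L w1 w2 w3 k)"
  by (rule finite_subset[of _ "I \<times> J \<times> L"]) (auto simp: plane_points_def)

lemma card_plane_points_mono:
  "I \<subseteq> I' \<Longrightarrow> J \<subseteq> J' \<Longrightarrow> L \<subseteq> L' \<Longrightarrow> finite I' \<Longrightarrow> finite J' \<Longrightarrow> finite L' \<Longrightarrow>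
    card (plane_points I J L w1 w2 w3 k) \<le> card (plane_points I' J' L' w1 w2 w3 k)"
  by (rule card_mono[OF finite_plane_points]) (auto simp: plane_points_def)

lemma card_plane_points_swap12: "card (plane_points I J L w1 w2 w3 k) = card (plane_points J I L w2 w1 w3 k)"
proof -
  have "plane_points I J L w1 w2 w3 k = (\<lambda>(x, y, z). (y, x, z)) ` plane_points J I L w2 w1 w3 k"
    by (auto simp: plane_points_def image_iff algebra_simps)
  moreover have "inj_on (\<lambda>(x, y, z). (y, x, z)) (plane_points J I L w2 w1 w3 k)" by (auto simp: inj_on_def)
  ultimately show ?thesis by (simp add: card_image)
qed

lemma card_plane_points_swap13: "card (plane_points I J L w1 w2 w3 k) = card (plane_points L J I w3 w2 w1 k)"
proof -
  have "plane_points I J L w1 w2 w3 k = (\<lambda>(x, y, z). (z, y, x)) ` plane_points L J I w3 w2 w1 k"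
    by (auto simp: plane_points_def image_iff algebra_simps)
  moreover have "inj_on (\<lambda>(x, y, z). (z, y, x)) (plane_points L J I w3 w2 w1 k)" by (auto simp: inj_on_def)
  ultimately show ?thesis by (simp add: card_image)
qed

lemma card_escape_le: "card {x\<in>{l..u}. x + v \<notin> {l..u}} \<le> nat \<bar>v :: int\<bar>"
proof (cases "v \<ge> 0")
  case True
  have "card {x\<in>{l..u}. x + v \<notin> {l..u}} \<le> card {u - v<..u}" by (rule card_mono) (use True in auto)
  then show ?thesis using True by simp
next
  case False
  have "card {x\<in>{l..u}. x + v \<notin> {l..u}} \<le> card {l..<l - v}" by (rule card_mono) (use False in auto)
  then show ?thesis using False by simp
qed

text \<open>A small \<open>gcd w2 w3\<close> and a \<open>w3\<close> of order \<open>P\<close> leave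
  a bounded number of points for each value of \<open>x\<close>. This controls the points that a
  translation pushes out of the box.\<close>

lemma card_plane_points_slab:
  fixes w1 w2 w3 k P :: int and \<delta> G m :: real
  assumes "I \<subseteq> {-P..P}" "J \<subseteq> {-P..P}" "L \<subseteq> {-P..P}" "I' \<subseteq> I" "w3 \<noteq> 0" "P \<ge> 1"
    "\<bar>w3\<bar> \<ge> \<delta> * P" "\<delta> > 0" "gcd w2 w3 \<le> G" "real (card I') \<le> m"
  shows "real (card (plane_points I' J L w1 w2 w3 k)) \<le> (2 * G / \<delta> + 1) * m"
proof -
  have fin: "finite I'" using assms(1,4) finite_subset by (metis finite_atLeastAtMost_int)
  have G: "0 \<le> G" using assms(9) gcd_ge_0_int by (metis of_int_0_le_iff order_trans)
  have "real (card (plane_points I' J L w1 w2 w3 k)) \<le> real (card {(x, y, z). x \<in> I' \<and> \<bar>y\<bar> \<le> P \<and> \<bar>z\<bar> \<le> P \<and> w1 * x + w2 * y + w3 * z = k})"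
  proof -
    have "finite {(x, y, z). x \<in> I' \<and> \<bar>y\<bar> \<le> P \<and> \<bar>z\<bar> \<le> P \<and> w1 * x + w2 * y + w3 * z = k}"
      by (rule finite_subset[of _ "I' \<times> {-P..P} \<times> {-P..P}"]) (use fin in auto)
    then show ?thesis using assms(1-4) by (intro of_nat_mono card_mono) (auto simp: plane_points_def abs_le_iff subset_iff)
  qed
  also have "\<dots> \<le> (2 * P * gcd w2 w3 / \<bar>w3\<bar> + 1) * card I'"
    by (rule card_slab_le) (use assms fin in auto)
  also have "\<dots> \<le> (2 * G / \<delta> + 1) * m"
  proof (intro mult_mono add_mono)
    have "2 * P * real_of_int (gcd w2 w3) / \<bar>w3\<bar> \<le> 2 * P * G / (\<delta> * P)"
      by (rule frac_le) (use assms G in \<open>auto intro!: mult_left_mono\<close>)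
    then show "real_of_int (2 * P * gcd w2 w3) / \<bar>w3\<bar> \<le> 2 * G / \<delta>" using assms(6) by simp
  qed (use assms G in auto)
  finally show ?thesis .
qed

text \<open>Translation by \<open>v\<close> carries the plane at height \<open>k\<close> into the
  plane at height \<open>k + h\<close>. A point is lost when one of its coordinates leaves its
  interval; this coordinate then has at most \<open>m\<close> possible values, so the lost points
  lie in three thin slabs.\<close>

lemma plane_points_shift_defect:
  fixes w1 w2 w3 P :: int and \<delta> G m :: real
  assumes IJL: "I = {l1..u1}" "J = {l2..u2}" "L = {l3..u3}"
    and sub: "I \<subseteq> {-P..P}" "J \<subseteq> {-P..P}" "L \<subseteq> {-P..P}" and P: "P \<ge> 1"
    and w: "\<bar>w1\<bar> \<ge> \<delta> * P" "\<bar>w2\<bar> \<ge> \<delta> * P" "\<bar>w3\<bar> \<ge> \<delta> * P" "\<delta> > 0"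
    and gcd: "gcd w1 w2 \<le> G" "gcd w1 w3 \<le> G" "gcd w2 w3 \<le> G"
    and v: "w1 * v1 + w2 * v2 + w3 * v3 = h" "\<bar>v1\<bar> \<le> m" "\<bar>v2\<bar> \<le> m" "\<bar>v3\<bar> \<le> m"
  shows "real (card (plane_points I J L w1 w2 w3 k)) - real (card (plane_points I J L w1 w2 w3 (k + h)))
     \<le> 3 * (2 * G / \<delta> + 1) * m"
proof -
  define I' J' L' where "I' = {x\<in>I. x + v1 \<notin> I}" and "J' = {x\<in>J. x + v2 \<notin> J}" and "L' = {x\<in>L. x + v3 \<notin> L}"
  have fin: "finite I" "finite J" "finite L" by (simp_all add: IJL)
  have w0: "w1 \<noteq> 0" "w2 \<noteq> 0" "w3 \<noteq> 0" 
  proof -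
    have "\<delta> * P > 0" using w(4) P by simp
    then show "w1 \<noteq> 0" "w2 \<noteq> 0" "w3 \<noteq> 0" using w by auto
  qed
  define Y where "Y = {(x, y, z) \<in> plane_points I J L w1 w2 w3 k. x + v1 \<in> I \<and> y + v2 \<in> J \<and> z + v3 \<in> L}"
  have "plane_points I J L w1 w2 w3 k \<subseteq>
      Y \<union> (plane_points I' J L w1 w2 w3 k \<union> (plane_points I J' L w1 w2 w3 k \<union> plane_points I J L' w1 w2 w3 k))"
    by (auto simp: plane_points_def Y_def I'_def J'_def L'_def)
  moreover have "finite Y" unfolding Y_def by (rule finite_subset[OF _ finite_plane_points[OF fin]]) auto
  moreover have fin': "finite I'" "finite J'" "finite L'" using fin by (auto simp: I'_def J'_def L'_def)
  ultimately have "card (plane_points I J L w1 w2 w3 k) \<le>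
      card (Y \<union> (plane_points I' J L w1 w2 w3 k \<union> (plane_points I J' L w1 w2 w3 k \<union> plane_points I J L' w1 w2 w3 k)))"
    by (intro card_mono) (use fin in \<open>auto intro: finite_plane_points\<close>)
  also have "\<dots> \<le> card Y + (card (plane_points I' J L w1 w2 w3 k) + (card (plane_points I J' L w1 w2 w3 k) + card (plane_points I J L' w1 w2 w3 k)))"
    by (meson add_le_mono card_Un_le le_refl order_trans)
  finally have main: "card (plane_points I J L w1 w2 w3 k) \<le> \<dots>" .
  have "card Y \<le> card (plane_points I J L w1 w2 w3 (k + h))"
  proof (rule card_inj_on_le[where f = "\<lambda>(x, y, z). (x + v1, y + v2, z + v3)"])
    show "(\<lambda>(x, y, z). (x + v1, y + v2, z + v3)) ` Y \<subseteq> plane_points I J L w1 w2 w3 (k + h)"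
      using v(1) by (auto simp: Y_def plane_points_def algebra_simps)
  qed (use fin in \<open>auto simp: inj_on_def intro: finite_plane_points\<close>)
  moreover have "real (card (plane_points I' J L w1 w2 w3 k)) \<le> (2 * G / \<delta> + 1) * m"
  proof (rule card_plane_points_slab[OF sub _ w0(3) P w(3,4) gcd(3)])
    show "real (card I') \<le> m" using card_escape_le[of l1 u1 v1] v(2) unfolding I'_def IJL by linarith
  qed (auto simp: I'_def)
  moreover have "real (card (plane_points I J' L w1 w2 w3 k)) \<le> (2 * G / \<delta> + 1) * m"
    unfolding card_plane_points_swap12[of I]
  proof (rule card_plane_points_slab[OF sub(2,1,3) _ w0(3) P w(3,4) gcd(2)])
    show "real (card J') \<le> m" using card_escape_le[of l2 u2 v2] v(3) unfolding J'_def IJL by linarith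
  qed (auto simp: J'_def)
  moreover have "real (card (plane_points I J L' w1 w2 w3 k)) \<le> (2 * G / \<delta> + 1) * m"
    unfolding card_plane_points_swap13[of I]
  proof (rule card_plane_points_slab[OF sub(3,2,1) _ w0(1) P w(1,4)])
    show "real (card L') \<le> m" using card_escape_le[of l3 u3 v3] v(4) unfolding L'_def IJL by linarith
    show "gcd w2 w1 \<le> G" using gcd(1) by (simp add: gcd.commute)
  qed (auto simp: L'_def)
  moreover have "3 * (2 * G / \<delta> + 1) * m = (2 * G / \<delta> + 1) * m + (2 * G / \<delta> + 1) * m + (2 * G / \<delta> + 1) * m" by simp
  ultimately show ?thesis using main by linarith
qed

text \<open>The normals for which translation works. Large entries and small pairwise gcds bound the
  number of points per line; the absence of kernel vectors of norm up to \<open>T\<close> makes the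
  kernel lattice so round that it has two independent vectors of norm O(P / T + T), which is the
  order of the translation.\<close>

definition generic :: "real \<Rightarrow> real \<Rightarrow> int \<Rightarrow> int \<Rightarrow> int \<times> int \<times> int \<Rightarrow> bool" where
  "generic \<delta> G T P = (\<lambda>(w1, w2, w3). \<bar>w1\<bar> \<ge> \<delta> * P \<and> \<bar>w2\<bar> \<ge> \<delta> * P \<and> \<bar>w3\<bar> \<ge> \<delta> * P \<and>
     gcd w1 w2 \<le> G \<and> gcd w1 w3 \<le> G \<and> gcd w2 w3 \<le> G \<and>
     (\<forall>v1 v2 v3. w1 * v1 + w2 * v2 + w3 * v3 = 0 \<longrightarrow> norm3 v1 v2 v3 \<le> T \<longrightarrow> v1 = 0 \<and> v2 = 0 \<and> v3 = 0))"

lemma generic_defect: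
  fixes c :: int and \<delta> G \<epsilon> :: real
  assumes "c \<ge> 1" "\<delta> > 0" "\<epsilon> > 0" "G \<ge> 0"
  obtains T \<eta> P0 where "T \<ge> 1" "\<eta> > 0" "\<And>P w1 w2 w3 h l1 u1 l2 u2 l3 u3 k.
     P \<ge> P0 \<Longrightarrow> P \<ge> 1 \<Longrightarrow> norm3 w1 w2 w3 \<le> c * P \<Longrightarrow> generic \<delta> G T P (w1, w2, w3) \<Longrightarrow> 
     gcd w1 (gcd w2 w3) dvd h \<Longrightarrow> \<bar>real_of_int h\<bar> \<le> \<eta> * (real_of_int P)^2 \<Longrightarrow> 
     {l1..u1} \<subseteq> {-P..P} \<Longrightarrow> {l2..u2} \<subseteq> {-P..P} \<Longrightarrow> {l3..u3} \<subseteq> {-P..P} \<Longrightarrow>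
     real (card (plane_points {l1..u1} {l2..u2} {l3..u3} w1 w2 w3 k)) - 
     real (card (plane_points {l1..u1} {l2..u2} {l3..u3} w1 w2 w3 (k + h))) \<le> \<epsilon> * P"
proof -
  \<comment> \<open>\<open>A\<close> is the slab factor of \<open>plane_points_shift_defect\<close>,
    and \<open>D B + \<eta> P / \<delta>\<close> bounds the translation in terms of the bound
    \<open>B\<close> for the kernel vectors. With \<open>B\<close> about
    \<open>3 c P / T + T\<close>, three terms result, which are made at most
    \<open>\<epsilon> P / 3\<close> by the choice of \<open>T\<close>, of \<open>P0\<close> and of
    \<open>\<eta>\<close> respectively.\<close>
  define A where "A = 3 * (2 * G / \<delta> + 1)"
  have A: "A > 0" using assms by (auto simp: A_def intro!: add_nonneg_pos)
  define D where "D = 2 + 4 * c / \<delta>"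
  have D: "D > 0" using assms by (auto simp: D_def intro!: add_pos_nonneg)
  define T where "T = max 1 \<lceil>3 * (A * D * 3 * c) / \<epsilon>\<rceil>"
  have T: "T \<ge> 1" "A * D * (3 * c) / T \<le> \<epsilon> / 3"
  proof -
    show T1: "T \<ge> 1" by (simp add: T_def)
    have "3 * (A * D * 3 * c) / \<epsilon> \<le> T" unfolding T_def by linarith
    then show "A * D * (3 * c) / T \<le> \<epsilon> / 3" using T1 assms(3) by (simp add: field_simps)
  qed
  define \<eta> where "\<eta> = \<epsilon> * \<delta> / (3 * A)"
  define P0 where "P0 = \<lceil>3 * (A * D * T) / \<epsilon>\<rceil>"
  have P0: "A * D * T \<le> \<epsilon> / 3 * P" if "P \<ge> P0" for P
  proof -
    have "3 * (A * D * T) / \<epsilon> \<le> P" using that unfolding P0_def by linarith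
    then show ?thesis using assms(3) by (simp add: field_simps)
  qed
  show ?thesis
  proof (rule that[OF T(1), of \<eta> P0])
    show "\<eta> > 0" using assms A by (simp add: \<eta>_def)
    fix P w1 w2 w3 h l1 u1 l2 u2 l3 u3 k :: int
    assume P: "P \<ge> P0" "P \<ge> 1" and cP: "norm3 w1 w2 w3 \<le> c * P" and gen: "generic \<delta> G T P (w1, w2, w3)" 
      and h: "gcd w1 (gcd w2 w3) dvd h" "\<bar>real_of_int h\<bar> \<le> \<eta> * (real_of_int P)^2" 
      and sub: "{l1..u1} \<subseteq> {-P..P}" "{l2..u2} \<subseteq> {-P..P}" "{l3..u3} \<subseteq> {-P..P}"
    have gw: "\<bar>w1\<bar> \<ge> \<delta> * P" "\<bar>w2\<bar> \<ge> \<delta> * P" "\<bar>w3\<bar> \<ge> \<delta> * P"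
      and gg: "gcd w1 w2 \<le> G" "gcd w1 w3 \<le> G" "gcd w2 w3 \<le> G"
      and gn: "\<And>v1 v2 v3. w1 * v1 + w2 * v2 + w3 * v3 = 0 \<Longrightarrow> norm3 v1 v2 v3 \<le> T \<Longrightarrow> v1 = 0 \<and> v2 = 0 \<and> v3 = 0"
      using gen unfolding generic_def prod.case by blast+
    define B where "B = (3 * (c * P)) div T + T"
    have dP: "\<delta> * P > 0" using assms P by simp
    have w3: "w3 \<noteq> 0" using gw(3) dP by auto
    have le: "\<bar>w1\<bar> \<le> c * P" "\<bar>w2\<bar> \<le> c * P" "\<bar>w3\<bar> \<le> c * P" using cP by (auto simp: norm3_def)
    have cP1: "1 \<le> c * P" using mult_mono[of 1 c 1 P] assms(1) P(2) by simp
    have TB: "T \<le> B" unfolding B_def using T cP1 by (simp add: pos_imp_zdiv_nonneg_iff)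
    have "3 * (c * P) = T * ((3 * (c * P)) div T) + (3 * (c * P)) mod T" by simp
    also have "\<dots> \<le> T * ((3 * (c * P)) div T) + T" using pos_mod_bound[of T "3 * (c * P)"] T(1) by linarith
    also have "\<dots> \<le> T * (B + 1)" using T(1) by (simp add: B_def algebra_simps)
    finally have TB2: "3 * (c * P) \<le> T * (B + 1)" .
    obtain v1 v2 v3 where v: "w1 * v1 + w2 * v2 + w3 * v3 = h" "\<bar>v1\<bar> \<le> 2 * B" "\<bar>v2\<bar> \<le> 2 * B"
      by (rule short_solution[OF le w3 cP1 T(1) TB TB2 gn h(1)])
    have B: "real_of_int B \<le> 3 * c * P / T + T"
    proof -
      have "real_of_int ((3 * (c * P)) div T) \<le> real_of_int (3 * (c * P)) / T" by (rule real_of_int_div4)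
      then show ?thesis by (simp add: B_def mult.assoc)
    qed
    have B0: "B \<ge> 1" using TB T by simp
    define m where "m = 2 * B + (\<eta> * P + 4 * c * B) / \<delta>"
    \<comment> \<open>The third entry comes from \<open>w3 v3 = h - w1 v1 - w2 v2\<close> and
      \<open>|w3| >= \<delta> P\<close>.\<close>
    have v3: "\<bar>v3\<bar> \<le> (\<eta> * P + 4 * c * B) / \<delta>"
    proof -
      have "\<delta> * P * \<bar>real_of_int v3\<bar> \<le> \<bar>real_of_int w3\<bar> * \<bar>real_of_int v3\<bar>"
        by (rule mult_right_mono) (use gw in auto)
      also have "\<dots> = \<bar>real_of_int (h - w1 * v1 - w2 * v2)\<bar>"
        using v(1) by (metis (no_types, opaque_lifting) abs_mult add_diff_cancel_left' diff_diff_add of_int_mult)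
      also have "\<dots> \<le> \<bar>real_of_int h\<bar> + \<bar>real_of_int (w1 * v1)\<bar> + \<bar>real_of_int (w2 * v2)\<bar>" by simp
      also have "\<dots> \<le> \<eta> * (real_of_int P)^2 + c * P * (2 * B) + c * P * (2 * B)"
      proof (intro add_mono)
        show "\<bar>real_of_int (w1 * v1)\<bar> \<le> c * P * (2 * B)"
          using mult_mono[OF le(1) v(2)] cP1 by (metis abs_ge_zero abs_mult of_int_abs of_int_le_iff order.trans zero_le_one)
        show "\<bar>real_of_int (w2 * v2)\<bar> \<le> c * P * (2 * B)"
          using mult_mono[OF le(2) v(3)] cP1 by (metis abs_ge_zero abs_mult of_int_abs of_int_le_iff order.trans zero_le_one)
      qed (use h in auto)
      also have "\<dots> = (\<eta> * P + 4 * c * B) * P" by (simp add: power2_eq_square algebra_simps)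
      finally have "\<delta> * \<bar>real_of_int v3\<bar> * P \<le> (\<eta> * P + 4 * c * B) * P" by (simp add: mult_ac)
      then have "\<delta> * \<bar>real_of_int v3\<bar> \<le> \<eta> * P + 4 * c * B" using P by simp
      then show ?thesis using assms(2) by (simp add: field_simps)
    qed
    have pos: "0 \<le> (\<eta> * P + 4 * c * B) / \<delta>" using v3 by linarith
    have vm: "\<bar>real_of_int v1\<bar> \<le> m" "\<bar>real_of_int v2\<bar> \<le> m" "\<bar>real_of_int v3\<bar> \<le> m" using v v3 pos B0 unfolding m_def by linarith+
    have "real (card (plane_points {l1..u1} {l2..u2} {l3..u3} w1 w2 w3 k)) - 
     real (card (plane_points {l1..u1} {l2..u2} {l3..u3} w1 w2 w3 (k + h))) \<le> A * m" unfolding A_def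
      by (rule plane_points_shift_defect[OF refl refl refl sub P(2) gw assms(2) gg v(1) vm])
    also have "m = D * B + \<eta> * P / \<delta>" using assms(2) by (simp add: m_def D_def field_simps)
    also have "A * (D * B + \<eta> * P / \<delta>) \<le> A * (D * (3 * c * P / T + T) + \<eta> * P / \<delta>)"
      using A D B by (intro mult_left_mono add_mono) auto
    also have "\<dots> = (A * D * (3 * c) / T) * P + A * D * T + \<epsilon> / 3 * P"
      using assms A by (simp add: \<eta>_def field_simps)
    also have "\<dots> \<le> \<epsilon> / 3 * P + \<epsilon> / 3 * P + \<epsilon> / 3 * P"
      using mult_right_mono[OF T(2), of P] P0[OF P(1)] P by (intro add_mono) auto
    finally show "real (card (plane_points {l1..u1} {l2..u2} {l3..u3} w1 w2 w3 k)) - 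
     real (card (plane_points {l1..u1} {l2..u2} {l3..u3} w1 w2 w3 (k + h))) \<le> \<epsilon> * P" by simp
  qed
qed

section \<open>Averages over the normal vectors in a cube\<close>

definition cube :: "int \<Rightarrow> (int \<times> int \<times> int) set" where
  "cube R = {-R..R} \<times> {-R..R} \<times> {-R..R}"

definition vnorm :: "int \<times> int \<times> int \<Rightarrow> int" where
  "vnorm = (\<lambda>(a, b, c). norm3 a b c)"

definition vgcd :: "int \<times> int \<times> int \<Rightarrow> int" where
  "vgcd = (\<lambda>(a, b, c). gcd a (gcd b c))"

lemma finite_cube [simp]: "finite (cube R)" by (simp add: cube_def)

lemma card_cube: "R \<ge> 0 \<Longrightarrow> int (card (cube R)) = (2 * R + 1)^3"
  by (simp add: cube_def card_cartesian_product power3_eq_cube algebra_simps)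

lemma in_cube_iff: "w \<in> cube R \<longleftrightarrow> vnorm w \<le> R"
  by (cases w) (auto simp: cube_def vnorm_def norm3_def)

lemma vnorm_pos: "w \<noteq> (0, 0, 0) \<Longrightarrow> vnorm w \<ge> 1"
proof (cases w)
  case (fields a b c)
  assume "w \<noteq> (0, 0, 0)"
  then have "1 \<le> \<bar>a\<bar> \<or> 1 \<le> \<bar>b\<bar> \<or> 1 \<le> \<bar>c\<bar>" using fields by auto
  then show ?thesis unfolding fields vnorm_def norm3_def prod.case le_max_iff_disj .
qed

lemma vgcd_pos: "w \<noteq> (0, 0, 0) \<Longrightarrow> vgcd w \<ge> 1"
  by (cases w) (auto simp: vgcd_def int_one_le_iff_zero_less)

lemma vgcd_le_vnorm: "w \<noteq> (0, 0, 0) \<Longrightarrow> vgcd w \<le> vnorm w"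
proof (cases w)
  case (fields a b c)
  assume "w \<noteq> (0, 0, 0)"
  then consider "a \<noteq> 0" | "b \<noteq> 0" | "c \<noteq> 0" using fields by auto
  moreover have "gcd a (gcd b c) dvd a" "gcd a (gcd b c) dvd b" "gcd a (gcd b c) dvd c" 
    by (auto intro: dvd_trans[OF gcd_dvd2])
  ultimately have "gcd a (gcd b c) \<le> \<bar>a\<bar> \<or> gcd a (gcd b c) \<le> \<bar>b\<bar> \<or> gcd a (gcd b c) \<le> \<bar>c\<bar>"
    by (metis dvd_imp_le_int abs_gcd_int)
  then show ?thesis unfolding fields vgcd_def vnorm_def norm3_def prod.case le_max_iff_disj .
qed

text \<open>Summation over shells: \<open>24 m^2 + 2 <= 26 m^2\<close> vectors have norm exactly
  \<open>m\<close>.\<close>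

lemma sum_inverse_vnorm_le:
  assumes "R \<ge> 0"
  shows "(\<Sum>w\<in>cube R - {(0, 0, 0)}. 1 / vnorm w) \<le> 26 * (real_of_int R)^2"
proof -
  define S where "S = cube R - {(0, 0, 0)}"
  have fS: "finite S" by (simp add: S_def)
  have im: "vnorm ` S \<subseteq> {1..R}" 
  proof
    fix m assume "m \<in> vnorm ` S"
    then obtain w where "w \<in> S" "m = vnorm w" by blast
    then show "m \<in> {1..R}" using vnorm_pos[of w] by (simp add: S_def in_cube_iff)
  qed
  have "(\<Sum>w\<in>S. 1 / vnorm w) = (\<Sum>m\<in>{1..R}. \<Sum>w\<in>{w\<in>S. vnorm w = m}. 1 / real_of_int (vnorm w))"
    by (rule sum.group[symmetric]) (use fS im in auto)
  also have "\<dots> \<le> (\<Sum>m\<in>{1..R}. 26 * real_of_int R)"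
  proof (rule sum_mono)
    fix m assume m: "m \<in> {1..R}"
    have sub: "cube (m - 1) \<subseteq> cube m" by (auto simp: cube_def)
    have "{w\<in>S. vnorm w = m} \<subseteq> cube m - cube (m - 1)" by (auto simp: in_cube_iff)
    then have "card {w\<in>S. vnorm w = m} \<le> card (cube m - cube (m - 1))" by (rule card_mono[rotated]) simp
    also have "\<dots> = card (cube m) - card (cube (m - 1))" by (rule card_Diff_subset[OF finite_cube sub])
    finally have "int (card {w\<in>S. vnorm w = m}) \<le> int (card (cube m)) - int (card (cube (m - 1)))"
      using card_mono[OF finite_cube sub] by linarith
    also have "\<dots> = 24 * m^2 + 2" using m by (simp add: card_cube power2_eq_square power3_eq_cube algebra_simps)
    also have "\<dots> \<le> 26 * m^2" using one_le_power[of m 2] m by auto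
    finally have card: "real (card {w\<in>S. vnorm w = m}) \<le> 26 * (real_of_int m)^2"
    proof -
      assume "int (card {w\<in>S. vnorm w = m}) \<le> 26 * m^2"
      then have "real_of_int (int (card {w\<in>S. vnorm w = m})) \<le> real_of_int (26 * m^2)" by (simp only: of_int_le_iff)
      then show ?thesis by simp
    qed
    have "(\<Sum>w\<in>{w\<in>S. vnorm w = m}. 1 / real_of_int (vnorm w)) = real (card {w\<in>S. vnorm w = m}) / m"
      by (simp add: divide_inverse)
    also have "\<dots> \<le> 26 * (real_of_int m)^2 / m" using card m by (intro divide_right_mono) auto
    also have "\<dots> = 26 * real_of_int m" using m by (simp add: power2_eq_square)
    finally show "(\<Sum>w\<in>{w\<in>S. vnorm w = m}. 1 / real_of_int (vnorm w)) \<le> 26 * real_of_int R" using m by auto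
  qed
  also have "\<dots> = 26 * (real_of_int R)^2" using assms by (simp add: power2_eq_square)
  finally show ?thesis by (simp add: S_def)
qed

lemma sum_inverse_squares_le:
  fixes K R :: int
  assumes "1 \<le> K" "K \<le> R"
  shows "(\<Sum>g\<in>{K+1..R}. 1 / (real_of_int g)^2) \<le> 1 / K - 1 / R"
  using assms(2)
proof (induction R rule: int_ge_induct)
  case (step R)
  have "{K+1..R+1} = insert (R+1) {K+1..R}" using step by auto
  then have "(\<Sum>g\<in>{K+1..R+1}. 1 / (real_of_int g)^2) = 1 / (real_of_int R + 1)^2 + (\<Sum>g\<in>{K+1..R}. 1 / (real_of_int g)^2)"
    by simp
  also have "1 / (real_of_int R + 1)^2 \<le> 1 / (R * (real_of_int R + 1))"
    by (rule divide_left_mono) (use step assms(1) in \<open>auto simp: power2_eq_square\<close>)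
  also have "\<dots> = 1 / R - 1 / (real_of_int R + 1)" using step assms(1) by (simp add: field_simps)
  finally show ?case using step by simp
qed simp

text \<open>Writing \<open>w = g w'\<close> turns \<open>vgcd w / vnorm w\<close> into
  \<open>1 / vnorm w'\<close> over a cube of side \<open>R / g\<close>, so that the divisor
  \<open>g\<close> contributes at most \<open>26 (R / g)^2\<close>, and the tail of the sum of
  \<open>1 / g^2\<close> gives \<open>1 / K\<close>. The normals with gcd beyond \<open>K\<close>
  are those for which a shift divisible by \<open>K!\<close> need not be attained by any
  translation.\<close>

lemma sum_large_vgcd_le:
  assumes "R \<ge> 0" "K \<ge> 1"
  shows "(\<Sum>w\<in>{w\<in>cube R - {(0, 0, 0)}. vgcd w > K}. vgcd w / vnorm w) \<le> 26 * (real_of_int R)^2 / K"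
proof -
  define S where "S = {w\<in>cube R - {(0, 0, 0)}. vgcd w > K}"
  define sc where "sc = (\<lambda>g::int. \<lambda>(a, b, c). (g * a, g * b, g * c))"
  have fS: "finite S" by (simp add: S_def)
  have im: "vgcd ` S \<subseteq> {K+1..R}"
  proof
    fix g assume "g \<in> vgcd ` S"
    then obtain w where "w \<in> S" "g = vgcd w" by auto
    then show "g \<in> {K+1..R}" using vgcd_le_vnorm[of w] by (auto simp: S_def in_cube_iff)
  qed
  have "(\<Sum>w\<in>S. vgcd w / vnorm w) = (\<Sum>g\<in>{K+1..R}. \<Sum>w\<in>{w\<in>S. vgcd w = g}. real_of_int (vgcd w) / real_of_int (vnorm w))"
    by (rule sum.group[symmetric]) (use fS im in auto)
  also have "\<dots> \<le> (\<Sum>g\<in>{K+1..R}. 26 * (real_of_int R)^2 * (1 / (real_of_int g)^2))"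
  proof (rule sum_mono)
    fix g assume g: "g \<in> {K+1..R}"
    have g0: "g > 0" using g assms by auto
    define Q where "Q = R div g"
    have Q0: "Q \<ge> 0" using assms g0 by (simp add: Q_def pos_imp_zdiv_nonneg_iff)
    have nsc: "vnorm (sc g w) = g * vnorm w" for w
      using g0 by (cases w) (simp add: vnorm_def sc_def norm3_def abs_mult max_mult_distrib_left)
    have sub: "{w\<in>S. vgcd w = g} \<subseteq> sc g ` (cube Q - {(0, 0, 0)})"
    proof
      fix w assume w: "w \<in> {w\<in>S. vgcd w = g}"
      obtain a b c where abc: "w = (a, b, c)" by (cases w)
      have gg: "g = gcd a (gcd b c)" using w abc by (simp add: vgcd_def)
      then have "g dvd a" "g dvd b" "g dvd c" by (auto intro: dvd_trans[OF gcd_dvd2])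
      then obtain a' b' c' where "a = g * a'" "b = g * b'" "c = g * c'" by (elim dvdE)
      then have eq: "w = sc g (a', b', c')" by (simp add: abc sc_def)
      have "g * vnorm (a', b', c') \<le> R" using w eq nsc by (auto simp: S_def in_cube_iff)
      then have "vnorm (a', b', c') \<le> Q" unfolding Q_def using g0 by (metis mult.commute zdiv_mono1 nonzero_mult_div_cancel_right less_irrefl)
      moreover have "(a', b', c') \<noteq> (0, 0, 0)" using w eq by (auto simp: S_def sc_def)
      ultimately show "w \<in> sc g ` (cube Q - {(0, 0, 0)})" using eq by (auto simp: in_cube_iff)
    qed
    have "(\<Sum>w\<in>{w\<in>S. vgcd w = g}. real_of_int (vgcd w) / real_of_int (vnorm w)) = (\<Sum>w\<in>{w\<in>S. vgcd w = g}. g / real_of_int (vnorm w))"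
      by simp
    also have "\<dots> \<le> (\<Sum>w\<in>sc g ` (cube Q - {(0, 0, 0)}). g / real_of_int (vnorm w))"
    proof (rule sum_mono2[OF _ sub])
      fix w assume "w \<in> sc g ` (cube Q - {(0, 0, 0)}) - {w\<in>S. vgcd w = g}"
      then obtain w' where "w' \<noteq> (0, 0, 0)" "w = sc g w'" by blast
      then show "0 \<le> real_of_int g / real_of_int (vnorm w)" using g0 nsc vnorm_pos[of w'] by simp
    qed simp
    also have "\<dots> = (\<Sum>w\<in>cube Q - {(0, 0, 0)}. g / real_of_int (vnorm (sc g w)))"
      by (subst sum.reindex) (use g0 in \<open>auto simp: inj_on_def sc_def\<close>)
    also have "\<dots> = (\<Sum>w\<in>cube Q - {(0, 0, 0)}. 1 / vnorm w)" using g0 by (simp add: nsc)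
    also have "\<dots> \<le> 26 * (real_of_int Q)^2" by (rule sum_inverse_vnorm_le[OF Q0])
    also have "\<dots> \<le> 26 * (R / g)^2"
      using Q0 real_of_int_div4[of R g] by (intro mult_left_mono power_mono) (auto simp: Q_def)
    finally show "(\<Sum>w\<in>{w\<in>S. vgcd w = g}. real_of_int (vgcd w) / real_of_int (vnorm w)) \<le> 26 * (real_of_int R)^2 * (1 / (real_of_int g)^2)"
      by (simp add: power_divide)
  qed
  also have "\<dots> = 26 * (real_of_int R)^2 * (\<Sum>g\<in>{K+1..R}. 1 / (real_of_int g)^2)" by (simp add: sum_distrib_left)
  also have "\<dots> \<le> 26 * (real_of_int R)^2 * (1 / K)"
  proof (rule mult_left_mono)
    show "(\<Sum>g\<in>{K+1..R}. 1 / (real_of_int g)^2) \<le> 1 / K"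
    proof (cases "K \<le> R")
      case True
      have "1 / real_of_int R \<ge> 0" using assms by simp
      then show ?thesis using sum_inverse_squares_le[OF assms(2) True] by linarith
    qed (use assms in auto)
  qed simp
  finally show ?thesis by (simp add: S_def)
qed

text \<open>Pairs with \<open>gcd a b = d\<close> consist of nonzero multiples of \<open>d\<close>,
  of which there are at most \<open>2 R / d\<close> in the range; the squares of these counts are
  summed over \<open>d > G\<close>.\<close>

lemma card_large_gcd_pairs_le:
  fixes R G :: int
  assumes "R \<ge> 0" "G \<ge> 1"
  shows "real (card {(a, b). a \<noteq> 0 \<and> b \<noteq> 0 \<and> \<bar>a\<bar> \<le> R \<and> \<bar>b\<bar> \<le> R \<and> gcd a b > G}) \<le> 4 * (real_of_int R)^2 / G"
    (is "real (card ?S) \<le> _")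
proof -
  define M where "M = (\<lambda>d. {a. a \<noteq> 0 \<and> \<bar>a\<bar> \<le> R \<and> d dvd a})"
  have finM: "finite (M d)" for d by (rule finite_subset[of _ "{-R..R}"]) (auto simp: M_def)
  have cM: "real (card (M d)) \<le> 2 * (R / d)" if "d > 0" for d
  proof -
    have "M d \<subseteq> (*) d ` ({-(R div d)..R div d} - {0})"
    proof
      fix a assume a: "a \<in> M d"
      then obtain k where k: "a = d * k" by (auto simp: M_def)
      have "d * \<bar>k\<bar> \<le> R" using a that by (simp add: M_def k abs_mult)
      then have "\<bar>k\<bar> \<le> R div d" using that by (metis mult.commute zdiv_mono1 nonzero_mult_div_cancel_right less_irrefl)
      then have "k \<in> {-(R div d)..R div d} - {0}" using a k by (auto simp: M_def)
      then show "a \<in> (*) d ` ({-(R div d)..R div d} - {0})" using k by blast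
    qed
    then have "card (M d) \<le> card ((*) d ` ({-(R div d)..R div d} - {0}))" by (rule card_mono[rotated]) auto
    also have "\<dots> \<le> card ({-(R div d)..R div d} - {0})" by (rule card_image_le) auto
    also have "\<dots> = nat (2 * (R div d))"
      using assms that by (simp add: pos_imp_zdiv_nonneg_iff)
    finally have "real (card (M d)) \<le> 2 * real_of_int (R div d)"
      using assms(1) that by (simp add: pos_imp_zdiv_nonneg_iff le_nat_iff)
    then show ?thesis using real_of_int_div4[of R d] by linarith
  qed
  have "?S \<subseteq> (\<Union>d\<in>{G+1..R}. M d \<times> M d)"
  proof clarify
    fix a b :: int assume ab: "a \<noteq> 0" "b \<noteq> 0" "\<bar>a\<bar> \<le> R" "\<bar>b\<bar> \<le> R" "gcd a b > G"
    have "gcd a b \<le> R" using ab(1,3) by (metis abs_gcd_int dvd_imp_le_int gcd_dvd1 order_trans)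
    then show "(a, b) \<in> (\<Union>d\<in>{G+1..R}. M d \<times> M d)" using ab by (auto simp: M_def intro!: bexI[of _ "gcd a b"])
  qed
  then have "card ?S \<le> card (\<Union>d\<in>{G+1..R}. M d \<times> M d)" by (rule card_mono[rotated]) (use finM in auto)
  also have "\<dots> \<le> (\<Sum>d\<in>{G+1..R}. card (M d \<times> M d))" by (rule card_UN_le) auto
  finally have "real (card ?S) \<le> real (\<Sum>d\<in>{G+1..R}. card (M d \<times> M d))" by (simp only: of_nat_le_iff)
  then have "real (card ?S) \<le> (\<Sum>d\<in>{G+1..R}. real (card (M d)) * real (card (M d)))"
    by (simp only: of_nat_sum of_nat_mult card_cartesian_product)
  also have "\<dots> \<le> (\<Sum>d\<in>{G+1..R}. 4 * (real_of_int R)^2 * (1 / (real_of_int d)^2))"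
  proof (rule sum_mono)
    fix d assume "d \<in> {G+1..R}"
    then have "d > 0" using assms by auto
    then have "real (card (M d)) * real (card (M d)) \<le> 2 * (R / d) * (2 * (R / d))"
      using assms by (intro mult_mono cM) auto
    then show "real (card (M d)) * real (card (M d)) \<le> 4 * (real_of_int R)^2 * (1 / (real_of_int d)^2)"
      by (simp add: power2_eq_square)
  qed
  also have "\<dots> = 4 * (real_of_int R)^2 * (\<Sum>g\<in>{G+1..R}. 1 / (real_of_int g)^2)" by (simp add: sum_distrib_left)
  also have "\<dots> \<le> 4 * (real_of_int R)^2 * (1 / G)"
  proof (rule mult_left_mono)
    show "(\<Sum>g\<in>{G+1..R}. 1 / (real_of_int g)^2) \<le> 1 / G"
    proof (cases "G \<le> R")
      case True
      have "1 / real_of_int R \<ge> 0" using assms by simp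
      then show ?thesis using sum_inverse_squares_le[OF assms(2) True] by linarith
    qed (use assms in auto)
  qed simp
  finally show ?thesis by simp
qed

lemma card_small_coordinate_le:
  fixes R :: int and \<delta> :: real
  assumes "R \<ge> 0" "\<delta> \<ge> 0"
  shows "real (card {x\<in>{-R..R}. \<bar>real_of_int x\<bar> < \<delta>}) \<le> 2 * \<delta> + 1"
proof -
  have "card {x\<in>{-R..R}. \<bar>real_of_int x\<bar> < \<delta>} \<le> card {-\<lfloor>\<delta>\<rfloor>..\<lfloor>\<delta>\<rfloor>}"
    by (rule card_mono) (auto simp: le_floor_iff minus_le_iff)
  also have "\<dots> = nat (2 * \<lfloor>\<delta>\<rfloor> + 1)" by simp
  finally show ?thesis using assms by linarith
qed

lemma card_orthogonal_le:
  fixes R :: int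
  assumes "R \<ge> 0" "v \<noteq> (0, 0, 0)"
  shows "real (card {w\<in>cube R. (\<lambda>(w1, w2, w3) (v1, v2, v3). w1 * v1 + w2 * v2 + w3 * v3) w v = (0::int)}) \<le> (2 * R + 1)^2"
    (is "real (card ?S) \<le> _")
proof -
  obtain v1 v2 v3 where v: "v = (v1, v2, v3)" by (cases v)
  have c: "card ({-R..R} \<times> {-R..R}) = nat (2 * R + 1) * nat (2 * R + 1)"
    by (simp add: card_cartesian_product)
  have "card ?S \<le> card ({-R..R} \<times> {-R..R})"
  proof -
    consider "v1 \<noteq> 0" | "v2 \<noteq> 0" | "v3 \<noteq> 0" using assms(2) v by auto
    then show ?thesis
    proof cases
      case 1
      then show ?thesis by (intro card_inj_on_le[where f = "\<lambda>(a, b, c). (b, c)"])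
        (auto simp: inj_on_def cube_def v, metis add_right_cancel mult_cancel_right)
    next
      case 2
      then show ?thesis by (intro card_inj_on_le[where f = "\<lambda>(a, b, c). (a, c)"])
        (auto simp: inj_on_def cube_def v, metis add_right_cancel add_left_cancel mult_cancel_right)
    next
      case 3
      then show ?thesis by (intro card_inj_on_le[where f = "\<lambda>(a, b, c). (a, b)"])
        (auto simp: inj_on_def cube_def v, metis add_left_cancel mult_cancel_right)
    qed
  qed
  then have "real (card ?S) \<le> real (nat (2 * R + 1)) * real (nat (2 * R + 1))"
    unfolding c of_nat_mult[symmetric] by (simp only: of_nat_le_iff)
  then show ?thesis using assms(1) by (simp add: power2_eq_square)
qed

text \<open>Union bound over the ways to fail: a small entry, a pair of entries with large gcd, or
  orthogonality to one of at most \<open>(2 T + 1)^3\<close> short vectors. The last term has order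
  \<open>R^2\<close> only, so any fixed \<open>T\<close> is affordable.\<close>

lemma card_nongeneric_le:
  fixes R P T G :: int and \<delta> :: real
  assumes "R \<ge> 0" "P \<ge> 1" "\<delta> > 0" "G \<ge> 1" "T \<ge> 1"
  shows "real (card {w\<in>cube R. \<not> generic \<delta> G T P w}) \<le>
     3 * ((2 * (\<delta> * P) + 1) * (2 * R + 1)^2) + 3 * (4 * (real_of_int R)^2 / G * (2 * R + 1)) + (2 * T + 1)^3 * (2 * R + 1)^2"
proof -
  define I where "I = {-R..R}"
  define Sm where "Sm = {x\<in>{-R..R}. \<bar>real_of_int x\<bar> < \<delta> * P}"
  define Gc where "Gc = {(a, b). a \<noteq> 0 \<and> b \<noteq> 0 \<and> \<bar>a\<bar> \<le> R \<and> \<bar>b\<bar> \<le> R \<and> gcd a b > G}"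
  define O' where "O' = (\<lambda>v. {w\<in>cube R. (\<lambda>(w1, w2, w3) (v1, v2, v3). w1 * v1 + w2 * v2 + w3 * v3) w v = (0::int)})"
  define V where "V = cube T - {(0, 0, 0)}"
  have dP: "\<delta> * P > 0" using assms by simp
  have finG: "finite Gc" by (rule finite_subset[of _ "{-R..R} \<times> {-R..R}"]) (auto simp: Gc_def)
  have finI: "finite I" by (simp add: I_def)
  have finS: "finite Sm" by (rule finite_subset[of _ "{-R..R}"]) (auto simp: Sm_def)
  define A where "A = Sm \<times> I \<times> I"
  define B where "B = I \<times> Sm \<times> I"
  define C where "C = I \<times> I \<times> Sm"
  define A' where "A' = Gc \<times> I"
  have "{w\<in>cube R. \<not> generic \<delta> G T P w} \<subseteq> (A \<union> (B \<union> C)) \<union> (((\<lambda>((a, b), c). (a, b, c)) ` A' \<union> ((\<lambda>((a, b), c). (a, c, b)) ` A' \<union>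
     (\<lambda>((a, b), c). (c, a, b)) ` A')) \<union> (\<Union>v\<in>V. O' v))" (is "_ \<subseteq> ?U")
  proof
    fix w assume w: "w \<in> {w\<in>cube R. \<not> generic \<delta> G T P w}"
    obtain a b c where abc: "w = (a, b, c)" by (cases w)
    have cub: "a \<in> I" "b \<in> I" "c \<in> I" using w abc by (auto simp: cube_def I_def)
    show "w \<in> ?U"
    proof (cases "a \<in> Sm \<or> b \<in> Sm \<or> c \<in> Sm")
      case True
      then have "w \<in> A \<union> (B \<union> C)" using cub unfolding abc A_def B_def C_def by blast
      then show ?thesis by blast
    next
      case False
      then have big: "\<bar>a\<bar> \<ge> \<delta> * P" "\<bar>b\<bar> \<ge> \<delta> * P" "\<bar>c\<bar> \<ge> \<delta> * P" using cub by (auto simp: Sm_def I_def)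
      then have nz: "a \<noteq> 0" "b \<noteq> 0" "c \<noteq> 0" using dP by auto
      show ?thesis
      proof (cases "gcd a b > G \<or> gcd a c > G \<or> gcd b c > G")
        case True
        then have "(a, b) \<in> Gc \<or> (a, c) \<in> Gc \<or> (b, c) \<in> Gc" using nz cub by (auto simp: Gc_def I_def)
        then have "((a, b), c) \<in> A' \<or> ((a, c), b) \<in> A' \<or> ((b, c), a) \<in> A'" using cub by (auto simp: A'_def)
        then have "w \<in> (\<lambda>((a, b), c). (a, b, c)) ` A' \<union> ((\<lambda>((a, b), c). (a, c, b)) ` A' \<union> (\<lambda>((a, b), c). (c, a, b)) ` A')"
          unfolding abc by force
        then show ?thesis by blast
      next
        case False
        then have "\<not> (\<forall>v1 v2 v3. a * v1 + b * v2 + c * v3 = 0 \<longrightarrow> norm3 v1 v2 v3 \<le> T \<longrightarrow> v1 = 0 \<and> v2 = 0 \<and> v3 = 0)"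
          using w big unfolding abc generic_def prod.case by auto
        then obtain v1 v2 v3 where "a * v1 + b * v2 + c * v3 = 0" "norm3 v1 v2 v3 \<le> T" "(v1, v2, v3) \<noteq> (0, 0, 0)" by auto
        then have "(v1, v2, v3) \<in> V" "w \<in> O' (v1, v2, v3)" using w abc by (auto simp: V_def O'_def in_cube_iff vnorm_def)
        then show ?thesis by blast
      qed
    qed
  qed
  then have "card {w\<in>cube R. \<not> generic \<delta> G T P w} \<le> card ?U"
    by (rule card_mono[rotated]) (use finG finI finS in \<open>auto simp: A_def B_def C_def A'_def V_def O'_def\<close>)
  also have "\<dots> \<le> (card A + (card B + card C)) + ((card A' + (card A' + card A')) + (\<Sum>v\<in>V. card (O' v)))"
  proof -
    have im: "card ((\<lambda>((a, b), c). (a, b, c)) ` A') \<le> card A'" "card ((\<lambda>((a, b), c). (a, c, b)) ` A') \<le> card A'"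
      "card ((\<lambda>((a, b), c). (c, a, b)) ` A') \<le> card A'"
      by (rule card_image_le; simp add: A'_def finG finI)+
    have un: "card (\<Union>v\<in>V. O' v) \<le> (\<Sum>v\<in>V. card (O' v))" by (rule card_UN_le) (simp add: V_def)
    show ?thesis by (intro order_trans[OF card_Un_le] add_mono order_refl im un)
  qed
  finally have main: "real (card {w\<in>cube R. \<not> generic \<delta> G T P w}) \<le>
     (real (card A) + (real (card B) + real (card C))) + ((real (card A') + (real (card A') + real (card A'))) + (\<Sum>v\<in>V. real (card (O' v))))"
    by (simp only: of_nat_add[symmetric] of_nat_sum[symmetric] of_nat_le_iff)
  have cI: "real (card I) = 2 * R + 1" using assms(1) by (simp add: I_def)
  have cS: "real (card Sm) \<le> 2 * (\<delta> * P) + 1" unfolding Sm_def by (rule card_small_coordinate_le) (use assms dP in auto)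
  have sA: "real (card Sm) * (real (card I) * real (card I)) \<le> (2 * (\<delta> * P) + 1) * (2 * R + 1)^2"
    unfolding cI power2_eq_square using assms(1) cS by (simp add: mult_right_mono)
  have eA: "real (card A) = real (card Sm) * (real (card I) * real (card I))"
       "real (card B) = real (card Sm) * (real (card I) * real (card I))"
       "real (card C) = real (card Sm) * (real (card I) * real (card I))"
    unfolding A_def B_def C_def by (simp_all add: card_cartesian_product)
  have eA': "real (card A') \<le> 4 * (real_of_int R)^2 / G * (2 * R + 1)"
    unfolding A'_def card_cartesian_product of_nat_mult cI Gc_def
    by (rule mult_right_mono[OF card_large_gcd_pairs_le]) (use assms in auto)
  have "(\<Sum>v\<in>V. real (card (O' v))) \<le> (\<Sum>v\<in>V. (2 * R + 1)^2)"
    unfolding of_int_sum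
  proof (rule sum_mono)
    fix v assume "v \<in> V"
    then show "real (card (O' v)) \<le> real_of_int ((2 * R + 1)^2)" unfolding O'_def
      using card_orthogonal_le[OF assms(1), of v] by (simp add: V_def)
  qed
  also have "\<dots> = real (card V) * (2 * R + 1)^2" by simp
  also have "\<dots> \<le> (2 * T + 1)^3 * (2 * R + 1)^2"
  proof -
    have "card V \<le> card (cube T)" unfolding V_def by (rule card_mono) auto
    then have "int (card V) \<le> (2 * T + 1)^3" using card_cube[of T] assms(5) by simp
    then have "real_of_int (int (card V)) \<le> real_of_int ((2 * T + 1)^3)" by (simp only: of_int_le_iff)
    then have "real (card V) \<le> (2 * T + 1)^3" by simp
    then show ?thesis by (simp add: mult_right_mono)
  qed
  finally have "(\<Sum>v\<in>V. real (card (O' v))) \<le> (2 * T + 1)^3 * (2 * R + 1)^2" .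
  then show ?thesis using main sA eA' unfolding eA by linarith
qed

text \<open>The order of quantifiers is the point: the \<open>T\<close> of
  \<open>generic_defect\<close> depends on \<open>\<delta>\<close> and \<open>G\<close>, so these
  are fixed first; \<open>T\<close> enters only through a term of order \<open>P^2\<close>, which a
  large \<open>P\<close> absorbs.\<close>

lemma nongeneric_rare:
  fixes c :: int and \<epsilon> :: real
  assumes "c \<ge> 1" "\<epsilon> > 0"
  obtains \<delta> :: real and G :: int where "\<delta> > 0" "G \<ge> 1"
    "\<And>T. T \<ge> 1 \<Longrightarrow> \<exists>P0. \<forall>P\<ge>P0. P \<ge> 1 \<longrightarrow> real (card {w\<in>cube (c * P). \<not> generic \<delta> G T P w}) \<le> \<epsilon> * (real_of_int P)^3"
proof -
  define cr where "cr = real_of_int c"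
  have cr: "cr \<ge> 1" using assms by (simp add: cr_def)
  \<comment> \<open>A quarter of \<open>\<epsilon> P^3\<close> goes to small entries and a quarter
    to large gcds: \<open>54 \<delta> c^2 = \<epsilon> / 4\<close> and
    \<open>36 c^3 / G <= \<epsilon> / 4\<close>. The remaining half covers the terms of order
    \<open>P^2\<close>.\<close>
  define \<delta> where "\<delta> = \<epsilon> / (216 * cr^2)"
  define G where "G = max 1 \<lceil>144 * cr^3 / \<epsilon>\<rceil>"
  have \<delta>: "\<delta> > 0" using assms cr by (simp add: \<delta>_def)
  have G: "G \<ge> 1" "36 * cr^3 / G \<le> \<epsilon> / 4"
  proof -
    show G1: "G \<ge> 1" by (simp add: G_def)
    have "144 * cr^3 / \<epsilon> \<le> G" unfolding G_def by linarith
    then show "36 * cr^3 / G \<le> \<epsilon> / 4" using G1 assms(2) by (simp add: field_simps)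
  qed
  show ?thesis
  proof (rule that[OF \<delta> G(1)])
    fix T :: int assume T: "T \<ge> 1"
    define D where "D = 27 * cr^2 + 9 * cr^2 * (2 * real_of_int T + 1)^3"
    define P0 where "P0 = \<lceil>2 * D / \<epsilon>\<rceil>"
    have "real (card {w\<in>cube (c * P). \<not> generic \<delta> G T P w}) \<le> \<epsilon> * (real_of_int P)^3" if P: "P \<ge> P0" "P \<ge> 1" for P
    proof -
      define p where "p = real_of_int P"
      have p: "p \<ge> 1" using P by (simp add: p_def)
      have "2 * D / \<epsilon> \<le> p" using P(1) unfolding P0_def p_def by linarith
      then have Dp: "D \<le> \<epsilon> / 2 * p" using assms(2) by (simp add: field_simps)
      have cp: "1 \<le> cr * p" using mult_mono[of 1 cr 1 p] cr p by simp
      have R1: "2 * (cr * p) + 1 \<le> 3 * cr * p" using cp by linarith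
      have R2: "(2 * (cr * p) + 1)^2 \<le> 9 * cr^2 * p^2" using power_mono[OF R1, of 2] cp by (simp add: power_mult_distrib)
      have R0: "c * P \<ge> 0" using cp using assms(1) P by simp
      have "real (card {w\<in>cube (c * P). \<not> generic \<delta> G T P w}) \<le>
        3 * ((2 * (\<delta> * p) + 1) * (2 * (cr * p) + 1)^2) + 3 * (4 * (cr * p)^2 / G * (2 * (cr * p) + 1)) + (2 * real_of_int T + 1)^3 * (2 * (cr * p) + 1)^2"
        using card_nongeneric_le[OF R0 P(2) \<delta> G(1) T] by (simp add: cr_def p_def)
      also have "\<dots> \<le> 3 * ((2 * (\<delta> * p) + 1) * (9 * cr^2 * p^2)) + 3 * (4 * (cr * p)^2 / G * (3 * cr * p)) + (2 * real_of_int T + 1)^3 * (9 * cr^2 * p^2)"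
        using R1 R2 \<delta> p G T by (intro add_mono mult_left_mono) auto
      also have "\<dots> = (54 * \<delta> * cr^2) * p^3 + (36 * cr^3 / G) * p^3 + D * p^2"
        by (simp add: D_def algebra_simps power2_eq_square power3_eq_cube)
      also have "\<dots> \<le> \<epsilon> / 4 * p^3 + \<epsilon> / 4 * p^3 + (\<epsilon> / 2 * p) * p^2"
        using G(2) Dp p cr by (intro add_mono mult_right_mono) (auto simp: \<delta>_def)
      also have "\<dots> = \<epsilon> * p^3" by (simp add: power2_eq_square power3_eq_cube)
      finally show ?thesis by (simp add: p_def)
    qed
    then show "\<exists>P0. \<forall>P\<ge>P0. P \<ge> 1 \<longrightarrow> real (card {w\<in>cube (c * P). \<not> generic \<delta> G T P w}) \<le> \<epsilon> * (real_of_int P)^3" by blast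
  qed
qed

text \<open>\<open>\<beta>\<close> bounds the defect of a normal uniformly in the heights, the shift
  and the box: trivially for the zero normal, by translation for a generic normal of gcd at most
  \<open>K\<close> (the gcd then divides \<open>K!\<close> and hence \<open>h\<close>), and by the
  full number of points on the plane otherwise. Arbitrary boxes inside the cube are needed because
  requiring two points of given difference to lie in the cube cuts it down to a box.\<close>

lemma plane_defect_sum:
  fixes c :: int and K :: nat
  assumes c: "c \<ge> 1" and K: "K \<ge> 1"
  obtains \<eta> :: real and P0 :: int and \<beta> :: "int \<Rightarrow> int \<times> int \<times> int \<Rightarrow> real" where "\<eta> > 0"
    "\<And>P w. P \<ge> P0 \<Longrightarrow> w \<in> cube (c * P) \<Longrightarrow> \<beta> P w \<ge> 0"
    "\<And>P. P \<ge> P0 \<Longrightarrow> (\<Sum>w\<in>cube (c * P). \<beta> P w) \<le> (4 + 26 * (4 + 5 * c) * (real_of_int c)^2) / K * (real_of_int P)^4"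
    "\<And>P w1 w2 w3 h l1 u1 l2 u2 l3 u3 k. P \<ge> P0 \<Longrightarrow> (w1, w2, w3) \<in> cube (c * P) \<Longrightarrow>
       fact K dvd h \<Longrightarrow> \<bar>real_of_int h\<bar> \<le> \<eta> * (real_of_int P)^2 \<Longrightarrow>
       {l1..u1} \<subseteq> {-P..P} \<Longrightarrow> {l2..u2} \<subseteq> {-P..P} \<Longrightarrow> {l3..u3} \<subseteq> {-P..P} \<Longrightarrow>
       real (card (plane_points {l1..u1} {l2..u2} {l3..u3} w1 w2 w3 k)) - 
       real (card (plane_points {l1..u1} {l2..u2} {l3..u3} w1 w2 w3 (k + h))) \<le> \<beta> P (w1, w2, w3)"
    "P0 \<ge> 1"
proof -
  define C where "C = 4 + 5 * real_of_int c"
  define kr where "kr = real K"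
  define cr where "cr = real_of_int c"
  have C: "C \<ge> 1" and kr: "kr \<ge> 1" and cr: "cr \<ge> 1" using assms by (auto simp: C_def kr_def cr_def)
  \<comment> \<open>\<open>\<delta>1 P\<close> separates short normals from long ones;
    \<open>\<delta>1\<close>, \<open>\<epsilon>\<close> and \<open>\<epsilon>1\<close> are tuned so
    that the classes \<open>X3\<close>, \<open>X4\<close> and \<open>X2\<close> below contribute at
    most \<open>P^4 / K\<close> each. The large gcds in \<open>X1\<close> account for the term with
    26.\<close>
  define \<delta>1 where "\<delta>1 = 1 / (26 * C * kr^2)"
  have \<delta>1: "\<delta>1 > 0" "C * kr * 26 * \<delta>1^2 \<le> 1 / kr"
  proof -
    have a: "1 \<le> C * kr^2" using C kr mult_mono[of 1 C 1 "kr^2"] by simp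
    then show d: "\<delta>1 > 0" by (simp add: \<delta>1_def)
    have le1: "\<delta>1 \<le> 1" unfolding \<delta>1_def using a by (simp add: field_simps)
    have "C * kr * 26 * \<delta>1^2 \<le> C * kr * 26 * \<delta>1"
      using le1 d C kr by (intro mult_left_mono) (auto simp: power2_eq_square mult_le_one intro: mult_left_le)
    also have "\<dots> = 1 / kr" using C kr by (simp add: \<delta>1_def field_simps power2_eq_square)
    finally show "C * kr * 26 * \<delta>1^2 \<le> 1 / kr" .
  qed
  define \<epsilon> where "\<epsilon> = \<delta>1 / (C * kr^2)"
  have \<epsilon>: "\<epsilon> > 0" using \<delta>1 C kr by (simp add: \<epsilon>_def)
  define \<epsilon>1 where "\<epsilon>1 = 1 / (27 * cr^3 * kr)"
  have \<epsilon>1: "\<epsilon>1 > 0" using cr kr by (simp add: \<epsilon>1_def)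
  obtain \<delta> :: real and G :: int where \<delta>: "\<delta> > 0" and G: "G \<ge> 1" and
    rare: "\<And>T. T \<ge> 1 \<Longrightarrow> \<exists>P0. \<forall>P\<ge>P0. P \<ge> 1 \<longrightarrow> real (card {w\<in>cube (c * P). \<not> generic \<delta> G T P w}) \<le> \<epsilon> * (real_of_int P)^3"
    by (rule nongeneric_rare[OF c \<epsilon>]) blast
  have G0: "real_of_int G \<ge> 0" using G by simp
  obtain T \<eta> P1 where T: "T \<ge> 1" and \<eta>: "\<eta> > 0" and defect: "\<And>P w1 w2 w3 h l1 u1 l2 u2 l3 u3 k.
     P \<ge> P1 \<Longrightarrow> P \<ge> 1 \<Longrightarrow> norm3 w1 w2 w3 \<le> c * P \<Longrightarrow> generic \<delta> G T P (w1, w2, w3) \<Longrightarrow> 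
     gcd w1 (gcd w2 w3) dvd h \<Longrightarrow> \<bar>real_of_int h\<bar> \<le> \<eta> * (real_of_int P)^2 \<Longrightarrow> 
     {l1..u1} \<subseteq> {-P..P} \<Longrightarrow> {l2..u2} \<subseteq> {-P..P} \<Longrightarrow> {l3..u3} \<subseteq> {-P..P} \<Longrightarrow>
     real (card (plane_points {l1..u1} {l2..u2} {l3..u3} w1 w2 w3 k)) - 
     real (card (plane_points {l1..u1} {l2..u2} {l3..u3} w1 w2 w3 (k + h))) \<le> \<epsilon>1 * P"
    by (rule generic_defect[OF c \<delta> \<epsilon>1 G0]) (rule that; blast)
  obtain P2 where P2: "\<And>P. P \<ge> P2 \<Longrightarrow> P \<ge> 1 \<Longrightarrow> real (card {w\<in>cube (c * P). \<not> generic \<delta> G T P w}) \<le> \<epsilon> * (real_of_int P)^3"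
    using rare[OF T] by blast
  \<comment> \<open>The bound \<open>27 K\<close> makes the zero normal affordable:
    \<open>(2 P + 1)^3 <= 27 P^3 <= P^4 / K\<close>.\<close>
  define P0 where "P0 = max (max P1 P2) (27 * int K)"
  define \<beta> where "\<beta> = (\<lambda>P w. if w = (0, 0, 0) then (2 * real_of_int P + 1)^3
     else if vgcd w \<le> int K \<and> generic \<delta> G T P w then \<epsilon>1 * P
     else C * (real_of_int P)^2 * vgcd w / vnorm w)"
  have big: "P \<ge> P1" "P \<ge> P2" "P \<ge> 1" "real_of_int P \<ge> 27 * kr" if "P \<ge> P0" for P
  proof -
    have "27 * int K \<le> P" using that by (simp add: P0_def)
    then have "real_of_int (27 * int K) \<le> real_of_int P" by (simp only: of_int_le_iff)
    then show "real_of_int P \<ge> 27 * kr" by (simp add: kr_def)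
    show "P \<ge> P1" "P \<ge> P2" "P \<ge> 1" using that K by (auto simp: P0_def)
  qed
  show ?thesis
  proof (rule that[OF \<eta>, of P0 \<beta>])
    show "P0 \<ge> 1" using K by (simp add: P0_def)
    fix P w assume "P0 \<le> P" "w \<in> cube (c * P)"
    then show "0 \<le> \<beta> P w" using big[of P] \<epsilon>1 C vnorm_pos[of w] vgcd_pos[of w]
      by (auto simp: \<beta>_def intro!: mult_nonneg_nonneg divide_nonneg_nonneg)
  next
    fix P w1 w2 w3 h l1 u1 l2 u2 l3 u3 k :: int
    assume P: "P \<ge> P0" and w: "(w1, w2, w3) \<in> cube (c * P)" and h: "fact K dvd h" "\<bar>real_of_int h\<bar> \<le> \<eta> * (real_of_int P)^2"
      and sub: "{l1..u1} \<subseteq> {-P..P}" "{l2..u2} \<subseteq> {-P..P}" "{l3..u3} \<subseteq> {-P..P}"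
    note b = big[OF P]
    let ?A = "plane_points {l1..u1} {l2..u2} {l3..u3} w1 w2 w3 k"
    let ?B = "plane_points {l1..u1} {l2..u2} {l3..u3} w1 w2 w3 (k + h)"
    have n: "norm3 w1 w2 w3 \<le> c * P" using w by (simp add: in_cube_iff vnorm_def)
    have AP: "card ?A \<le> card (plane_points {-P..P} {-P..P} {-P..P} w1 w2 w3 k)" 
      by (rule card_plane_points_mono) (use sub in auto)
    show "real (card ?A) - real (card ?B) \<le> \<beta> P (w1, w2, w3)"
    proof (cases "(w1, w2, w3) = (0, 0, 0)")
      case True
      have "card ?A \<le> card (plane_points {-P..P} {-P..P} {-P..P} w1 w2 w3 k)" by (rule AP)
      also have "\<dots> \<le> card (cube P)" by (rule card_mono) (auto simp: plane_points_def cube_def)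
      finally have "int (card ?A) \<le> (2 * P + 1)^3" using card_cube[of P] b by simp
      then have "real_of_int (int (card ?A)) \<le> real_of_int ((2 * P + 1)^3)" by (simp only: of_int_le_iff)
      then show ?thesis using True by (simp add: \<beta>_def)
    next
      case False
      show ?thesis
      proof (cases "vgcd (w1, w2, w3) \<le> int K \<and> generic \<delta> G T P (w1, w2, w3)")
        case True
        define g where "g = vgcd (w1, w2, w3)"
        have "g \<ge> 1" "g \<le> int K" using True vgcd_pos[OF False] by (auto simp: g_def)
        then have "nat g dvd fact K" by (intro dvd_fact) auto
        then have "int (nat g) dvd int (fact K)" by (simp only: of_nat_dvd_iff)
        then have "g dvd fact K" using \<open>g \<ge> 1\<close> by simp
        then have "gcd w1 (gcd w2 w3) dvd h" using dvd_trans[OF _ h(1)] by (simp add: g_def vgcd_def)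
        then have "real (card ?A) - real (card ?B) \<le> \<epsilon>1 * P"
          using defect[OF b(1,3) n _ _ h(2) sub] True by blast
        then show ?thesis by (simp only: \<beta>_def if_not_P[OF False] if_P[OF True])
      next
        case nong: False
        have pos: "norm3 w1 w2 w3 > 0" using vnorm_pos[OF False] by (simp add: vnorm_def)
        have "plane_points {-P..P} {-P..P} {-P..P} w1 w2 w3 k = {(x, y, z). \<bar>x\<bar> \<le> P \<and> \<bar>y\<bar> \<le> P \<and> \<bar>z\<bar> \<le> P \<and> w1 * x + w2 * y + w3 * z = k}"
          by (auto simp: plane_points_def)
        then have "real (card ?A) \<le> C * (real_of_int P)^2 * gcd w1 (gcd w2 w3) / norm3 w1 w2 w3"
          using card_plane_le[OF pos b(3) n, of k] AP by (simp add: C_def)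
        moreover have "\<beta> P (w1, w2, w3) = C * (real_of_int P)^2 * gcd w1 (gcd w2 w3) / norm3 w1 w2 w3"
          using False nong unfolding \<beta>_def by (simp only: if_False vgcd_def vnorm_def prod.case)
        ultimately show ?thesis by linarith
      qed
    qed
  next
    fix P assume P: "P \<ge> P0"
    note b = big[OF P]
    define p where "p = real_of_int P"
    have p: "p \<ge> 1" "p \<ge> 27 * kr" using b by (auto simp: p_def)
    define R where "R = c * P"
    have R0: "R \<ge> 0" using b c by (simp add: R_def)
    define S where "S = cube R - {(0, 0, 0)}"
    define X1 where "X1 = {w\<in>S. vgcd w > int K}"
    define X2 where "X2 = {w\<in>S. vgcd w \<le> int K \<and> generic \<delta> G T P w}"
    define X3 where "X3 = {w\<in>S. vgcd w \<le> int K \<and> vnorm w \<le> \<delta>1 * p}"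
    define X4 where "X4 = {w\<in>S. \<not> generic \<delta> G T P w \<and> vgcd w \<le> int K \<and> \<delta>1 * p < vnorm w}"
    have fin: "finite S" "finite X1" "finite X2" "finite X3" "finite X4" by (auto simp: S_def X1_def X2_def X3_def X4_def)
    have nn: "0 \<le> C * p^2 * vgcd w / vnorm w" if "w \<in> S" for w
      using that vnorm_pos[of w] vgcd_pos[of w] C by (auto simp: S_def intro!: mult_nonneg_nonneg divide_nonneg_nonneg)
    have cubeR: "cube R = insert (0, 0, 0) S" using R0 by (auto simp: S_def cube_def)
    have "(\<Sum>w\<in>cube R. \<beta> P w) = (2 * p + 1)^3 + (\<Sum>w\<in>S. \<beta> P w)"
      unfolding cubeR by (subst sum.insert) (auto simp: fin(1), auto simp: S_def \<beta>_def p_def)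
    also have "(\<Sum>w\<in>S. \<beta> P w) \<le> (\<Sum>w\<in>X1. C * p^2 * vgcd w / vnorm w) + (\<Sum>w\<in>X2. \<epsilon>1 * p) + (\<Sum>w\<in>X3. C * p^2 * kr / vnorm w) + (\<Sum>w\<in>X4. C * p^2 * kr / (\<delta>1 * p))"
    proof -
      have "(\<Sum>w\<in>S. \<beta> P w) \<le> (\<Sum>w\<in>S. (if w \<in> X1 then C * p^2 * vgcd w / vnorm w else 0) + (if w \<in> X2 then \<epsilon>1 * p else 0)
         + (if w \<in> X3 then C * p^2 * kr / vnorm w else 0) + (if w \<in> X4 then C * p^2 * kr / (\<delta>1 * p) else 0))"
      proof (rule sum_mono)
        fix w assume w: "w \<in> S"
        have v1: "vnorm w \<ge> 1" using w vnorm_pos by (auto simp: S_def)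
        have pos: "0 \<le> C * p^2 * kr / vnorm w" "0 \<le> C * p^2 * kr / (\<delta>1 * p)" "0 \<le> \<epsilon>1 * p" 
          using C kr v1 \<delta>1 p \<epsilon>1 by auto
        have w0: "w \<noteq> (0, 0, 0)" using w by (auto simp: S_def)
        consider "w \<in> X1" | "w \<in> X2" "w \<notin> X1" | "vgcd w \<le> int K" "\<not> generic \<delta> G T P w" using w by (fastforce simp: X1_def X2_def)
        then show "\<beta> P w \<le> (if w \<in> X1 then C * p^2 * vgcd w / vnorm w else 0) + (if w \<in> X2 then \<epsilon>1 * p else 0)
           + (if w \<in> X3 then C * p^2 * kr / vnorm w else 0) + (if w \<in> X4 then C * p^2 * kr / (\<delta>1 * p) else 0)"
        proof cases
          case 1
          then have "\<beta> P w = C * p^2 * vgcd w / vnorm w" using w0 by (auto simp: \<beta>_def X1_def p_def)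
          then show ?thesis using 1 pos nn[OF w] by auto
        next
          case 2
          then have "\<beta> P w = \<epsilon>1 * p" using w0 by (auto simp: \<beta>_def X2_def p_def)
          then show ?thesis using 2 pos nn[OF w] by auto
        next
          case 3
          then have be: "\<beta> P w = C * p^2 * vgcd w / vnorm w" using w0 by (auto simp: \<beta>_def p_def)
          have vk: "real_of_int (vgcd w) \<le> kr" using 3 by (simp add: kr_def)
          have "C * p^2 * vgcd w \<le> C * p^2 * kr" using vk C by (intro mult_left_mono) auto
          then have le: "\<beta> P w \<le> C * p^2 * kr / vnorm w" unfolding be using v1 by (intro divide_right_mono) auto
          show ?thesis
          proof (cases "vnorm w \<le> \<delta>1 * p")
            case True
            then have "w \<in> X3" using w 3 by (simp add: X3_def)
            then show ?thesis using le pos nn[OF w] by auto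
          next
            case False
            then have "w \<in> X4" using w 3 by (simp add: X4_def)
            moreover have "C * p^2 * kr / vnorm w \<le> C * p^2 * kr / (\<delta>1 * p)"
              using False \<delta>1 p C kr v1 by (intro divide_left_mono) auto
            ultimately show ?thesis using le pos nn[OF w] by auto
          qed
        qed
      qed
      also have "\<dots> = (\<Sum>w\<in>X1. C * p^2 * vgcd w / vnorm w) + (\<Sum>w\<in>X2. \<epsilon>1 * p) + (\<Sum>w\<in>X3. C * p^2 * kr / vnorm w) + (\<Sum>w\<in>X4. C * p^2 * kr / (\<delta>1 * p))"
      proof -
        have r: "(\<Sum>w\<in>S. if w \<in> X then h w else 0) = (\<Sum>w\<in>X. h w)" if "X \<subseteq> S" for X and h :: "int \<times> int \<times> int \<Rightarrow> real"
          using that fin(1) by (simp add: sum.inter_restrict[symmetric] Int_absorb1)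
        have s: "X1 \<subseteq> S" "X2 \<subseteq> S" "X3 \<subseteq> S" "X4 \<subseteq> S" by (auto simp: X1_def X2_def X3_def X4_def)
        show ?thesis by (simp only: sum.distrib r[OF s(1)] r[OF s(2)] r[OF s(3)] r[OF s(4)])
      qed
      finally show ?thesis .
    qed
    also have "(\<Sum>w\<in>X1. C * p^2 * vgcd w / vnorm w) \<le> 26 * C * cr^2 / kr * p^4"
    proof -
      have "(\<Sum>w\<in>X1. C * p^2 * vgcd w / vnorm w) = C * p^2 * (\<Sum>w\<in>X1. vgcd w / vnorm w)"
        by (simp add: sum_distrib_left)
      also have "\<dots> \<le> C * p^2 * (26 * (real_of_int R)^2 / int K)"
        using sum_large_vgcd_le[OF R0, of "int K"] K C by (intro mult_left_mono) (auto simp: X1_def S_def)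
      also have "\<dots> = 26 * C * cr^2 / kr * p^4"
        by (simp add: R_def cr_def p_def kr_def power_mult_distrib power2_eq_square power4_eq_xxxx)
      finally show ?thesis .
    qed
    also have "(\<Sum>w\<in>X2. \<epsilon>1 * p) \<le> 1 / kr * p^4"
    proof -
      have "card X2 \<le> card (cube R)" by (rule card_mono) (auto simp: X2_def S_def)
      then have "int (card X2) \<le> (2 * R + 1)^3" using card_cube[OF R0] by simp
      then have "real_of_int (int (card X2)) \<le> real_of_int ((2 * R + 1)^3)" by (simp only: of_int_le_iff)
      then have "real (card X2) \<le> (2 * (cr * p) + 1)^3" by (simp add: R_def cr_def p_def)
      also have "\<dots> \<le> (3 * cr * p)^3"
        using mult_mono[of 1 cr 1 p] cr p by (intro power_mono) auto
      finally have "real (card X2) * (\<epsilon>1 * p) \<le> (3 * cr * p)^3 * (\<epsilon>1 * p)"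
        using \<epsilon>1 p by (intro mult_right_mono) auto
      also have "\<dots> = 1 / kr * p^4" using cr kr
        by (simp add: \<epsilon>1_def power_mult_distrib power4_eq_xxxx power3_eq_cube)
      finally show ?thesis by simp
    qed
    also have "(\<Sum>w\<in>X3. C * p^2 * kr / vnorm w) \<le> 1 / kr * p^4"
    proof -
      define R' where "R' = \<lfloor>\<delta>1 * p\<rfloor>"
      have R': "R' \<ge> 0" "real_of_int R' \<le> \<delta>1 * p" using \<delta>1 p by (auto simp: R'_def)
      have "(\<Sum>w\<in>X3. C * p^2 * kr / vnorm w) = C * p^2 * kr * (\<Sum>w\<in>X3. 1 / vnorm w)"
        by (simp add: sum_distrib_left)
      also have "(\<Sum>w\<in>X3. 1 / vnorm w) \<le> (\<Sum>w\<in>cube R' - {(0, 0, 0)}. 1 / vnorm w)"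
      proof (rule sum_mono2)
        show "X3 \<subseteq> cube R' - {(0, 0, 0)}" by (auto simp: X3_def S_def in_cube_iff R'_def le_floor_iff)
        fix w assume "w \<in> cube R' - {(0, 0, 0)} - X3"
        then show "0 \<le> 1 / real_of_int (vnorm w)" using vnorm_pos[of w] by simp
      qed simp
      also have "\<dots> \<le> 26 * (real_of_int R')^2" by (rule sum_inverse_vnorm_le[OF R'(1)])
      also have "\<dots> \<le> 26 * (\<delta>1 * p)^2" using R' by (intro mult_left_mono power_mono) auto
      also have "C * p^2 * kr * (26 * (\<delta>1 * p)^2) = (C * kr * 26 * \<delta>1^2) * p^4"
        by (simp add: power_mult_distrib power2_eq_square power4_eq_xxxx)
      also have "\<dots> \<le> 1 / kr * p^4" using \<delta>1 by (intro mult_right_mono) auto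
      finally show ?thesis using C kr by (simp add: mult_left_mono)
    qed
    also have "(\<Sum>w\<in>X4. C * p^2 * kr / (\<delta>1 * p)) \<le> 1 / kr * p^4"
    proof -
      have "card X4 \<le> card {w\<in>cube R. \<not> generic \<delta> G T P w}" by (rule card_mono) (auto simp: X4_def S_def)
      then have "real (card X4) \<le> \<epsilon> * p^3" using P2[OF b(2,3)] by (simp add: R_def p_def)
      then have "real (card X4) * (C * p^2 * kr / (\<delta>1 * p)) \<le> \<epsilon> * p^3 * (C * p^2 * kr / (\<delta>1 * p))"
        using C p kr \<delta>1 by (intro mult_right_mono) auto
      also have "\<dots> = 1 / kr * p^4" using C kr \<delta>1(1) p
        by (simp add: \<epsilon>_def field_simps power2_eq_square power4_eq_xxxx power3_eq_cube)
      finally show ?thesis by simp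
    qed
    also have "(2 * p + 1)^3 \<le> 1 / kr * p^4"
    proof -
      have "(2 * p + 1)^3 \<le> (3 * p)^3" using p by (intro power_mono) auto
      also have "\<dots> = 27 * kr / kr * p^3" using kr by (simp add: power_mult_distrib)
      also have "\<dots> \<le> p / kr * p^3" using p kr by (intro mult_right_mono divide_right_mono) auto
      also have "\<dots> = 1 / kr * p^4" by (simp add: power4_eq_xxxx power3_eq_cube)
      finally show ?thesis .
    qed
    finally have "(\<Sum>w\<in>cube R. \<beta> P w) \<le> 1 / kr * p^4 + (26 * C * cr^2 / kr * p^4 + 1 / kr * p^4 + 1 / kr * p^4 + 1 / kr * p^4)" by linarith
    also have "\<dots> = (4 + 26 * (4 + 5 * c) * (real_of_int c)^2) / K * (real_of_int P)^4"
      by (simp add: C_def cr_def kr_def p_def add_divide_distrib algebra_simps)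
    finally show "(\<Sum>w\<in>cube (c * P). \<beta> P w) \<le> (4 + 26 * (4 + 5 * c) * (real_of_int c)^2) / K * (real_of_int P)^4"
      by (simp add: R_def)
  qed
qed

section \<open>Second moment of the representation numbers\<close>

text \<open>Expand \<open>\<Sum> (r(d) - r(d+h))\<^sup>2\<close> and use that \<open>r\<close> vanishes on \<open>E\<close>.\<close>

lemma exceptional_second_moment:
  fixes F :: "'a \<Rightarrow> int"
  assumes "finite X" "finite E" and E: "\<And>x. x \<in> X \<Longrightarrow> F x \<notin> E"
  shows "(\<Sum>d\<in>E. (real (card {x\<in>X. F x = d + h}))^2)
    \<le> 2 * (real (card {(x, y). x \<in> X \<and> y \<in> X \<and> F y = F x}) - real (card {(x, y). x \<in> X \<and> y \<in> X \<and> F y = F x + h}))"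
proof -
  define r where "r = (\<lambda>d. real (card {x\<in>X. F x = d}))"
  \<comment> \<open>\<open>U\<close> contains every \<open>d\<close> with \<open>r d\<close> or
    \<open>r (d + h)\<close> nonzero, so sums over \<open>U\<close> are complete correlations. Those
    of \<open>r(d)^2\<close> and of \<open>r(d + h)^2\<close> both count the pairs with equal
    values, whence the factor 2.\<close>
  define U where "U = E \<union> F ` X \<union> (\<lambda>x. F x - h) ` X"
  have fU: "finite U" using assms by (simp add: U_def)
  have corr: "(\<Sum>d\<in>U. r (d + a) * r (d + b)) = real (card {(x, y). x \<in> X \<and> y \<in> X \<and> F y = F x - a + b})"
    if "a = 0 \<or> a = h" for a b
  proof -
    define S where "S = {(x, y). x \<in> X \<and> y \<in> X \<and> F y = F x - a + b}"
    have "finite S" by (rule finite_subset[of _ "X \<times> X"]) (use assms in \<open>auto simp: S_def\<close>)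
    moreover have "(\<lambda>(x, y). F x - a) ` S \<subseteq> U" using that by (auto simp: S_def U_def)
    ultimately have "card S = (\<Sum>d\<in>U. card {p\<in>S. (\<lambda>(x, y). F x - a) p = d})"
      using sum.group[of S U "\<lambda>(x, y). F x - a" "\<lambda>_. 1::nat"] fU by simp
    also have "\<dots> = (\<Sum>d\<in>U. card ({x\<in>X. F x = d + a} \<times> {x\<in>X. F x = d + b}))"
      by (intro sum.cong refl arg_cong[of _ _ card]) (auto simp: S_def)
    finally show ?thesis by (simp add: S_def r_def card_cartesian_product)
  qed
  have "(\<Sum>d\<in>E. (r (d + h))^2) = (\<Sum>d\<in>E. (r d - r (d + h))^2)"
  proof (rule sum.cong)
    fix d assume "d \<in> E"
    then have "{x\<in>X. F x = d} = {}" using E by auto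
    then show "(r (d + h))^2 = (r d - r (d + h))^2" by (simp only: r_def card.empty) simp
  qed simp
  also have "\<dots> \<le> (\<Sum>d\<in>U. (r d - r (d + h))^2)"
    by (rule sum_mono2) (use fU in \<open>auto simp: U_def\<close>)
  also have "\<dots> = (\<Sum>d\<in>U. r (d + 0) * r (d + 0)) + (\<Sum>d\<in>U. r (d + h) * r (d + h)) - 2 * (\<Sum>d\<in>U. r (d + 0) * r (d + h))"
    by (simp add: power2_eq_square algebra_simps sum.distrib sum_subtractf sum_distrib_left)
  also have "\<dots> = 2 * (real (card {(x, y). x \<in> X \<and> y \<in> X \<and> F y = F x}) - real (card {(x, y). x \<in> X \<and> y \<in> X \<and> F y = F x + h}))"
    using corr[of 0 0] corr[of h h] corr[of 0 h] by simp
  finally show ?thesis by (simp add: r_def)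
qed

section \<open>From correlations of a quadratic form to points on planes\<close>

definition ibox :: "int \<Rightarrow> ('n::finite \<Rightarrow> int) set" where
  "ibox P = {x. \<forall>i. \<bar>x i\<bar> \<le> P}"

lemma ibox_eq_PiE: "ibox P = (\<Pi>\<^sub>E i\<in>UNIV. {-P..P})"
  by (auto simp: ibox_def PiE_def Pi_def abs_le_iff minus_le_iff)

lemma finite_ibox [simp]: "finite (ibox P :: ('n::finite \<Rightarrow> int) set)"
  unfolding ibox_eq_PiE by (rule finite_PiE) auto

text \<open>Projection along three coordinates, kept inside the same function type by setting them
  to 0. Its values index the slices into which a hyperplane is cut.\<close>

definition rest :: "'n \<Rightarrow> 'n \<Rightarrow> 'n \<Rightarrow> ('n \<Rightarrow> int) \<Rightarrow> ('n \<Rightarrow> int)" where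
  "rest i j k x = x(i := 0, j := 0, k := 0)"

lemma card_rest_ibox:
  fixes i j k :: "'n::finite"
  assumes ijk: "i \<noteq> j" "i \<noteq> k" "j \<noteq> k" and P: "P \<ge> 0"
  shows "finite (rest i j k ` ibox P)" "real (card (rest i j k ` ibox P)) \<le> (2 * P + 1)^(CARD('n) - 3)"
proof -
  show "finite (rest i j k ` ibox P)" by simp
  define A where "A = (\<lambda>l. if l \<in> {i, j, k} then {0} else {-P..P})"
  have sub: "rest i j k ` ibox P \<subseteq> (\<Pi>\<^sub>E l\<in>UNIV. A l)"
    by (auto simp: rest_def ibox_def A_def PiE_def Pi_def abs_le_iff minus_le_iff)
  have "card (rest i j k ` ibox P) \<le> card (\<Pi>\<^sub>E l\<in>UNIV. A l)"
    by (rule card_mono[OF _ sub]) (auto intro!: finite_PiE simp: A_def)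
  also have "\<dots> = (\<Prod>l\<in>UNIV. card (A l))" by (rule card_PiE) simp
  also have "\<dots> = (\<Prod>l\<in>{i, j, k}. card (A l)) * (\<Prod>l\<in>UNIV - {i, j, k}. card (A l))"
    by (metis finite_class.finite_UNIV prod.subset_diff subset_UNIV mult.commute)
  also have "(\<Prod>l\<in>{i, j, k}. card (A l)) = 1" by (rule prod.neutral) (auto simp: A_def)
  also have "(\<Prod>l\<in>UNIV - {i, j, k}. card (A l)) = (\<Prod>l\<in>UNIV - {i, j, k}. nat (2 * P + 1))"
    by (rule prod.cong) (auto simp: A_def)
  also have "\<dots> = nat (2 * P + 1) ^ (CARD('n) - 3)"
    using ijk by (simp add: card_Diff_subset numeral_3_eq_3)
  finally have "real (card (rest i j k ` ibox P)) \<le> real (nat (2 * P + 1) ^ (CARD('n) - 3))"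
    by (simp only: mult_1 of_nat_le_iff)
  then show "real (card (rest i j k ` ibox P)) \<le> (2 * P + 1)^(CARD('n) - 3)" using P by simp
qed

definition qf :: "('n::finite \<Rightarrow> 'n \<Rightarrow> int) \<Rightarrow> ('n \<Rightarrow> int) \<Rightarrow> int" where
  "qf q x = (\<Sum>i\<in>UNIV. \<Sum>j\<in>UNIV. q i j * x i * x j)"

text \<open>The gradient of the form at \<open>u\<close>, that is, the coefficients of the linear
  form by which the value at a sum exceeds the sum of the values. The matrix \<open>q\<close> need
  not be symmetric, hence the symmetrisation.\<close>

definition wv :: "('n::finite \<Rightarrow> 'n \<Rightarrow> int) \<Rightarrow> ('n \<Rightarrow> int) \<Rightarrow> 'n \<Rightarrow> int" where
  "wv q u j = (\<Sum>i\<in>UNIV. (q i j + q j i) * u i)"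

lemma qf_add: "qf q (\<lambda>i. y i + u i) = qf q y + qf q u + (\<Sum>j\<in>UNIV. wv q u j * y j)"
proof -
  have "qf q (\<lambda>i. y i + u i) = qf q y + qf q u + ((\<Sum>i\<in>UNIV. \<Sum>j\<in>UNIV. q i j * u i * y j) + (\<Sum>i\<in>UNIV. \<Sum>j\<in>UNIV. q i j * y i * u j))"
    unfolding qf_def by (simp add: algebra_simps sum.distrib)
  also have "(\<Sum>i\<in>UNIV. \<Sum>j\<in>UNIV. q i j * y i * u j) = (\<Sum>i\<in>UNIV. \<Sum>j\<in>UNIV. q j i * u i * y j)"
    by (subst sum.swap) (simp add: mult_ac)
  also have "(\<Sum>i\<in>UNIV. \<Sum>j\<in>UNIV. q i j * u i * y j) + \<dots> = (\<Sum>j\<in>UNIV. wv q u j * y j)"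
    unfolding wv_def sum_distrib_right sum.distrib[symmetric]
    by (subst sum.swap) (simp add: algebra_simps)
  finally show ?thesis .
qed

lemma qf_scale: "qf q (\<lambda>i. k * x i) = k^2 * qf q x"
  by (simp add: qf_def sum_distrib_left power2_eq_square mult_ac)

lemma abs_wv_le:
  assumes "u \<in> ibox B" "B \<ge> 0"
  shows "\<bar>wv q u j\<bar> \<le> (\<Sum>i\<in>UNIV. \<Sum>j\<in>UNIV. \<bar>q i j + q j i\<bar>) * B"
proof -
  have "\<bar>wv q u j\<bar> \<le> (\<Sum>i\<in>UNIV. \<bar>(q i j + q j i) * u i\<bar>)" unfolding wv_def by (rule sum_abs)
  also have "\<dots> \<le> (\<Sum>i\<in>UNIV. \<bar>q i j + q j i\<bar> * B)"
    using assms by (intro sum_mono) (auto simp: abs_mult ibox_def intro!: mult_left_mono)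
  also have "\<dots> \<le> (\<Sum>i\<in>UNIV. (\<Sum>j\<in>UNIV. \<bar>q i j + q j i\<bar>) * B)"
    using assms(2) by (intro sum_mono mult_right_mono member_le_sum) auto
  finally show ?thesis by (simp add: sum_distrib_right)
qed

text \<open>The points \<open>y\<close> with both \<open>y\<close> and \<open>y + u\<close> in the
  cube form a box, the product of the intervals \<open>I i\<close>. Once all but three coordinates
  are fixed, the hyperplane becomes a plane in a three-dimensional box, to which the bound
  \<open>\<beta>\<close> applies; there are at most \<open>(2 P + 1)^(CARD('n) - 3)\<close> such
  slices.\<close>

lemma hyperplane_defect:
  fixes i1 i2 i3 :: "'n::finite" and w u :: "'n \<Rightarrow> int"
  assumes ijk: "i1 \<noteq> i2" "i1 \<noteq> i3" "i2 \<noteq> i3" and P: "P \<ge> 0"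
    and b: "\<And>l1 u1 l2 u2 l3 u3 k. {l1..u1} \<subseteq> {-P..P} \<Longrightarrow> {l2..u2} \<subseteq> {-P..P} \<Longrightarrow> {l3..u3} \<subseteq> {-P..P} \<Longrightarrow>
       real (card (plane_points {l1..u1} {l2..u2} {l3..u3} (w i1) (w i2) (w i3) k)) - 
       real (card (plane_points {l1..u1} {l2..u2} {l3..u3} (w i1) (w i2) (w i3) (k + h))) \<le> \<beta>"
    and \<beta>: "\<beta> \<ge> 0"
  defines "N \<equiv> (\<lambda>k. real (card {y \<in> ibox P. (\<lambda>i. y i + u i) \<in> ibox P \<and> (\<Sum>j\<in>UNIV. w j * y j) = k}))"
  shows "N k - N (k + h) \<le> (2 * P + 1)^(CARD('n) - 3) * \<beta>"
proof -
  define I where "I = (\<lambda>i. {max (-P) (-P - u i)..min P (P - u i)})"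
  have Isub: "I i \<subseteq> {-P..P}" for i by (auto simp: I_def)
  define A where "A = (\<lambda>k. {y \<in> ibox P. (\<lambda>i. y i + u i) \<in> ibox P \<and> (\<Sum>j\<in>UNIV. w j * y j) = k})"
  have A_iff: "y \<in> A k \<longleftrightarrow> (\<forall>i. y i \<in> I i) \<and> (\<Sum>j\<in>UNIV. w j * y j) = k" for y k
  proof -
    have e: "y i \<in> I i \<longleftrightarrow> \<bar>y i\<bar> \<le> P \<and> \<bar>y i + u i\<bar> \<le> P" for i unfolding I_def by auto
    show ?thesis by (auto simp: A_def ibox_def e)
  qed
  have finA: "finite (A k)" for k by (simp add: A_def)
  define Rs where "Rs = rest i1 i2 i3 ` ibox P"
  note cR = card_rest_ibox[OF ijk P, folded Rs_def]
  define f where "f = rest i1 i2 i3"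
  have NA: "N k = (\<Sum>z\<in>Rs. real (card {y\<in>A k. f y = z}))" for k
  proof -
    have "card (A k) = (\<Sum>z\<in>Rs. card {y\<in>A k. f y = z})"
    proof -
      have sub: "f ` A k \<subseteq> Rs" by (auto simp: A_def Rs_def f_def)
      show ?thesis using sum.group[OF finA cR(1) sub, of "\<lambda>_. 1::nat"] by simp
    qed
    then show ?thesis by (simp add: N_def A_def)
  qed
  have fib: "card {y\<in>A k. f y = z} = card (plane_points (I i1) (I i2) (I i3) (w i1) (w i2) (w i3) (k - (\<Sum>j\<in>UNIV. w j * z j)))"
    if z: "z i1 = 0" "z i2 = 0" "z i3 = 0" "\<And>i. i \<notin> {i1, i2, i3} \<Longrightarrow> z i \<in> I i" for z k
  proof (rule bij_betw_same_card[where f = "\<lambda>y. (y i1, y i2, y i3)"])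
    have sumeq: "(\<Sum>j\<in>UNIV. w j * y j) = w i1 * y i1 + w i2 * y i2 + w i3 * y i3 + (\<Sum>j\<in>UNIV. w j * z j)" if "f y = z" for y
    proof -
      have "(\<Sum>j\<in>UNIV. w j * y j) = (\<Sum>j\<in>UNIV. w j * f y j) + (\<Sum>j\<in>UNIV. w j * (y j - f y j))"
        by (simp add: sum.distrib[symmetric] algebra_simps)
      also have "(\<Sum>j\<in>UNIV. w j * (y j - f y j)) = (\<Sum>j\<in>{i1, i2, i3}. w j * (y j - f y j))"
        by (rule sum.mono_neutral_right) (auto simp: f_def rest_def)
      also have "\<dots> = w i1 * y i1 + w i2 * y i2 + w i3 * y i3" using ijk by (simp add: f_def rest_def)
      finally show ?thesis using that by simp
    qed
    show "bij_betw (\<lambda>y. (y i1, y i2, y i3)) {y\<in>A k. f y = z} (plane_points (I i1) (I i2) (I i3) (w i1) (w i2) (w i3) (k - (\<Sum>j\<in>UNIV. w j * z j)))"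
    proof (rule bij_betwI[where g = "\<lambda>(a, b, c). z(i1 := a, i2 := b, i3 := c)"])
      show "(\<lambda>y. (y i1, y i2, y i3)) \<in> {y\<in>A k. f y = z} \<rightarrow> plane_points (I i1) (I i2) (I i3) (w i1) (w i2) (w i3) (k - (\<Sum>j\<in>UNIV. w j * z j))"
        using sumeq by (auto simp: A_iff plane_points_def)
      show "(\<lambda>(a, b, c). z(i1 := a, i2 := b, i3 := c)) \<in> plane_points (I i1) (I i2) (I i3) (w i1) (w i2) (w i3) (k - (\<Sum>j\<in>UNIV. w j * z j)) \<rightarrow> {y\<in>A k. f y = z}"
      proof clarify
        fix a b c assume abc: "(a, b, c) \<in> plane_points (I i1) (I i2) (I i3) (w i1) (w i2) (w i3) (k - (\<Sum>j\<in>UNIV. w j * z j))"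
        define y where "y = z(i1 := a, i2 := b, i3 := c)"
        have fy: "f y = z" using z(1-3) ijk by (auto simp: f_def rest_def y_def)
        have "\<forall>i. y i \<in> I i" using abc z(4) ijk by (auto simp: y_def plane_points_def)
        moreover have "(\<Sum>j\<in>UNIV. w j * y j) = k" using sumeq[OF fy] abc ijk by (auto simp: y_def plane_points_def)
        ultimately show "y \<in> A k \<and> f y = z" using fy A_iff by blast
      qed
    qed (use z ijk in \<open>auto simp: f_def rest_def plane_points_def\<close>)
  qed
  have "N k - N (k + h) = (\<Sum>z\<in>Rs. real (card {y\<in>A k. f y = z}) - real (card {y\<in>A (k + h). f y = z}))"
    by (simp add: NA sum_subtractf)
  also have "\<dots> \<le> (\<Sum>z\<in>Rs. \<beta>)"
  proof (rule sum_mono)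
    fix z assume "z \<in> Rs"
    then have z0: "z i1 = 0" "z i2 = 0" "z i3 = 0" by (auto simp: Rs_def rest_def)
    show "real (card {y\<in>A k. f y = z}) - real (card {y\<in>A (k + h). f y = z}) \<le> \<beta>"
    proof (cases "\<forall>i. i \<notin> {i1, i2, i3} \<longrightarrow> z i \<in> I i")
      case True
      have eq: "k + h - (\<Sum>j\<in>UNIV. w j * z j) = k - (\<Sum>j\<in>UNIV. w j * z j) + h" by simp
      have f: "card {y\<in>A k'. f y = z} = card (plane_points (I i1) (I i2) (I i3) (w i1) (w i2) (w i3) (k' - (\<Sum>j\<in>UNIV. w j * z j)))" for k'
        by (rule fib[OF z0]) (use True in blast)
      show ?thesis unfolding f eq
        using b[of _ _ _ _ _ _ "k - (\<Sum>j\<in>UNIV. w j * z j)", OF Isub[of i1, unfolded I_def] Isub[of i2, unfolded I_def] Isub[of i3, unfolded I_def]]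
        unfolding I_def .
    next
      case False
      then obtain i where i: "i \<notin> {i1, i2, i3}" "z i \<notin> I i" by auto
      have "f y \<noteq> z" if "y \<in> A k" for y
      proof
        assume "f y = z"
        then have "y i = z i" using i(1) by (auto simp: f_def rest_def)
        then show False using that i(2) A_iff by metis
      qed
      then have e: "{y\<in>A k. f y = z} = {}" by blast
      show ?thesis unfolding e using \<beta> by simp
    qed
  qed
  also have "\<dots> = real (card Rs) * \<beta>" by simp
  also have "\<dots> \<le> (2 * P + 1)^(CARD('n) - 3) * \<beta>" using cR(2) \<beta> by (rule mult_right_mono)
  finally show ?thesis .
qed

text \<open>For a fixed difference \<open>u = y - x\<close> the condition
  \<open>qf q y = qf q x + h\<close> is linear in \<open>x\<close>: by \<open>qf_add\<close> it puts
  \<open>x\<close> on a hyperplane with normal \<open>wv q u\<close>.\<close>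

lemma correlation_difference_sum:
  fixes q :: "'n::finite \<Rightarrow> 'n \<Rightarrow> int"
  assumes P: "P \<ge> 0"
  shows "real (card {(x, y). x \<in> ibox P \<and> y \<in> ibox P \<and> qf q y = qf q x + h}) =
    (\<Sum>u\<in>ibox (2 * P). real (card {y \<in> ibox P. (\<lambda>i. y i + u i) \<in> ibox P \<and> (\<Sum>j\<in>UNIV. wv q u j * y j) = h - qf q u}))"
proof -
  define S where "S = {(x, y). x \<in> ibox P \<and> y \<in> ibox P \<and> qf q y = qf q x + h}"
  define g where "g = (\<lambda>(x, y). (\<lambda>i. y i - x i :: int) :: 'n \<Rightarrow> int)"
  have fS: "finite S" by (rule finite_subset[of _ "ibox P \<times> ibox P"]) (auto simp: S_def)
  have im: "g ` S \<subseteq> ibox (2 * P)"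
  proof clarify
    fix x y assume "(x, y) \<in> S"
    then have "\<bar>x i\<bar> \<le> P \<and> \<bar>y i\<bar> \<le> P" for i by (auto simp: S_def ibox_def)
    then have "\<bar>y i - x i\<bar> \<le> P + P" for i by (metis abs_triangle_ineq4 add_mono order_trans)
    then have "\<bar>y i - x i\<bar> \<le> 2 * P" for i by simp
    then show "g (x, y) \<in> ibox (2 * P)" by (simp add: g_def ibox_def)
  qed
  have "card S = (\<Sum>u\<in>ibox (2 * P). card {p\<in>S. g p = u})"
    using sum.group[OF fS finite_ibox im, of "\<lambda>_. 1::nat"] by simp
  also have "\<dots> = (\<Sum>u\<in>ibox (2 * P). card {y \<in> ibox P. (\<lambda>i. y i + u i) \<in> ibox P \<and> (\<Sum>j\<in>UNIV. wv q u j * y j) = h - qf q u})"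
  proof (rule sum.cong[OF refl])
    fix u :: "'n \<Rightarrow> int"
    define T where "T = {y \<in> ibox P. (\<lambda>i. y i + u i) \<in> ibox P \<and> (\<Sum>j\<in>UNIV. wv q u j * y j) = h - qf q u}"
    have "{p\<in>S. g p = u} = (\<lambda>y. (y, \<lambda>i. y i + u i)) ` T"
    proof (rule set_eqI)
      fix p :: "('n \<Rightarrow> int) \<times> ('n \<Rightarrow> int)"
      obtain x y where p: "p = (x, y)" by (cases p)
      show "p \<in> {p\<in>S. g p = u} \<longleftrightarrow> p \<in> (\<lambda>y. (y, \<lambda>i. y i + u i)) ` T"
      proof
        assume a: "p \<in> {p\<in>S. g p = u}"
        then have y: "y = (\<lambda>i. x i + u i)" by (auto simp: p g_def)
        then have "x \<in> T" using a qf_add[of q x u] by (auto simp: T_def S_def p)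
        then show "p \<in> (\<lambda>y. (y, \<lambda>i. y i + u i)) ` T" using p y by blast
      next
        assume "p \<in> (\<lambda>y. (y, \<lambda>i. y i + u i)) ` T"
        then show "p \<in> {p\<in>S. g p = u}" using qf_add[of q _ u] by (auto simp: T_def S_def g_def)
      qed
    qed
    then show "card {p\<in>S. g p = u} = card T" by (simp add: card_image inj_on_def)
  qed
  finally show ?thesis by (simp add: S_def)
qed

text \<open>Each difference \<open>u\<close> costs \<open>(2 P + 1)^(n - 3)\<close> times the defect
  bound of the triple formed by three fixed entries of \<open>wv q u\<close>. Injectivity of
  \<open>wv q\<close> lets O(P^(n - 3)) differences share a triple, and the sum of
  \<open>\<beta>\<close> over all triples is O(P^4 / K); the exponents add up to
  \<open>2 n - 2\<close>. The constant \<open>C\<close> is independent of \<open>K\<close>, while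
  \<open>\<eta>\<close> is not.\<close>

lemma second_moment_bound:
  fixes q :: "'n::finite \<Rightarrow> 'n \<Rightarrow> int"
  assumes n: "CARD('n) \<ge> 3" and inj: "inj (wv q)"
  obtains C :: real where "C > 0" "\<And>K. K \<ge> 1 \<Longrightarrow> \<exists>\<eta>>0. \<exists>P0\<ge>1. \<forall>P\<ge>P0. \<forall>h E. fact K dvd h \<longrightarrow> \<bar>real_of_int h\<bar> \<le> \<eta> * (real_of_int P)^2 \<longrightarrow>
     finite E \<longrightarrow> (\<forall>x\<in>ibox P. qf q x \<notin> E) \<longrightarrow>
     (\<Sum>d\<in>E. (real (card {x\<in>ibox P. qf q x = d + h}))^2) \<le> C / real K * (real_of_int P)^(2 * CARD('n) - 2)"
proof -
  obtain T :: "'n set" where T: "card T = 3" using obtain_subset_with_card_n[OF n] by metis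
  then obtain i1 i2 i3 where "T = {i1, i2, i3}" and ijk: "i1 \<noteq> i2" "i1 \<noteq> i3" "i2 \<noteq> i3"
    using card_3_iff[of T] by auto
  define c where "c = 1 + 2 * (\<Sum>i\<in>UNIV. \<Sum>j\<in>UNIV. \<bar>q i j + q j i\<bar>)"
  have c: "c \<ge> 1" by (auto simp: c_def intro!: sum_nonneg)
  define cr where "cr = real_of_int c"
  have cr: "cr \<ge> 1" using c by (simp add: cr_def)
  define C where "C = 2 * (3^(CARD('n) - 3) * ((3 * cr)^(CARD('n) - 3) * (4 + 26 * (4 + 5 * cr) * cr^2)))"
  define n' where "n' = CARD('n) - 3"
  show ?thesis
  proof (rule that[of C])
    show "C > 0" using cr by (simp add: C_def add_pos_nonneg)
    fix K :: nat assume K: "K \<ge> 1"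
    show "\<exists>\<eta>>0. \<exists>P0\<ge>1. \<forall>P\<ge>P0. \<forall>h E. fact K dvd h \<longrightarrow> \<bar>real_of_int h\<bar> \<le> \<eta> * (real_of_int P)^2 \<longrightarrow>
     finite E \<longrightarrow> (\<forall>x\<in>ibox P. qf q x \<notin> E) \<longrightarrow>
     (\<Sum>d\<in>E. (real (card {x\<in>ibox P. qf q x = d + h}))^2) \<le> C / real K * (real_of_int P)^(2 * CARD('n) - 2)"
    proof (rule plane_defect_sum[OF c K], goal_cases)
      case (1 \<eta> P0 \<beta>)
      note \<eta> = 1(1) and \<beta>0 = 1(2) and \<beta>sum = 1(3) and \<beta> = 1(4) and P0 = 1(5)
    have main: "(\<Sum>d\<in>E. (real (card {x\<in>ibox P. qf q x = d + h}))^2) \<le> C / real K * (real_of_int P)^(2 * CARD('n) - 2)"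
      if P: "P \<ge> P0" and h: "fact K dvd h" "\<bar>real_of_int h\<bar> \<le> \<eta> * (real_of_int P)^2" and E: "finite E" "\<forall>x\<in>ibox P. qf q x \<notin> E"
      for P h E
    proof -
      define p where "p = real_of_int P"
      have p: "p \<ge> 1" and Pn: "P \<ge> 0" "P \<ge> 1" using P P0 by (auto simp: p_def)
      define t where "t = (\<lambda>u. (wv q u i1, wv q u i2, wv q u i3))"
      have wb: "\<bar>wv q u j\<bar> \<le> c * P" if "u \<in> ibox (2 * P)" for u j
      proof -
        have "\<bar>wv q u j\<bar> \<le> (\<Sum>i\<in>UNIV. \<Sum>j\<in>UNIV. \<bar>q i j + q j i\<bar>) * (2 * P)" by (rule abs_wv_le) (use that Pn in auto)
        also have "\<dots> \<le> c * P" using Pn by (simp add: c_def algebra_simps)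
        finally show ?thesis .
      qed
      have tc: "t u \<in> cube (c * P)" if "u \<in> ibox (2 * P)" for u
        using wb[OF that] by (auto simp: t_def cube_def abs_le_iff minus_le_iff)
      define N where "N = (\<lambda>u h. real (card {y \<in> ibox P. (\<lambda>i. y i + u i) \<in> ibox P \<and> (\<Sum>j\<in>UNIV. wv q u j * y j) = h - qf q u}))"
      have Nd: "N u 0 - N u h \<le> (2 * P + 1)^n' * \<beta> P (t u)" if u: "u \<in> ibox (2 * P)" for u
      proof -
        have "h - qf q u = (0 - qf q u) + h" by simp
        then show ?thesis unfolding N_def n'_def
          using hyperplane_defect[OF ijk Pn(1), of "wv q u" h "\<beta> P (t u)" u "0 - qf q u"]
            \<beta>[OF P tc[OF u, unfolded t_def] h] \<beta>0[OF P tc[OF u]] by (simp add: t_def)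
      qed
      have cn: "finite (rest i1 i2 i3 ` ibox (c * P))" "real (card (rest i1 i2 i3 ` ibox (c * P))) \<le> (2 * (c * P) + 1)^n'"
        using card_rest_ibox[OF ijk, of "c * P"] c Pn unfolding n'_def by auto
      have fibt: "real (card {u\<in>ibox (2 * P). t u = b}) \<le> (2 * (c * P) + 1)^n'" for b
      proof -
        have "card {u\<in>ibox (2 * P). t u = b} \<le> card (rest i1 i2 i3 ` ibox (c * P))"
        proof (rule card_inj_on_le[where f = "\<lambda>u. rest i1 i2 i3 (wv q u)"])
          show "inj_on (\<lambda>u. rest i1 i2 i3 (wv q u)) {u\<in>ibox (2 * P). t u = b}"
          proof (rule inj_onI)
            fix u v assume uv: "u \<in> {u\<in>ibox (2 * P). t u = b}" "v \<in> {u\<in>ibox (2 * P). t u = b}" "rest i1 i2 i3 (wv q u) = rest i1 i2 i3 (wv q v)"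
            have "wv q u i = wv q v i" for i
            proof (cases "i \<in> {i1, i2, i3}")
              case True
              then show ?thesis using uv(1,2) by (auto simp: t_def)
            next
              case False
              then show ?thesis using fun_cong[OF uv(3), of i] by (simp add: rest_def)
            qed
            then have "wv q u = wv q v" by (rule ext)
            then show "u = v" by (rule injD[OF inj])
          qed
          show "(\<lambda>u. rest i1 i2 i3 (wv q u)) ` {u\<in>ibox (2 * P). t u = b} \<subseteq> rest i1 i2 i3 ` ibox (c * P)"
            using wb by (auto simp: ibox_def)
        qed (rule cn(1))
        then have "real (card {u\<in>ibox (2 * P). t u = b}) \<le> real (card (rest i1 i2 i3 ` ibox (c * P)))" by (simp only: of_nat_le_iff)
        then show ?thesis using cn(2) by linarith
      qed
      have "real (card {(x, y). x \<in> ibox P \<and> y \<in> ibox P \<and> qf q y = qf q x}) - real (card {(x, y). x \<in> ibox P \<and> y \<in> ibox P \<and> qf q y = qf q x + h})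
         = (\<Sum>u\<in>ibox (2 * P). N u 0 - N u h)"
        using correlation_difference_sum[OF Pn(1), of q 0] correlation_difference_sum[OF Pn(1), of q h]
        by (simp add: N_def sum_subtractf)
      also have "\<dots> \<le> (\<Sum>u\<in>ibox (2 * P). (2 * P + 1)^n' * \<beta> P (t u))" by (rule sum_mono[OF Nd])
      also have "\<dots> = (2 * P + 1)^n' * (\<Sum>u\<in>ibox (2 * P). \<beta> P (t u))" by (simp add: sum_distrib_left)
      also have "(\<Sum>u\<in>ibox (2 * P). \<beta> P (t u)) = (\<Sum>b\<in>cube (c * P). \<Sum>u\<in>{u\<in>ibox (2 * P). t u = b}. \<beta> P (t u))"
        by (rule sum.group[symmetric]) (use tc in auto)
      also have "\<dots> = (\<Sum>b\<in>cube (c * P). real (card {u\<in>ibox (2 * P). t u = b}) * \<beta> P b)" by simp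
      also have "\<dots> \<le> (\<Sum>b\<in>cube (c * P). (2 * (c * P) + 1)^n' * \<beta> P b)"
        by (intro sum_mono mult_right_mono fibt \<beta>0[OF P])
      also have "\<dots> = (2 * (c * P) + 1)^n' * (\<Sum>b\<in>cube (c * P). \<beta> P b)" by (simp add: sum_distrib_left)
      also have "\<dots> \<le> (2 * (c * P) + 1)^n' * ((4 + 26 * (4 + 5 * cr) * cr^2) / K * p^4)"
        using \<beta>sum[OF P] c Pn by (intro mult_left_mono) (auto simp: cr_def p_def)
      also have "\<dots> \<le> (3 * cr * p)^n' * ((4 + 26 * (4 + 5 * cr) * cr^2) / K * p^4)"
      proof (rule mult_right_mono)
        have "2 * (cr * p) + 1 \<le> 3 * cr * p" using mult_mono[of 1 cr 1 p] cr p by simp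
        then have "(2 * (cr * p) + 1)^n' \<le> (3 * cr * p)^n'" using cr p by (intro power_mono) auto
        then show "real_of_int ((2 * (c * P) + 1)^n') \<le> (3 * cr * p)^n'" by (simp add: cr_def p_def)
      qed (use cr in auto)
      finally have "real (card {(x, y). x \<in> ibox P \<and> y \<in> ibox P \<and> qf q y = qf q x}) - real (card {(x, y). x \<in> ibox P \<and> y \<in> ibox P \<and> qf q y = qf q x + h})
         \<le> (2 * P + 1)^n' * ((3 * cr * p)^n' * ((4 + 26 * (4 + 5 * cr) * cr^2) / K * p^4))"
        using Pn by (simp add: mult_left_mono)
      also have "\<dots> \<le> (3 * p)^n' * ((3 * cr * p)^n' * ((4 + 26 * (4 + 5 * cr) * cr^2) / K * p^4))"
      proof (rule mult_right_mono)
        have "(2 * p + 1)^n' \<le> (3 * p)^n'" using p by (intro power_mono) auto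
        then show "real_of_int ((2 * P + 1)^n') \<le> (3 * p)^n'" by (simp add: p_def)
      qed (use cr p in auto)
      also have "\<dots> = C / 2 / K * (p^n' * p^n' * p^4)" by (simp add: C_def n'_def[symmetric] power_mult_distrib)
      also have "p^n' * p^n' * p^4 = p^(2 * CARD('n) - 2)"
      proof -
        have "2 * CARD('n) - 2 = n' + n' + 4" using n unfolding n'_def by linarith
        then show ?thesis by (simp only: power_add)
      qed
      finally have le: "real (card {(x, y). x \<in> ibox P \<and> y \<in> ibox P \<and> qf q y = qf q x}) - real (card {(x, y). x \<in> ibox P \<and> y \<in> ibox P \<and> qf q y = qf q x + h})
        \<le> C / 2 / K * p^(2 * CARD('n) - 2)" .
      have "(\<Sum>d\<in>E. (real (card {x\<in>ibox P. qf q x = d + h}))^2) \<le> 2 * (C / 2 / K * p^(2 * CARD('n) - 2))"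
        using exceptional_second_moment[OF finite_ibox E(1), of P "qf q" h] E(2) le by force
      then show ?thesis by (simp add: p_def)
    qed
    show ?case
      using \<eta> P0 main by blast
    qed
  qed
qed

section \<open>Congruences represented by the form\<close>

text \<open>Newton iteration for the square root of \<open>u / v\<close>, to a modulus that need not
  be prime. The step to \<open>\<kappa> + 4 M^k t\<close> changes \<open>\<kappa>^2 v\<close> by
  \<open>8 M^k \<kappa> v t\<close> up to a multiple of \<open>16 M^(2 k)\<close>, and a suitable
  \<open>t\<close> exists because \<open>\<kappa> v\<close> is a unit modulo \<open>M\<close>. The
  factor 8 makes the argument uniform in the prime 2.\<close>

lemma hensel_square:
  fixes M u v :: int
  assumes "coprime u M" "coprime v M" "8 * M dvd u - v" "k \<ge> 1"
  shows "\<exists>\<kappa>. 8 * M^k dvd \<kappa>^2 * v - u"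
  using assms(4)
proof (induction k rule: nat_induct_at_least)
  case base
  then show ?case using assms(3) by (intro exI[of _ 1]) (simp add: dvd_diff_commute)
next
  case (Suc k)
  then obtain \<kappa> r where r: "\<kappa>^2 * v - u = 8 * M^k * r" by (auto elim: dvdE)
  have "M dvd M^k" using Suc(1) by (simp add: dvd_power)
  then have "M dvd \<kappa>^2 * v - u" unfolding r by (simp add: dvd_mult dvd_mult2)
  then have "gcd (\<kappa>^2 * v) M = gcd u M" by (metis gcd.commute gcd_add_mult diff_add_cancel dvdE mult.commute add.commute)
  then have "coprime (\<kappa>^2 * v) M" using assms(1) by (simp add: coprime_iff_gcd_eq_1)
  then have cop: "coprime (\<kappa> * v) M" by (simp add: power2_eq_square)
  then obtain t0 where "[\<kappa> * v * t0 = 1] (mod M)" using cong_solve_coprime_int by blast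
  then have "[\<kappa> * v * t0 * (- r) = 1 * (- r)] (mod M)" by (rule cong_mult) simp
  then have "M dvd \<kappa> * v * (t0 * (- r)) + r" by (simp add: cong_iff_dvd_diff mult_ac)
  then obtain w where w: "r + \<kappa> * v * (t0 * (- r)) = M * w" by (auto elim: dvdE simp: add.commute)
  define t where "t = t0 * (- r)"
  obtain j where j: "k = Suc j" using Suc(1) by (cases k) auto
  have "(\<kappa> + 4 * M^k * t)^2 * v - u = (\<kappa>^2 * v - u) + 8 * M^k * (\<kappa> * v * t) + 16 * M^k * M^k * t^2 * v"
    by (simp add: power2_eq_square algebra_simps)
  also have "\<dots> = 8 * M^k * (r + \<kappa> * v * t) + 16 * M^k * M^k * t^2 * v" unfolding r by (simp only: distrib_left mult_ac)
  also have "\<dots> = 8 * M^(Suc k) * (w + 2 * M^j * t^2 * v)" using w unfolding t_def[symmetric]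
    by (simp only: j power_Suc) (simp add: algebra_simps)
  finally show ?case by (metis dvd_triv_left)
qed

section \<open>Isotropic vectors modulo a prime\<close>

lemma kernel_pigeonhole:
  fixes a b :: "'n::finite \<Rightarrow> int" and p :: int
  assumes "CARD('n) \<ge> 3" "p > 1"
  obtains z where "\<exists>i. \<not> p dvd z i" "p dvd (\<Sum>j\<in>UNIV. a j * z j)" "p dvd (\<Sum>j\<in>UNIV. b j * z j)"
proof -
  define X where "X = (\<Pi>\<^sub>E i\<in>(UNIV::'n set). {0..<p})"
  define \<phi> where "\<phi> = (\<lambda>z. ((\<Sum>j\<in>UNIV. a j * z j) mod p, (\<Sum>j\<in>UNIV. b j * z j) mod p))"
  have "card X = nat p ^ CARD('n)" by (simp add: X_def card_PiE)
  moreover have "card ({0..<p} \<times> {0..<p}) = nat p ^ 2" by (simp add: card_cartesian_product power2_eq_square)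
  moreover have "nat p ^ 2 < nat p ^ CARD('n)" by (rule power_strict_increasing) (use assms in auto)
  ultimately have "card ({0..<p} \<times> {0..<p}) < card X" by simp
  moreover have "\<phi> ` X \<subseteq> {0..<p} \<times> {0..<p}" using assms by (auto simp: \<phi>_def)
  ultimately have "\<not> inj_on \<phi> X" using card_inj_on_le[of \<phi> X "{0..<p} \<times> {0..<p}"] by force
  then obtain x y where xy: "x \<in> X" "y \<in> X" "x \<noteq> y" "\<phi> x = \<phi> y" unfolding inj_on_def by blast
  then obtain i where i: "x i \<noteq> y i" by auto
  show ?thesis
  proof (rule that[of "\<lambda>i. x i - y i"])
    have "0 \<le> x i" "x i < p" "0 \<le> y i" "y i < p" using xy by (auto simp: X_def PiE_def Pi_def)
    then have "\<bar>x i - y i\<bar> < p" by auto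
    then have "\<not> p dvd x i - y i" using i by (metis dvd_imp_le_int right_minus_eq not_le abs_of_pos assms(2) zero_less_one less_trans)
    then show "\<exists>i. \<not> p dvd x i - y i" by blast
    have lin: "(\<Sum>j\<in>UNIV. f j * (x j - y j)) = (\<Sum>j\<in>UNIV. f j * x j) - (\<Sum>j\<in>UNIV. f j * y j)" for f :: "'n \<Rightarrow> int"
      by (simp add: algebra_simps sum_subtractf)
    show "p dvd (\<Sum>j\<in>UNIV. a j * (x j - y j))" "p dvd (\<Sum>j\<in>UNIV. b j * (x j - y j))"
      using xy(4) unfolding lin \<phi>_def by (auto simp: mod_eq_dvd_iff)
  qed
qed

text \<open>Both \<open>a \<alpha>^2\<close> and \<open>- b \<beta>^2 - c\<close> take
  \<open>(p + 1) / 2\<close> different values modulo \<open>p\<close> on the half system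
  \<open>H\<close>, so the two sets of values meet.\<close>

lemma conic_point_mod_prime:
  fixes a b c p :: int
  assumes p: "prime p" "p > 2" and ab: "\<not> p dvd a" "\<not> p dvd b"
  obtains \<alpha> \<beta> where "p dvd a * \<alpha>^2 + b * \<beta>^2 + c"
proof -
  define H where "H = {0..(p - 1) div 2}"
  have cH: "int (card H) = (p - 1) div 2 + 1" using p by (simp add: H_def)
  have inj: "inj_on (\<lambda>x. (a' * x^2 + c') mod p) H" if "\<not> p dvd a'" for a' c'
  proof (rule inj_onI)
    fix x y assume xy: "x \<in> H" "y \<in> H" "(a' * x^2 + c') mod p = (a' * y^2 + c') mod p"
    have "p dvd a' * x^2 + c' - (a' * y^2 + c')" using xy(3) by (simp add: mod_eq_dvd_iff)
    also have "a' * x^2 + c' - (a' * y^2 + c') = a' * ((x - y) * (x + y))" by (simp add: power2_eq_square algebra_simps)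
    finally have "p dvd x - y \<or> p dvd x + y" using p that by (simp add: prime_dvd_mult_iff)
    then show "x = y"
    proof
      assume d: "p dvd x - y"
      have "\<bar>x - y\<bar> < p" using xy p by (auto simp: H_def)
      then show ?thesis using d by (metis dvd_imp_le_int right_minus_eq not_le abs_of_pos p(2) zero_less_numeral less_trans)
    next
      assume d: "p dvd x + y"
      have "0 \<le> x" "0 \<le> y" "x + y < p" using xy p by (auto simp: H_def)
      then show ?thesis using d by (metis add_nonneg_eq_0_iff add_nonneg_nonneg zdvd_not_zless less_le)
    qed
  qed
  define A where "A = (\<lambda>x. (a * x^2 + 0) mod p) ` H"
  define B where "B = (\<lambda>x. (- b * x^2 + (- c)) mod p) ` H"
  have nb: "\<not> p dvd - b" using ab by simp
  have "card A = card H" "card B = card H" unfolding A_def B_def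
    by (rule card_image[OF inj[OF ab(1)]], rule card_image[OF inj[OF nb]])
  moreover have "A \<union> B \<subseteq> {0..<p}" using p by (auto simp: A_def B_def)
  then have "card (A \<union> B) \<le> card {0..<p}" by (rule card_mono[rotated]) simp
  moreover have "2 * ((p - 1) div 2 + 1) > p" using prime_odd_int[OF p] by presburger
  moreover have "card (A \<union> B) + card (A \<inter> B) = card A + card B" 
    by (rule card_Un_Int[symmetric]) (auto simp: A_def B_def H_def)
  ultimately have "card (A \<inter> B) \<noteq> 0" using cH p by simp
  then have "A \<inter> B \<noteq> {}" by auto
  then obtain \<alpha> \<beta> where "(a * \<alpha>^2 + 0) mod p = (- b * \<beta>^2 + (- c)) mod p" unfolding A_def B_def by blast
  then have "p dvd a * \<alpha>^2 + b * \<beta>^2 + c" by (simp add: mod_eq_dvd_iff algebra_simps)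
  then show ?thesis by (rule that)
qed

text \<open>If the form were anisotropic modulo \<open>p\<close>, take pairwise orthogonal
  \<open>x\<close>, \<open>y\<close>, \<open>z\<close> and a point of the conic
  \<open>q(x) \<alpha>^2 + q(y) \<beta>^2 + q(z) = 0\<close>. Then
  \<open>e = \<alpha> x + \<beta> y + z\<close> is isotropic, hence zero modulo \<open>p\<close>;
  pairing it with \<open>z\<close> leaves \<open>2 q(z) = 0\<close>, a contradiction.\<close>

lemma isotropic_vector_mod_prime:
  fixes q :: "'n::finite \<Rightarrow> 'n \<Rightarrow> int" and p :: int
  assumes n: "CARD('n) \<ge> 3" and p: "prime p" "p > 2"
  shows "\<exists>e. (\<exists>i. \<not> p dvd e i) \<and> p dvd qf q e"
proof (rule ccontr)
  assume "\<not> ?thesis"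
  then have ani: "\<not> p dvd qf q e" if "\<exists>i. \<not> p dvd e i" for e using that by blast
  have p1: "p > 1" using p by simp
  obtain i0 :: 'n where True by simp
  define x :: "'n \<Rightarrow> int" where "x = (\<lambda>_. 1)"
  have x: "\<not> p dvd qf q x" by (rule ani) (use p1 in \<open>auto simp: x_def\<close>)
  define B where "B = (\<lambda>u y. \<Sum>j\<in>UNIV. wv q u j * y j)"
  obtain y where y: "\<exists>i. \<not> p dvd y i" "p dvd B x y"
    unfolding B_def using kernel_pigeonhole[OF n p1, of "wv q x" "wv q x"] by blast
  obtain z where z: "\<exists>i. \<not> p dvd z i" "p dvd B x z" "p dvd B y z"
    unfolding B_def using kernel_pigeonhole[OF n p1, of "wv q x" "wv q y"] by blast
  obtain \<alpha> \<beta> where ab: "p dvd qf q x * \<alpha>^2 + qf q y * \<beta>^2 + qf q z"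
    by (rule conic_point_mod_prime[OF p x ani[OF y(1)]])
  have qf_addB: "qf q (\<lambda>i. y i + u i) = qf q y + qf q u + B u y" for y u by (simp add: qf_add B_def)
  have Bscale: "B (\<lambda>i. k * u i) v = k * B u v" for k u v
    by (simp add: B_def wv_def sum_distrib_left sum_distrib_right mult_ac)
  have Bscale2: "B u (\<lambda>i. k * v i) = k * B u v" for k u v
    by (simp add: B_def sum_distrib_left mult_ac)
  have Badd2: "B u (\<lambda>i. v i + v' i) = B u v + B u v'" for u v v' by (simp add: B_def algebra_simps sum.distrib)
  have Badd: "B (\<lambda>i. u i + u' i) v = B u v + B u' v" for u u' v by (simp add: B_def wv_def algebra_simps sum.distrib)
  have Bsym: "B u v = B v u" for u v
    using qf_add[of q u v] qf_add[of q v u] by (simp add: B_def add.commute)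
  define e where "e = (\<lambda>i. (\<alpha> * x i + \<beta> * y i) + z i)"
  have "qf q e = qf q x * \<alpha>^2 + qf q y * \<beta>^2 + qf q z + \<alpha> * \<beta> * B x y + \<alpha> * B x z + \<beta> * B y z"
    unfolding e_def qf_addB qf_scale Bscale Bscale2 Badd2 Bsym[of z] Bsym[of y x] Badd by (simp add: algebra_simps)
  then have "p dvd qf q e" using ab y(2) z by (auto intro!: dvd_add)
  then have all: "\<forall>i. p dvd e i" using ani by blast
  then have "p dvd B z e" unfolding B_def by (auto intro!: dvd_sum)
  moreover have "B z e = \<alpha> * B x z + \<beta> * B y z + B z z" unfolding e_def Badd2 Bscale2 Bsym[of z x] Bsym[of z y] by simp
  ultimately have "p dvd B z z" using z by (metis dvd_add_right_iff dvd_add dvd_mult)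
  moreover have "B z z = 2 * qf q z"
  proof -
    have "(\<lambda>i. z i + z i) = (\<lambda>i. 2 * z i)" by auto
    then show ?thesis using qf_addB[of z z] qf_scale[of q 2 z] by simp
  qed
  ultimately have "p dvd qf q z" using p zdvd_not_zless[of 2 p] by (auto simp: prime_dvd_mult_iff)
  then show False using ani[OF z(1)] by simp
qed

section \<open>A lower bound for the totient\<close>

lemma prod_one_minus_inverse_6j:
  fixes J :: nat
  assumes "J \<ge> 1"
  shows "(\<Prod>j=1..J. (1 - 1 / (6 * real j - 1)) * (1 - 1 / (6 * real j + 1)))^3 \<ge> 1 / (4 * real J)"
  using assms
proof (induction J rule: nat_induct_at_least)
  case base
  show ?case by (simp add: power3_eq_cube)
next
  case (Suc J)
  define x where "x = (1 - 1 / (6 * real (Suc J) - 1)) * (1 - 1 / (6 * real (Suc J) + 1))"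
  define j where "j = real (Suc J)"
  have j: "j \<ge> 2" using Suc(1) by (simp add: j_def)
  have jj: "36 * j^2 > 1" using one_le_power[of j 2] j by linarith
  have "x = (36 * j^2 - 12 * j) / (36 * j^2 - 1)" unfolding x_def j_def[symmetric] using j jj
    by (simp add: field_simps power2_eq_square)
  also have "\<dots> \<ge> 1 - 1 / (3 * j)" using j jj by (simp add: field_simps power2_eq_square)
  finally have x: "x \<ge> 1 - 1 / (3 * j)" .
  \<comment> \<open>A pair of factors is at least \<open>1 - 1 / (3 j)\<close>, and by Bernoulli its
    cube is at least \<open>1 - 1 / j = (j - 1) / j\<close>. These telescope to
    \<open>1 / J\<close>, up to the constant 4 that the case \<open>J = 1\<close> allows.\<close>
  have "1 - 1 / j \<le> (1 - 1 / (3 * j))^3"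
  proof -
    have "(1 + (- 1 / (3 * j)))^3 \<ge> 1 + real 3 * (- 1 / (3 * j))"
      by (rule Bernoulli_inequality) (use j in \<open>simp add: field_simps\<close>)
    then show ?thesis using j by simp
  qed
  also have "\<dots> \<le> x^3" using x j by (intro power_mono) (auto simp: field_simps)
  finally have x3: "1 - 1 / j \<le> x^3" .
  have "1 - 1 / j = real J / j" by (simp add: j_def field_simps)
  then have "1 / (4 * j) = 1 / (4 * real J) * (1 - 1 / j)" using Suc(1) by simp
  also have "\<dots> \<le> (\<Prod>j=1..J. (1 - 1 / (6 * real j - 1)) * (1 - 1 / (6 * real j + 1)))^3 * x^3"
  proof (rule mult_mono)
    show "0 \<le> (\<Prod>j=1..J. (1 - 1 / (6 * real j - 1)) * (1 - 1 / (6 * real j + 1)))^3"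
      by (intro zero_le_power prod_nonneg mult_nonneg_nonneg; simp add: field_simps)
  qed (use Suc x3 j in auto)
  also have "\<dots> = (\<Prod>j=1..Suc J. (1 - 1 / (6 * real j - 1)) * (1 - 1 / (6 * real j + 1)))^3"
    by (simp add: x_def power_mult_distrib)
  finally show ?case by (simp add: j_def)
qed

text \<open>The primes dividing \<open>Q\<close> exceed 3 and so occur among the numbers
  \<open>6 j - 1\<close> and \<open>6 j + 1\<close> with \<open>j <= K\<close>; enlarging the
  product to all of these only lowers it. The resulting exponent 1/3 is below the critical value 1/2
  of \<open>almost_all_represented\<close>.\<close>

lemma totient_ratio_cube_ge:
  fixes Q K :: nat
  assumes Q: "Q > 0" "coprime Q 6" and K: "\<And>p. prime p \<Longrightarrow> p dvd Q \<Longrightarrow> p \<le> K" "K \<ge> 1"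
  shows "(real (totient Q) / real Q)^3 \<ge> 1 / (4 * real K)"
proof -
  define T1 where "T1 = (\<lambda>j::nat. 6 * j - 1) ` {1..K}"
  define T2 where "T2 = (\<lambda>j::nat. 6 * j + 1) ` {1..K}"
  have disj: "T1 \<inter> T2 = {}" by (auto simp: T1_def T2_def) presburger
  have ge: "t \<ge> 5" if "t \<in> T1 \<union> T2" for t using that by (auto simp: T1_def T2_def)
  have sub: "prime_factors Q \<subseteq> T1 \<union> T2"
  proof
    fix p assume "p \<in> prime_factors Q"
    then have p: "prime p" "p dvd Q" by auto
    have "coprime p 6" using p(2) Q(2) by (metis coprime_commute coprime_divisors dvd_refl)
    then have "\<not> 2 dvd p" "\<not> 3 dvd p"
      using coprime_common_divisor[of p 6 2] coprime_common_divisor[of p 6 3] by auto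
    moreover have "p \<ge> 2" "p \<le> K" using p K prime_ge_2_nat by auto
    ultimately have "(\<exists>j\<in>{1..K}. p = 6 * j - 1) \<or> (\<exists>j\<in>{1..K}. p = 6 * j + 1)"
    proof -
      assume a: "\<not> 2 dvd p" "\<not> 3 dvd p" "p \<ge> 2" "p \<le> K"
      have "p mod 6 = 1 \<or> p mod 6 = 5" using a(1,2) by presburger
      then show ?thesis
      proof
        assume "p mod 6 = 1"
        then have "p = 6 * (p div 6) + 1" by (metis div_mult_mod_eq mult.commute)
        moreover have "p div 6 \<ge> 1" using calculation a(3) by (cases "p div 6") auto
        ultimately show ?thesis using a(4) by (intro disjI2 bexI[of _ "p div 6"]) auto
      next
        assume "p mod 6 = 5"
        then have "p = 6 * (p div 6) + 5" by (metis div_mult_mod_eq mult.commute)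
        then show ?thesis using a(4) by (intro disjI1 bexI[of _ "p div 6 + 1"]) auto
      qed
    qed
    then show "p \<in> T1 \<union> T2" by (auto simp: T1_def T2_def)
  qed
  have fin: "finite (T1 \<union> T2)" by (simp add: T1_def T2_def)
  have "(\<Prod>j=1..K. (1 - 1 / (6 * real j - 1)) * (1 - 1 / (6 * real j + 1))) = (\<Prod>t\<in>T1. 1 - 1 / real t) * (\<Prod>t\<in>T2. 1 - 1 / real t)"
  proof -
    have "(\<Prod>t\<in>T1. 1 - 1 / real t) = (\<Prod>j=1..K. 1 - 1 / (6 * real j - 1))" unfolding T1_def
      by (subst prod.reindex) (auto simp: inj_on_def of_nat_diff intro!: prod.cong)
    moreover have "(\<Prod>t\<in>T2. 1 - 1 / real t) = (\<Prod>j=1..K. 1 - 1 / (6 * real j + 1))" unfolding T2_def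
      by (subst prod.reindex) (auto simp: inj_on_def intro!: prod.cong)
    ultimately show ?thesis by (simp add: prod.distrib)
  qed
  also have "\<dots> = (\<Prod>t\<in>T1 \<union> T2. 1 - 1 / real t)"
    by (rule prod.union_disjoint[symmetric]) (use disj in \<open>auto simp: T1_def T2_def\<close>)
  also have "\<dots> = (\<Prod>t\<in>(T1 \<union> T2) - prime_factors Q. 1 - 1 / real t) * (\<Prod>t\<in>prime_factors Q. 1 - 1 / real t)"
    by (rule prod.subset_diff[OF sub fin])
  also have "\<dots> \<le> 1 * (\<Prod>t\<in>prime_factors Q. 1 - 1 / real t)"
    using sub ge by (intro mult_right_mono prod_le_1 prod_nonneg) (force simp: field_simps)+
  also have "\<dots> = real (totient Q) / real Q"
    using totient_formula2[of Q] Q(1) by simp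
  finally have le: "(\<Prod>j=1..K. (1 - 1 / (6 * real j - 1)) * (1 - 1 / (6 * real j + 1))) \<le> real (totient Q) / real Q" .
  have "0 \<le> (\<Prod>j=1..K. (1 - 1 / (6 * real j - 1)) * (1 - 1 / (6 * real j + 1)))"
    by (intro prod_nonneg mult_nonneg_nonneg; simp add: field_simps)
  then have "(\<Prod>j=1..K. (1 - 1 / (6 * real j - 1)) * (1 - 1 / (6 * real j + 1)))^3 \<le> (real (totient Q) / real Q)^3"
    using le by (rule power_mono[rotated])
  then show ?thesis using prod_one_minus_inverse_6j[OF K(2)] by linarith
qed

section \<open>Counting solutions of the congruence\<close>

lemma chinese_remainder_vector:
  fixes f :: "int \<Rightarrow> 'n \<Rightarrow> int"
  assumes "finite S" "\<And>a b. a \<in> S \<Longrightarrow> b \<in> S \<Longrightarrow> a \<noteq> b \<Longrightarrow> coprime a b" "\<And>a. a \<in> S \<Longrightarrow> a > 0"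
  shows "\<exists>e. \<forall>a\<in>S. \<forall>i. [e i = f a i] (mod a)"
proof -
  have "\<exists>x. \<forall>a\<in>S. [x = f a i] (mod a)" for i
  proof -
    have "\<exists>x. \<forall>a\<in>S. [x = nat (f a i mod a)] (mod nat a)"
      by (rule chinese_remainder_nat[OF assms(1)]) (use assms(2,3) in \<open>simp add: coprime_int_iff[symmetric] less_imp_le\<close>)
    then obtain x where x: "\<forall>a\<in>S. [x = nat (f a i mod a)] (mod nat a)" by blast
    have "[int x = f a i] (mod a)" if "a \<in> S" for a
    proof -
      have "[int x = int (nat (f a i mod a))] (mod int (nat a))" using x that by (simp only: cong_int_iff)
      then show ?thesis using assms(3)[OF that] by simp
    qed
    then show ?thesis by blast
  qed
  then show ?thesis by metis
qed

lemma qf_cong: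
  fixes q :: "'n::finite \<Rightarrow> 'n \<Rightarrow> int"
  assumes "\<And>i. [x i = y i] (mod m)"
  shows "[qf q x = qf q y] (mod m)"
  unfolding qf_def by (intro cong_sum cong_mult cong_refl assms)

definition residues_box :: "int \<Rightarrow> ('n::finite \<Rightarrow> int) set" where
  "residues_box Q = (\<Pi>\<^sub>E i\<in>UNIV. {0..<Q})"

lemma finite_residues_box [simp]: "finite (residues_box Q)"
  unfolding residues_box_def by (rule finite_PiE) auto

lemma card_congruent_residues:
  fixes L Q c :: int
  assumes "L > 0" "L dvd Q" "Q > 0"
  shows "card {a\<in>{0..<Q}. L dvd a - c} = nat (Q div L)"
proof -
  have eq: "{a\<in>{0..<Q}. L dvd a - c} = (\<lambda>t. t * L + c mod L) ` {0..<Q div L}"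
  proof (intro equalityI subsetI)
    fix a assume a: "a \<in> {a\<in>{0..<Q}. L dvd a - c}"
    then have "a mod L = c mod L" by (simp add: mod_eq_dvd_iff)
    then have "a = (a div L) * L + c mod L" by (metis div_mult_mod_eq)
    moreover have "a div L \<in> {0..<Q div L}"
    proof -
      have "(a div L) * L \<le> a" using assms(1) pos_mod_sign[of L a] div_mult_mod_eq[of a L] by linarith
      also have "a < (Q div L) * L" using a assms(2) by simp
      finally have "a div L < Q div L" using assms(1) by simp
      then show ?thesis using a assms(1) by (simp add: pos_imp_zdiv_nonneg_iff)
    qed
    ultimately show "a \<in> (\<lambda>t. t * L + c mod L) ` {0..<Q div L}" by blast
  next
    fix a assume "a \<in> (\<lambda>t. t * L + c mod L) ` {0..<Q div L}"
    then obtain t where t: "0 \<le> t" "t < Q div L" "a = t * L + c mod L" by auto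
    have "a < (t + 1) * L" using t assms by (simp add: algebra_simps)
    also have "\<dots> \<le> (Q div L) * L" using t assms by (intro mult_right_mono) auto
    also have "\<dots> = Q" using assms by simp
    finally have "a < Q" .
    moreover have "a \<ge> 0" using t assms by simp
    moreover have "L dvd a - c"
    proof -
      have "L dvd c mod L - c" by (simp add: mod_eq_dvd_iff[symmetric])
      then have "L dvd t * L + (c mod L - c)" by (rule dvd_add[rotated]) simp
      then show ?thesis by (simp add: t(3) algebra_simps)
    qed
    ultimately show "a \<in> {a\<in>{0..<Q}. L dvd a - c}" by simp
  qed
  have "inj_on (\<lambda>t. t * L + c mod L) {0..<Q div L}" using assms by (auto simp: inj_on_def)
  then show ?thesis unfolding eq by (simp add: card_image)
qed

lemma card_coprime_affine:
  fixes Q :: nat and a b :: int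
  assumes "Q > 0" "coprime b (int Q)"
  shows "card {j\<in>{0..<int Q}. coprime (a + j * b) (int Q)} = totient Q"
proof -
  define f where "f = (\<lambda>j. (a + j * b) mod int Q)"
  have inj: "inj_on f {0..<int Q}"
  proof (rule inj_onI)
    fix x y assume xy: "x \<in> {0..<int Q}" "y \<in> {0..<int Q}" "f x = f y"
    then have "int Q dvd (a + x * b) - (a + y * b)" by (simp add: f_def mod_eq_dvd_iff)
    then have "int Q dvd (x - y) * b" by (simp add: algebra_simps)
    then have "int Q dvd x - y" using assms(2) by (simp add: coprime_commute coprime_dvd_mult_left_iff)
    then have "x mod int Q = y mod int Q" by (simp add: mod_eq_dvd_iff)
    then show "x = y" using xy by simp
  qed
  have surj: "f ` {0..<int Q} = {0..<int Q}"
    by (rule endo_inj_surj) (use inj assms in \<open>auto simp: f_def\<close>)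
  have cop: "coprime (a + j * b) (int Q) \<longleftrightarrow> coprime (f j) (int Q)" for j
    unfolding f_def using assms by (simp add: coprime_mod_left_iff)
  have "{j\<in>{0..<int Q}. coprime (a + j * b) (int Q)} = {j\<in>{0..<int Q}. coprime (f j) (int Q)}" using cop by auto
  moreover have b: "bij_betw f {j\<in>{0..<int Q}. coprime (f j) (int Q)} {k\<in>{0..<int Q}. coprime k (int Q)}"
  proof -
    have "f ` {j\<in>{0..<int Q}. coprime (f j) (int Q)} = {k\<in>f ` {0..<int Q}. coprime k (int Q)}" by blast
    then show ?thesis unfolding surj using inj by (auto simp: bij_betw_def inj_on_def)
  qed
  moreover have "card {k\<in>{0..<int Q}. coprime k (int Q)} = totient Q"
  proof (cases "Q = 1")
    case True
    have "{k\<in>{0..<int Q}. coprime k (int Q)} = {0}" using True by auto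
    then show ?thesis using True by simp
  next
    case False
    have "bij_betw int (totatives Q) {k\<in>{0..<int Q}. coprime k (int Q)}"
    proof (rule bij_betwI[where g = nat])
      show "int \<in> totatives Q \<rightarrow> {k\<in>{0..<int Q}. coprime k (int Q)}"
        using totatives_less[of _ Q] assms(1) False by (auto simp: in_totatives_iff)
      show "nat \<in> {k\<in>{0..<int Q}. coprime k (int Q)} \<rightarrow> totatives Q"
      proof
        fix k assume k: "k \<in> {k\<in>{0..<int Q}. coprime k (int Q)}"
        have "k \<noteq> 0" using k False assms(1) by auto
        then show "nat k \<in> totatives Q" using k by (auto simp: in_totatives_iff coprime_int_iff[symmetric])
      qed
    qed auto
    then show ?thesis unfolding totient_def by (rule bij_betw_same_card[symmetric])
  qed
  ultimately show ?thesis using bij_betw_same_card[OF b] by simp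
qed

text \<open>The difference of two values is \<open>(x - y) (l + (x + y) e)\<close>, where the second
  factor is a unit: every prime of \<open>Q\<close> divides \<open>e\<close> but not
  \<open>l\<close>. So the polynomial is injective modulo \<open>Q\<close>, hence surjective. A
  vector that is isotropic modulo each prime of \<open>Q\<close> thus suffices for solving modulo
  \<open>Q\<close> itself.\<close>

lemma quadratic_bijective_mod:
  fixes A l e d Q :: int
  assumes Q: "Q > 0" and l: "coprime l Q" and e: "\<And>p. prime p \<Longrightarrow> p dvd Q \<Longrightarrow> p dvd e"
  shows "\<exists>t\<in>{0..<Q}. [A + t * l + t^2 * e = d] (mod Q)"
proof -
  define f where "f = (\<lambda>t. (A + t * l + t^2 * e) mod Q)"
  have cop: "coprime (l + k * e) Q" for k
  proof (rule ccontr)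
    assume "\<not> coprime (l + k * e) Q"
    then obtain p where p: "prime p" "p dvd l + k * e" "p dvd Q"
    proof -
      have "gcd (l + k * e) Q \<noteq> 0" "\<not> is_unit (gcd (l + k * e) Q)"
        using Q \<open>\<not> coprime (l + k * e) Q\<close> by (auto simp: is_unit_gcd)
      then obtain p where "prime p" "p dvd gcd (l + k * e) Q" using prime_divisor_exists by blast
      then show ?thesis using that[of p] by simp
    qed
    then have "p dvd k * e" using e by simp
    then have "p dvd l" using p(2) by (metis dvd_add_left_iff)
    then show False using p l coprime_common_divisor not_prime_unit by blast
  qed
  have inj: "inj_on f {0..<Q}"
  proof (rule inj_onI)
    fix x y assume xy: "x \<in> {0..<Q}" "y \<in> {0..<Q}" "f x = f y"
    then have "Q dvd (A + x * l + x^2 * e) - (A + y * l + y^2 * e)" by (simp add: f_def mod_eq_dvd_iff)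
    also have "(A + x * l + x^2 * e) - (A + y * l + y^2 * e) = (x - y) * (l + (x + y) * e)"
      by (simp add: power2_eq_square algebra_simps)
    finally have "Q dvd x - y" using cop[of "x + y"] by (simp add: coprime_commute coprime_dvd_mult_left_iff)
    then have "x mod Q = y mod Q" by (simp add: mod_eq_dvd_iff)
    then show "x = y" using xy by simp
  qed
  have "f ` {0..<Q} = {0..<Q}" by (rule endo_inj_surj) (use inj Q in \<open>auto simp: f_def\<close>)
  then have "d mod Q \<in> f ` {0..<Q}" using Q by simp
  then show ?thesis by (auto simp: f_def cong_def)
qed

text \<open>Isotropic vectors modulo the single primes of \<open>Q2\<close> are glued to
  \<open>e\<close> by the Chinese remainder theorem. No prime of \<open>Q2\<close> divides
  \<open>\<Delta>\<close>, so the form is nonsingular there and \<open>wv q e\<close> does not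
  vanish, which provides \<open>v\<close>. Both vectors vanish modulo \<open>Q1\<close>, so moving
  along them changes nothing to that modulus.\<close>

lemma isotropic_vector_mod:
  fixes q :: "'n::finite \<Rightarrow> 'n \<Rightarrow> int" and Q1 Q2 \<Delta> :: int
  assumes n: "CARD('n) \<ge> 3" and inv: "\<And>x i. \<Delta> * x i = (\<Sum>j\<in>UNIV. Rm i j * wv q x j)"
    and Q: "Q1 > 0" "Q2 > 0" "coprime Q1 Q2" "coprime Q2 (6 * \<Delta>)"
  obtains e v where "\<And>i. Q1 dvd e i" "\<And>i. Q1 dvd v i" "\<And>p. prime p \<Longrightarrow> p dvd Q2 \<Longrightarrow> p dvd qf q e"
    "coprime (\<Sum>j\<in>UNIV. wv q e j * v j) Q2"
proof -
  define Pr where "Pr = {p. prime p \<and> p dvd Q2}"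
  have finPr: "finite Pr" unfolding Pr_def by (rule finite_subset[of _ "{0..Q2}"]) (use Q(2) in \<open>auto simp: prime_ge_0_int zdvd_imp_le\<close>)
  have podd: "p > 2 \<and> \<not> p dvd \<Delta>" if "p \<in> Pr" for p
  proof -
    have p: "prime p" "p dvd Q2" using that by (auto simp: Pr_def)
    have "coprime p (6 * \<Delta>)" using p(2) Q(4) coprime_divisors[of p Q2 "6 * \<Delta>" "6 * \<Delta>"] by simp
    then have np: "\<not> p dvd 6 * \<Delta>" using p(1) coprime_common_divisor[of p "6 * \<Delta>" p] not_prime_unit by auto
    have "p \<noteq> 2" using np by auto
    then show ?thesis using np prime_ge_2_int[OF p(1)] by auto
  qed
  have "\<forall>p\<in>Pr. \<exists>e. (\<exists>i. \<not> p dvd e i) \<and> p dvd qf q e"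
    using isotropic_vector_mod_prime[OF n, of _ q] podd by (auto simp: Pr_def)
  then obtain ep where ep: "\<And>p. p \<in> Pr \<Longrightarrow> (\<exists>i. \<not> p dvd ep p i) \<and> p dvd qf q (ep p)" by metis
  define S where "S = (if Q1 = 1 then Pr else insert Q1 Pr)"
  have Q1Pr: "coprime Q1 p" if "p \<in> Pr" for p using that Q(3) by (auto simp: Pr_def intro: coprime_divisors[of Q1 Q1 p Q2])
  have Q1Pr': "coprime p Q1" if "p \<in> Pr" for p using Q1Pr[OF that] by (simp add: coprime_commute)
  have S: "finite S" "\<And>a b. a \<in> S \<Longrightarrow> b \<in> S \<Longrightarrow> a \<noteq> b \<Longrightarrow> coprime a b" "\<And>a. a \<in> S \<Longrightarrow> a > 0"
  proof -
    show "finite S" using finPr by (simp add: S_def)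
    have pp: "coprime a b" if "a \<in> Pr" "b \<in> Pr" "a \<noteq> b" for a b using that by (auto simp: Pr_def intro: primes_coprime)
    show "coprime a b" if "a \<in> S" "b \<in> S" "a \<noteq> b" for a b
      using that pp Q1Pr Q1Pr' by (auto simp: S_def split: if_splits)
    show "a > 0" if "a \<in> S" for a using that Q(1) by (auto simp: S_def Pr_def prime_gt_0_int split: if_splits)
  qed
  have notPr: "Q1 \<notin> Pr"
  proof
    assume a: "Q1 \<in> Pr"
    then have "is_unit Q1" using Q1Pr[OF a] by simp
    then show False using a not_prime_unit by (auto simp: Pr_def)
  qed
  obtain e where e0: "\<And>a i. a \<in> S \<Longrightarrow> [e i = (if a \<in> Pr then ep a i else 0)] (mod a)"
    using chinese_remainder_vector[OF S, of "\<lambda>a i. if a \<in> Pr then ep a i else 0"] by blast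
  have eQ: "Q1 dvd e i" for i
    using e0[of Q1 i] notPr by (cases "Q1 = 1") (auto simp: S_def cong_0_iff)
  have eP: "[e i = ep p i] (mod p)" if "p \<in> Pr" for p i using e0[of p i] that by (auto simp: S_def split: if_splits)
  have qe: "p dvd qf q e" if "p \<in> Pr" for p
    using cong_dvd_iff[OF qf_cong[OF eP[OF that]], of q] ep[OF that] by simp
  have we: "\<exists>i. \<not> p dvd wv q e i" if p: "p \<in> Pr" for p
  proof (rule ccontr)
    assume "\<not> ?thesis"
    then have "p dvd (\<Sum>j\<in>UNIV. Rm i j * wv q e j)" for i by (auto intro!: dvd_sum)
    then have "p dvd \<Delta> * e i" for i by (simp add: inv)
    then have "p dvd e i" for i using podd[OF p] p by (auto simp: Pr_def prime_dvd_mult_iff)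
    then have "p dvd ep p i" for i using cong_dvd_iff[OF eP[OF p]] by simp
    then show False using ep[OF p] by blast
  qed
  then obtain ip where ip: "\<And>p. p \<in> Pr \<Longrightarrow> \<not> p dvd wv q e (ip p)" by metis
  obtain v where v0: "\<And>a i. a \<in> S \<Longrightarrow> [v i = (if a \<in> Pr \<and> i = ip a then 1 else 0)] (mod a)"
    using chinese_remainder_vector[OF S, of "\<lambda>a i. if a \<in> Pr \<and> i = ip a then 1 else 0"] by blast
  have vQ: "Q1 dvd v i" for i
    using v0[of Q1 i] notPr by (cases "Q1 = 1") (auto simp: S_def cong_0_iff)
  have vP: "\<not> p dvd (\<Sum>j\<in>UNIV. wv q e j * v j)" if p: "p \<in> Pr" for p
  proof -
    have "[v j = (if j = ip p then 1 else 0)] (mod p)" for j using v0[of p j] p by (auto simp: S_def split: if_splits)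
    then have "[(\<Sum>j\<in>UNIV. wv q e j * v j) = (\<Sum>j\<in>UNIV. wv q e j * (if j = ip p then 1 else 0))] (mod p)"
      by (intro cong_sum cong_mult cong_refl)
    also have "(\<Sum>j\<in>UNIV. wv q e j * (if j = ip p then 1 else 0)) = wv q e (ip p)" by (simp add: if_distrib cong: if_cong)
    finally show ?thesis using ip[OF p] cong_dvd_iff by blast
  qed
  have cop: "coprime (\<Sum>j\<in>UNIV. wv q e j * v j) Q2"
  proof (rule ccontr)
    assume nc: "\<not> coprime (\<Sum>j\<in>UNIV. wv q e j * v j) Q2"
    have "gcd (\<Sum>j\<in>UNIV. wv q e j * v j) Q2 \<noteq> 0" "\<not> is_unit (gcd (\<Sum>j\<in>UNIV. wv q e j * v j) Q2)"
      using Q(2) nc by (auto simp: is_unit_gcd)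
    then obtain p where "prime p" "p dvd gcd (\<Sum>j\<in>UNIV. wv q e j * v j) Q2" using prime_divisor_exists by blast
    then show False using vP[of p] by (simp add: Pr_def)
  qed
  show ?thesis by (rule that[of e v]) (use eQ vQ qe cop in \<open>auto simp: Pr_def\<close>)
qed

text \<open>Solutions are built from pairs \<open>(z, j)\<close> with \<open>z\<close> congruent to
  \<open>x0\<close> modulo \<open>L\<close>. The value at \<open>z' = z + j v\<close> is
  \<open>s m1\<close> with \<open>m1\<close> congruent to \<open>m\<close> modulo
  \<open>48 \<Delta>\<close>, so modulo \<open>Q1\<close> scaling by a square root \<open>c\<close>
  of \<open>m / m1\<close> gives \<open>s m\<close>. Modulo \<open>Q2\<close> a multiple
  \<open>t e\<close> is added, which succeeds when the linear coefficient \<open>l z'\<close> is a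
  unit. Given a solution, the triple \<open>(c, t, j)\<close> determines \<open>z\<close>, so at
  most \<open>Q1 Q2^2\<close> pairs share it; there are \<open>(Q / L)^n totient Q2\<close> pairs,
  and division gives the bound.\<close>

lemma card_residue_solutions_ge:
  fixes q :: "'n::finite \<Rightarrow> 'n \<Rightarrow> int" and Q1 \<Delta> s m m0 :: int and Q2 :: nat
  assumes n: "CARD('n) \<ge> 3" and inv: "\<And>x i. \<Delta> * x i = (\<Sum>j\<in>UNIV. Rm i j * wv q x j)" and \<Delta>: "\<Delta> \<noteq> 0"
    and Q: "Q1 > 0" "Q2 > 0" "coprime Q1 (int Q2)" "coprime (int Q2) (6 * \<Delta>)" "Q1 dvd (6 * \<Delta>)^k" "k \<ge> 1"
    and s: "s > 0" "s * (8 * (6 * \<bar>\<Delta>\<bar>)) dvd Q1"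
    and m: "coprime m (6 * \<Delta>)" "coprime m0 (6 * \<Delta>)" "8 * (6 * \<Delta>) dvd m - m0"
    and x0: "qf q x0 = s * m0"
  shows "real_of_int (Q1 * Q2)^(CARD('n) - 1) * (totient Q2 / Q2) / (s * (8 * (6 * \<bar>\<Delta>\<bar>)))^CARD('n)
     \<le> real (card {x \<in> residues_box (Q1 * Q2). Q1 * Q2 dvd qf q x - s * m})"
proof -
  define Q where "Q = Q1 * Q2"
  define M0 where "M0 = 6 * \<Delta>"
  define L where "L = s * (8 * (6 * \<bar>\<Delta>\<bar>))"
  have Q0: "Q > 0" using Q by (simp add: Q_def)
  have L0: "L > 0" using s \<Delta> by (simp add: L_def)
  have LQ: "L dvd Q" using s by (simp add: Q_def L_def)
  have Q2i: "int Q2 > 0" using Q by simp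
  obtain e v where e: "\<And>i. Q1 dvd e i" and v: "\<And>i. Q1 dvd v i" and ep: "\<And>p. prime p \<Longrightarrow> p dvd int Q2 \<Longrightarrow> p dvd qf q e"
    and ev: "coprime (\<Sum>j\<in>UNIV. wv q e j * v j) (int Q2)"
    using isotropic_vector_mod[OF n inv Q(1) Q2i Q(3,4)] by metis
  define l where "l = (\<lambda>z. \<Sum>j\<in>UNIV. wv q e j * z j)"
  obtain E1 where E1: "[E1 = 1] (mod Q1)" "[E1 = 0] (mod int Q2)"
    using binary_chinese_remainder_int[OF Q(3), of 1 0] by blast
  \<comment> \<open>\<open>kap c\<close> is \<open>c\<close> modulo \<open>Q1\<close> and 1 modulo
    \<open>Q2\<close>, so the scaling acts on the first component alone.\<close>
  define kap where "kap = (\<lambda>c. c * E1 + (1 - E1))"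
  have kap1: "[kap c = c] (mod Q1)" for c
  proof -
    have "[c * E1 + (1 - E1) = c * 1 + (1 - 1)] (mod Q1)" by (intro cong_add cong_mult cong_diff cong_refl E1)
    then show ?thesis by (simp add: kap_def)
  qed
  have kap2: "[kap c = 1] (mod int Q2)" for c
  proof -
    have "[c * E1 + (1 - E1) = c * 0 + (1 - 0)] (mod int Q2)" by (intro cong_add cong_mult cong_diff cong_refl E1)
    then show ?thesis by (simp add: kap_def)
  qed
  define Z where "Z = {z \<in> residues_box Q. \<forall>i. L dvd z i - x0 i}"
  \<comment> \<open>Translating by \<open>j v\<close> replaces a statement on the distribution of
    \<open>l z\<close>: for every single \<open>z\<close> exactly \<open>totient Q2\<close> values
    of \<open>j\<close> make the linear coefficient a unit.\<close>
  define D where "D = Sigma Z (\<lambda>z. {j\<in>{0..<int Q2}. coprime (l z + j * l v) (int Q2)})"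
  define xx where "xx = (\<lambda>z j c t i. (kap c * (z i + j * v i) + t * e i) mod Q)"
  have ex: "\<exists>c\<in>{0..<Q1}. \<exists>t\<in>{0..<int Q2}. coprime c Q1 \<and> Q dvd qf q (xx z j c t) - s * m" if zj: "(z, j) \<in> D" for z j
  proof -
    define z' where "z' = (\<lambda>i. z i + j * v i)"
    have "L dvd Q1" using s by (simp add: L_def)
    have "L dvd z' i - x0 i" for i
    proof -
      have "L dvd v i" using v \<open>L dvd Q1\<close> dvd_trans by blast
      then have "L dvd (z i - x0 i) + j * v i" using zj by (intro dvd_add dvd_mult) (auto simp: D_def Z_def)
      then show ?thesis by (simp add: z'_def algebra_simps)
    qed
    then have "\<exists>y. z' i - x0 i = L * y" for i by (simp add: dvd_def)
    then obtain y where y: "\<And>i. z' i - x0 i = L * y i" by metis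
    have z'eq: "z' = (\<lambda>i. x0 i + L * y i)" using y by (auto simp: algebra_simps intro!: ext)
    have "qf q z' = qf q x0 + L^2 * qf q y + L * (\<Sum>j\<in>UNIV. wv q y j * x0 j)"
      unfolding z'eq qf_add qf_scale by (simp add: wv_def sum_distrib_left sum_distrib_right mult_ac)
    then have "qf q z' = s * (m0 + 8 * (6 * \<bar>\<Delta>\<bar>) * (L * qf q y + (\<Sum>j\<in>UNIV. wv q y j * x0 j)))"
      by (simp add: x0 L_def power2_eq_square algebra_simps)
    then obtain m1 w where m1: "qf q z' = s * m1" "m1 = m0 + 8 * (6 * \<bar>\<Delta>\<bar>) * w" by blast
    have mm: "8 * M0 dvd m - m1"
    proof -
      have "8 * M0 dvd 8 * (6 * \<bar>\<Delta>\<bar>) * w" by (simp add: M0_def)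
      moreover have "m - m1 = (m - m0) - 8 * (6 * \<bar>\<Delta>\<bar>) * w" using m1(2) by simp
      ultimately show ?thesis using m(3) by (simp only: M0_def[symmetric] dvd_diff)
    qed
    have cm1: "coprime m1 M0"
    proof -
      have "[m1 = m] (mod M0)" using mm by (metis cong_iff_dvd_diff cong_sym dvd_mult_right)
      then show ?thesis using m(1) cong_imp_coprime cong_sym unfolding M0_def by blast
    qed
    obtain c0 where "8 * M0^k dvd c0^2 * m1 - m" using hensel_square[OF m(1)[folded M0_def] cm1 mm Q(6)] by blast
    then have c0: "Q1 dvd c0^2 * m1 - m" using Q(5) unfolding M0_def by (meson dvd_trans dvd_mult)
    define c where "c = c0 mod Q1"
    have c: "c \<in> {0..<Q1}" "[c = c0] (mod Q1)" using Q(1) by (auto simp: c_def cong_def)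
    have "[c^2 * m1 = c0^2 * m1] (mod Q1)" by (intro cong_mult cong_pow c(2) cong_refl)
    also have "[c0^2 * m1 = m] (mod Q1)" using c0 by (simp add: cong_iff_dvd_diff)
    finally have cm: "[c^2 * m1 = m] (mod Q1)" .
    have "coprime m Q1" 
      using coprime_divisors[of m m Q1 "(6 * \<Delta>)^k"] m(1) Q(5) by (simp add: coprime_power_right_iff)
    then have "coprime (c^2 * m1) Q1" using cm cong_imp_coprime cong_sym by blast
    then have cc: "coprime c Q1" by simp
    have lz': "coprime (l z') (int Q2)"
    proof -
      have "l z' = l z + j * l v" by (simp add: l_def z'_def algebra_simps sum.distrib sum_distrib_left)
      then show ?thesis using zj by (simp add: D_def)
    qed
    obtain t where t: "t \<in> {0..<int Q2}" "[qf q z' + t * l z' + t^2 * qf q e = s * m] (mod int Q2)"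
      using quadratic_bijective_mod[OF Q2i lz' ep] by blast
    have "[xx z j c t i = c * z' i] (mod Q1)" for i
    proof -
      have "[xx z j c t i = kap c * z' i + t * e i] (mod Q1)"
        by (simp add: xx_def z'_def Q_def cong_def mod_mod_cancel)
      also have "[kap c * z' i + t * e i = c * z' i + t * 0] (mod Q1)"
        by (intro cong_add cong_mult cong_refl kap1) (use e in \<open>simp add: cong_0_iff\<close>)
      finally show ?thesis by simp
    qed
    then have "[qf q (xx z j c t) = qf q (\<lambda>i. c * z' i)] (mod Q1)" by (rule qf_cong)
    also have "qf q (\<lambda>i. c * z' i) = s * (c^2 * m1)" by (simp add: qf_scale m1 mult_ac)
    also have "[s * (c^2 * m1) = s * m] (mod Q1)" by (intro cong_mult cong_refl cm)
    finally have d1: "Q1 dvd qf q (xx z j c t) - s * m" by (simp add: cong_iff_dvd_diff)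
    have "[xx z j c t i = z' i + t * e i] (mod int Q2)" for i
    proof -
      have "[xx z j c t i = kap c * z' i + t * e i] (mod int Q2)"
        by (simp add: xx_def z'_def Q_def cong_def mod_mod_cancel)
      also have "[kap c * z' i + t * e i = 1 * z' i + t * e i] (mod int Q2)"
        by (intro cong_add cong_mult cong_refl kap2)
      finally show ?thesis by simp
    qed
    then have "[qf q (xx z j c t) = qf q (\<lambda>i. z' i + t * e i)] (mod int Q2)" by (rule qf_cong)
    also have "qf q (\<lambda>i. z' i + t * e i) = qf q z' + t * l z' + t^2 * qf q e"
      unfolding qf_add qf_scale l_def by (simp add: wv_def sum_distrib_left sum_distrib_right mult_ac)
    also note t(2)
    finally have d2: "int Q2 dvd qf q (xx z j c t) - s * m" by (simp add: cong_iff_dvd_diff)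
    have "Q dvd qf q (xx z j c t) - s * m" unfolding Q_def using d1 d2 Q(3) by (rule divides_mult)
    then show ?thesis using c(1) t(1) cc by blast
  qed
  then have "\<forall>p\<in>D. \<exists>ct. fst ct \<in> {0..<Q1} \<and> snd ct \<in> {0..<int Q2} \<and> coprime (fst ct) Q1 \<and> Q dvd qf q (xx (fst p) (snd p) (fst ct) (snd ct)) - s * m"
    by (metis (no_types, lifting) fst_conv snd_conv prod.collapse)
  then obtain ct where ct: "\<And>p. p \<in> D \<Longrightarrow> fst (ct p) \<in> {0..<Q1} \<and> snd (ct p) \<in> {0..<int Q2} \<and> coprime (fst (ct p)) Q1 \<and>
      Q dvd qf q (xx (fst p) (snd p) (fst (ct p)) (snd (ct p))) - s * m" by metis
  define f where "f = (\<lambda>p. xx (fst p) (snd p) (fst (ct p)) (snd (ct p)))"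
  define Sol where "Sol = {x \<in> residues_box Q. Q dvd qf q x - s * m}"
  have "real (card D) \<le> (Q1 * Q2 * Q2) * real (card Sol)"
  proof (rule card_le_fibres(2)[where f = f])
    show "finite Sol" by (simp add: Sol_def)
    show "f ` D \<subseteq> Sol" using ct Q0 by (auto simp: f_def Sol_def residues_box_def xx_def)
    fix x assume "x \<in> Sol"
    define T where "T = {0..<Q1} \<times> {0..<int Q2} \<times> {0..<int Q2}"
    have inj: "inj_on (\<lambda>p. (fst (ct p), snd (ct p), snd p)) {p\<in>D. f p = x}"
    proof (rule inj_onI)
      fix p p' assume p: "p \<in> {p\<in>D. f p = x}" and p': "p' \<in> {p\<in>D. f p = x}"
        and eq: "(fst (ct p), snd (ct p), snd p) = (fst (ct p'), snd (ct p'), snd p')"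
      define c t j where "c = fst (ct p)" and "t = snd (ct p)" and "j = snd p"
      have eq': "fst (ct p') = c" "snd (ct p') = t" "snd p' = j" using eq by (auto simp: c_def t_def j_def)
      have ff: "xx (fst p) j c t = xx (fst p') j c t" using p p' eq' by (simp add: f_def c_def t_def j_def)
      have ck: "coprime (kap c) Q"
      proof -
        have "coprime (kap c) Q1" using ct[of p] p kap1[of c] cong_imp_coprime cong_sym unfolding c_def by blast
        moreover have "coprime (kap c) (int Q2)" using cong_imp_coprime[OF cong_sym[OF kap2[of c]]] by simp
        ultimately show ?thesis by (simp add: Q_def)
      qed
      have "fst p i = fst p' i" for i
      proof -
        have "Q dvd (kap c * (fst p i + j * v i) + t * e i) - (kap c * (fst p' i + j * v i) + t * e i)"
          using fun_cong[OF ff, of i] by (simp add: xx_def mod_eq_dvd_iff)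
        also have "\<dots> = kap c * (fst p i - fst p' i)" by (simp add: algebra_simps)
        finally have "Q dvd fst p i - fst p' i" using ck by (simp add: coprime_commute coprime_dvd_mult_right_iff)
        then have "fst p i mod Q = fst p' i mod Q" by (simp add: mod_eq_dvd_iff)
        moreover have "fst p i \<in> {0..<Q}" "fst p' i \<in> {0..<Q}" using p p' by (auto simp: D_def Z_def residues_box_def)
        ultimately show ?thesis by simp
      qed
      then have "fst p = fst p'" by (rule ext)
      then show "p = p'" using eq by (simp add: prod_eq_iff)
    qed
    have sub: "(\<lambda>p. (fst (ct p), snd (ct p), snd p)) ` {p\<in>D. f p = x} \<subseteq> T"
      using ct by (auto simp: T_def D_def)
    have finT: "finite T" by (simp add: T_def)
    have "card {p\<in>D. f p = x} \<le> card T" by (rule card_inj_on_le[OF inj sub finT])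
    moreover have "finite {p\<in>D. f p = x}" using inj_on_finite[OF inj sub finT] .
    moreover have "card T = nat Q1 * (Q2 * Q2)" by (simp add: T_def card_cartesian_product)
    ultimately have "finite {p\<in>D. f p = x}" "real (card {p\<in>D. f p = x}) \<le> real (nat Q1 * (Q2 * Q2))"
      by (simp_all only: of_nat_le_iff)
    then show "finite {p\<in>D. f p = x} \<and> real (card {p\<in>D. f p = x}) \<le> real_of_int (Q1 * Q2 * Q2)" using Q(1) by (simp add: mult.assoc)
  qed
  moreover have "card D = card Z * totient Q2"
  proof -
    have finj: "finite {j\<in>{0..<int Q2}. coprime (l z + j * l v) (int Q2)}" for z
      by (rule finite_subset[of _ "{0..<int Q2}"]) auto
    have lv: "coprime (l v) (int Q2)" using ev by (simp add: l_def)
    have "card D = (\<Sum>z\<in>Z. card {j\<in>{0..<int Q2}. coprime (l z + j * l v) (int Q2)})"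
      unfolding D_def
      by (rule card_SigmaI) (simp add: Z_def, rule ballI, rule finj)
    then show ?thesis using card_coprime_affine[OF Q(2) lv] by simp
  qed
  moreover have "card Z = nat (Q div L) ^ CARD('n)"
  proof -
    have "Z = (\<Pi>\<^sub>E i\<in>UNIV. {a\<in>{0..<Q}. L dvd a - x0 i})" by (auto simp: Z_def residues_box_def PiE_def Pi_def)
    then show ?thesis using card_congruent_residues[OF L0 LQ Q0] by (simp add: card_PiE)
  qed
  ultimately have main: "real (nat (Q div L) ^ CARD('n)) * totient Q2 \<le> (Q1 * Q2 * Q2) * real (card Sol)" by simp
  have "real (nat (Q div L)) = Q / L" using L0 LQ Q0 by (simp add: pos_imp_zdiv_nonneg_iff real_of_int_div)
  then have "(Q / L)^CARD('n) * totient Q2 \<le> Q * Q2 * real (card Sol)" using main by (simp add: Q_def)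
  then have "(Q / L)^CARD('n) * totient Q2 / (Q * Q2) \<le> real (card Sol)"
    using Q0 Q(2) by (simp add: divide_le_eq mult_ac)
  moreover have "(Q / L)^CARD('n) * totient Q2 / (Q * Q2) = real_of_int Q^(CARD('n) - 1) * (totient Q2 / Q2) / real_of_int L^CARD('n)"
  proof -
    have "real_of_int Q^CARD('n) = Q * real_of_int Q^(CARD('n) - 1)" using n by (simp add: power_eq_if)
    then show ?thesis using Q0 by (simp add: power_divide)
  qed
  ultimately show ?thesis unfolding Sol_def Q_def L_def by simp
qed

section \<open>Solutions of the congruence near a real point of the quadric\<close>

lemma finite_int_ball: "finite {a::int. \<bar>real_of_int a - y\<bar> \<le> \<rho> \<and> R a}"
  by (rule finite_subset[of _ "{\<lfloor>y - \<rho>\<rfloor>..\<lceil>y + \<rho>\<rceil>}"]) (auto, linarith+)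

lemma card_progression_ball_ge:
  fixes Q b :: int and y \<rho> :: real
  assumes "Q > 0" "\<rho> \<ge> Q"
  shows "real (card {a::int. \<bar>real_of_int a - y\<bar> \<le> \<rho> \<and> Q dvd a - b}) \<ge> \<rho> / Q"
proof -
  define l u where "l = \<lceil>(y - \<rho> - b) / Q\<rceil>" and "u = \<lfloor>(y + \<rho> - b) / Q\<rfloor>"
  have inj: "inj_on (\<lambda>k. b + Q * k) {l..u}" using assms by (auto simp: inj_on_def)
  have "(\<lambda>k. b + Q * k) ` {l..u} \<subseteq> {a::int. \<bar>real_of_int a - y\<bar> \<le> \<rho> \<and> Q dvd a - b}"
  proof clarsimp
    fix k assume "l \<le> k" "k \<le> u"
    then have "(y - \<rho> - b) / Q \<le> k" "k \<le> (y + \<rho> - b) / Q" unfolding l_def u_def by linarith+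
    then have "y - \<rho> - b \<le> Q * k" "Q * k \<le> y + \<rho> - b" using assms(1) by (simp_all add: field_simps)
    then show "\<bar>real_of_int b + real_of_int Q * real_of_int k - y\<bar> \<le> \<rho>" by simp
  qed
  then have "card ((\<lambda>k. b + Q * k) ` {l..u}) \<le> card {a::int. \<bar>real_of_int a - y\<bar> \<le> \<rho> \<and> Q dvd a - b}"
    by (rule card_mono[OF finite_int_ball])
  then have "int (card {a::int. \<bar>real_of_int a - y\<bar> \<le> \<rho> \<and> Q dvd a - b}) \<ge> u - l + 1" by (simp add: card_image[OF inj])
  then have "real (card {a::int. \<bar>real_of_int a - y\<bar> \<le> \<rho> \<and> Q dvd a - b}) \<ge> real_of_int u - real_of_int l + 1" by linarith
  moreover have "real_of_int u \<ge> (y + \<rho> - b) / Q - 1" "real_of_int l \<le> (y - \<rho> - b) / Q + 1" unfolding l_def u_def by linarith+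
  moreover have "(y + \<rho> - b) / Q - (y - \<rho> - b) / Q = \<rho> / Q + \<rho> / Q" using assms(1) by (simp add: field_simps)
  moreover have "\<rho> / Q \<ge> 1" using assms by simp
  ultimately show ?thesis by linarith
qed

text \<open>A cube of half side \<open>\<rho> >= Q\<close> contains at least
  \<open>(\<rho> / Q)^n\<close> points of each residue class modulo \<open>Q\<close>, and the
  congruence depends on the class only.\<close>

lemma card_solutions_near_ge:
  fixes q :: "'n::finite \<Rightarrow> 'n \<Rightarrow> int" and Q d :: int and y :: "'n \<Rightarrow> real" and \<rho> :: real
  assumes "Q > 0" "\<rho> \<ge> Q"
  defines "Zs \<equiv> {z. (\<forall>i. \<bar>real_of_int (z i) - y i\<bar> \<le> \<rho>) \<and> Q dvd qf q z - d}"
  shows "finite Zs" "real (card Zs) \<ge> real (card {x\<in>residues_box Q. Q dvd qf q x - d}) * (\<rho> / Q)^CARD('n)"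
proof -
  define Sol where "Sol = {x\<in>residues_box Q. Q dvd qf q x - d}"
  have "Zs \<subseteq> (\<Pi>\<^sub>E i\<in>UNIV. {a. \<bar>real_of_int a - y i\<bar> \<le> \<rho> \<and> True})" by (auto simp: Zs_def)
  moreover have "finite (\<Pi>\<^sub>E i\<in>(UNIV::'n set). {a. \<bar>real_of_int a - y i\<bar> \<le> \<rho> \<and> True})" by (rule finite_PiE) (auto simp: finite_int_ball[where R = "\<lambda>_. True", simplified])
  ultimately show fin: "finite Zs" by (rule finite_subset)
  define g where "g = (\<lambda>(z :: 'n \<Rightarrow> int) i. z i mod Q)"
  have cg: "[z i = g z i] (mod Q)" for z :: "'n \<Rightarrow> int" and i by (simp add: g_def cong_def)
  have im: "g ` Zs \<subseteq> Sol"
  proof clarify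
    fix z assume z: "z \<in> Zs"
    have "[qf q z = qf q (g z)] (mod Q)" by (rule qf_cong[OF cg])
    then have "Q dvd qf q (g z) - d" using z unfolding Zs_def
      by (metis (mono_tags, lifting) cong_iff_dvd_diff cong_sym cong_trans mem_Collect_eq)
    then show "g z \<in> Sol" using assms(1) by (auto simp: Sol_def residues_box_def g_def)
  qed
  have "card Zs = (\<Sum>b\<in>Sol. card {z\<in>Zs. g z = b})"
    using sum.group[OF fin _ im, of "\<lambda>_. 1::nat"] by (simp add: Sol_def)
  then have "real (card Zs) = (\<Sum>b\<in>Sol. real (card {z\<in>Zs. g z = b}))" by simp
  also have "\<dots> \<ge> (\<Sum>b\<in>Sol. (\<rho> / Q)^CARD('n))"
  proof (rule sum_mono)
    fix b assume b: "b \<in> Sol"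
    define T where "T = (\<Pi>\<^sub>E i\<in>(UNIV::'n set). {a. \<bar>real_of_int a - y i\<bar> \<le> \<rho> \<and> Q dvd a - b i})"
    have sub: "T \<subseteq> {z\<in>Zs. g z = b}"
    proof
      fix z assume "z \<in> T"
      then have z: "\<bar>real_of_int (z i) - y i\<bar> \<le> \<rho>" "Q dvd z i - b i" for i by (auto simp: T_def)
      have "g z i = b i" for i
      proof -
        have "z i mod Q = b i mod Q" using z(2) by (simp add: mod_eq_dvd_iff)
        moreover have "b i \<in> {0..<Q}" using b by (auto simp: Sol_def residues_box_def)
        ultimately show ?thesis by (simp add: g_def)
      qed
      then have gz: "g z = b" by (rule ext)
      have "[qf q z = qf q b] (mod Q)" using qf_cong[OF cg[of z], of q] gz by simp
      then have "Q dvd qf q z - d" using b unfolding Sol_def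
        by (metis (mono_tags, lifting) cong_iff_dvd_diff cong_trans mem_Collect_eq)
      then show "z \<in> {z\<in>Zs. g z = b}" using z gz by (simp add: Zs_def)
    qed
    have "(\<rho> / Q)^CARD('n) = (\<Prod>i\<in>(UNIV::'n set). \<rho> / Q)" by simp
    also have "\<dots> \<le> (\<Prod>i\<in>UNIV. real (card {a. \<bar>real_of_int a - y i\<bar> \<le> \<rho> \<and> Q dvd a - b i}))"
      using assms by (intro prod_mono conjI card_progression_ball_ge) auto
    also have "\<dots> = real (card T)" unfolding T_def by (simp add: card_PiE)
    also have "\<dots> \<le> real (card {z\<in>Zs. g z = b})" using fin by (intro of_nat_mono card_mono sub) auto
    finally show "(\<rho> / Q)^CARD('n) \<le> real (card {z\<in>Zs. g z = b})" .
  qed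
  finally show "real (card Zs) \<ge> real (card {x\<in>residues_box Q. Q dvd qf q x - d}) * (\<rho> / Q)^CARD('n)"
    by (simp add: Sol_def)
qed

lemma qf_approx:
  fixes q :: "'n::finite \<Rightarrow> 'n \<Rightarrow> int" and z x0 :: "'n \<Rightarrow> int" and t P \<rho> :: real
  assumes z: "\<And>i. \<bar>z i - t * x0 i\<bar> \<le> \<rho>" and b: "\<And>i. \<bar>real_of_int (z i)\<bar> \<le> P" "\<And>i. \<bar>t * x0 i\<bar> \<le> P" and \<rho>: "\<rho> \<ge> 0"
  shows "\<bar>qf q z - t^2 * qf q x0\<bar> \<le> (\<Sum>i\<in>UNIV. \<Sum>j\<in>UNIV. \<bar>real_of_int (q i j)\<bar>) * (2 * \<rho> * P)"
proof -
  have "real_of_int (qf q z) - t^2 * qf q x0 = (\<Sum>i\<in>UNIV. \<Sum>j\<in>UNIV. q i j * (real_of_int (z i) * z j - (t * x0 i) * (t * x0 j)))"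
    by (simp add: qf_def sum_distrib_left sum_subtractf[symmetric] algebra_simps power2_eq_square)
  also have "\<bar>\<dots>\<bar> \<le> (\<Sum>i\<in>UNIV. \<Sum>j\<in>UNIV. \<bar>q i j * (real_of_int (z i) * z j - (t * x0 i) * (t * x0 j))\<bar>)"
    by (intro order_trans[OF sum_abs] sum_mono sum_abs)
  also have "\<dots> \<le> (\<Sum>i\<in>UNIV. \<Sum>j\<in>UNIV. \<bar>real_of_int (q i j)\<bar> * (2 * \<rho> * P))"
  proof (intro sum_mono)
    fix i j
    have "real_of_int (z i) * z j - (t * x0 i) * (t * x0 j) = z i * (z j - t * x0 j) + (z i - t * x0 i) * (t * x0 j)"
      by (simp add: algebra_simps)
    also have "\<bar>\<dots>\<bar> \<le> \<bar>real_of_int (z i)\<bar> * \<bar>z j - t * x0 j\<bar> + \<bar>z i - t * x0 i\<bar> * \<bar>t * x0 j\<bar>"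
      by (metis abs_mult abs_triangle_ineq)
    also have "\<dots> \<le> P * \<rho> + \<rho> * P"
      using z b \<rho> order_trans[OF abs_ge_zero b(1)] by (intro add_mono mult_mono) auto
    finally show "\<bar>q i j * (real_of_int (z i) * z j - (t * x0 i) * (t * x0 j))\<bar> \<le> \<bar>real_of_int (q i j)\<bar> * (2 * \<rho> * P)"
      unfolding abs_mult by (intro mult_left_mono) (auto simp: mult_ac)
  qed
  finally show ?thesis by (simp add: sum_distrib_right)
qed

text \<open>By Euler's identity the polar form of \<open>x0\<close> and \<open>t x0\<close> is
  \<open>2 t qf q x0\<close>; the right side estimates the change from \<open>t x0\<close> to
  \<open>z\<close>.\<close>

lemma polar_approx:
  fixes q :: "'n::finite \<Rightarrow> 'n \<Rightarrow> int" and z x0 :: "'n \<Rightarrow> int" and t \<rho> X :: real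
  assumes z: "\<And>i. \<bar>z i - t * x0 i\<bar> \<le> \<rho>" and b: "\<And>i. \<bar>real_of_int (x0 i)\<bar> \<le> X" and \<rho>: "\<rho> \<ge> 0"
  shows "\<bar>(\<Sum>j\<in>UNIV. wv q x0 j * z j) - 2 * t * qf q x0\<bar> \<le> (\<Sum>i\<in>UNIV. \<Sum>j\<in>UNIV. \<bar>real_of_int (q i j + q j i)\<bar>) * (X * \<rho>)"
proof -
  have two: "(\<Sum>j\<in>UNIV. wv q x0 j * x0 j) = 2 * qf q x0"
  proof -
    have "(\<lambda>i. x0 i + x0 i) = (\<lambda>i. 2 * x0 i)" by auto
    then show ?thesis using qf_add[of q x0 x0] qf_scale[of q 2 x0] by simp
  qed
  have "real_of_int (\<Sum>j\<in>UNIV. wv q x0 j * z j) - 2 * t * qf q x0 = real_of_int (\<Sum>j\<in>UNIV. wv q x0 j * z j) - t * real_of_int (\<Sum>j\<in>UNIV. wv q x0 j * x0 j)"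
    unfolding two by simp
  also have "\<dots> = (\<Sum>i\<in>UNIV. \<Sum>j\<in>UNIV. real_of_int (q i j + q j i) * (x0 i * (z j - t * x0 j)))"
    unfolding wv_def
    by (subst sum.swap) (simp add: sum_distrib_left sum_distrib_right sum_subtractf[symmetric] algebra_simps)
  also have "\<bar>\<dots>\<bar> \<le> (\<Sum>i\<in>UNIV. \<Sum>j\<in>UNIV. \<bar>real_of_int (q i j + q j i) * (x0 i * (z j - t * x0 j))\<bar>)"
    by (intro order_trans[OF sum_abs] sum_mono sum_abs)
  also have "\<dots> \<le> (\<Sum>i\<in>UNIV. \<Sum>j\<in>UNIV. \<bar>real_of_int (q i j + q j i)\<bar> * (X * \<rho>))"
    unfolding abs_mult using z b \<rho> order_trans[OF abs_ge_zero b(1)] by (intro sum_mono mult_left_mono mult_mono) auto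
  finally show ?thesis by (simp add: sum_distrib_right)
qed

text \<open>Without perturbation the left side is \<open>a (t + \<tau>)^2\<close>, which at
  \<open>\<tau> = t / 2\<close> and \<open>\<tau> = - t / 2\<close> differs from
  \<open>a t^2\<close> by \<open>5/4 a t^2\<close> and \<open>- 3/4 a t^2\<close>. Perturbations up
  to \<open>3/4 a t^2\<close> keep these signs, and the intermediate value theorem applies.\<close>

lemma quadratic_root_near:
  fixes a t A B e1 e2 :: real
  assumes a: "a > 0" "t > 0" and A: "\<bar>A - t^2 * a\<bar> \<le> e1" and B: "\<bar>B - 2 * t * a\<bar> \<le> e2"
    and e: "e1 + t / 2 * e2 \<le> 3 / 4 * (a * t^2)"
  shows "\<exists>\<tau>. \<bar>\<tau>\<bar> \<le> t / 2 \<and> A + \<tau> * B + \<tau>^2 * a = t^2 * a"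
proof -
  define f where "f = (\<lambda>\<tau>. A + \<tau> * B + \<tau>^2 * a)"
  define x y where "x = A - t^2 * a" and "y = B - 2 * t * a"
  have xy: "\<bar>x\<bar> \<le> e1" "\<bar>y\<bar> \<le> e2" using A B by (auto simp: x_def y_def)
  have fv: "f \<tau> - t^2 * a = x + \<tau> * y + 2 * t * \<tau> * a + \<tau>^2 * a" for \<tau> by (simp add: f_def x_def y_def algebra_simps)
  have ty: "\<bar>t / 2 * y\<bar> \<le> t / 2 * e2" using xy a by (simp add: abs_mult mult_left_mono)
  have up: "f (t / 2) - t^2 * a = x + t / 2 * y + 5 / 4 * (a * t^2)" unfolding fv by (simp add: power2_eq_square algebra_simps)
  have lo: "f (- (t / 2)) - t^2 * a = x - t / 2 * y - 3 / 4 * (a * t^2)" unfolding fv by (simp add: power2_eq_square algebra_simps)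
  have pos: "a * t^2 > 0" using a by simp
  have "f (- (t / 2)) \<le> t^2 * a" "t^2 * a \<le> f (t / 2)" using up lo xy ty e pos by linarith+
  moreover have "continuous_on {- (t / 2)..t / 2} f" unfolding f_def by (intro continuous_intros)
  ultimately obtain \<tau> where "- (t / 2) \<le> \<tau>" "\<tau> \<le> t / 2" "f \<tau> = t^2 * a" using IVT'[of f "- (t / 2)" "t^2 * a" "t / 2"] a by auto
  then show ?thesis by (auto simp: f_def intro!: exI[of _ \<tau>])
qed

text \<open>The point \<open>t x0\<close> lies on the real quadric of level \<open>d\<close>.
  Solutions \<open>z\<close> of the congruence within \<open>c2 P\<close> of it have values off by
  O(P^2); moving along \<open>x0\<close> to \<open>z + k x0\<close>, with \<open>k\<close> a
  multiple of \<open>Q\<close> close to the real root \<open>\<tau> z\<close>, brings the value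
  within \<open>\<eta> P^2\<close> of \<open>d\<close> and keeps the congruence. As \<open>k\<close>
  and the new point determine \<open>z\<close>, each point arises at most \<open>3 P / Q\<close>
  times, which causes the division by 3. The constants \<open>c2\<close> and \<open>A4\<close> are
  chosen before \<open>\<eta>\<close> and \<open>Q\<close>.\<close>

lemma card_near_representations_ge:
  fixes q :: "'n::finite \<Rightarrow> 'n \<Rightarrow> int" and x0 :: "'n \<Rightarrow> int" and X c3 :: real
  assumes a: "qf q x0 > 0" and X: "X \<ge> 1" "\<And>i. \<bar>real_of_int (x0 i)\<bar> \<le> X" and c3: "c3 > 0"
  obtains c2 A4 :: real where "c2 > 0" "A4 > 0" "\<And>Q P d t \<eta>. Q > 0 \<Longrightarrow> \<eta> > 0 \<Longrightarrow> \<eta> \<le> A4 / (8 * X) \<Longrightarrow> c3 * real_of_int P \<le> t \<Longrightarrow>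
     4 * X * t \<le> real_of_int P \<Longrightarrow> real_of_int d = t^2 * qf q x0 \<Longrightarrow> real_of_int Q \<le> c2 * real_of_int P \<Longrightarrow>
     real_of_int Q \<le> \<eta> / A4 * real_of_int P \<Longrightarrow> real_of_int P \<ge> 1 \<Longrightarrow>
     real (card {x\<in>residues_box Q. Q dvd qf q x - d}) * (c2 * P / Q)^CARD('n) * (\<eta> / A4) / 3
      \<le> real (card {x\<in>ibox P. Q dvd qf q x - d \<and> \<bar>real_of_int (qf q x - d)\<bar> \<le> \<eta> * (real_of_int P)^2})"
proof -
  define a where "a = real_of_int (qf q x0)"
  define A where "A = (\<Sum>i\<in>UNIV. \<Sum>j\<in>UNIV. \<bar>real_of_int (q i j)\<bar>)"
  define A' where "A' = (\<Sum>i\<in>UNIV. \<Sum>j\<in>UNIV. \<bar>real_of_int (q i j + q j i)\<bar>)"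
  have a0: "a > 0" using assms by (simp add: a_def)
  have A0: "A \<ge> 0" "A' \<ge> 0" by (auto simp: A_def A'_def intro!: sum_nonneg)
  \<comment> \<open>\<open>c2\<close> keeps the errors at \<open>z\<close> below the threshold
    \<open>3/4 a t^2\<close> of \<open>quadratic_root_near\<close> as long as
    \<open>t >= c3 P\<close>; \<open>A4 P\<close> below bounds the change of the value per unit of
    \<open>k\<close>.\<close>
  define c2 where "c2 = min (1 / 4) (3 / 4 * (a * c3^2) / (2 * A + A' * X + 1))"
  define A4 where "A4 = 4 * a + A' * X"
  have den: "2 * A + A' * X + 1 > 0" using A0 X by (intro add_nonneg_pos) auto
  have c2: "c2 > 0" "c2 \<le> 1 / 4" "c2 * (2 * A + A' * X + 1) \<le> 3 / 4 * (a * c3^2)"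
  proof -
    show "c2 > 0" using a0 c3 den by (simp add: c2_def)
    show "c2 \<le> 1 / 4" by (simp add: c2_def)
    have "c2 \<le> 3 / 4 * (a * c3^2) / (2 * A + A' * X + 1)" by (simp add: c2_def)
    then show "c2 * (2 * A + A' * X + 1) \<le> 3 / 4 * (a * c3^2)" by (simp only: pos_le_divide_eq[OF den])
  qed
  have A4: "A4 > 0" using a0 A0 X by (auto simp: A4_def intro!: add_pos_nonneg)
  show ?thesis
  proof (rule that[OF c2(1) A4])
    fix Q P d :: int and t \<eta> :: real
    assume Q: "Q > 0" and \<eta>: "\<eta> > 0" "\<eta> \<le> A4 / (8 * X)" and t: "c3 * real_of_int P \<le> t" "4 * X * t \<le> real_of_int P" and d: "real_of_int d = t^2 * qf q x0"
      and QP: "real_of_int Q \<le> c2 * real_of_int P" "real_of_int Q \<le> \<eta> / A4 * real_of_int P" and P1: "real_of_int P \<ge> 1"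
    define p where "p = real_of_int P"
    have p1: "p \<ge> 1" using P1 by (simp add: p_def)
    have t0: "t > 0" using t(1) c3 p1 unfolding p_def by (smt (verit) mult_pos_pos)
    have tX: "X * t \<le> p / 4" using t(2) by (simp add: p_def)
    have tp: "t \<le> p" using tX X(1) t0 mult_right_mono[of 1 X t] p1 by linarith
    define \<rho> where "\<rho> = c2 * p"
    define \<sigma> where "\<sigma> = \<eta> / A4 * p"
    have \<rho>: "\<rho> > 0" "\<rho> \<le> p / 4" "\<rho> \<ge> Q" using c2 p1 QP by (auto simp: \<rho>_def p_def)
    have \<sigma>: "\<sigma> > 0" "\<sigma> \<ge> Q" using \<eta> A4 p1 QP by (auto simp: \<sigma>_def p_def)
    have \<sigma>X: "\<sigma> * X \<le> p / 8"
    proof -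
      have "\<eta> * (8 * X) \<le> A4" using \<eta>(2) X by (simp add: pos_le_divide_eq)
      then have "\<eta> / A4 * X \<le> 1 / 8" using A4 by (simp add: field_simps)
      then have "\<eta> / A4 * X * p \<le> 1 / 8 * p" using p1 by (intro mult_right_mono) auto
      then show ?thesis by (simp add: \<sigma>_def mult_ac)
    qed
    have \<sigma>p: "\<sigma> \<le> p / 8" using \<sigma>X X(1) \<sigma>(1) mult_left_mono[of 1 X \<sigma>] by linarith
    define Zs where "Zs = {z. (\<forall>i. \<bar>real_of_int (z i) - t * x0 i\<bar> \<le> \<rho>) \<and> Q dvd qf q z - d}"
    note Zs = card_solutions_near_ge[OF Q \<rho>(3), where y = "\<lambda>i. t * x0 i" and q = q and d = d, folded Zs_def]
    define Bf where "Bf = (\<lambda>z. real_of_int (\<Sum>j\<in>UNIV. wv q x0 j * z j))"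
    have tx: "\<bar>t * x0 i\<bar> \<le> p / 4" for i
    proof -
      have "\<bar>t * x0 i\<bar> = t * \<bar>real_of_int (x0 i)\<bar>" using t0 by (simp add: abs_mult)
      also have "\<dots> \<le> t * X" using t0 X by (intro mult_left_mono) auto
      finally show ?thesis using tX by (simp add: mult.commute)
    qed
    have zb: "\<bar>real_of_int (z i)\<bar> \<le> p / 2" if "z \<in> Zs" for z i
    proof -
      have "\<bar>real_of_int (z i) - t * x0 i\<bar> \<le> \<rho>" using that by (simp add: Zs_def)
      then show ?thesis using tx[of i] \<rho> by linarith
    qed
    have Bz: "\<bar>Bf z - 2 * t * a\<bar> \<le> A' * (X * \<rho>)" if "z \<in> Zs" for z
      unfolding Bf_def a_def A'_def by (rule polar_approx[OF _ X(2)]) (use that \<rho> in \<open>auto simp: Zs_def\<close>)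
    have "\<exists>\<tau>. \<bar>\<tau>\<bar> \<le> t / 2 \<and> real_of_int (qf q z) + \<tau> * Bf z + \<tau>^2 * a = t^2 * a" if z: "z \<in> Zs" for z
    proof (rule quadratic_root_near[OF a0 t0])
      show "\<bar>real_of_int (qf q z) - t^2 * a\<bar> \<le> A * (2 * \<rho> * p)" unfolding a_def A_def
      proof (rule qf_approx)
        show "\<bar>real_of_int (z i)\<bar> \<le> p" for i using zb[OF z, of i] p1 by linarith
        show "\<bar>t * real_of_int (x0 i)\<bar> \<le> p" for i using tx[of i] p1 by linarith
      qed (use z \<rho> in \<open>auto simp: Zs_def\<close>)
      show "\<bar>Bf z - 2 * t * a\<bar> \<le> A' * (X * \<rho>)" by (rule Bz[OF z])
      have "t / 2 * (A' * (X * \<rho>)) \<le> p * (A' * (X * \<rho>))"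
        using tp t0 p1 A0 X \<rho> by (intro mult_right_mono) auto
      then have "A * (2 * \<rho> * p) + t / 2 * (A' * (X * \<rho>)) \<le> c2 * (2 * A + A' * X) * p^2"
        by (simp add: \<rho>_def power2_eq_square algebra_simps)
      also have "\<dots> \<le> c2 * (2 * A + A' * X + 1) * p^2" using c2 by (intro mult_right_mono mult_left_mono) auto
      also have "\<dots> \<le> 3 / 4 * (a * c3^2) * p^2" using c2 by (intro mult_right_mono) auto
      also have "\<dots> = 3 / 4 * (a * (c3 * p)^2)" by (simp add: power_mult_distrib)
      also have "\<dots> \<le> 3 / 4 * (a * t^2)" using t(1) c3 p1 a0 by (intro mult_left_mono power_mono) (auto simp: p_def)
      finally show "A * (2 * \<rho> * p) + t / 2 * (A' * (X * \<rho>)) \<le> 3 / 4 * (a * t^2)" .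
    qed
    then obtain \<tau> where \<tau>: "\<And>z. z \<in> Zs \<Longrightarrow> \<bar>\<tau> z\<bar> \<le> t / 2 \<and> real_of_int (qf q z) + \<tau> z * Bf z + (\<tau> z)^2 * a = t^2 * a" by metis
    define G where "G = {x\<in>ibox P. Q dvd qf q x - d \<and> \<bar>real_of_int (qf q x - d)\<bar> \<le> \<eta> * (real_of_int P)^2}"
    define Ks where "Ks = (\<lambda>z. {k::int. \<bar>real_of_int k - \<tau> z\<bar> \<le> \<sigma> \<and> Q dvd k - 0})"
    define W where "W = Sigma Zs Ks"
    define f where "f = (\<lambda>(z, k) i. z i + k * x0 i)"
    have kb: "\<bar>real_of_int k\<bar> \<le> t / 2 + \<sigma>" if "z \<in> Zs" "k \<in> Ks z" for z k
      using \<tau>[OF that(1)] that(2) unfolding Ks_def by auto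
    have kp: "\<bar>real_of_int k\<bar> \<le> p" if "z \<in> Zs" "k \<in> Ks z" for z k
      using kb[OF that] tp \<sigma>p p1 by linarith
    have fG: "f (z, k) \<in> G" if z: "z \<in> Zs" and k: "k \<in> Ks z" for z k
    proof -
      have "\<bar>z i + k * x0 i\<bar> \<le> P" for i
      proof -
        have "\<bar>real_of_int k * x0 i\<bar> \<le> (t / 2 + \<sigma>) * X" unfolding abs_mult using kb[OF z k] X t0 \<sigma> by (intro mult_mono) auto
        also have "\<dots> \<le> p / 4" using tX \<sigma>X by (simp add: algebra_simps)
        finally have "real_of_int \<bar>z i + k * x0 i\<bar> \<le> real_of_int P" using zb[OF z, of i] p1 by (simp add: p_def)
        then show ?thesis by (simp only: of_int_le_iff)
      qed
      then have "f (z, k) \<in> ibox P" by (simp add: ibox_def f_def)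
      moreover have q1: "qf q (f (z, k)) = qf q z + k^2 * qf q x0 + k * (\<Sum>j\<in>UNIV. wv q x0 j * z j)"
        unfolding f_def prod.case qf_add qf_scale by (simp add: wv_def sum_distrib_left sum_distrib_right mult_ac)
      moreover have "Q dvd qf q (f (z, k)) - d"
      proof -
        have "Q dvd k" using k by (simp add: Ks_def)
        then have "Q dvd (qf q z - d) + (k^2 * qf q x0 + k * (\<Sum>j\<in>UNIV. wv q x0 j * z j))"
          using z by (intro dvd_add) (auto simp: Zs_def power2_eq_square)
        then show ?thesis unfolding q1 by (simp add: algebra_simps)
      qed
      moreover have "\<bar>real_of_int (qf q (f (z, k)) - d)\<bar> \<le> \<eta> * p^2"
      proof -
        have e: "real_of_int (qf q z) + \<tau> z * Bf z + (\<tau> z)^2 * a = t^2 * a" using \<tau>[OF z] by blast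
        have q1r: "real_of_int (qf q (f (z, k))) = real_of_int (qf q z) + (real_of_int k)^2 * a + k * Bf z"
          unfolding q1 by (simp add: a_def Bf_def)
        have dr: "real_of_int d = t^2 * a" using d by (simp add: a_def)
        have "real_of_int (qf q (f (z, k)) - d) = (k - \<tau> z) * (Bf z + (k + \<tau> z) * a)"
          using e q1r dr by (simp add: algebra_simps power2_eq_square)
        also have "\<bar>\<dots>\<bar> \<le> \<sigma> * (A4 * p)"
          unfolding abs_mult
        proof (rule mult_mono)
          show "\<bar>k - \<tau> z\<bar> \<le> \<sigma>" using k by (simp add: Ks_def)
          have "\<bar>Bf z\<bar> \<le> 2 * t * a + A' * (X * \<rho>)" using Bz[OF z] mult_pos_pos[OF t0 a0] by linarith
          also have "\<dots> \<le> 2 * p * a + A' * (X * p)" using tp a0 A0 X \<rho> p1 by (intro add_mono mult_right_mono mult_left_mono) auto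
          finally have b: "\<bar>Bf z\<bar> \<le> 2 * p * a + A' * (X * p)" .
          have "\<bar>k + \<tau> z\<bar> \<le> 2 * p" using kp[OF z k] \<tau>[OF z] tp p1 by linarith
          then have "\<bar>(k + \<tau> z) * a\<bar> \<le> 2 * p * a" unfolding abs_mult using a0 by simp
          then show "\<bar>Bf z + (k + \<tau> z) * a\<bar> \<le> A4 * p" using b unfolding A4_def by (simp add: algebra_simps)
        qed (use \<sigma> A4 p1 in auto)
        also have "\<sigma> * (A4 * p) = \<eta> * p^2" using A4 by (simp add: \<sigma>_def power2_eq_square)
        finally show ?thesis .
      qed
      ultimately show ?thesis by (simp add: G_def p_def)
    qed
    have finK: "finite (Ks z)" for z unfolding Ks_def by (rule finite_int_ball)
    have finW: "finite W" unfolding W_def using Zs(1) finK by (intro finite_SigmaI) auto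
    have cW: "real (card W) \<ge> real (card Zs) * (\<sigma> / Q)"
    proof -
      have "real (card W) = (\<Sum>z\<in>Zs. real (card (Ks z)))" unfolding W_def using Zs(1) finK by (subst card_SigmaI) auto
      also have "\<dots> \<ge> (\<Sum>z\<in>Zs. \<sigma> / Q)" unfolding Ks_def by (intro sum_mono card_progression_ball_ge Q \<sigma>(2))
      finally show ?thesis by simp
    qed
    have "real (card W) \<le> 3 * p / Q * real (card G)"
    proof (rule card_le_fibres(2)[where f = f])
      show "finite G" by (simp add: G_def)
      show "f ` W \<subseteq> G" using fG by (auto simp: W_def)
      fix x assume "x \<in> G"
      have sub: "snd ` {w\<in>W. f w = x} \<subseteq> {k\<in>{-P..P}. Q dvd k}"
      proof clarsimp
        fix z k assume "(z, k) \<in> W"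
        then have "\<bar>real_of_int k\<bar> \<le> p" "Q dvd k" using kp by (auto simp: W_def Ks_def)
        then show "- P \<le> k \<and> k \<le> P \<and> Q dvd k" unfolding p_def by linarith
      qed
      have inj: "inj_on snd {w\<in>W. f w = x}"
      proof (rule inj_onI)
        fix w w' assume w: "w \<in> {w\<in>W. f w = x}" "w' \<in> {w\<in>W. f w = x}" "snd w = snd w'"
        obtain z k where zk: "w = (z, k)" by (cases w)
        obtain z' where z': "w' = (z', k)" using w(3) zk by (cases w') auto
        have "(\<lambda>i. z i + k * x0 i) = (\<lambda>i. z' i + k * x0 i)" using w zk z' by (simp add: f_def)
        then have "z i = z' i" for i by (metis add_right_cancel)
        then show "w = w'" using zk z' by auto
      qed
      have "card {w\<in>W. f w = x} \<le> card {k\<in>{-P..P}. Q dvd k}" by (rule card_inj_on_le[OF inj sub]) (rule finite_subset[of _ "{-P..P}"], auto)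
      then have "real (card {w\<in>W. f w = x}) \<le> real (card {k\<in>{-P..P}. Q dvd k})" by (simp only: of_nat_le_iff)
      also have "\<dots> \<le> (P - (-P)) / Q + 1"
      proof -
        have "real (card {k\<in>{-P..P}. Q dvd k}) \<le> real_of_int (P - (-P)) / Q + 1"
          unfolding of_int_diff by (rule card_congruent_le[unfolded of_int_diff]) (use p1 Q in \<open>auto simp: p_def\<close>)
        then show ?thesis .
      qed
      also have "\<dots> \<le> 3 * p / Q"
      proof -
        have "real_of_int Q \<le> p" using \<rho> p1 by linarith
        then show ?thesis using Q by (simp add: p_def field_simps)
      qed
      finally show "finite {w\<in>W. f w = x} \<and> real (card {w\<in>W. f w = x}) \<le> 3 * p / Q" using finW by simp
    qed
    then have "real (card Zs) * (\<sigma> / Q) \<le> 3 * p / Q * real (card G)" using cW by linarith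
    then have "real (card Zs) * \<sigma> \<le> 3 * p * real (card G)" using Q by (simp add: field_simps)
    then have "real (card Zs) * (\<eta> / A4) * p \<le> 3 * real (card G) * p" by (simp add: \<sigma>_def mult_ac)
    then have "real (card Zs) * (\<eta> / A4) \<le> 3 * real (card G)" by (rule mult_right_le_imp_le) (use p1 in simp)
    moreover have "x / 3 \<le> y" if "x \<le> 3 * y" for x y :: real using that by simp
    ultimately have le3: "real (card Zs) * (\<eta> / A4) / 3 \<le> real (card G)" by blast
    have "real (card {x\<in>residues_box Q. Q dvd qf q x - d}) * (\<rho> / Q)^CARD('n) * (\<eta> / A4) / 3 \<le> real (card Zs) * (\<eta> / A4) / 3"
      using Zs(2) \<eta> A4 by (intro mult_right_mono divide_right_mono) auto
    from order_trans[OF this le3] show "real (card {x\<in>residues_box Q. Q dvd qf q x - d}) * (c2 * P / Q)^CARD('n) * (\<eta> / A4) / 3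
      \<le> real (card {x\<in>ibox P. Q dvd qf q x - d \<and> \<bar>real_of_int (qf q x - d)\<bar> \<le> \<eta> * (real_of_int P)^2})"
      unfolding G_def[symmetric] \<rho>_def p_def .
  qed
qed

section \<open>Rationality from a dichotomy\<close>

definition zero_density :: "nat set \<Rightarrow> bool" where
  "zero_density A \<longleftrightarrow> (\<forall>\<epsilon>>0. \<exists>N0. \<forall>N\<ge>N0. real (card (A \<inter> {1..N})) \<le> \<epsilon> * real N)"

lemma zero_density_subset: "zero_density B \<Longrightarrow> A \<subseteq> B \<Longrightarrow> zero_density A"
  unfolding zero_density_def
proof (intro allI impI)
  fix \<epsilon> :: real assume B: "\<forall>\<epsilon>>0. \<exists>N0. \<forall>N\<ge>N0. real (card (B \<inter> {1..N})) \<le> \<epsilon> * real N" and sub: "A \<subseteq> B" and \<epsilon>: "\<epsilon> > 0"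
  then obtain N0 where N0: "\<And>N. N \<ge> N0 \<Longrightarrow> real (card (B \<inter> {1..N})) \<le> \<epsilon> * real N" by blast
  have "real (card (A \<inter> {1..N})) \<le> real (card (B \<inter> {1..N}))" for N
    using sub by (intro of_nat_mono card_mono) auto
  then show "\<exists>N0. \<forall>N\<ge>N0. real (card (A \<inter> {1..N})) \<le> \<epsilon> * real N" using N0 order_trans by blast
qed

lemma zero_density_empty [simp]: "zero_density {}"
  by (auto simp: zero_density_def)

lemma zero_density_Un:
  assumes "zero_density A" "zero_density B" shows "zero_density (A \<union> B)"
  unfolding zero_density_def
proof (intro allI impI)
  fix \<epsilon> :: real assume \<epsilon>: "\<epsilon> > 0"
  then have e2: "\<epsilon> / 2 > 0" by simp
  obtain N1 where N1: "\<And>N. N \<ge> N1 \<Longrightarrow> real (card (A \<inter> {1..N})) \<le> \<epsilon> / 2 * real N"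
    using assms(1) e2 unfolding zero_density_def by blast
  obtain N2 where N2: "\<And>N. N \<ge> N2 \<Longrightarrow> real (card (B \<inter> {1..N})) \<le> \<epsilon> / 2 * real N"
    using assms(2) e2 unfolding zero_density_def by blast
  have "real (card ((A \<union> B) \<inter> {1..N})) \<le> \<epsilon> * real N" if "N \<ge> max N1 N2" for N
  proof -
    have "card ((A \<union> B) \<inter> {1..N}) \<le> card (A \<inter> {1..N}) + card (B \<inter> {1..N})"
      unfolding Int_Un_distrib2 by (rule card_Un_le)
    then show ?thesis using N1[of N] N2[of N] that by simp
  qed
  then show "\<exists>N0. \<forall>N\<ge>N0. real (card ((A \<union> B) \<inter> {1..N})) \<le> \<epsilon> * real N" by blast
qed

lemma zero_density_UN:
  assumes "finite I" "\<And>i. i \<in> I \<Longrightarrow> zero_density (A i)" shows "zero_density (\<Union>i\<in>I. A i)"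
  using assms by (induction I rule: finite_induct) (auto intro: zero_density_Un)

lemma zero_density_tendsto:
  assumes "zero_density A" shows "(\<lambda>N. real (card (A \<inter> {1..N})) / real N) \<longlonglongrightarrow> 0"
proof (rule LIMSEQ_I)
  fix r :: real assume r: "r > 0"
  then have "r / 2 > 0" by simp
  then obtain N0 where N0: "\<And>N. N \<ge> N0 \<Longrightarrow> real (card (A \<inter> {1..N})) \<le> r / 2 * real N"
    using assms unfolding zero_density_def by blast
  have "norm (real (card (A \<inter> {1..N})) / real N - 0) < r" if "N \<ge> max 1 N0" for N
  proof -
    have "real (card (A \<inter> {1..N})) / real N \<le> r / 2" using N0[of N] that by (simp add: pos_divide_le_eq)
    then have "real (card (A \<inter> {1..N})) / real N < r" using r by linarith
    then show ?thesis by simp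
  qed
  then show "\<exists>no. \<forall>n\<ge>no. norm (real (card (A \<inter> {1..n})) / real n - 0) < r" by blast
qed

section \<open>Sets of smooth numbers closed under multiplication by squares of primes\<close>

lemma smooth_decomposition:
  fixes M n :: nat
  assumes "n > 0"
  shows "\<exists>s m k. n = s * m \<and> coprime m M \<and> s dvd M^k"
  using assms
proof (induction n rule: less_induct)
  case (less n)
  show ?case
  proof (cases "coprime n M")
    case True
    then show ?thesis by (intro exI[of _ 1] exI[of _ n]) auto
  next
    case False
    then have "gcd n M \<noteq> 1" by (simp add: coprime_iff_gcd_eq_1)
    then obtain p where p: "prime p" "p dvd gcd n M" using prime_factor_nat by blast
    then obtain n' where n': "n = p * n'" by (auto elim: dvdE)
    have "n' < n" "n' > 0" using less.prems n' prime_gt_1_nat[OF p(1)] by auto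
    then obtain s m k where smk: "n' = s * m" "coprime m M" "s dvd M^k" using less.IH by blast
    have "p * s dvd M * M^k" using p smk by (intro mult_dvd_mono) auto
    then have "p * s dvd M^(Suc k)" by simp
    then show ?thesis using smk n' by (intro exI[of _ "p * s"] exI[of _ m] exI[of _ "Suc k"]) simp
  qed
qed

definition smooth_over :: "nat set \<Rightarrow> nat set" where
  "smooth_over S = {s. s > 0 \<and> (\<forall>p. prime p \<longrightarrow> p dvd s \<longrightarrow> p \<in> S)}"

definition square_closed :: "nat set \<Rightarrow> nat set \<Rightarrow> bool" where
  "square_closed S A \<longleftrightarrow> A \<subseteq> smooth_over S \<and> (\<forall>a\<in>A. \<forall>p\<in>S. p^2 * a \<in> A)"

text \<open>For \<open>p\<close> outside \<open>S\<close>, the members of \<open>A\<close> with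
  exactly \<open>j\<close> factors \<open>p\<close>, divided by \<open>p^j\<close>. One entry of the
  exponent vector is fixed in this way, and induction on \<open>S\<close> handles the
  others.\<close>

definition slice :: "nat set \<Rightarrow> nat \<Rightarrow> nat set \<Rightarrow> nat \<Rightarrow> nat set" where
  "slice S p A j = {s \<in> smooth_over S. p^j * s \<in> A}"

lemma smooth_over_mult: "a \<in> smooth_over S \<Longrightarrow> b \<in> smooth_over S \<Longrightarrow> a * b \<in> smooth_over S"
  by (auto simp: smooth_over_def prime_dvd_mult_iff)

lemma smooth_over_prime: "prime p \<Longrightarrow> p \<in> S \<Longrightarrow> p \<in> smooth_over S"
  by (auto simp: smooth_over_def prime_gt_0_nat dest: primes_dvd_imp_eq)

lemma smooth_over_power: "a \<in> smooth_over S \<Longrightarrow> a^k \<in> smooth_over S"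
  by (auto simp: smooth_over_def dest: prime_dvd_power)

lemma slice_square_closed:
  assumes "square_closed (insert p S) A" "\<And>q. q \<in> S \<Longrightarrow> prime q"
  shows "square_closed S (slice S p A j)" "slice S p A j \<subseteq> slice S p A (j + 2)"
proof -
  show "square_closed S (slice S p A j)" unfolding square_closed_def
  proof (intro conjI ballI)
    fix a q assume a: "a \<in> slice S p A j" and q: "q \<in> S"
    have "q^2 * (p^j * a) \<in> A" using a q assms(1) by (auto simp: slice_def square_closed_def)
    moreover have "q^2 * a \<in> smooth_over S" using a
      by (intro smooth_over_mult[OF smooth_over_power[OF smooth_over_prime[OF assms(2)[OF q] q]]]) (auto simp: slice_def)
    ultimately show "q^2 * a \<in> slice S p A j" by (simp add: slice_def mult_ac)
  qed (auto simp: slice_def)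
  show "slice S p A j \<subseteq> slice S p A (j + 2)"
  proof
    fix a assume a: "a \<in> slice S p A j"
    then have "p^2 * (p^j * a) \<in> A" using assms(1) by (auto simp: slice_def square_closed_def)
    then show "a \<in> slice S p A (j + 2)" using a by (simp add: slice_def power_add power2_eq_square mult_ac)
  qed
qed

lemma smooth_over_insert:
  assumes "prime p" "p \<notin> S" "s \<in> smooth_over (insert p S)"
  shows "\<exists>j t. s = p^j * t \<and> t \<in> smooth_over S"
proof -
  have s0: "s \<noteq> 0" using assms by (auto simp: smooth_over_def)
  obtain t where t: "s = p ^ multiplicity p s * t" "\<not> p dvd t"
    using multiplicity_decompose'[of s p] s0 assms(1) not_prime_unit by metis
  have "t \<in> smooth_over S" unfolding smooth_over_def
  proof (intro CollectI conjI allI impI)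
    show "t > 0" using t s0 by (metis gr0I mult_0_right)
    fix r assume r: "prime r" "r dvd t"
    then have "r dvd s" using t(1) by (metis dvd_mult)
    then have "r \<in> insert p S" using assms(3) r by (auto simp: smooth_over_def)
    then show "r \<in> S" using r t(2) by auto
  qed
  then show ?thesis using t by blast
qed

lemma slice_ext:
  assumes "prime p" "p \<notin> S" "A \<subseteq> smooth_over (insert p S)" "B \<subseteq> smooth_over (insert p S)"
    "\<And>j. slice S p A j = slice S p B j"
  shows "A = B"
proof -
  have "A \<subseteq> B" if sub: "A \<subseteq> smooth_over (insert p S)" and eq: "\<And>j. slice S p A j = slice S p B j" for A B
  proof
    fix a assume a: "a \<in> A"
    then obtain j t where "a = p^j * t" "t \<in> smooth_over S" using smooth_over_insert[OF assms(1,2)] sub by blast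
    then have "t \<in> slice S p A j" using a by (simp add: slice_def)
    then show "a \<in> B" using eq \<open>a = p^j * t\<close> by (auto simp: slice_def)
  qed
  then show ?thesis using assms(3-5) by (metis subset_antisym)
qed

text \<open>Dickson's lemma for the exponent vectors.\<close>
lemma square_closed_chain_stabilizes:
  assumes "finite S" "\<And>q. q \<in> S \<Longrightarrow> prime q" "\<And>k. square_closed S (B k)" "\<And>k. B k \<subseteq> B (Suc k)"
  shows "\<exists>K. \<forall>k\<ge>K. B k = B K"
  using assms
proof (induction S arbitrary: B rule: finite_induct)
  case empty
  have sm: "smooth_over {} \<subseteq> {1}"
  proof
    fix s :: nat assume "s \<in> smooth_over {}"
    then have "\<not> (\<exists>p. prime p \<and> p dvd s)" by (auto simp: smooth_over_def)
    then show "s \<in> {1}" using prime_factor_nat[of s] by auto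
  qed
  have mono: "B i \<subseteq> B j" if "i \<le> j" for i j using lift_Suc_mono_le[of B, OF empty(3) that] .
  have sub: "B k \<subseteq> {1}" for k using empty(2)[of k] sm by (auto simp: square_closed_def)
  show ?case
  proof (cases "\<exists>K. 1 \<in> B K")
    case True
    then obtain K where "1 \<in> B K" by blast
    then have "B k = {1}" if "k \<ge> K" for k using mono[OF that] sub[of k] by auto
    then show ?thesis by (metis order_refl)
  next
    case False
    then have "B k = {}" for k using sub[of k] by auto
    then show ?thesis by auto
  qed
next
  case (insert p S)
  have p: "prime p" and Spr: "\<And>q. q \<in> S \<Longrightarrow> prime q" using insert.prems(1) by auto
  have mono: "B i \<subseteq> B j" if "i \<le> j" for i j using lift_Suc_mono_le[of B, OF insert.prems(3) that] .
  note cl = slice_square_closed[OF insert.prems(2) Spr]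
  have smono: "slice S p (B k) j \<subseteq> slice S p (B l) j" if "k \<le> l" for k l j using mono[OF that] by (auto simp: slice_def)
  have jmono: "slice S p (B k) j \<subseteq> slice S p (B k) (j + 2 * i)" for k i j
  proof (induction i)
    case (Suc i)
    then show ?case using cl(2)[of k "j + 2 * i"] by (simp add: add.assoc)
  qed simp
  \<comment> \<open>Infinitely many slices have to stabilise at once. Small exponents are treated
    one by one; the large ones of each parity are compared with the diagonal chain
    \<open>slice S p (B k) (2 k + r)\<close>, which increases because it grows both with
    \<open>B\<close> and with the exponent.\<close>
  have diag: "\<exists>K. \<forall>k\<ge>K. slice S p (B k) (2 * k + r) = slice S p (B K) (2 * K + r)" for r
  proof (rule insert.IH[OF Spr cl(1)])
    fix k
    have "slice S p (B k) (2 * k + r) \<subseteq> slice S p (B (Suc k)) (2 * k + r)" by (rule smono) simp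
    also have "\<dots> \<subseteq> slice S p (B (Suc k)) (2 * k + r + 2)" by (rule cl(2))
    finally show "slice S p (B k) (2 * k + r) \<subseteq> slice S p (B (Suc k)) (2 * Suc k + r)" by (simp add: add_ac)
  qed
  then obtain Kd where Kd: "\<And>r k. k \<ge> Kd r \<Longrightarrow> slice S p (B k) (2 * k + r) = slice S p (B (Kd r)) (2 * Kd r + r)" by metis
  have "\<exists>K. \<forall>k\<ge>K. slice S p (B k) j = slice S p (B K) j" for j
    by (rule insert.IH[OF Spr cl(1)]; (assumption | (rule smono, simp)))
  then obtain Kj where Kj: "\<And>j k. k \<ge> Kj j \<Longrightarrow> slice S p (B k) j = slice S p (B (Kj j)) j" by metis
  define K0 where "K0 = max (Kd 0) (Kd 1)"
  define K where "K = max K0 (Max (Kj ` {..2 * K0 + 1}))"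
  have "slice S p (B k) j = slice S p (B K) j" if k: "k \<ge> K" for k j
  proof (cases "j \<le> 2 * K0 + 1")
    case True
    then have "Kj j \<le> K" unfolding K_def by (auto intro!: max.coboundedI2 Max_ge)
    then show ?thesis using Kj[of j k] Kj[of j K] k by simp
  next
    case False
    define r where "r = j mod 2"
    define K1 where "K1 = Kd r"
    have r: "r < 2" by (simp add: r_def)
    then have "r = 0 \<or> r = 1" by auto
    then have K1: "K1 \<le> K0" by (auto simp: K1_def K0_def)
    obtain i where i: "j = 2 * i + r" unfolding r_def by (metis div_mult_mod_eq mult.commute)
    have iK: "i \<ge> K1" using False K1 r i by linarith
    \<comment> \<open>Sandwich: the slice contains the diagonal term at \<open>K1\<close> and is
      contained in the diagonal term at \<open>l = max k i\<close>, and these two agree.\<close>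
    have "slice S p (B k) j = slice S p (B K1) (2 * K1 + r)" if kk: "k \<ge> K0" for k
    proof
      have "slice S p (B K1) (2 * K1 + r) \<subseteq> slice S p (B k) (2 * K1 + r)" by (rule smono) (use kk K1 in simp)
      also have "\<dots> \<subseteq> slice S p (B k) (2 * K1 + r + 2 * (i - K1))" by (rule jmono)
      also have "2 * K1 + r + 2 * (i - K1) = j" using i iK by simp
      finally show "slice S p (B K1) (2 * K1 + r) \<subseteq> slice S p (B k) j" .
      define l where "l = max k i"
      have "slice S p (B k) j \<subseteq> slice S p (B l) j" by (rule smono) (simp add: l_def)
      also have "\<dots> \<subseteq> slice S p (B l) (j + 2 * (l - i))" by (rule jmono)
      also have "j + 2 * (l - i) = 2 * l + r" using i by (simp add: l_def)
      also have "slice S p (B l) (2 * l + r) = slice S p (B K1) (2 * K1 + r)" unfolding K1_def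
        by (rule Kd) (use iK in \<open>simp add: l_def K1_def\<close>)
      finally show "slice S p (B k) j \<subseteq> slice S p (B K1) (2 * K1 + r)" .
    qed
    then show ?thesis using k by (simp add: K_def)
  qed
  then have "B k = B K" if "k \<ge> K" for k
    using slice_ext[OF p insert.hyps(2)] insert.prems(2) that unfolding square_closed_def by metis
  then show ?case by blast
qed

text \<open>From \<open>J\<close> on, the terms of each parity form a geometric series of ratio
  \<open>p^(-2)\<close>; finitely many rational terms precede them.\<close>

lemma rational_tail_sums:
  fixes x :: "nat \<Rightarrow> real" and p :: nat
  assumes p: "p \<ge> 2" and rat: "\<And>j. x j \<in> \<rat>" and per: "\<And>j. j \<ge> J \<Longrightarrow> x (j + 2) = x j"
  shows "\<exists>y\<in>\<rat>. (\<lambda>j. x j / real p^j) sums y"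
proof -
  define c where "c = 1 / real p"
  have c: "0 \<le> c" "c < 1" "c \<in> \<rat>" using p by (auto simp: c_def)
  define g where "g = (\<lambda>j. x (j + J) * c^(j + J))"
  have gper: "g (j + 2) = c^2 * g j" for j using per[of "j + J"] by (simp add: g_def power_add add_ac power2_eq_square)
  have ge: "g (2 * j) = g 0 * (c^2)^j" for j
    by (induction j) (simp_all add: gper[simplified] mult_ac)
  have go: "g (2 * j + 1) = g 1 * (c^2)^j" for j
    by (induction j) (use gper in \<open>simp_all add: mult_ac\<close>)
  have c2: "c^2 < 1" using c by (simp add: power_less_one_iff)
  have s1: "(\<lambda>j. g 0 * (c^2)^j) sums (g 0 * (1 / (1 - c^2)))" using c2 c by (intro sums_mult geometric_sums) simp
  have s2: "(\<lambda>j. g 1 * (c^2)^j) sums (g 1 * (1 / (1 - c^2)))" using c2 c by (intro sums_mult geometric_sums) simp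
  have grp1: "(\<lambda>j. g (2 * j) + g (2 * j + 1)) sums (g 0 * (1 / (1 - c^2)) + g 1 * (1 / (1 - c^2)))"
    unfolding ge go by (rule sums_add[OF s1 s2])
  \<comment> \<open>Grouping in pairs determines the sum only once convergence is known, so
    \<open>g\<close> is first dominated by a geometric series.\<close>
  have "summable g"
  proof -
    have bd: "norm (g j) \<le> (\<bar>g 0\<bar> + \<bar>g 1\<bar>) * (c^2)^(j div 2)" for j
    proof (cases "even j")
      case True
      then obtain i where "j = 2 * i" by (elim evenE)
      then show ?thesis using ge[of i] c by (simp add: abs_mult mult_right_mono)
    next
      case False
      then obtain i where "j = 2 * i + 1" by (elim oddE)
      then show ?thesis using go[of i] c by (simp add: abs_mult mult_right_mono)
    qed
    have bd2: "(c^2)^(j div 2) * c \<le> c^j" for j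
    proof -
      have "(c^2)^(j div 2) * c = c^(2 * (j div 2) + 1)" by (simp add: power_mult)
      also have "\<dots> \<le> c^j" using c by (intro power_decreasing) auto
      finally show ?thesis .
    qed
    show ?thesis
    proof (rule summable_comparison_test')
      show "summable (\<lambda>j. (\<bar>g 0\<bar> + \<bar>g 1\<bar>) / c * c^j)" using c by (intro summable_mult summable_geometric) simp
      fix j
      have c0: "c > 0" using p by (simp add: c_def)
      have "(c^2)^(j div 2) \<le> c^j / c" using bd2[of j] c0 by (simp add: pos_le_divide_eq)
      then have "(\<bar>g 0\<bar> + \<bar>g 1\<bar>) * (c^2)^(j div 2) \<le> (\<bar>g 0\<bar> + \<bar>g 1\<bar>) * (c^j / c)" by (intro mult_left_mono) auto
      then show "norm (g j) \<le> (\<bar>g 0\<bar> + \<bar>g 1\<bar>) / c * c^j" using bd[of j] by simp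
    qed
  qed
  then have gs: "g sums suminf g" by (rule summable_sums)
  from sums_group[OF this, of 2] have grp2: "(\<lambda>j. g (2 * j) + g (2 * j + 1)) sums suminf g"
    by (simp add: mult.commute atLeastLessThanSuc numeral_2_eq_2 add.commute)
  have "g sums (g 0 * (1 / (1 - c^2)) + g 1 * (1 / (1 - c^2)))" using gs unfolding sums_unique2[OF grp2 grp1] .
  then have "(\<lambda>j. x j * c^j) sums (g 0 * (1 / (1 - c^2)) + g 1 * (1 / (1 - c^2)) + (\<Sum>i<J. x i * c^i))"
    unfolding g_def by (subst (asm) sums_iff_shift) simp
  moreover have "g 0 * (1 / (1 - c^2)) + g 1 * (1 / (1 - c^2)) + (\<Sum>i<J. x i * c^i) \<in> \<rat>"
    using rat c by (auto simp: g_def intro!: Rats_add Rats_mult Rats_divide Rats_diff Rats_power Rats_sum)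
  moreover have "x j * c^j = x j / real p^j" for j by (simp add: c_def power_one_over)
  ultimately show ?thesis by auto
qed

text \<open>Splitting off the power of \<open>p\<close> gives the sum of \<open>x j / p^j\<close>,
  where \<open>x j\<close> is the reciprocal sum of the slice with exponent \<open>j\<close>,
  rational by induction. Slices of one parity increase with \<open>j\<close>, so by the chain
  condition they become constant and \<open>x\<close> becomes periodic with period 2.\<close>

lemma rational_reciprocal_sum:
  assumes "finite S" "\<And>q. q \<in> S \<Longrightarrow> prime q" "square_closed S A"
  shows "\<exists>x\<in>\<rat>. ((\<lambda>s. 1 / real s) has_sum x) A"
  using assms
proof (induction S arbitrary: A rule: finite_induct)
  case empty
  have "A \<subseteq> {1}"
  proof
    fix s assume "s \<in> A"
    then have "s > 0" "\<not> (\<exists>p. prime p \<and> p dvd s)" using empty by (auto simp: smooth_over_def square_closed_def)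
    then show "s \<in> {1}" using prime_factor_nat[of s] by auto
  qed
  then have "finite A" by (rule finite_subset) simp
  then have "((\<lambda>s. 1 / real s) has_sum (\<Sum>s\<in>A. 1 / real s)) A" by (rule has_sum_finite)
  moreover have "(\<Sum>s\<in>A. 1 / real s) \<in> \<rat>" by (auto intro!: Rats_sum)
  ultimately show ?case by blast
next
  case (insert p S)
  have p: "prime p" and Spr: "\<And>q. q \<in> S \<Longrightarrow> prime q" using insert.prems(1) by auto
  have p2: "p \<ge> 2" using p by (rule prime_ge_2_nat)
  note cl = slice_square_closed[OF insert.prems(2) Spr]
  have "\<forall>j. \<exists>x\<in>\<rat>. ((\<lambda>s. 1 / real s) has_sum x) (slice S p A j)" using insert.IH[OF Spr cl(1)] by blast
  then obtain x where x: "\<And>j. x j \<in> \<rat>" "\<And>j. ((\<lambda>s. 1 / real s) has_sum x j) (slice S p A j)" by metis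
  have "\<exists>K. \<forall>k\<ge>K. slice S p A (2 * k + r) = slice S p A (2 * K + r)" for r
  proof (rule square_closed_chain_stabilizes[OF insert.hyps(1) Spr cl(1)])
    fix k
    have "2 * Suc k + r = 2 * k + r + 2" by simp
    then show "slice S p A (2 * k + r) \<subseteq> slice S p A (2 * Suc k + r)" using cl(2)[of "2 * k + r"] by (simp only:)
  qed
  then obtain Kd where Kd: "\<And>r k. k \<ge> Kd r \<Longrightarrow> slice S p A (2 * k + r) = slice S p A (2 * Kd r + r)" by metis
  define J where "J = 2 * (Kd 0 + Kd 1) + 1"
  have per: "x (j + 2) = x j" if "j \<ge> J" for j
  proof -
    define r where "r = j mod 2"
    obtain i where i: "j = 2 * i + r" unfolding r_def by (metis div_mult_mod_eq mult.commute)
    have "r = 0 \<or> r = 1" unfolding r_def by auto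
    then have "i \<ge> Kd r" using that i unfolding J_def by auto
    then have "slice S p A (2 * i + r) = slice S p A (2 * Suc i + r)" using Kd[of r i] Kd[of r "Suc i"] by simp
    then have "slice S p A (j + 2) = slice S p A j" using i by (simp add: add_ac)
    then show ?thesis using x(2)[of j] x(2)[of "j + 2"] has_sum_unique by metis
  qed
  obtain y where y: "y \<in> \<rat>" "(\<lambda>j. x j / real p^j) sums y" using rational_tail_sums[of p x J, OF p2 x(1) per] by blast
  have x0: "x j \<ge> 0" for j by (rule has_sum_nonneg[OF x(2)]) simp
  have ysum: "((\<lambda>j. x j / real p^j) has_sum y) UNIV" by (rule sums_nonneg_imp_has_sum[OF y(2)]) (use x0 in simp)
  define F where "F = (\<lambda>(j, s). 1 / real (p^j * s))"
  have inner: "((\<lambda>s. F (j, s)) has_sum (x j / real p^j)) (slice S p A j)" for j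
    using has_sum_cmult_left[OF x(2)[of j], of "1 / real p^j"] by (simp add: F_def field_simps)
  have "(F has_sum y) (Sigma UNIV (slice S p A))"
  proof (rule has_sum_SigmaI[OF inner ysum])
    show "F summable_on Sigma UNIV (slice S p A)"
      by (rule summable_on_SigmaI[OF inner]) (use ysum in \<open>auto simp: F_def summable_on_def\<close>)
  qed
  moreover have "bij_betw (\<lambda>(j, s). p^j * s) (Sigma UNIV (slice S p A)) A"
  proof (rule bij_betw_imageI)
    show "(\<lambda>(j, s). p^j * s) ` Sigma UNIV (slice S p A) = A"
    proof (intro equalityI subsetI)
      fix a assume a: "a \<in> A"
      then have "a \<in> smooth_over (insert p S)" using insert.prems(2) by (auto simp: square_closed_def)
      then obtain j t where jt: "a = p^j * t" "t \<in> smooth_over S"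
        using smooth_over_insert[OF p insert.hyps(2)] by blast
      then have "(j, t) \<in> Sigma UNIV (slice S p A)" using a by (simp add: slice_def)
      then show "a \<in> (\<lambda>(j, s). p^j * s) ` Sigma UNIV (slice S p A)" using jt(1)
        by (intro image_eqI[of _ _ "(j, t)"]) auto
    qed (auto simp: slice_def)
    show "inj_on (\<lambda>(j, s). p^j * s) (Sigma UNIV (slice S p A))"
    proof (rule inj_onI, clarify)
      fix j s j' s' assume s: "s \<in> slice S p A j" "s' \<in> slice S p A j'" and eq: "p^j * s = p^j' * s'"
      have nd: "\<not> p dvd s" "\<not> p dvd s'" "s > 0" "s' > 0" using s p insert.hyps(2) unfolding slice_def smooth_over_def by blast+
      have m: "multiplicity p (p^i * t) = i" if "\<not> p dvd t" "t > 0" for i t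
        using that p by (simp add: prime_elem_multiplicity_mult_distrib not_dvd_imp_multiplicity_0)
      have "j = j'" using m[OF nd(1,3), of j] m[OF nd(2,4), of j'] eq by simp
      then show "j = j' \<and> s = s'" using eq p2 by simp
    qed
  qed
  ultimately have "((\<lambda>s. 1 / real s) has_sum y) A"
    using has_sum_reindex_bij_betw[of "\<lambda>(j, s). p^j * s" "Sigma UNIV (slice S p A)" A "\<lambda>s. 1 / real s" y]
    by (simp add: F_def case_prod_unfold)
  then show ?case using y(1) by blast
qed

lemma real_div_bounds:
  fixes n s :: nat
  assumes "s > 0"
  shows "real (n div s) \<le> real n / real s" "real n / real s \<le> real (n div s) + 1"
proof -
  have "real n = real (s * (n div s) + n mod s)" by simp
  then have "real n = real s * real (n div s) + real (n mod s)" by (simp only: of_nat_add of_nat_mult)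
  then have eq: "real n / real s = real (n div s) + real (n mod s) / real s" using assms by (simp add: add_divide_distrib)
  have "real (n mod s) / real s \<le> 1" using assms by (simp add: less_imp_le)
  then show "real (n div s) \<le> real n / real s" "real n / real s \<le> real (n div s) + 1" unfolding eq by auto
qed

lemma card_residue_class:
  fixes M n c :: nat
  assumes "M > 0"
  shows "\<bar>real (card {m\<in>{1..n}. [m = c] (mod M)}) - real n / real M\<bar> \<le> 1"
proof -
  define A where "A = {m\<in>{1..n}. [m = c] (mod M)}"
  \<comment> \<open>Counting starts at 1, so the class is represented in \<open>{1..M}\<close>
    rather than in \<open>{0..<M}\<close>.\<close>
  define r where "r = (if c mod M = 0 then M else c mod M)"
  have r: "1 \<le> r" "r \<le> M" "[r = c] (mod M)" using assms by (auto simp: r_def cong_def Suc_leI less_imp_le)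
  have "inj_on (\<lambda>j. j * M + r) {..<n div M}" using assms by (auto simp: inj_on_def)
  moreover have "(\<lambda>j. j * M + r) ` {..<n div M} \<subseteq> A"
  proof
    fix x assume "x \<in> (\<lambda>j. j * M + r) ` {..<n div M}"
    then obtain j where j: "j \<in> {..<n div M}" and x: "x = j * M + r" by blast
    have "j * M + r \<le> (Suc j) * M" using r by simp
    also have "\<dots> \<le> (n div M) * M" using j by (intro mult_right_mono) auto
    also have "\<dots> \<le> n" by simp
    finally have "j * M + r \<le> n" .
    moreover have "[j * M + r = c] (mod M)" using r(3) by (simp add: cong_def)
    ultimately show "x \<in> A" using r x by (simp add: A_def)
  qed
  ultimately have "card {..<n div M} \<le> card A" by (rule card_inj_on_le) (simp add: A_def)
  then have lo: "n div M \<le> card A" by simp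
  have "inj_on (\<lambda>m. (m - 1) div M) A"
  proof (rule inj_onI)
    fix x y assume x: "x \<in> A" and y: "y \<in> A" and eq: "(x - 1) div M = (y - 1) div M"
    obtain x' y' where xy: "x = Suc x'" "y = Suc y'" using x y by (auto simp: A_def Suc_le_eq gr0_conv_Suc)
    have "[Suc x' = Suc y'] (mod M)" using x y xy by (auto simp: A_def intro: cong_trans cong_sym)
    then have "[x' + 1 = y' + 1] (mod M)" by simp
    then have "[x' = y'] (mod M)" using cong_add_rcancel_nat by blast
    then have "x' mod M = y' mod M" by (simp add: cong_def)
    then have "x' = y'" using eq xy by (metis diff_Suc_1 div_mult_mod_eq)
    then show "x = y" using xy by simp
  qed
  moreover have "(\<lambda>m. (m - 1) div M) ` A \<subseteq> {..n div M}" by (auto simp: A_def intro!: div_le_mono)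
  ultimately have "card A \<le> card {..n div M}" by (rule card_inj_on_le) simp
  then have hi: "card A \<le> n div M + 1" by simp
  show ?thesis using lo hi real_div_bounds[OF assms, of n] unfolding A_def[symmetric] by linarith
qed

lemma residue_class_tendsto:
  assumes "M > 0"
  shows "(\<lambda>n. real (card {m\<in>{1..n}. [m = c] (mod M)}) / real n) \<longlonglongrightarrow> 1 / real M"
proof -
  have "(\<lambda>n. real (card {m\<in>{1..n}. [m = c] (mod M)}) / real n - 1 / real M) \<longlonglongrightarrow> 0"
  proof (rule Lim_null_comparison)
    show "\<forall>\<^sub>F n in sequentially. norm (real (card {m\<in>{1..n}. [m = c] (mod M)}) / real n - 1 / real M) \<le> 1 / real n"
    proof (rule eventually_sequentiallyI[of 1])
      fix n :: nat assume n: "1 \<le> n"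
      have "real (card {m\<in>{1..n}. [m = c] (mod M)}) / real n - 1 / real M = (real (card {m\<in>{1..n}. [m = c] (mod M)}) - real n / real M) / real n"
        using n by (simp add: diff_divide_distrib)
      also have "norm \<dots> \<le> 1 / real n" using card_residue_class[OF assms, of n c] n by (simp add: divide_right_mono)
      finally show "norm (real (card {m\<in>{1..n}. [m = c] (mod M)}) / real n - 1 / real M) \<le> 1 / real n" .
    qed
    show "(\<lambda>n. 1 / real n) \<longlonglongrightarrow> 0" by (rule lim_1_over_n)
  qed
  then show ?thesis by (simp add: LIM_zero_iff)
qed

lemma div_const_tendsto:
  assumes "s > 0" shows "(\<lambda>N. real (N div s) / real N) \<longlonglongrightarrow> 1 / real s"
proof -
  have "(\<lambda>N. real (N div s) / real N - 1 / real s) \<longlonglongrightarrow> 0"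
  proof (rule Lim_null_comparison)
    show "\<forall>\<^sub>F N in sequentially. norm (real (N div s) / real N - 1 / real s) \<le> 1 / real N"
    proof (rule eventually_sequentiallyI[of 1])
      fix N :: nat assume N: "1 \<le> N"
      have "real (N div s) / real N - 1 / real s = (real (N div s) - real N / real s) / real N" using N by (simp add: diff_divide_distrib)
      also have "norm \<dots> \<le> 1 / real N"
      proof -
        have "\<bar>real (N div s) - real N / real s\<bar> \<le> 1" using real_div_bounds[OF assms, of N] by linarith
        then show ?thesis using N by (simp add: divide_right_mono)
      qed
      finally show "norm (real (N div s) / real N - 1 / real s) \<le> 1 / real N" .
    qed
    show "(\<lambda>n. 1 / real n) \<longlonglongrightarrow> 0" by (rule lim_1_over_n)
  qed
  then show ?thesis by (simp add: LIM_zero_iff)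
qed

text \<open>Every positive \<open>d\<close> is uniquely \<open>s m\<close> with \<open>s\<close>
  composed of primes of \<open>M\<close> and \<open>m\<close> coprime to \<open>M\<close>. For fixed
  \<open>s\<close> and a class \<open>c\<close>, the dichotomy makes the density of the suitable
  \<open>m\<close> either 0 or \<open>1 / M\<close>. The sum over \<open>s\<close> and the limit in
  \<open>N\<close> commute by Tannery's theorem, with majorant \<open>1 / s\<close>, whose sum over
  smooth numbers converges. What remains are the reciprocal sums of the sets \<open>A c\<close>, to
  which \<open>rational_reciprocal_sum\<close> applies.\<close>

theorem rational_density_dichotomy:
  fixes D :: "nat set" and M :: nat
  assumes M: "M > 0" and sq: "\<And>d p. d \<in> D \<Longrightarrow> prime p \<Longrightarrow> p dvd M \<Longrightarrow> p^2 * d \<in> D"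
    and dich: "\<And>s k m0. s > 0 \<Longrightarrow> s dvd M^k \<Longrightarrow> m0 > 0 \<Longrightarrow> coprime m0 M \<Longrightarrow> s * m0 \<in> D \<Longrightarrow>
      zero_density {m. [m = m0] (mod M) \<and> s * m \<notin> D}"
  shows "\<exists>\<delta>\<in>\<rat>. (\<lambda>N. real (card (D \<inter> {1..N})) / real N) \<longlonglongrightarrow> \<delta>"
proof -
  define PM where "PM = {p. prime p \<and> p dvd M}"
  define Sm where "Sm = smooth_over PM"
  define C where "C = {c. c < M \<and> coprime c M}"
  define A where "A c = {s\<in>Sm. \<exists>m>0. [m = c] (mod M) \<and> s * m \<in> D}" for c
  define cnt where "cnt s n = card {m\<in>{1..n}. coprime m M \<and> s * m \<in> D}" for s n
  have finPM: "finite PM" unfolding PM_def using M finite_divisors_nat[of M] by (auto intro: finite_subset)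
  have PMp: "prime p" if "p \<in> PM" for p using that by (simp add: PM_def)
  have finC: "finite C" by (simp add: C_def)
  have Sm_dvd: "\<exists>k. s dvd M^k" if s: "s \<in> Sm" for s
  proof -
    have s0: "s > 0" using s by (simp add: Sm_def smooth_over_def)
    obtain s' m' k where d: "s = s' * m'" "coprime m' M" "s' dvd M^k" using smooth_decomposition[OF s0, of M] by blast
    have "m' = 1"
    proof (rule ccontr)
      assume "m' \<noteq> 1"
      then obtain p where p: "prime p" "p dvd m'" using prime_factor_nat by blast
      then have "p dvd M" using s d(1) by (auto simp: Sm_def smooth_over_def PM_def)
      then show False using p d(2) coprime_common_divisor_nat[of m' M p] by (auto simp: prime_nat_iff)
    qed
    then show ?thesis using d by auto
  qed
  have Sm0: "s > 0" if "s \<in> Sm" for s using that by (simp add: Sm_def smooth_over_def)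
  have Sm_closed: "square_closed PM Sm" unfolding square_closed_def Sm_def
    using smooth_over_mult[OF smooth_over_power[OF smooth_over_prime[OF PMp]]] by blast
  have A_closed: "square_closed PM (A c)" for c unfolding square_closed_def
  proof (intro conjI ballI)
    show "A c \<subseteq> smooth_over PM" by (auto simp: A_def Sm_def)
    fix a p assume a: "a \<in> A c" and p: "p \<in> PM"
    then obtain m where m: "m > 0" "[m = c] (mod M)" "a * m \<in> D" by (auto simp: A_def)
    have "p^2 * (a * m) \<in> D" using sq[OF m(3)] p by (simp add: PM_def)
    then have "p^2 * a * m \<in> D" by (simp add: mult.assoc)
    moreover have "p^2 * a \<in> Sm" using Sm_closed a p by (auto simp: square_closed_def A_def)
    ultimately show "p^2 * a \<in> A c" using m unfolding A_def by blast
  qed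
  have lim1: "(\<lambda>n. real (cnt s n) / real n) \<longlonglongrightarrow> (\<Sum>c\<in>C. if s \<in> A c then 1 / real M else 0)" if s: "s \<in> Sm" for s
  proof -
    have cl: "(\<lambda>n. real (card {m\<in>{1..n}. [m = c] (mod M) \<and> s * m \<in> D}) / real n) \<longlonglongrightarrow> (if s \<in> A c then 1 / real M else 0)"
      if c: "c \<in> C" for c
    proof (cases "s \<in> A c")
      case True
      then obtain m0 where m0: "m0 > 0" "[m0 = c] (mod M)" "s * m0 \<in> D" by (auto simp: A_def)
      have cop: "coprime m0 M" using c cong_imp_coprime[OF cong_sym[OF m0(2)]] by (simp add: C_def)
      obtain k where "s dvd M^k" using Sm_dvd[OF s] by blast
      then have zd: "zero_density {m. [m = m0] (mod M) \<and> s * m \<notin> D}" using dich Sm0[OF s] m0 cop by blast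
      have cc: "[m = c] (mod M) \<longleftrightarrow> [m = m0] (mod M)" for m using m0(2) cong_trans cong_sym by blast
      have eq: "real (card {m\<in>{1..n}. [m = c] (mod M) \<and> s * m \<in> D}) / real n =
         real (card {m\<in>{1..n}. [m = c] (mod M)}) / real n - real (card ({m. [m = m0] (mod M) \<and> s * m \<notin> D} \<inter> {1..n})) / real n" for n
      proof -
        have "{m\<in>{1..n}. [m = c] (mod M)} = {m\<in>{1..n}. [m = c] (mod M) \<and> s * m \<in> D} \<union> ({m. [m = m0] (mod M) \<and> s * m \<notin> D} \<inter> {1..n})"
          using cc by auto
        then have "card {m\<in>{1..n}. [m = c] (mod M)} = card {m\<in>{1..n}. [m = c] (mod M) \<and> s * m \<in> D} + card ({m. [m = m0] (mod M) \<and> s * m \<notin> D} \<inter> {1..n})"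
          by (simp only:) (rule card_Un_disjoint, auto)
        then show ?thesis by (simp add: add_divide_distrib)
      qed
      show ?thesis unfolding eq using tendsto_diff[OF residue_class_tendsto[OF M, of c] zero_density_tendsto[OF zd]] True by simp
    next
      case False
      then have e: "{m\<in>{1..n}. [m = c] (mod M) \<and> s * m \<in> D} = {}" for n using s by (force simp: A_def)
      show ?thesis unfolding e using False by simp
    qed
    have "cnt s n = (\<Sum>c\<in>C. card {m\<in>{1..n}. [m = c] (mod M) \<and> s * m \<in> D})" for n
    proof -
      have "{m\<in>{1..n}. coprime m M \<and> s * m \<in> D} = (\<Union>c\<in>C. {m\<in>{1..n}. [m = c] (mod M) \<and> s * m \<in> D})"
      proof (intro equalityI subsetI)
        fix m assume m: "m \<in> {m\<in>{1..n}. coprime m M \<and> s * m \<in> D}"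
        then have "m mod M \<in> C" using M by (simp add: C_def coprime_mod_left_iff)
        moreover have "[m = m mod M] (mod M)" by (simp add: cong_def)
        ultimately show "m \<in> (\<Union>c\<in>C. {m\<in>{1..n}. [m = c] (mod M) \<and> s * m \<in> D})" using m by blast
      next
        fix m assume "m \<in> (\<Union>c\<in>C. {m\<in>{1..n}. [m = c] (mod M) \<and> s * m \<in> D})"
        then obtain c where c: "c \<in> C" "m \<in> {1..n}" "[m = c] (mod M)" "s * m \<in> D" by blast
        have "coprime m M" using c(1) cong_imp_coprime[OF cong_sym[OF c(3)]] by (simp add: C_def)
        then show "m \<in> {m\<in>{1..n}. coprime m M \<and> s * m \<in> D}" using c by simp
      qed
      then show ?thesis unfolding cnt_def
      proof (simp only:, intro card_UN_disjoint finC ballI impI)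
        fix c c' assume "c \<in> C" "c' \<in> C" "c \<noteq> c'"
        then show "{m\<in>{1..n}. [m = c] (mod M) \<and> s * m \<in> D} \<inter> {m\<in>{1..n}. [m = c'] (mod M) \<and> s * m \<in> D} = {}"
          by (auto simp: C_def cong_def)
      qed auto
    qed
    then have "real (cnt s n) / real n = (\<Sum>c\<in>C. real (card {m\<in>{1..n}. [m = c] (mod M) \<and> s * m \<in> D}) / real n)" for n
      by (simp add: sum_divide_distrib)
    then show ?thesis using tendsto_sum[OF cl] by simp
  qed
  \<comment> \<open>\<open>f s N\<close> is the contribution of the values with smooth part
    \<open>s\<close> to the density ratio at \<open>N\<close>; \<open>b s\<close> is its
    limit.\<close>
  define f where "f s N = (if s \<in> Sm then real (cnt s (N div s)) / real N else 0)" for s N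
  define b where "b s = (if s \<in> Sm then (\<Sum>c\<in>C. if s \<in> A c then 1 / real M else 0) / real s else 0)" for s
  have lim2: "(\<lambda>N. f s N) \<longlonglongrightarrow> b s" for s
  proof (cases "s \<in> Sm")
    case True
    have fl: "filterlim (\<lambda>N. N div s) sequentially sequentially"
    proof (rule filterlim_at_top_mono[of "\<lambda>N. N div s" , OF _ ])
      show "filterlim (\<lambda>N. N div s) at_top sequentially"
        unfolding filterlim_at_top eventually_sequentially using Sm0[OF True]
        by (metis div_le_mono nonzero_mult_div_cancel_right less_irrefl)
    qed simp
    have "(\<lambda>N. real (cnt s (N div s)) / real (N div s) * (real (N div s) / real N)) \<longlonglongrightarrow> (\<Sum>c\<in>C. if s \<in> A c then 1 / real M else 0) * (1 / real s)"
      by (intro tendsto_mult filterlim_compose[OF lim1[OF True] fl] div_const_tendsto Sm0 True)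
    moreover have "real (cnt s (N div s)) / real (N div s) * (real (N div s) / real N) = f s N" for N
      using True by (cases "N div s = 0") (auto simp: f_def cnt_def)
    ultimately show ?thesis using True by (simp add: b_def)
  qed (simp add: f_def b_def)
  obtain x0 where x0: "((\<lambda>s. 1 / real s) has_sum x0) Sm" using rational_reciprocal_sum[OF finPM PMp Sm_closed] by blast
  have to_sums: "(\<lambda>s. if s \<in> T then 1 / real s else 0) sums x" if "((\<lambda>s. 1 / real s) has_sum x) T" for T x
  proof (rule has_sum_imp_sums)
    show "((\<lambda>s. if s \<in> T then 1 / real s else 0) has_sum x) UNIV"
      by (rule has_sum_cong_neutral[THEN iffD1, OF _ _ _ that]) auto
  qed
  have smb: "summable (\<lambda>s. if s \<in> Sm then 1 / real s else 0)" using to_sums[OF x0] by (rule sums_summable)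
  have bound: "norm (f s N) \<le> (if s \<in> Sm then 1 / real s else 0)" for s N
  proof (cases "s \<in> Sm \<and> N > 0")
    case True
    have "cnt s (N div s) \<le> card {1..N div s}" unfolding cnt_def by (rule card_mono) auto
    then have "real (cnt s (N div s)) \<le> real N / real s" using real_div_bounds(1)[OF Sm0, of s N] True by simp
    then have "real (cnt s (N div s)) / real N \<le> real N / real s / real N" by (intro divide_right_mono) auto
    then show ?thesis using True by (simp add: f_def)
  qed (auto simp: f_def)
  have "((\<lambda>N. suminf (\<lambda>s. f s N)) \<longlongrightarrow> suminf b) sequentially"
  proof -
    have "\<forall>\<^sub>F (s, N) in at_top \<times>\<^sub>F sequentially. norm (f s N) \<le> (if s \<in> Sm then 1 / real s else 0)"
      by (rule always_eventually) (use bound in auto)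
    from tannerys_theorem[OF lim2 this smb] show ?thesis by simp
  qed
  moreover have "suminf (\<lambda>s. f s N) = real (card (D \<inter> {1..N})) / real N" for N
  proof -
    have "suminf (\<lambda>s. f s N) = (\<Sum>s\<in>{1..N}. f s N)"
    proof (rule suminf_finite)
      fix s assume "s \<notin> {1..N}"
      then have "s = 0 \<or> N div s = 0" by auto
      then show "f s N = 0" using Sm0[of s] by (auto simp: f_def cnt_def)
    qed simp
    also have "\<dots> = (\<Sum>s\<in>Sm \<inter> {1..N}. real (cnt s (N div s)) / real N)"
      unfolding f_def by (subst sum.inter_restrict[symmetric]) (auto simp: Int_commute)
    also have "\<dots> = real (\<Sum>s\<in>Sm \<inter> {1..N}. cnt s (N div s)) / real N" by (simp add: sum_divide_distrib)
    also have "(\<Sum>s\<in>Sm \<inter> {1..N}. cnt s (N div s)) = card (Sigma (Sm \<inter> {1..N}) (\<lambda>s. {m\<in>{1..N div s}. coprime m M \<and> s * m \<in> D}))"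
      unfolding cnt_def by (rule card_SigmaI[symmetric]) auto
    also have "\<dots> = card (D \<inter> {1..N})"
    proof (rule bij_betw_same_card[of "\<lambda>(s, m). s * m"], rule bij_betw_imageI)
      show "inj_on (\<lambda>(s, m). s * m) (Sigma (Sm \<inter> {1..N}) (\<lambda>s. {m\<in>{1..N div s}. coprime m M \<and> s * m \<in> D}))"
      proof (rule inj_onI, clarify)
        fix s m s' m' assume a: "s \<in> Sm" "s' \<in> Sm" "coprime m M" "coprime m' M" "s * m = s' * m'" "s \<in> {1..N}" "s' \<in> {1..N}"
        have dv: "t dvd t'" if t1: "t \<in> Sm" and t2: "coprime n' M" and t3: "t * n = t' * n'" for t t' n n'
        proof -
          obtain k where k: "t dvd M^k" using Sm_dvd[OF t1] by blast
          have "coprime (M^k) n'" using t2 by (simp add: coprime_commute)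
          then have "coprime t n'" using k coprime_divisors[of t "M^k" n' n'] by simp
          moreover have "t dvd t' * n'" using t3 by (metis dvd_triv_left)
          ultimately show ?thesis by (simp add: coprime_dvd_mult_left_iff)
        qed
        have "s = s'" using dv[OF a(1,4,5)] dv[OF a(2,3) a(5)[symmetric]] by (rule dvd_antisym)
        then show "s = s' \<and> m = m'" using a by auto
      qed
      show "(\<lambda>(s, m). s * m) ` Sigma (Sm \<inter> {1..N}) (\<lambda>s. {m\<in>{1..N div s}. coprime m M \<and> s * m \<in> D}) = D \<inter> {1..N}"
      proof (intro equalityI subsetI)
        fix d assume "d \<in> (\<lambda>(s, m). s * m) ` Sigma (Sm \<inter> {1..N}) (\<lambda>s. {m\<in>{1..N div s}. coprime m M \<and> s * m \<in> D})"
        then obtain s m where sm: "d = s * m" "s \<in> {1..N}" "m \<in> {1..N div s}" "s * m \<in> D" by auto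
        have "s * m \<le> s * (N div s)" using sm by simp
        also have "\<dots> \<le> N" by simp
        finally show "d \<in> D \<inter> {1..N}" using sm by (auto simp: Suc_le_eq)
      next
        fix d assume d: "d \<in> D \<inter> {1..N}"
        then have d0: "d > 0" by auto
        obtain s m k where smk: "d = s * m" "coprime m M" "s dvd M^k" using smooth_decomposition[OF d0, of M] by blast
        have s0: "s > 0" "m > 0" using smk d0 by auto
        have "s \<in> Sm" unfolding Sm_def smooth_over_def PM_def
          using s0 smk(3) by (auto dest: dvd_trans prime_dvd_power)
        moreover have "s \<le> N" "m \<le> N div s"
        proof -
          have "s * m \<le> N" using d smk by simp
          then show "m \<le> N div s" using s0 by (metis div_le_mono nonzero_mult_div_cancel_left less_irrefl)
          show "s \<le> N" using \<open>s * m \<le> N\<close> s0 by (metis Suc_leI One_nat_def mult.right_neutral mult_le_mono2 order_trans)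
        qed
        ultimately have "(s, m) \<in> Sigma (Sm \<inter> {1..N}) (\<lambda>s. {m\<in>{1..N div s}. coprime m M \<and> s * m \<in> D})"
          using smk s0 d by auto
        then show "d \<in> (\<lambda>(s, m). s * m) ` Sigma (Sm \<inter> {1..N}) (\<lambda>s. {m\<in>{1..N div s}. coprime m M \<and> s * m \<in> D})"
          using smk(1) by (intro image_eqI[of _ _ "(s, m)"]) auto
      qed
    qed
    finally show ?thesis .
  qed
  moreover have "suminf b \<in> \<rat>"
  proof -
    have "\<forall>c. \<exists>x\<in>\<rat>. ((\<lambda>s. 1 / real s) has_sum x) (A c)" using rational_reciprocal_sum[OF finPM PMp A_closed] by blast
    then obtain x where x: "\<And>c. x c \<in> \<rat>" "\<And>c. ((\<lambda>s. 1 / real s) has_sum x c) (A c)" by metis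
    have "(\<lambda>s. \<Sum>c\<in>C. (if s \<in> A c then 1 / real s else 0) / real M) sums (\<Sum>c\<in>C. x c / real M)"
      by (intro sums_sum sums_divide to_sums x)
    moreover have "(\<Sum>c\<in>C. (if s \<in> A c then 1 / real s else 0) / real M) = b s" for s
    proof (cases "s \<in> Sm")
      case True
      have "(\<Sum>c\<in>C. (if s \<in> A c then 1 / real s else 0) / real M) = (\<Sum>c\<in>C. (if s \<in> A c then 1 / real M else 0) / real s)"
        by (intro sum.cong) auto
      then show ?thesis using True by (simp add: b_def sum_divide_distrib)
    next
      case False
      then have "s \<notin> A c" for c by (auto simp: A_def)
      then show ?thesis using False by (simp add: b_def)
    qed
    ultimately have "b sums (\<Sum>c\<in>C. x c / real M)" by simp
    then have "suminf b = (\<Sum>c\<in>C. x c / real M)" by (rule sums_unique[symmetric])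
    then show ?thesis using x(1) by (auto intro!: Rats_sum Rats_divide)
  qed
  ultimately show ?thesis by auto
qed

section \<open>Almost all integers of an admissible class are represented\<close>

lemma exceptional_bound_combine:
  fixes r :: "int \<Rightarrow> real" and J :: int and E :: "int set"
  assumes "finite E" "J \<ge> 0" and g: "g \<ge> 0" "\<And>d. d \<in> E \<Longrightarrow> g \<le> (\<Sum>j\<in>{-J..J}. r (d + Q * j))"
    and V: "\<And>j. j \<in> {-J..J} \<Longrightarrow> (\<Sum>d\<in>E. (r (d + Q * j))^2) \<le> V"
  shows "real (card E) * g^2 \<le> (2 * real_of_int J + 1)^2 * V"
proof -
  have cJ: "real (card {-J..J}) = 2 * real_of_int J + 1" using assms(2) by simp
  have "real (card E) * g^2 = (\<Sum>d\<in>E. g^2)" by simp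
  also have "\<dots> \<le> (\<Sum>d\<in>E. (\<Sum>j\<in>{-J..J}. r (d + Q * j))^2)"
    using g by (intro sum_mono power_mono) auto
  \<comment> \<open>Cauchy-Schwarz over the \<open>2 J + 1\<close> shifts. Because of it the lower
    bound \<open>g\<close>, and with it the totient ratio, enters squared.\<close>
  also have "\<dots> \<le> (\<Sum>d\<in>E. (\<Sum>j\<in>{-J..J}. (r (d + Q * j))^2) * real (card {-J..J}))"
    by (intro sum_mono sum_squared_le_sum_of_squares)
  also have "\<dots> = (2 * real_of_int J + 1) * (\<Sum>j\<in>{-J..J}. \<Sum>d\<in>E. (r (d + Q * j))^2)"
    unfolding cJ by (subst sum.swap) (simp add: sum_distrib_left mult.commute)
  also have "\<dots> \<le> (2 * real_of_int J + 1) * (\<Sum>j\<in>{-J..J}. V)"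
    using V assms(2) by (intro mult_left_mono sum_mono) auto
  also have "\<dots> = (2 * real_of_int J + 1)^2 * V" using cJ by (simp add: power2_eq_square)
  finally show ?thesis .
qed

text \<open>Around an unrepresented \<open>d\<close> the numbers \<open>d + Q j\<close>, with
  \<open>Q = K!\<close> and \<open>|Q j| <= \<eta> P^2\<close>, carry at least \<open>g\<close>
  representations in total, while the second moment says that these are few on average. Together
  this gives \<open>|E| <= C6 P^2 / (K \<phi>^2)\<close>. Since \<open>P^2\<close> is comparable to
  \<open>N\<close>, and \<open>K \<phi>^2\<close> grows at least like a multiple of
  \<open>K^(1/3)\<close>, a large \<open>K\<close> makes this a small part of
  \<open>N\<close>.\<close>

theorem almost_all_represented:
  fixes q :: "'n::finite \<Rightarrow> 'n \<Rightarrow> int" and \<Delta> :: int and s m0 :: nat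
  assumes n: "CARD('n) \<ge> 3" and inv: "\<And>x i. \<Delta> * x i = (\<Sum>j\<in>UNIV. Rm i j * wv q x j)" and \<Delta>: "\<Delta> \<noteq> 0"
    and s: "s > 0" "s dvd (48 * nat \<bar>\<Delta>\<bar>)^k0" and m0: "m0 > 0" "coprime m0 (48 * nat \<bar>\<Delta>\<bar>)"
    and x0: "qf q x0 = int (s * m0)"
  shows "zero_density {m. [m = m0] (mod 48 * nat \<bar>\<Delta>\<bar>) \<and> int (s * m) \<notin> range (qf q)}"
  unfolding zero_density_def
proof (intro allI impI)
  fix \<epsilon> :: real assume \<epsilon>: "\<epsilon> > 0"
  define M where "M = 48 * nat \<bar>\<Delta>\<bar>"
  have M0: "M > 0" using \<Delta> by (simp add: M_def)
  have Mint: "int M = 8 * (6 * \<bar>\<Delta>\<bar>)" by (simp add: M_def)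
  have d6: "6 * \<Delta> dvd int M" unfolding Mint by (rule dvd_mult) simp
  define nn where "nn = CARD('n)"
  have inj: "inj (wv q)"
  proof (rule injI, rule ext)
    fix u v i assume "wv q u = wv q v"
    then have "\<Delta> * u i = \<Delta> * v i" by (simp add: inv)
    then show "u i = v i" using \<Delta> by simp
  qed
  obtain C :: real where C: "C > 0" and sm: "\<And>K. K \<ge> 1 \<Longrightarrow> \<exists>\<eta>>0. \<exists>P0\<ge>1. \<forall>P\<ge>P0. \<forall>h E. fact K dvd h \<longrightarrow> \<bar>real_of_int h\<bar> \<le> \<eta> * (real_of_int P)^2 \<longrightarrow>
     finite E \<longrightarrow> (\<forall>x\<in>ibox P. qf q x \<notin> E) \<longrightarrow>
     (\<Sum>d\<in>E. (real (card {x\<in>ibox P. qf q x = d + h}))^2) \<le> C / real K * (real_of_int P)^(2 * CARD('n) - 2)"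
    by (rule second_moment_bound[OF n inj]) blast
  define X where "X = 1 + (\<Sum>i\<in>UNIV. \<bar>real_of_int (x0 i)\<bar>)"
  have X: "X \<ge> 1" "\<And>i. \<bar>real_of_int (x0 i)\<bar> \<le> X"
  proof -
    show "X \<ge> 1" by (simp add: X_def sum_nonneg)
    have "\<bar>real_of_int (x0 i)\<bar> \<le> (\<Sum>i\<in>UNIV. \<bar>real_of_int (x0 i)\<bar>)" for i by (rule member_le_sum) auto
    then show "\<bar>real_of_int (x0 i)\<bar> \<le> X" for i unfolding X_def by (meson add_increasing zero_le_one)
  qed
  \<comment> \<open>Integers below \<open>\<kappa> N\<close> are given up at a cost of
    \<open>\<epsilon> N / 2\<close>. For the others \<open>t = sqrt (m / m0)\<close> is at least
    \<open>c3 P\<close>, as \<open>card_near_representations_ge\<close> requires.\<close>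
  define \<kappa> where "\<kappa> = \<epsilon> / 2"
  define c3 where "c3 = sqrt (\<kappa> / m0) / (5 * X)"
  have \<kappa>: "\<kappa> > 0" using \<epsilon> by (simp add: \<kappa>_def)
  have c3: "c3 > 0" using \<kappa> m0 X by (simp add: c3_def)
  have a: "qf q x0 > 0" using x0 s m0 by simp
  show "\<exists>N0. \<forall>N\<ge>N0. real (card ({m. [m = m0] (mod 48 * nat \<bar>\<Delta>\<bar>) \<and> int (s * m) \<notin> range (qf q)} \<inter> {1..N})) \<le> \<epsilon> * real N"
  proof (rule card_near_representations_ge[OF a X c3], goal_cases)
    case (1 c2 A4)
    note c2 = 1(1) and A4 = 1(2) and near = 1(3)
    define L where "L = real (s * M)"
    have L: "L > 0" using s M0 by (simp add: L_def)
    \<comment> \<open>The constants collect everything except \<open>K\<close> and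
      \<open>\<phi>\<close>; 81 comes from the squares of the 3 in
      \<open>2 J + 1 <= 3 \<eta> P^2 / Q\<close> and of the 3 in the denominator of
      \<open>g\<close>. Neither \<open>\<eta>\<close> nor \<open>Q\<close> occurs: both cancel,
      which is essential as they depend on \<open>K\<close>.\<close>
    define C6 where "C6 = 81 * C * A4^2 * L^(2 * nn) / c2^(2 * nn)"
    define C7 where "C7 = 25 * X^2 * C6"
    have C7: "C7 > 0" using C A4 L c2 X by (simp add: C7_def C6_def)
    \<comment> \<open>\<open>K >= s M\<close> makes \<open>s M\<close> divide \<open>K!\<close>. By
      the second bound the cube of \<open>C7 / (K \<phi>^2)\<close>, which is at most
      \<open>16 C7^3 / K\<close>, does not exceed \<open>(\<epsilon> / 2)^3\<close>.\<close>
    define K where "K = max (s * M) (nat \<lceil>16 * (2 * C7 / \<epsilon>)^3\<rceil>)"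
    have K1: "K \<ge> 1" using s M0 by (simp add: K_def le_max_iff_disj Suc_leI)
    have Kb: "16 * (2 * C7 / \<epsilon>)^3 \<le> real K" unfolding K_def by linarith
    define Q :: nat where "Q = fact K"
    have Q0: "Q > 0" by (simp add: Q_def)
    obtain Q1 Q2 k where Q12: "Q = Q1 * Q2" "coprime Q2 M" "Q1 dvd M^k" using smooth_decomposition[OF Q0, of M] by blast
    have Q1p: "Q1 > 0" "Q2 > 0" using Q0 Q12(1) by auto
    have "Q1 dvd M^(Suc k)" using Q12(3) dvd_trans[OF _ le_imp_power_dvd[of k "Suc k" M]] by simp
    have Mdvd: "int M dvd (6 * \<Delta>)^4"
    proof -
      have "(6 * \<Delta>)^4 = 8 * (6 * \<Delta>) * (27 * \<Delta>^3)" by (simp add: power4_eq_xxxx power3_eq_cube)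
      moreover have "int M dvd 8 * (6 * \<Delta>)" unfolding Mint by simp
      ultimately show ?thesis by (simp only: dvd_mult2)
    qed
    have Q1d: "int Q1 dvd (6 * \<Delta>)^(4 * Suc k)"
    proof -
      have "int Q1 dvd int (M^Suc k)" using \<open>Q1 dvd M^(Suc k)\<close> by (simp only: of_nat_dvd_iff)
      also have "int (M^Suc k) = (int M)^Suc k" by simp
      also have "\<dots> dvd ((6 * \<Delta>)^4)^Suc k" by (rule dvd_power_same[OF Mdvd])
      finally show ?thesis by (simp only: power_mult)
    qed
    have cQ2: "coprime (int Q2) (6 * \<Delta>)"
    proof -
      have "coprime (int Q2) (int M)" using Q12(2) by simp
      then show ?thesis using coprime_divisors[OF dvd_refl d6] by blast
    qed
    have cQ12: "coprime (int Q1) (int Q2)"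
    proof -
      have "coprime (M^k) Q2" using Q12(2) by (simp add: coprime_commute)
      then have "coprime Q1 Q2" using Q12(3) coprime_divisors[of Q1 "M^k" Q2 Q2] by simp
      then show ?thesis by simp
    qed
    have sMQ1: "int s * (8 * (6 * \<bar>\<Delta>\<bar>)) dvd int Q1"
    proof -
      have "s * M dvd Q" unfolding Q_def by (rule dvd_fact) (use s M0 in \<open>auto simp: K_def\<close>)
      moreover have "coprime (s * M) Q2"
      proof -
        have "coprime (M^k0) Q2" using Q12(2) by (simp add: coprime_commute)
        then have "coprime s Q2" using s(2) coprime_divisors[of s "M^k0" Q2 Q2] by (simp add: M_def)
        then show ?thesis using Q12(2) by (simp add: coprime_commute)
      qed
      ultimately have "s * M dvd Q1" unfolding Q12(1) by (simp add: coprime_dvd_mult_left_iff)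
      then have "int (s * M) dvd int Q1" by (simp only: of_nat_dvd_iff)
      then show ?thesis by (simp add: Mint)
    qed
    define \<phi> where "\<phi> = real (totient Q2) / real Q2"
    have \<phi>: "\<phi> > 0" using Q1p by (simp add: \<phi>_def)
    have \<phi>3: "\<phi>^3 \<ge> 1 / (4 * real K)" unfolding \<phi>_def
    proof (rule totient_ratio_cube_ge[OF Q1p(2) _ _ K1])
      have "6 dvd M" by (auto simp: M_def)
      then show "coprime Q2 6" using Q12(2) coprime_divisors[of Q2 Q2 6 M] by simp
      fix p assume "prime p" "p dvd Q2"
      then have "p dvd fact K" using Q12(1) by (metis Q_def dvd_mult)
      then show "p \<le> K" using \<open>prime p\<close> prime_dvd_fact_iff by blast
    qed
    have small: "C7 / (K * \<phi>^2) \<le> \<epsilon> / 2"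
    proof -
      have Kr: "real K > 0" using K1 by simp
      have "(C7 / (K * \<phi>^2))^3 = C7^3 / (real K^3 * (\<phi>^3)^2)" by (simp add: power_divide power_mult_distrib power_mult[symmetric])
      also have "\<dots> \<le> C7^3 / (real K^3 * (1 / (4 * real K))^2)"
        using \<phi>3 Kr C7 by (intro divide_left_mono mult_left_mono power_mono mult_pos_pos) (auto simp: \<phi>)
      also have "\<dots> = 16 * C7^3 / real K" using Kr by (simp add: power2_eq_square power3_eq_cube field_simps)
      also have "\<dots> \<le> (\<epsilon> / 2)^3"
      proof -
        have "16 * (2 * C7 / \<epsilon>)^3 = 16 * C7^3 / (\<epsilon> / 2)^3" by (simp add: power_divide power_mult_distrib)
        then have "16 * C7^3 / (\<epsilon> / 2)^3 \<le> real K" using Kb by simp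
        then show ?thesis using Kr \<epsilon> by (simp add: pos_divide_le_eq mult.commute)
      qed
      finally show ?thesis using \<epsilon> power_le_imp_le_base[of "C7 / (K * \<phi>^2)" 2 "\<epsilon> / 2"] by (simp add: numeral_3_eq_3)
    qed
    define Bounded where "Bounded \<eta> P0 \<longleftrightarrow> (\<forall>P\<ge>P0. \<forall>h E. fact K dvd h \<longrightarrow> \<bar>real_of_int h\<bar> \<le> \<eta> * (real_of_int P)^2 \<longrightarrow>
     finite E \<longrightarrow> (\<forall>x\<in>ibox P. qf q x \<notin> E) \<longrightarrow>
     (\<Sum>d\<in>E. (real (card {x\<in>ibox P. qf q x = d + h}))^2) \<le> C / real K * (real_of_int P)^(2 * CARD('n) - 2))" for \<eta> :: real and P0 :: int
    have "\<exists>\<eta>>0. \<exists>P0\<ge>1. Bounded \<eta> P0" unfolding Bounded_def by (rule sm[OF K1])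
    then obtain \<eta>0 P0 where \<eta>0: "\<eta>0 > 0" and P0: "P0 \<ge> 1" and "Bounded \<eta>0 P0"
      by blast
    note sm' = \<open>Bounded \<eta>0 P0\<close>[unfolded Bounded_def, rule_format]
    define \<eta> where "\<eta> = min \<eta>0 (A4 / (8 * X))"
    have \<eta>: "\<eta> > 0" "\<eta> \<le> \<eta>0" "\<eta> \<le> A4 / (8 * X)" using \<eta>0 A4 X by (auto simp: \<eta>_def)
    define Bd where "Bd = max (real_of_int P0) (max (Q / c2) (max (Q * A4 / \<eta>) (Q / \<eta>)))"
    define N0 where "N0 = max 1 (nat \<lceil>Bd^2\<rceil>)"
    have main: "real (card ({m. [m = m0] (mod M) \<and> int (s * m) \<notin> range (qf q)} \<inter> {1..N})) \<le> \<epsilon> * real N" if N: "N \<ge> N0" for N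
    proof -
      have N1: "real N \<ge> 1" using N by (simp add: N0_def)
      have "Bd^2 \<le> real N" using N unfolding N0_def by linarith
      then have sB: "Bd \<le> sqrt N" using real_le_rsqrt by blast
      \<comment> \<open>With this side the entries of \<open>t x0\<close>, for
        \<open>t <= sqrt N\<close>, are at most \<open>P / 4\<close>, which leaves room for the
        search around \<open>t x0\<close> and for the moves along \<open>x0\<close>.\<close>
      define P where "P = \<lceil>4 * X * sqrt N\<rceil>"
      define p where "p = real_of_int P"
      have sN: "sqrt N \<ge> 1" using N1 by simp
      have XsN: "X * sqrt N \<ge> sqrt N" "X * sqrt N \<ge> 1" using X(1) sN mult_mono[of 1 X 1 "sqrt N"] mult_right_mono[of 1 X "sqrt N"] by auto
      have Pl: "4 * X * sqrt N \<le> p" "p \<le> 5 * X * sqrt N"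
      proof -
        show "4 * X * sqrt N \<le> p" unfolding p_def P_def by linarith
        have "p \<le> 4 * X * sqrt N + 1" unfolding p_def P_def by linarith
        then show "p \<le> 5 * X * sqrt N" using XsN by linarith
      qed
      have pB: "Bd \<le> p" using sB Pl XsN sN by linarith
      have p1: "p \<ge> 1" using Pl XsN by linarith
      have PP0: "P \<ge> P0" using pB unfolding Bd_def p_def by linarith
      have QP: "real Q \<le> c2 * p" "real Q \<le> \<eta> / A4 * p" "real Q \<le> \<eta> * p^2"
      proof -
        have "Q / c2 \<le> p" "Q * A4 / \<eta> \<le> p" "Q / \<eta> \<le> p" using pB unfolding Bd_def by linarith+
        then show "real Q \<le> c2 * p" "real Q \<le> \<eta> / A4 * p" using c2 A4 \<eta>(1) by (simp_all add: field_simps)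
        have "real Q \<le> \<eta> * p" using \<open>Q / \<eta> \<le> p\<close> \<eta>(1) by (simp add: field_simps)
        also have "\<dots> \<le> \<eta> * p^2" using \<eta>(1) p1 by (simp add: power2_eq_square)
        finally show "real Q \<le> \<eta> * p^2" .
      qed
      define S where "S = {m. [m = m0] (mod M) \<and> int (s * m) \<notin> range (qf q)} \<inter> {1..N}"
      define S1 where "S1 = {m\<in>S. real m < \<kappa> * N}"
      define S2 where "S2 = {m\<in>S. \<kappa> * N \<le> real m}"
      have finS: "finite S" by (simp add: S_def)
      have cS: "card S \<le> card S1 + card S2"
      proof -
        have "S = S1 \<union> S2" by (auto simp: S1_def S2_def)
        then show ?thesis using card_Un_le by metis
      qed
      have cS1: "real (card S1) \<le> \<kappa> * N"
      proof -
        have "S1 \<subseteq> {1..nat \<lfloor>\<kappa> * N\<rfloor>}" by (auto simp: S1_def S_def) (simp add: le_nat_floor less_imp_le)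
        then have "card S1 \<le> card {1..nat \<lfloor>\<kappa> * N\<rfloor>}" by (rule card_mono[rotated]) simp
        then have "card S1 \<le> nat \<lfloor>\<kappa> * N\<rfloor>" by simp
        moreover have "0 \<le> \<kappa> * N" using \<kappa> by simp
        ultimately show ?thesis by linarith
      qed
      define E where "E = (\<lambda>m. int (s * m)) ` S2"
      have finE: "finite E" using finS by (simp add: E_def S2_def)
      have cE: "card E = card S2" unfolding E_def by (rule card_image) (use s in \<open>auto simp: inj_on_def\<close>)
      have EX: "\<forall>x\<in>ibox P. qf q x \<notin> E" by (auto simp: E_def S2_def S_def) (metis rangeI)
      define J where "J = \<lfloor>\<eta> * p^2 / Q\<rfloor>"
      have J0: "J \<ge> 0" using \<eta>(1) by (simp add: J_def)
      have QJ: "real_of_int J * Q \<le> \<eta> * p^2"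
      proof -
        have "real_of_int J \<le> \<eta> * p^2 / Q" by (simp add: J_def)
        then show ?thesis using Q0 by (simp add: pos_le_divide_eq)
      qed
      define r where "r = (\<lambda>d. real (card {x\<in>ibox P. qf q x = d}))"
      \<comment> \<open>At least \<open>Q^(n - 1) \<phi> / L^n\<close> solutions modulo
        \<open>Q\<close>, times the number of points of the cube that
        \<open>card_near_representations_ge\<close> guarantees for each of them.\<close>
      define g where "g = c2^nn * \<phi> * \<eta> / (3 * A4 * L^nn) * (p^nn / Q)"
      have g0: "g > 0" using c2 \<phi> \<eta> A4 L p1 Q0 by (simp add: g_def)
      have gle: "g \<le> (\<Sum>j\<in>{-J..J}. r (d + int Q * j))" if d: "d \<in> E" for d
      proof -
        obtain m where m: "m \<in> S2" "d = int s * int m" using d by (auto simp: E_def)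
        have m': "[m = m0] (mod M)" "m \<ge> 1" "m \<le> N" "\<kappa> * N \<le> real m" using m by (auto simp: S2_def S_def)
        define t where "t = sqrt (real m / real m0)"
        have t2: "real_of_int d = t^2 * qf q x0" using m0 by (simp add: t_def x0 m)
        have t4: "4 * X * t \<le> p"
        proof -
          have "real m / real m0 \<le> real N" using m' m0 by (simp add: pos_divide_le_eq) (metis mult_le_mono mult.right_neutral of_nat_le_iff of_nat_mult Suc_leI One_nat_def)
          then have "t \<le> sqrt N" by (simp add: t_def)
          then have "4 * X * t \<le> 4 * X * sqrt N" using X by (intro mult_left_mono) auto
          then show ?thesis using Pl by linarith
        qed
        have t3: "c3 * p \<le> t"
        proof -
          have "c3 * p \<le> c3 * (5 * X * sqrt N)" using Pl(2) c3 by (intro mult_left_mono) auto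
          also have "\<dots> = sqrt (\<kappa> / m0) * sqrt N" using X by (simp add: c3_def)
          also have "\<dots> = sqrt (\<kappa> * N / m0)" by (simp add: real_sqrt_mult[symmetric] mult.commute)
          also have "\<dots> \<le> t" unfolding t_def using m' m0 by (intro real_sqrt_le_mono divide_right_mono) auto
          finally show ?thesis .
        qed
        have cm: "coprime m M" using m'(1) m0(2) cong_imp_coprime[OF cong_sym[OF m'(1)]] by (simp add: M_def)
        have cm6: "coprime (int m') (6 * \<Delta>)" if "coprime m' M" for m'
        proof -
          have "coprime (int m') (int M)" using that by simp
          then show ?thesis using coprime_divisors[OF dvd_refl d6] by blast
        qed
        have mm: "8 * (6 * \<Delta>) dvd int m - int m0"
        proof -
          have "[int m = int m0] (mod int M)" using m'(1) by (simp only: cong_int_iff)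
          then have "int M dvd int m - int m0" by (simp add: cong_iff_dvd_diff)
          moreover have "8 * (6 * \<Delta>) dvd int M" unfolding Mint by (intro mult_dvd_mono) simp_all
          ultimately show ?thesis by (rule dvd_trans[rotated])
        qed
        have s0: "int s > 0" using s by simp
        have x0': "qf q x0 = int s * int m0" using x0 by simp
        have Q1i: "int Q1 > 0" using Q1p by simp
        have QQ: "int Q1 * int Q2 = int Q" by (simp add: Q12(1))
        have nu: "real Q^(nn - 1) * \<phi> / L^nn \<le> real (card {x \<in> residues_box (int Q). int Q dvd qf q x - d})"
          using card_residue_solutions_ge[OF n inv \<Delta> Q1i Q1p(2) cQ12 cQ2 Q1d _ s0 sMQ1 cm6[OF cm] cm6[OF m0(2)[folded M_def]] mm x0']
          unfolding QQ by (simp add: nn_def \<phi>_def L_def Mint[symmetric] m(2)) (simp add: M_def mult_ac)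
        define G where "G = {x\<in>ibox P. int Q dvd qf q x - d \<and> \<bar>real_of_int (qf q x - d)\<bar> \<le> \<eta> * (real_of_int P)^2}"
        have "real (card {x\<in>residues_box (int Q). int Q dvd qf q x - d}) * (c2 * P / int Q)^CARD('n) * (\<eta> / A4) / 3 \<le> real (card G)"
          unfolding G_def by (rule near) (use Q0 \<eta> t3 t4 t2 QP p1 in \<open>auto simp: p_def\<close>)
        then have nr: "real (card {x\<in>residues_box (int Q). int Q dvd qf q x - d}) * ((c2 * p / Q)^nn * (\<eta> / A4) / 3) \<le> real (card G)"
          by (simp add: p_def nn_def)
        have "g = real Q^(nn - 1) * \<phi> / L^nn * ((c2 * p / Q)^nn * (\<eta> / A4) / 3)"
        proof -
          have "real Q^nn = real Q^(nn - 1) * Q" using n by (simp add: nn_def power_eq_if)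
          then show ?thesis using Q0 by (simp add: g_def power_divide power_mult_distrib field_simps)
        qed
        also have "\<dots> \<le> real (card {x\<in>residues_box (int Q). int Q dvd qf q x - d}) * ((c2 * p / Q)^nn * (\<eta> / A4) / 3)"
          using nu c2 p1 \<eta> A4 by (intro mult_right_mono) auto
        also have "\<dots> \<le> real (card G)" by (rule nr)
        also have "\<dots> \<le> (\<Sum>j\<in>{-J..J}. r (d + int Q * j))"
        proof -
          have "G \<subseteq> (\<Union>j\<in>{-J..J}. {x\<in>ibox P. qf q x = d + int Q * j})"
          proof
            fix x assume x: "x \<in> G"
            then obtain j where j: "qf q x - d = int Q * j" by (auto simp: G_def)
            have "\<bar>real_of_int (qf q x - d)\<bar> \<le> \<eta> * p^2" using x by (simp add: G_def p_def)
            then have "Q * \<bar>real_of_int j\<bar> \<le> \<eta> * p^2" unfolding j by (simp add: abs_mult)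
            then have "\<bar>real_of_int j\<bar> \<le> \<eta> * p^2 / Q" using Q0 by (simp add: pos_le_divide_eq mult.commute)
            then have "\<bar>j\<bar> \<le> J" unfolding J_def by linarith
            then have "j \<in> {-J..J}" by auto
            moreover have "qf q x = d + int Q * j" using j by simp
            ultimately show "x \<in> (\<Union>j\<in>{-J..J}. {x\<in>ibox P. qf q x = d + int Q * j})" using x by (auto simp: G_def)
          qed
          then have "card G \<le> card (\<Union>j\<in>{-J..J}. {x\<in>ibox P. qf q x = d + int Q * j})" by (rule card_mono[rotated]) auto
          also have "\<dots> \<le> (\<Sum>j\<in>{-J..J}. card {x\<in>ibox P. qf q x = d + int Q * j})" by (rule card_UN_le) auto
          finally have "real (card G) \<le> real (\<Sum>j\<in>{-J..J}. card {x\<in>ibox P. qf q x = d + int Q * j})" by (simp only: of_nat_le_iff)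
          then show ?thesis by (simp add: r_def)
        qed
        finally show ?thesis .
      qed
      have V: "(\<Sum>d\<in>E. (r (d + int Q * j))^2) \<le> C / real K * p^(2 * nn - 2)" if j: "j \<in> {-J..J}" for j
      proof -
        have "fact K dvd int Q * j" by (simp add: Q_def)
        moreover have "\<bar>real_of_int (int Q * j)\<bar> \<le> \<eta>0 * (real_of_int P)^2"
        proof -
          have "\<bar>real_of_int j\<bar> \<le> J" using j by auto
          then have "Q * \<bar>real_of_int j\<bar> \<le> Q * real_of_int J" by (intro mult_left_mono) auto
          also have "\<dots> \<le> \<eta> * p^2" using QJ by (simp add: mult.commute)
          also have "\<dots> \<le> \<eta>0 * p^2" using \<eta> by (intro mult_right_mono) auto
          finally show ?thesis by (simp add: abs_mult p_def)
        qed
        ultimately show ?thesis using sm'[OF PP0 _ _ finE] EX unfolding r_def p_def nn_def by blast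
      qed
      have "real (card E) * g^2 \<le> (2 * real_of_int J + 1)^2 * (C / real K * p^(2 * nn - 2))"
        by (rule exceptional_bound_combine[OF finE J0 _ gle V]) (use g0 in auto)
      also have "\<dots> \<le> (3 * (\<eta> * p^2 / Q))^2 * (C / real K * p^(2 * nn - 2))"
      proof (intro mult_right_mono power_mono)
        have "1 \<le> \<eta> * p^2 / Q" using QP(3) Q0 by simp
        moreover have "real_of_int J \<le> \<eta> * p^2 / Q" by (simp add: J_def)
        ultimately show "2 * real_of_int J + 1 \<le> 3 * (\<eta> * p^2 / Q)" by linarith
      qed (use J0 C p1 in auto)
      finally have "real (card E) \<le> (3 * (\<eta> * p^2 / Q))^2 * (C / real K * p^(2 * nn - 2)) / g^2"
        by (simp only: pos_le_divide_eq[OF zero_less_power[OF g0]])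
      also have "\<dots> = C6 / (K * \<phi>^2) * p^2"
      proof -
        have pw: "p^4 * p^(2 * nn - 2) = p^2 * (p^nn)^2"
        proof -
          have "4 + (2 * nn - 2) = 2 + nn * 2" using n unfolding nn_def by linarith
          then show ?thesis by (simp only: power_add[symmetric] power_mult[symmetric])
        qed
        have g2: "g^2 = c2^(2 * nn) * \<phi>^2 * \<eta>^2 / (9 * A4^2 * L^(2 * nn)) * ((p^nn)^2 / Q^2)"
          by (simp add: g_def power_mult_distrib power_divide power_mult[symmetric] mult.commute)
        have "(3 * (\<eta> * p^2 / Q))^2 * (C / real K * p^(2 * nn - 2)) = 9 * \<eta>^2 / Q^2 * (C / K) * (p^4 * p^(2 * nn - 2))"
          by (simp add: power_mult_distrib power_divide power_mult[symmetric])
        also have "\<dots> = 9 * \<eta>^2 / Q^2 * (C / K) * (p^2 * (p^nn)^2)" unfolding pw ..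
        finally show ?thesis unfolding g2 using Q0 K1 \<phi> \<eta>(1) A4 L c2 p1 C
          by (simp add: C6_def field_simps)
      qed
      also have "\<dots> \<le> C6 / (K * \<phi>^2) * (25 * X^2 * N)"
      proof (rule mult_left_mono)
        have "p^2 \<le> (5 * X * sqrt N)^2" using Pl p1 by (intro power_mono) auto
        then show "p^2 \<le> 25 * X^2 * N" by (simp add: power_mult_distrib)
        show "0 \<le> C6 / (K * \<phi>^2)" using C A4 L c2 by (simp add: C6_def)
      qed
      also have "\<dots> = C7 / (K * \<phi>^2) * N" by (simp add: C7_def)
      also have "\<dots> \<le> \<epsilon> / 2 * N" using small by (intro mult_right_mono) auto
      finally have "real (card S2) \<le> \<epsilon> / 2 * N" using cE by simp
      moreover have "real (card S) \<le> real (card S1) + real (card S2)" using cS by linarith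
      ultimately have "real (card S) \<le> \<epsilon> * N" using cS1 by (simp add: \<kappa>_def)
      then show ?thesis by (simp add: S_def)
    qed
    then show ?case unfolding M_def by blast
  qed
qed

section \<open>Binary forms\<close>

definition exactly_divides :: "nat \<Rightarrow> nat \<Rightarrow> bool" where
  "exactly_divides p m \<longleftrightarrow> p dvd m \<and> \<not> p^2 dvd m"

definition divergent_reciprocals :: "nat set \<Rightarrow> bool" where
  "divergent_reciprocals P \<longleftrightarrow> (\<forall>C. \<exists>F\<subseteq>P. finite F \<and> (\<Sum>p\<in>F. 1 / real p) \<ge> C)"

lemma sum_dvd_indicator:
  assumes "a > 0"
  shows "\<bar>(\<Sum>m=1..N. of_bool (a dvd m)) - real N / real a\<bar> \<le> 1"
proof -
  have "(\<Sum>m=1..N. of_bool (a dvd m) :: real) = real (card {m\<in>{1..N}. [m = 0] (mod a)})"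
    by (simp add: cong_0_iff sum.If_cases of_bool_def Int_def)
  then show ?thesis using card_residue_class[OF assms, of N 0] by simp
qed

lemma sum_exactly_divides:
  assumes p: "prime p"
  shows "\<bar>(\<Sum>m=1..N. of_bool (exactly_divides p m)) - real N * (1 / real p - 1 / real p^2)\<bar> \<le> 2"
proof -
  have eq: "of_bool (exactly_divides p m) = (of_bool (p dvd m) - of_bool (p^2 dvd m) :: real)" for m
    by (auto simp: exactly_divides_def power2_eq_square dest: dvd_mult_left)
  have "(\<Sum>m=1..N. of_bool (exactly_divides p m)) - real N * (1 / real p - 1 / real p^2) =
     ((\<Sum>m=1..N. of_bool (p dvd m)) - real N / real p) - ((\<Sum>m=1..N. of_bool (p^2 dvd m)) - real N / real (p^2))"
    unfolding eq by (simp add: sum_subtractf algebra_simps)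
  then show ?thesis using sum_dvd_indicator[of p N] sum_dvd_indicator[of "p^2" N] prime_gt_0_nat[OF p] by simp
qed

text \<open>Exact divisibility is a difference of two divisibility indicators, and a product of
  indicators for powers of different primes is again one; each of the four terms has error at most
  1.\<close>

lemma sum_exactly_divides_pair:
  assumes p: "prime p" and q: "prime q" and ne: "p \<noteq> q"
  shows "\<bar>(\<Sum>m=1..N. of_bool (exactly_divides p m) * of_bool (exactly_divides q m))
     - real N * ((1 / real p - 1 / real p^2) * (1 / real q - 1 / real q^2))\<bar> \<le> 4"
proof -
  have eq: "of_bool (exactly_divides r m) = (of_bool (r dvd m) - of_bool (r^2 dvd m) :: real)" for r m
    by (auto simp: exactly_divides_def power2_eq_square dest: dvd_mult_left)
  have cop: "coprime (p^i) (q^j)" for i j using primes_coprime[OF p q ne] by simp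
  have pr: "of_bool (p^i dvd m) * of_bool (q^j dvd m) = (of_bool (p^i * q^j dvd m) :: real)" for i j m
    using divides_mult[OF _ _ cop[of i j], of m] dvd_mult_left dvd_mult_right by (auto simp: of_bool_def)
  define S where "S i j = (\<Sum>m=1..N. of_bool (p^i * q^j dvd m) :: real) - real N / real (p^i * q^j)" for i j
  have S: "\<bar>S i j\<bar> \<le> 1" for i j unfolding S_def
    by (rule sum_dvd_indicator) (use p q in \<open>simp add: prime_gt_0_nat\<close>)
  have pe: "of_bool (exactly_divides p m) * of_bool (exactly_divides q m) = 
     (of_bool (p^1 * q^1 dvd m) - of_bool (p^1 * q^2 dvd m) - of_bool (p^2 * q^1 dvd m) + of_bool (p^2 * q^2 dvd m) :: real)" for m
    unfolding pr[symmetric] eq by (simp add: algebra_simps)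
  have "(\<Sum>m=1..N. of_bool (exactly_divides p m) * of_bool (exactly_divides q m)) =
     (\<Sum>m=1..N. of_bool (p^1 * q^1 dvd m)) - (\<Sum>m=1..N. of_bool (p^1 * q^2 dvd m)) - (\<Sum>m=1..N. of_bool (p^2 * q^1 dvd m)) + (\<Sum>m=1..N. of_bool (p^2 * q^2 dvd m) :: real)"
    by (simp only: pe sum_subtractf sum.distrib)
  then have "(\<Sum>m=1..N. of_bool (exactly_divides p m) * of_bool (exactly_divides q m))
     - real N * ((1 / real p - 1 / real p^2) * (1 / real q - 1 / real q^2)) = S 1 1 - S 1 2 - S 2 1 + S 2 2"
    unfolding S_def by (simp only:) (simp add: algebra_simps)
  then show ?thesis using S[of 1 1] S[of 1 2] S[of 2 1] S[of 2 2] by linarith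
qed

text \<open>Turan's variance argument.\<close>
lemma few_exact_divisors_zero_density:
  assumes P: "\<And>p. p \<in> P \<Longrightarrow> prime p" and div: "divergent_reciprocals P"
  shows "zero_density {m. card {p\<in>P. exactly_divides p m} < k}"
  unfolding zero_density_def
proof (intro allI impI)
  fix \<epsilon> :: real assume \<epsilon>: "\<epsilon> > 0"
  \<comment> \<open>The mean number \<open>L\<close> of exact divisors from \<open>F\<close> is at
    least \<open>C / 2\<close>, as \<open>1 / p - 1 / p^2 >= 1 / (2 p)\<close>. Then
    \<open>L >= 2 k\<close> forces a deviation of at least \<open>L / 2\<close> on the bad set, and
    \<open>L >= 8 / \<epsilon>\<close> makes the Chebyshev bound \<open>4 / L\<close> at most
    \<open>\<epsilon> / 2\<close>.\<close>
  define C where "C = max (4 * real k + 1) (2 * (8 / \<epsilon>) + 1)"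
  obtain F where F: "F \<subseteq> P" "finite F" "(\<Sum>p\<in>F. 1 / real p) \<ge> C" using div unfolding divergent_reciprocals_def by blast
  define lam where "lam p = 1 / real p - 1 / real p^2" for p
  define L where "L = (\<Sum>p\<in>F. lam p)"
  define n where "n = real (card F)"
  have Fp: "prime p" if "p \<in> F" for p using that F P by blast
  have lam2: "lam p \<ge> 1 / (2 * real p)" if "p \<in> F" for p
  proof -
    have "real p \<ge> 2" using prime_ge_2_nat[OF Fp[OF that]] by simp
    then show ?thesis by (simp add: lam_def field_simps power2_eq_square)
  qed
  have lam0: "lam p \<ge> 0" if "p \<in> F" for p using lam2[OF that] by (rule order_trans[rotated]) simp
  have "(\<Sum>p\<in>F. 1 / real p) / 2 = (\<Sum>p\<in>F. 1 / (2 * real p))" by (simp add: sum_divide_distrib mult.commute)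
  also have "\<dots> \<le> L" unfolding L_def by (rule sum_mono[OF lam2])
  finally have LC: "L \<ge> C / 2" using F(3) by linarith
  have "C \<ge> 4 * real k + 1" "C \<ge> 2 * (8 / \<epsilon>) + 1" by (simp_all add: C_def)
  then have L1: "L > 0" "L \<ge> 2 * real k" "L \<ge> 8 / \<epsilon>" using LC by linarith+
  define E where "E p m = (of_bool (exactly_divides p m) :: real)" for p m
  have EE: "E p m * E p m = E p m" for p m by (simp add: E_def)
  define K where "K = 2 * n + 4 * n^2 + 4 * n * L"
  have n0: "n \<ge> 0" by (simp add: n_def)
  have K0: "K \<ge> 0" using n0 L1 by (simp add: K_def)
  have var: "(\<Sum>m=1..N. ((\<Sum>p\<in>F. E p m) - L)^2) \<le> real N * L + K" for N
  proof -
    have "((\<Sum>p\<in>F. E p m) - L)^2 = (\<Sum>p\<in>F. \<Sum>q\<in>F. E p m * E q m) - 2 * L * (\<Sum>p\<in>F. E p m) + L^2" for m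
      by (simp add: power2_eq_square algebra_simps sum_product)
    then have "(\<Sum>m=1..N. ((\<Sum>p\<in>F. E p m) - L)^2) = (\<Sum>m=1..N. \<Sum>p\<in>F. \<Sum>q\<in>F. E p m * E q m) - (\<Sum>m=1..N. 2 * L * (\<Sum>p\<in>F. E p m)) + (\<Sum>m=1..N. L^2)"
      by (simp only: sum.distrib sum_subtractf)
    also have "(\<Sum>m=1..N. \<Sum>p\<in>F. \<Sum>q\<in>F. E p m * E q m) = (\<Sum>p\<in>F. \<Sum>m=1..N. \<Sum>q\<in>F. E p m * E q m)" by (rule sum.swap)
    also have "\<dots> = (\<Sum>p\<in>F. \<Sum>q\<in>F. \<Sum>m=1..N. E p m * E q m)" by (intro sum.cong refl sum.swap)
    also have "(\<Sum>m=1..N. 2 * L * (\<Sum>p\<in>F. E p m)) = 2 * L * (\<Sum>m=1..N. \<Sum>p\<in>F. E p m)" by (rule sum_distrib_left[symmetric])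
    also have "(\<Sum>m=1..N. \<Sum>p\<in>F. E p m) = (\<Sum>p\<in>F. \<Sum>m=1..N. E p m)" by (rule sum.swap)
    also have "(\<Sum>m=1..N. L^2) = real N * L^2" by simp
    also have "(\<Sum>p\<in>F. \<Sum>q\<in>F. \<Sum>m=1..N. E p m * E q m) \<le> (\<Sum>p\<in>F. \<Sum>q\<in>F. real N * (lam p * lam q) + 4 + (if p = q then real N * lam p + 2 else 0))"
    proof (intro sum_mono)
      fix p q assume pq: "p \<in> F" "q \<in> F"
      show "(\<Sum>m=1..N. E p m * E q m) \<le> real N * (lam p * lam q) + 4 + (if p = q then real N * lam p + 2 else 0)"
      proof (cases "p = q")
        case True
        have "(\<Sum>m=1..N. E p m) \<le> real N * lam p + 2" using sum_exactly_divides[OF Fp[OF pq(1)], of N] unfolding E_def lam_def by linarith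
        moreover have "0 \<le> real N * (lam p * lam q)" using lam0 pq by simp
        moreover have "(\<Sum>m=1..N. E p m * E q m) = (\<Sum>m=1..N. E p m)" unfolding True[symmetric] EE ..
        ultimately show ?thesis unfolding if_P[OF True] by linarith
      next
        case False
        show ?thesis using sum_exactly_divides_pair[OF Fp[OF pq(1)] Fp[OF pq(2)] False, of N]
          unfolding E_def lam_def if_not_P[OF False] by linarith
      qed
    qed
    also have "\<dots> = real N * L^2 + 4 * n^2 + (real N * L + 2 * n)"
    proof -
      have "(\<Sum>p\<in>F. \<Sum>q\<in>F. real N * (lam p * lam q)) = real N * L^2"
      proof -
        have "L^2 = (\<Sum>p\<in>F. \<Sum>q\<in>F. lam p * lam q)" by (simp only: L_def power2_eq_square sum_product)
        then show ?thesis by (simp only: sum_distrib_left)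
      qed
      moreover have "(\<Sum>p\<in>F. \<Sum>q\<in>F. (4::real)) = 4 * n^2" by (simp add: n_def power2_eq_square)
      moreover have "(\<Sum>p\<in>F. \<Sum>q\<in>F. if p = q then real N * lam p + 2 else 0) = real N * L + 2 * n"
        using F(2) by (simp add: L_def n_def sum.distrib sum_distrib_left)
      ultimately show ?thesis by (simp only: sum.distrib)
    qed
    also have "real N * L^2 + 4 * n^2 + (real N * L + 2 * n) - 2 * L * (\<Sum>p\<in>F. \<Sum>m=1..N. E p m) + real N * L^2 \<le> real N * L + K"
    proof -
      have "(\<Sum>p\<in>F. real N * lam p - 2) \<le> (\<Sum>p\<in>F. \<Sum>m=1..N. E p m)"
      proof (rule sum_mono)
        fix p assume "p \<in> F"
        then show "real N * lam p - 2 \<le> (\<Sum>m=1..N. E p m)" using sum_exactly_divides[OF Fp, of p N] unfolding E_def lam_def by linarith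
      qed
      then have "real N * L - 2 * n \<le> (\<Sum>p\<in>F. \<Sum>m=1..N. E p m)" by (simp add: L_def n_def sum_subtractf sum_distrib_left)
      then have "2 * L * (real N * L - 2 * n) \<le> 2 * L * (\<Sum>p\<in>F. \<Sum>m=1..N. E p m)" using L1 by (intro mult_left_mono) auto
      then show ?thesis by (simp add: K_def power2_eq_square algebra_simps)
    qed
    finally show ?thesis by simp
  qed
  define N0 where "N0 = nat \<lceil>8 * K / (L^2 * \<epsilon>)\<rceil>"
  have "real (card ({m. card {p\<in>P. exactly_divides p m} < k} \<inter> {1..N})) \<le> \<epsilon> * real N" if N: "N \<ge> N0" for N
  proof -
    define B where "B = {m. card {p\<in>P. exactly_divides p m} < k} \<inter> {1..N}"
    have big: "(L / 2)^2 \<le> ((\<Sum>p\<in>F. E p m) - L)^2" if m: "m \<in> B" for m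
    proof -
      have m0: "m > 0" using m by (auto simp: B_def)
      have "(\<Sum>p\<in>F. E p m) = real (card {p\<in>F. exactly_divides p m})"
        using F(2) by (simp add: E_def sum.If_cases of_bool_def Int_def)
      also have "card {p\<in>F. exactly_divides p m} \<le> card {p\<in>P. exactly_divides p m}"
      proof (rule card_mono)
        have "{p\<in>P. exactly_divides p m} \<subseteq> {..m}" using m0 by (auto simp: exactly_divides_def dvd_imp_le)
        then show "finite {p\<in>P. exactly_divides p m}" by (rule finite_subset) simp
      qed (use F(1) in auto)
      finally have "(\<Sum>p\<in>F. E p m) \<le> real k" using m by (auto simp: B_def)
      then have "L / 2 \<le> L - (\<Sum>p\<in>F. E p m)" using L1 by linarith
      then have "(L / 2)^2 \<le> (L - (\<Sum>p\<in>F. E p m))^2" using L1 by (intro power_mono) auto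
      then show ?thesis by (simp add: power2_commute)
    qed
    have "real (card B) * (L / 2)^2 = (\<Sum>m\<in>B. (L / 2)^2)" by simp
    also have "\<dots> \<le> (\<Sum>m\<in>B. ((\<Sum>p\<in>F. E p m) - L)^2)" by (rule sum_mono[OF big])
    also have "\<dots> \<le> (\<Sum>m=1..N. ((\<Sum>p\<in>F. E p m) - L)^2)" by (rule sum_mono2) (auto simp: B_def)
    also have "\<dots> \<le> real N * L + K" by (rule var)
    finally have "real (card B) \<le> (real N * L + K) / (L / 2)^2" using L1 by (simp only: pos_le_divide_eq zero_less_power half_gt_zero)
    also have "\<dots> = 4 / L * real N + 4 * K / L^2" using L1 by (simp add: field_simps power2_eq_square)
    also have "\<dots> \<le> \<epsilon> / 2 * real N + \<epsilon> / 2 * real N"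
    proof (intro add_mono mult_right_mono)
      show "4 / L \<le> \<epsilon> / 2" using L1 \<epsilon> by (simp add: field_simps)
      have "8 * K / (L^2 * \<epsilon>) \<le> real N" using N unfolding N0_def by linarith
      then show "4 * K / L^2 \<le> \<epsilon> / 2 * real N" using L1 \<epsilon> by (simp add: field_simps)
    qed simp
    finally show ?thesis by (simp add: B_def)
  qed
  then show "\<exists>N0. \<forall>N\<ge>N0. real (card ({m. card {p\<in>P. exactly_divides p m} < k} \<inter> {1..N})) \<le> \<epsilon> * real N" by blast
qed

section \<open>Integers free of a sparse set of primes\<close>

lemma not_divergent_reciprocals_bound:
  assumes "\<not> divergent_reciprocals R"
  shows "\<exists>C. \<forall>F. F \<subseteq> R \<longrightarrow> finite F \<longrightarrow> (\<Sum>p\<in>F. 1 / real p) < C"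
  using assms unfolding divergent_reciprocals_def not_le[symmetric] by blast

lemma reciprocal_tail_small:
  assumes "\<not> divergent_reciprocals R" "\<epsilon> > 0"
  shows "\<exists>y. \<forall>F. finite F \<longrightarrow> F \<subseteq> {p\<in>R. p > y} \<longrightarrow> (\<Sum>p\<in>F. 1 / real p) \<le> \<epsilon>"
proof -
  define X where "X = {\<Sum>p\<in>F. 1 / real p | F. finite F \<and> F \<subseteq> R}"
  obtain C where C: "\<And>F. F \<subseteq> R \<Longrightarrow> finite F \<Longrightarrow> (\<Sum>p\<in>F. 1 / real p) < C" using not_divergent_reciprocals_bound[OF assms(1)] by blast
  have bdd: "bdd_above X"
  proof (rule bdd_aboveI[of _ C])
    fix x assume "x \<in> X"
    then obtain F where "finite F" "F \<subseteq> R" "x = (\<Sum>p\<in>F. 1 / real p)" unfolding X_def by blast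
    then show "x \<le> C" using C[of F] by simp
  qed
  have ne: "X \<noteq> {}" unfolding X_def by blast
  obtain x where "x \<in> X" "Sup X - \<epsilon> < x" using less_cSupE[of "Sup X - \<epsilon>" X] ne assms(2) by auto
  then obtain F0 where F0: "finite F0" "F0 \<subseteq> R" "Sup X - \<epsilon> < (\<Sum>p\<in>F0. 1 / real p)" by (auto simp: X_def)
  have "(\<Sum>p\<in>F. 1 / real p) \<le> \<epsilon>" if F: "finite F" "F \<subseteq> {p\<in>R. p > Max (insert 0 F0)}" for F
  proof -
    have disj: "F0 \<inter> F = {}"
    proof (rule ccontr)
      assume "F0 \<inter> F \<noteq> {}"
      then obtain p where p: "p \<in> F0" "p \<in> F" by blast
      have "p \<le> Max (insert 0 F0)" using p(1) F0(1) by (intro Max_ge) auto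
      then show False using p(2) F(2) by auto
    qed
    have "(\<Sum>p\<in>F0 \<union> F. 1 / real p) \<in> X" using F F0 by (auto simp: X_def)
    then have "(\<Sum>p\<in>F0 \<union> F. 1 / real p) \<le> Sup X" using bdd by (rule cSup_upper)
    moreover have "(\<Sum>p\<in>F0 \<union> F. 1 / real p) = (\<Sum>p\<in>F0. 1 / real p) + (\<Sum>p\<in>F. 1 / real p)"
      by (rule sum.union_disjoint[OF F0(1) F(1) disj])
    ultimately show ?thesis using F0(3) by linarith
  qed
  then show ?thesis by blast
qed

text \<open>A sieve: the small primes of \<open>R\<close> are excluded by requiring
  \<open>m = 1\<close> modulo their product, and the large ones have reciprocal sum at most 1/4 and
  so remove only a fraction of the progression. For \<open>b = 1\<close> this also yields the
  divergence of the reciprocal sum over all primes.\<close>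

lemma exists_without_prime_factors:
  fixes b c :: nat
  assumes b: "b > 0" "coprime c b" and R: "\<And>p. p \<in> R \<Longrightarrow> prime p \<and> \<not> p dvd b" and conv: "\<not> divergent_reciprocals R"
  shows "\<exists>m>1. [m = c] (mod b) \<and> (\<forall>p\<in>R. \<not> p dvd m)"
proof (rule ccontr)
  assume contra: "\<not> ?thesis"
  obtain y where y: "\<And>F. finite F \<Longrightarrow> F \<subseteq> {p\<in>R. p > y} \<Longrightarrow> (\<Sum>p\<in>F. 1 / real p) \<le> 1 / 4"
    using reciprocal_tail_small[OF conv, of "1/4"] by auto
  define S where "S = {p\<in>R. p \<le> y}"
  define B where "B = \<Prod>S"
  have finS: "finite S" by (simp add: S_def)
  have B0: "B > 0" unfolding B_def using R prime_gt_0_nat by (intro prod_pos) (auto simp: S_def)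
  have copb: "coprime b B" unfolding B_def
  proof (rule prod_coprime_right)
    fix p assume "p \<in> S"
    then have "prime p" "\<not> p dvd b" using R by (auto simp: S_def)
    then have "coprime p b" by (rule prime_imp_coprime)
    then show "coprime b p" using coprime_commute by blast
  qed
  define q where "q = b * B"
  have q0: "q > 0" using b B0 by (simp add: q_def)
  obtain m0 where m0: "[m0 = c] (mod b)" "[m0 = 1] (mod B)" using binary_chinese_remainder_nat[OF copb, of c 1] by blast
  have pf: "\<exists>p\<in>R. p > y \<and> p dvd m" if m: "m > 1" "[m = m0] (mod q)" for m
  proof -
    have mb: "[m = c] (mod b)" using m(2) m0(1) cong_trans cong_modulus_mult_nat unfolding q_def by blast
    have mB: "[m = 1] (mod B)" using m(2) m0(2) cong_trans cong_modulus_mult_nat[of m m0 B b] unfolding q_def by (metis mult.commute)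
    obtain p where p: "p \<in> R" "p dvd m" using contra m(1) mb by blast
    have "p > y"
    proof (rule ccontr)
      assume "\<not> p > y"
      then have "p \<in> S" using p by (simp add: S_def)
      then have "p dvd B" unfolding B_def using finS by (intro dvd_prodI)
      then have "[m = 1] (mod p)" using cong_dvd_modulus_nat[OF mB] by blast
      then have "p dvd 1" using p(2) cong_dvd_iff by blast
      then show False using R[OF p(1)] by auto
    qed
    then show ?thesis using p by blast
  qed
  have e8: "1 / (8 * real q) > 0" using q0 by simp
  obtain y' where y': "\<And>F. finite F \<Longrightarrow> F \<subseteq> {p\<in>R. p > y'} \<Longrightarrow> (\<Sum>p\<in>F. 1 / real p) \<le> 1 / (8 * real q)"
    using reciprocal_tail_small[OF conv e8] by blast
  \<comment> \<open>\<open>N / q\<close> has to exceed the rounding errors, one for each prime of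
    \<open>R\<close> up to \<open>N\<close>. There are at most \<open>N / (8 q) + y' + 1\<close> of
    these, since a prime \<open>p <= N\<close> beyond \<open>y'\<close> takes at least
    \<open>1 / N\<close> from a tail of size \<open>1 / (8 q)\<close>. The value
    \<open>4 q (y' + 3)\<close> is large enough for a contradiction.\<close>
  define N where "N = 4 * q * (y' + 3)"
  have N0: "N \<ge> 1" using q0 by (simp add: N_def)
  define Rn where "Rn = {p\<in>R. p > y \<and> p \<le> N}"
  have finR: "finite Rn" by (simp add: Rn_def)
  define M where "M = {m\<in>{1..N}. [m = m0] (mod q)}"
  have "M - {1} \<subseteq> (\<Union>p\<in>Rn. {m\<in>M. p dvd m})"
  proof
    fix m assume m: "m \<in> M - {1}"
    then obtain p where p: "p \<in> R" "p > y" "p dvd m" using pf[of m] by (auto simp: M_def)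
    have "p \<le> N" using dvd_imp_le[OF p(3)] m by (auto simp: M_def)
    then show "m \<in> (\<Union>p\<in>Rn. {m\<in>M. p dvd m})" using p m by (auto simp: Rn_def)
  qed
  then have "card (M - {1}) \<le> card (\<Union>p\<in>Rn. {m\<in>M. p dvd m})" by (rule card_mono[rotated]) (use finR in \<open>auto simp: M_def\<close>)
  also have "\<dots> \<le> (\<Sum>p\<in>Rn. card {m\<in>M. p dvd m})" by (rule card_UN_le[OF finR])
  finally have "real (card (M - {1})) \<le> real (\<Sum>p\<in>Rn. card {m\<in>M. p dvd m})" by (simp only: of_nat_le_iff)
  also have "\<dots> \<le> (\<Sum>p\<in>Rn. real N / real q * (1 / real p) + 1)"
    unfolding of_nat_sum
  proof (rule sum_mono)
    fix p assume "p \<in> Rn"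
    then have p: "prime p" "\<not> p dvd b" "p > y" "p \<in> R" using R by (auto simp: Rn_def)
    have "\<not> p dvd B"
    proof
      assume "p dvd B"
      then obtain r where "r \<in> S" "p dvd r" unfolding B_def using prime_dvd_prod_iff[OF finS p(1)] by auto
      then have "p = r" using p(1) R primes_dvd_imp_eq by (auto simp: S_def)
      then show False using \<open>r \<in> S\<close> p(3) by (simp add: S_def)
    qed
    then have "\<not> p dvd q" using p by (simp add: q_def prime_dvd_mult_iff)
    then have cop: "coprime (int p) (int q)" using p(1) by (simp add: prime_imp_coprime)
    have "real (card (int ` {m\<in>M. p dvd m})) \<le> real_of_int (int N - 1) / real_of_int (int p * int q) + 1"
      unfolding of_int_diff
    proof (rule card_congruent_le[unfolded of_int_diff])
      show "int ` {m\<in>M. p dvd m} \<subseteq> {1..int N}" by (auto simp: M_def)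
      show "1 \<le> int N" using N0 by simp
      show "0 < int p * int q" using p(1) q0 by (simp add: prime_gt_0_nat)
      fix x x' assume "x \<in> int ` {m\<in>M. p dvd m}" "x' \<in> int ` {m\<in>M. p dvd m}"
      then obtain m m' where mm: "x = int m" "x' = int m'" "m \<in> M" "m' \<in> M" "p dvd m" "p dvd m'" by blast
      have "[m = m'] (mod q)" using mm by (auto simp: M_def intro: cong_trans cong_sym)
      then have "[int m = int m'] (mod int q)" by (simp only: cong_int_iff)
      then have "int q dvd x - x'" using mm by (simp add: cong_iff_dvd_diff)
      moreover have "int p dvd x - x'" using mm by simp
      ultimately show "int p * int q dvd x - x'" using cop by (intro divides_mult) auto
    qed
    moreover have "card (int ` {m\<in>M. p dvd m}) = card {m\<in>M. p dvd m}" by (rule card_image) simp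
    moreover have "real_of_int (int N - 1) / real_of_int (int p * int q) \<le> real N / real q * (1 / real p)"
      using q0 p(1) by (simp add: divide_right_mono mult.commute prime_gt_0_nat)
    ultimately show "real (card {m\<in>M. p dvd m}) \<le> real N / real q * (1 / real p) + 1" by linarith
  qed
  also have "\<dots> = real N / real q * (\<Sum>p\<in>Rn. 1 / real p) + real (card Rn)" by (simp add: sum.distrib sum_distrib_left)
  also have "\<dots> \<le> real N / real q * (1 / 4) + (real N / (8 * real q) + (real y' + 1))"
  proof (intro add_mono mult_left_mono)
    show "(\<Sum>p\<in>Rn. 1 / real p) \<le> 1 / 4" by (rule y[OF finR]) (auto simp: Rn_def)
    define R1 where "R1 = {p\<in>Rn. p > y'}"
    have "Rn \<subseteq> R1 \<union> {..y'}" by (auto simp: R1_def)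
    then have "card Rn \<le> card (R1 \<union> {..y'})" by (rule card_mono[rotated]) (simp add: R1_def finR)
    also have "\<dots> \<le> card R1 + (y' + 1)" using card_Un_le[of R1 "{..y'}"] by simp
    finally have c: "real (card Rn) \<le> real (card R1) + (real y' + 1)" by simp
    have "real (card R1) = (\<Sum>p\<in>R1. 1)" by simp
    also have "\<dots> \<le> (\<Sum>p\<in>R1. real N * (1 / real p))"
      using R by (intro sum_mono) (auto simp: R1_def Rn_def prime_gt_0_nat)
    also have "\<dots> = real N * (\<Sum>p\<in>R1. 1 / real p)" by (simp add: sum_distrib_left)
    also have "\<dots> \<le> real N * (1 / (8 * real q))" by (intro mult_left_mono y') (auto simp: R1_def Rn_def finR)
    finally show "real (card Rn) \<le> real N / (8 * real q) + (real y' + 1)" using c by simp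
  qed simp
  finally have up: "real (card (M - {1})) \<le> real N / real q * (1 / 4) + (real N / (8 * real q) + (real y' + 1))" .
  have "real (card M) \<ge> real N / real q - 1" using card_residue_class[OF q0, of N m0] unfolding M_def by linarith
  moreover have "card M \<le> card (M - {1}) + 1" by (cases "1 \<in> M") (auto simp: M_def card_Diff_singleton)
  ultimately have lo: "real (card (M - {1})) \<ge> real N / real q - 2" by linarith
  have e: "real N / real q = 4 * (real y' + 3)" "real N / (8 * real q) = (real y' + 3) / 2" using q0 by (simp_all add: N_def)
  have "4 * (real y' + 3) - 2 \<le> 4 * (real y' + 3) * (1 / 4) + ((real y' + 3) / 2 + (real y' + 1))"
    using order_trans[OF lo up] unfolding e .
  then have "4 * real y' + 10 \<le> (real y' + 3) + (real y' / 2 + 3 / 2 + (real y' + 1))" by (simp add: add_divide_distrib)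
  then show False using of_nat_0_le_iff[of y', where 'a = real] by linarith
qed

lemma divergent_reciprocals_Un:
  assumes "divergent_reciprocals (A \<union> B)" shows "divergent_reciprocals A \<or> divergent_reciprocals B"
proof (rule ccontr)
  assume "\<not> ?thesis"
  then have nd: "\<not> divergent_reciprocals A" "\<not> divergent_reciprocals B" by blast+
  obtain C1 where C1: "\<And>F. F \<subseteq> A \<Longrightarrow> finite F \<Longrightarrow> (\<Sum>p\<in>F. 1 / real p) < C1" using not_divergent_reciprocals_bound[OF nd(1)] by blast
  obtain C2 where C2: "\<And>F. F \<subseteq> B \<Longrightarrow> finite F \<Longrightarrow> (\<Sum>p\<in>F. 1 / real p) < C2" using not_divergent_reciprocals_bound[OF nd(2)] by blast
  obtain F where F: "F \<subseteq> A \<union> B" "finite F" "(\<Sum>p\<in>F. 1 / real p) \<ge> C1 + C2" using assms unfolding divergent_reciprocals_def by blast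
  have "(\<Sum>p\<in>F. 1 / real p) = (\<Sum>p\<in>(F \<inter> A) \<union> (F - A). 1 / real p)" by (rule sum.cong) auto
  also have "\<dots> = (\<Sum>p\<in>F \<inter> A. 1 / real p) + (\<Sum>p\<in>F - A. 1 / real p)" using F(2) by (intro sum.union_disjoint) auto
  also have "\<dots> < C1 + C2" by (rule add_strict_mono; rule C1 C2) (use F in auto)
  finally show False using F(3) by linarith
qed

lemma finite_not_divergent_reciprocals: "finite A \<Longrightarrow> \<not> divergent_reciprocals A"
proof
  assume A: "finite A" "divergent_reciprocals A"
  then obtain F where F: "F \<subseteq> A" "(\<Sum>p\<in>F. 1 / real p) \<ge> (\<Sum>p\<in>A. 1 / real p) + 1" unfolding divergent_reciprocals_def by blast
  have "(\<Sum>p\<in>F. 1 / real p) \<le> (\<Sum>p\<in>A. 1 / real p)" by (rule sum_mono2[OF A(1) F(1)]) simp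
  then show False using F(2) by linarith
qed

lemma divergent_prime_reciprocals: "divergent_reciprocals {p. prime p}"
proof (rule ccontr)
  assume nd: "\<not> ?thesis"
  have "\<exists>m>1::nat. [m = 1] (mod 1) \<and> (\<forall>p\<in>{p. prime p}. \<not> p dvd m)"
    by (rule exists_without_prime_factors) (use nd in auto)
  then obtain m :: nat where "m > 1" "\<forall>p. prime p \<longrightarrow> \<not> p dvd m" by auto
  then show False using prime_factor_nat[of m] by auto
qed

lemma not_divergent_reciprocals_UN:
  assumes "finite I" "\<And>i. i \<in> I \<Longrightarrow> \<not> divergent_reciprocals (A i)"
  shows "\<not> divergent_reciprocals (\<Union>i\<in>I. A i)"
  using assms
proof (induction I rule: finite_induct)
  case empty
  show ?case using finite_not_divergent_reciprocals[of "{}"] by simp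
next
  case (insert i I)
  show ?case using divergent_reciprocals_Un[of "A i" "\<Union>i\<in>I. A i"] insert.IH insert.prems by auto
qed

section \<open>Isotropic binary forms\<close>

lemma divisor_in_class:
  fixes b n :: nat
  assumes many: "\<And>g. g \<in> T \<Longrightarrow> k \<le> card {p. prime p \<and> p mod b = g \<and> exactly_divides p n}"
    and A: "\<And>p. p \<in># A \<Longrightarrow> p mod b \<in> T" "size A \<le> k"
  shows "\<exists>F. finite F \<and> card F = size A \<and> (\<forall>p\<in>F. prime p) \<and> \<Prod>F dvd n \<and> [\<Prod>F = prod_mset A] (mod b)"
  using A
proof (induction A)
  case empty
  show ?case by (rule exI[of _ "{}"]) simp
next
  case (add p A)
  then obtain F where F: "finite F" "card F = size A" "\<forall>p\<in>F. prime p" "\<Prod>F dvd n" "[\<Prod>F = prod_mset A] (mod b)" by auto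
  define X where "X = {r. prime r \<and> r mod b = p mod b \<and> exactly_divides r n}"
  have "card F < card X" using many[of "p mod b"] add.prems F(2) by (simp add: X_def)
  then have "\<not> X \<subseteq> F" using card_mono[OF F(1), of X] by linarith
  then obtain r where r: "r \<notin> F" "prime r" "r mod b = p mod b" "r dvd n" by (auto simp: X_def exactly_divides_def)
  have "coprime r (\<Prod>F)"
  proof (rule prod_coprime_right)
    fix s assume "s \<in> F"
    then show "coprime r s" using F(3) r by (intro primes_coprime) auto
  qed
  then have "\<Prod>(insert r F) dvd n" using F(1,4) r divides_mult[of r n "\<Prod>F"] by simp
  moreover have "[\<Prod>(insert r F) = prod_mset (add_mset p A)] (mod b)"
  proof -
    have "[r * \<Prod>F = p * prod_mset A] (mod b)" using r(3) F(5) by (intro cong_mult) (auto simp: cong_def)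
    then show ?thesis using F(1) r(1) by simp
  qed
  ultimately show ?case using F r by (intro exI[of _ "insert r F"]) auto
qed

text \<open>Let \<open>T\<close> be the set of classes whose primes have divergent reciprocal sum.
  The primes coprime to \<open>b\<close> outside these classes are sparse, so each unit class
  contains a number \<open>w c\<close> composed of primes from classes in \<open>T\<close>. Almost
  all \<open>m\<close> have at least \<open>k\<close> exact prime divisors in every class of
  \<open>T\<close>, and \<open>k\<close> is large enough to imitate the factorisation of
  \<open>w c\<close> inside \<open>m\<close>.\<close>

lemma divisors_in_all_classes:
  fixes b :: nat
  assumes b: "b > 0"
  shows "zero_density {m. \<exists>c. coprime c b \<and> \<not> (\<exists>e. e dvd m \<and> [e = c] (mod b))}"
proof -
  define cls where "cls g = {p. prime p \<and> coprime p b \<and> p mod b = g}" for g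
  define T where "T = {g. g < b \<and> divergent_reciprocals (cls g)}"
  define R where "R = (\<Union>g\<in>{g. g < b \<and> g \<notin> T}. cls g)"
  have "finite {g. g < b \<and> g \<notin> T}" by simp
  then have convR: "\<not> divergent_reciprocals R" unfolding R_def
    by (rule not_divergent_reciprocals_UN) (simp add: T_def)
  have R: "prime p \<and> \<not> p dvd b" if "p \<in> R" for p
    using that prime_imp_coprime[of p b] by (auto simp: R_def cls_def coprime_absorb_left)
  have "\<exists>m. m > 0 \<and> (coprime c b \<longrightarrow> [m = c] (mod b) \<and> (\<forall>p\<in>R. \<not> p dvd m))" for c
  proof (cases "coprime c b")
    case True
    then obtain m where "m > 1" "[m = c] (mod b)" "\<forall>p\<in>R. \<not> p dvd m" using exists_without_prime_factors[OF b _ R convR, of c] by blast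
    then show ?thesis by (intro exI[of _ m]) simp
  qed (auto intro: exI[of _ 1])
  then obtain w where w: "\<And>c. w c > 0" "\<And>c. coprime c b \<Longrightarrow> [w c = c] (mod b)" "\<And>c p. coprime c b \<Longrightarrow> p \<in> R \<Longrightarrow> \<not> p dvd w c"
    by metis
  define k where "k = (\<Sum>c<b. size (prime_factorization (w c)))"
  have fT: "finite T" by (simp add: T_def)
  have "zero_density (\<Union>g\<in>T. {m. card {p\<in>cls g. exactly_divides p m} < k})"
    by (rule zero_density_UN[OF fT], rule few_exact_divisors_zero_density) (auto simp: cls_def T_def)
  moreover have "\<exists>g\<in>T. card {p\<in>cls g. exactly_divides p m} < k" if c: "coprime c b" and ne: "\<not> (\<exists>e. e dvd m \<and> [e = c] (mod b))" for m c
  proof (rule ccontr)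
    assume contra: "\<not> ?thesis"
    have m0: "m > 0"
    proof (rule ccontr)
      assume "\<not> m > 0"
      then have "c dvd m \<and> [c = c] (mod b)" by simp
      then show False using ne by blast
    qed
    define c' where "c' = c mod b"
    have c': "c' < b" "coprime c' b" "[c' = c] (mod b)" using c b by (auto simp: c'_def cong_def)
    have "\<exists>F. finite F \<and> card F = size (prime_factorization (w c')) \<and> (\<forall>p\<in>F. prime p) \<and> \<Prod>F dvd m \<and> [\<Prod>F = prod_mset (prime_factorization (w c'))] (mod b)"
    proof (rule divisor_in_class[of T k])
      show "size (prime_factorization (w c')) \<le> k" unfolding k_def by (rule member_le_sum) (use c' in auto)
      fix p assume "p \<in># prime_factorization (w c')"
      then have p: "prime p" "p dvd w c'" by (auto simp: in_prime_factors_iff)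
      have "coprime (w c') b" using w(2)[OF c'(2)] c'(2) cong_imp_coprime cong_sym by blast
      then have "coprime p b" using p(2) coprime_divisors[of p "w c'" b b] by simp
      then have "p \<in> cls (p mod b)" using p by (simp add: cls_def)
      moreover have "p \<notin> R" using w(3)[OF c'(2)] p by blast
      ultimately show "p mod b \<in> T" using mod_less_divisor[OF b] unfolding R_def by blast
    next
      fix g assume "g \<in> T"
      then have "k \<le> card {p\<in>cls g. exactly_divides p m}" using contra by (simp add: not_less)
      also have "\<dots> \<le> card {p. prime p \<and> p mod b = g \<and> exactly_divides p m}"
      proof (rule card_mono)
        show "finite {p. prime p \<and> p mod b = g \<and> exactly_divides p m}"
          by (rule finite_subset[of _ "{..m}"]) (auto simp: exactly_divides_def m0 dvd_imp_le)
      qed (auto simp: cls_def)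
      finally show "k \<le> card {p. prime p \<and> p mod b = g \<and> exactly_divides p m}" .
    qed
    then obtain F where F: "\<Prod>F dvd m" "[\<Prod>F = prod_mset (prime_factorization (w c'))] (mod b)" by blast
    have "prod_mset (prime_factorization (w c')) = w c'" using w(1)[of c'] by (simp add: prod_mset_prime_factorization_nat)
    then have "[\<Prod>F = c] (mod b)" using F(2) w(2)[OF c'(2)] c'(3) cong_trans by metis
    then show False using ne F(1) by blast
  qed
  ultimately show ?thesis by (rule_tac zero_density_subset) blast+
qed

text \<open>Values are the products \<open>x w\<close> with \<open>w\<close> congruent to
  \<open>a x\<close> modulo \<open>b\<close>. Split \<open>s m0 = x0 w0\<close> as
  \<open>x0 = \<sigma> e0\<close>, \<open>w0 = \<sigma>' f0\<close> with
  \<open>s = \<sigma> \<sigma>'\<close> and \<open>m0 = e0 f0\<close>. If \<open>m\<close> is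
  congruent to \<open>m0\<close> and has a divisor \<open>e\<close> congruent to \<open>e0\<close>,
  its cofactor \<open>f\<close> is congruent to \<open>f0\<close>, and the product of
  \<open>\<sigma> e\<close> and \<open>\<sigma>' f\<close> represents \<open>s m\<close>.\<close>

lemma isotropic_binary_density:
  fixes a b :: int
  assumes b: "b \<noteq> 0"
  shows "\<exists>\<delta>\<in>\<rat>. (\<lambda>N. real (card ({d. d > 0 \<and> (\<exists>x y. int d = x * (a * x + b * y))} \<inter> {1..N})) / real N) \<longlonglongrightarrow> \<delta>"
proof (rule rational_density_dichotomy)
  show "nat \<bar>b\<bar> > 0" using b by simp
  fix d p :: nat assume "d \<in> {d. d > 0 \<and> (\<exists>x y. int d = x * (a * x + b * y))}" and p: "prime p"
  then obtain x y where d: "d > 0" "int d = x * (a * x + b * y)" by blast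
  have "int (p^2 * d) = (int p * x) * (a * (int p * x) + b * (int p * y))" using d(2) by (simp add: algebra_simps power2_eq_square)
  then show "p^2 * d \<in> {d. d > 0 \<and> (\<exists>x y. int d = x * (a * x + b * y))}" using d(1) p by (auto simp: prime_gt_0_nat)
next
  fix s k m0 :: nat
  assume s: "s > 0" "s dvd nat \<bar>b\<bar> ^ k" and m0: "m0 > 0" "coprime m0 (nat \<bar>b\<bar>)"
    and "s * m0 \<in> {d. d > 0 \<and> (\<exists>x y. int d = x * (a * x + b * y))}"
  then obtain x0 y0 where xy: "int (s * m0) = x0 * (a * x0 + b * y0)" by blast
  define w0 where "w0 = a * x0 + b * y0"
  define M where "M = nat \<bar>b\<bar>"
  have M0: "M > 0" using b by (simp add: M_def)
  have bM: "b dvd z \<longleftrightarrow> int M dvd z" for z by (simp add: M_def)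
  define \<sigma> where "\<sigma> = gcd (int s) x0"
  have \<sigma>0: "\<sigma> > 0" using s by (simp add: \<sigma>_def)
  obtain \<sigma>' where \<sigma>': "int s = \<sigma> * \<sigma>'" unfolding \<sigma>_def by (meson dvdE gcd_dvd1)
  obtain e0 where e0: "x0 = \<sigma> * e0" unfolding \<sigma>_def by (meson dvdE gcd_dvd2)
  have s'0: "\<sigma>' \<noteq> 0" using s \<sigma>' by auto
  have "coprime \<sigma>' e0"
  proof -
    have "\<sigma> = gcd (\<sigma> * \<sigma>') (\<sigma> * e0)" using \<sigma>_def \<sigma>' e0 by simp
    also have "\<dots> = \<sigma> * gcd \<sigma>' e0" using \<sigma>0 gcd_mult_distrib_int[of \<sigma> \<sigma>' e0] by simp
    finally show ?thesis using \<sigma>0 by (simp add: coprime_iff_gcd_eq_1)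
  qed
  have "\<sigma> * (\<sigma>' * int m0) = \<sigma> * (e0 * w0)" using xy \<sigma>' e0 by (simp add: w0_def mult_ac)
  then have eq: "\<sigma>' * int m0 = e0 * w0" using \<sigma>0 by simp
  then have "\<sigma>' dvd e0 * w0" by (metis dvd_triv_left)
  then have "\<sigma>' dvd w0" using \<open>coprime \<sigma>' e0\<close> by (simp add: coprime_dvd_mult_right_iff)
  then obtain f0 where f0: "w0 = \<sigma>' * f0" by (elim dvdE)
  have mef: "int m0 = e0 * f0" using eq s'0 unfolding f0 by simp
  have copm: "coprime (int m0) (int M)" using m0(2) by (simp add: M_def)
  then have cope: "coprime e0 (int M)" unfolding mef by simp
  \<comment> \<open>\<open>e0\<close> may be negative, whereas the divisors of \<open>m\<close> are
    natural numbers; only the class of \<open>e0\<close> matters.\<close>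
  define c where "c = nat (e0 mod int M)"
  have c: "int c = e0 mod int M" using M0 by (simp add: c_def)
  have copc: "coprime c M"
  proof -
    have "coprime (int c) (int M)" unfolding c using cope M0 by simp
    then show ?thesis by simp
  qed
  \<comment> \<open>Values are required to be positive, so \<open>m = 0\<close> has to be counted
    among the exceptions.\<close>
  have zero: "zero_density {0}" using zero_density_subset by (auto simp: zero_density_def)
  show "zero_density {m. [m = m0] (mod nat \<bar>b\<bar>) \<and> s * m \<notin> {d. d > 0 \<and> (\<exists>x y. int d = x * (a * x + b * y))}}"
  proof (rule zero_density_subset[OF zero_density_Un[OF divisors_in_all_classes[OF M0] zero]], rule subsetI, rule ccontr)
    fix m assume "m \<in> {m. [m = m0] (mod nat \<bar>b\<bar>) \<and> s * m \<notin> {d. d > 0 \<and> (\<exists>x y. int d = x * (a * x + b * y))}}"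
      "m \<notin> {m. \<exists>c. coprime c M \<and> \<not> (\<exists>e. e dvd m \<and> [e = c] (mod M))} \<union> {0}"
    then have m: "[m = m0] (mod nat \<bar>b\<bar>) \<and> \<not> (s * m > 0 \<and> (\<exists>x y. int (s * m) = x * (a * x + b * y)))" "m > 0"
      and "\<exists>e. e dvd m \<and> [e = c] (mod M)" using copc by auto
    then obtain e f where e: "m = e * f" "[e = c] (mod M)" by auto
    have "[m = m0] (mod M)" using m(1) unfolding M_def by (rule conjunct1)
    then have mm: "[int m = int m0] (mod int M)" by (simp only: cong_int_iff)
    have ee: "[int e = e0] (mod int M)"
    proof -
      have "[int e = int c] (mod int M)" using e(2) by (simp add: cong_int_iff)
      then show ?thesis by (simp add: c cong_def)
    qed
    have "[int e * int f = e0 * f0] (mod int M)" using mm unfolding e(1) mef by simp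
    moreover have "[int e * f0 = e0 * f0] (mod int M)" using ee by (rule cong_scalar_right)
    ultimately have "[int e * int f = int e * f0] (mod int M)" using cong_trans cong_sym by blast
    moreover have "coprime (int e) (int M)" using cope ee cong_imp_coprime cong_sym by blast
    ultimately have ff: "[int f = f0] (mod int M)" by (simp add: cong_mult_lcancel)
    have "[\<sigma>' * int f - a * (\<sigma> * int e) = \<sigma>' * f0 - a * (\<sigma> * e0)] (mod int M)"
      by (intro cong_diff cong_scalar_left ff ee)
    moreover have "int M dvd \<sigma>' * f0 - a * (\<sigma> * e0)" unfolding bM[symmetric] f0[symmetric] e0[symmetric] by (simp add: w0_def)
    ultimately have "int M dvd \<sigma>' * int f - a * (\<sigma> * int e)" using cong_dvd_iff by blast
    then obtain y where y: "\<sigma>' * int f - a * (\<sigma> * int e) = b * y" unfolding bM[symmetric] by (elim dvdE)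
    then have "a * (\<sigma> * int e) + b * y = \<sigma>' * int f" by simp
    then have "(\<sigma> * int e) * (a * (\<sigma> * int e) + b * y) = (\<sigma> * int e) * (\<sigma>' * int f)" by simp
    also have "\<dots> = int (s * m)" using \<sigma>' e(1) by (simp add: mult_ac)
    finally have "\<exists>x y. int (s * m) = x * (a * x + b * y)" by metis
    then show False using m s by simp
  qed
qed

section \<open>Anisotropic binary forms\<close>

definition binary_form :: "int \<Rightarrow> int \<Rightarrow> int \<Rightarrow> int \<Rightarrow> int \<Rightarrow> int" where
  "binary_form a b c x y = a * x^2 + b * x * y + c * y^2"

lemma power2_abs_mono:
  fixes z r :: int
  assumes "\<bar>z\<bar> \<le> r" shows "z^2 \<le> r^2"
  using power_mono[OF assms, of 2] by simp

text \<open>Pigeonhole on \<open>(r + 1)^2 > n\<close> points, where \<open>r\<close> is the integer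
  part of \<open>sqrt n\<close>.\<close>

lemma thue:
  fixes \<alpha> \<beta> n :: int
  assumes n: "n > 0"
  shows "\<exists>x y. (x \<noteq> 0 \<or> y \<noteq> 0) \<and> x^2 \<le> n \<and> y^2 \<le> n \<and> n dvd \<alpha> * x + \<beta> * y"
proof -
  define r where "r = \<lfloor>sqrt (real_of_int n)\<rfloor>"
  have r0: "r \<ge> 0" using n by (simp add: r_def)
  have "real_of_int r \<le> sqrt (real_of_int n)" by (simp add: r_def)
  then have "(real_of_int r)^2 \<le> (sqrt (real_of_int n))^2" using r0 by (intro power_mono) auto
  then have "real_of_int (r^2) \<le> real_of_int n" using n by simp
  then have rn: "r^2 \<le> n" by (simp only: of_int_le_iff)
  have "sqrt (real_of_int n) < real_of_int r + 1" unfolding r_def by linarith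
  then have "(sqrt (real_of_int n))^2 < (real_of_int r + 1)^2" using n by (intro power_strict_mono) auto
  then have "real_of_int n < real_of_int ((r + 1)^2)" using n by simp
  then have nr: "n < (r + 1)^2" by (simp only: of_int_less_iff)
  define X where "X = {0..r} \<times> {0..r}"
  define \<phi> where "\<phi> = (\<lambda>(x,y). (\<alpha> * x + \<beta> * y) mod n)"
  have cX: "card X = nat ((r + 1)^2)" using r0 by (simp add: X_def card_cartesian_product power2_eq_square nat_mult_distrib)
  have "card (\<phi> ` X) \<le> card {0..<n}" using n by (intro card_mono) (auto simp: \<phi>_def)
  also have "\<dots> < card X" unfolding cX using nr n by (simp only: card_atLeastLessThan_int nat_mono_iff)
  finally have "\<not> inj_on \<phi> X" by (rule pigeonhole)
  then obtain x y x' y' where xy: "x \<in> {0..r}" "y \<in> {0..r}" "x' \<in> {0..r}" "y' \<in> {0..r}" "(x,y) \<noteq> (x',y')"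
    "(\<alpha> * x + \<beta> * y) mod n = (\<alpha> * x' + \<beta> * y') mod n" unfolding inj_on_def X_def \<phi>_def by fastforce
  have "n dvd (\<alpha> * x + \<beta> * y) - (\<alpha> * x' + \<beta> * y')" using xy(6) by (simp add: mod_eq_dvd_iff)
  then have "n dvd \<alpha> * (x - x') + \<beta> * (y - y')" by (simp add: algebra_simps)
  moreover have "(x - x')^2 \<le> n"
    using xy(1,3) r0 by (intro order_trans[OF power2_abs_mono rn]) auto
  moreover have "(y - y')^2 \<le> n"
    using xy(2,4) r0 by (intro order_trans[OF power2_abs_mono rn]) auto
  moreover have "x - x' \<noteq> 0 \<or> y - y' \<noteq> 0" using xy(5) by auto
  ultimately show ?thesis by blast
qed

lemma prod_primes_dvd:
  fixes I :: "int set"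
  assumes "finite I" "\<And>p. p \<in> I \<Longrightarrow> prime p" "\<And>p. p \<in> I \<Longrightarrow> p dvd z"
  shows "\<Prod>I dvd z"
  using assms
proof (induction I rule: finite_induct)
  case (insert p I)
  have "coprime p (\<Prod>I)"
  proof (rule prod_coprime_right)
    fix s assume "s \<in> I"
    then show "coprime p s" using insert by (intro primes_coprime) auto
  qed
  then show ?case using insert divides_mult[of p z "\<Prod>I"] by simp
qed simp

text \<open>Homogenised polynomial division: both \<open>y1^2 F(x, y)\<close> and
  \<open>x1^2 F(x, y)\<close> are combinations of \<open>y1 x - x1 y\<close> and
  \<open>F(x1, y1)\<close>, and \<open>x1^2\<close>, \<open>y1^2\<close> are coprime. This covers
  composite \<open>e\<close>.\<close>

lemma binary_form_dvd:
  assumes "coprime x1 y1" "e dvd binary_form a b c x1 y1" "e dvd y1 * x - x1 * y"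
  shows "e dvd binary_form a b c x y"
proof -
  have "y1^2 * binary_form a b c x y = (y1 * x - x1 * y) * (a * y1 * x + (b * y1 + a * x1) * y) + binary_form a b c x1 y1 * y^2"
    by (simp add: binary_form_def algebra_simps power2_eq_square)
  then have 1: "e dvd y1^2 * binary_form a b c x y" using assms(2,3) by simp
  have "x1^2 * binary_form a b c x y = (y1 * x - x1 * y) * (- (c * x1 * y + (b * x1 + c * y1) * x)) + binary_form a b c x1 y1 * x^2"
    by (simp add: binary_form_def algebra_simps power2_eq_square)
  then have 2: "e dvd x1^2 * binary_form a b c x y" using assms(2,3) by simp
  have "e dvd gcd (x1^2 * binary_form a b c x y) (y1^2 * binary_form a b c x y)" using 1 2 by simp
  moreover have "gcd (x1^2) (y1^2) = 1" using assms(1) by simp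
  moreover have "gcd (x1^2 * binary_form a b c x y) (y1^2 * binary_form a b c x y) = \<bar>binary_form a b c x y\<bar> * gcd (x1^2) (y1^2)"
    using gcd_mult_distrib_int[of "binary_form a b c x y" "x1^2" "y1^2"] by (simp only: mult.commute)
  ultimately show ?thesis by simp
qed

text \<open>The linear form belongs to the conjugate root modulo \<open>p\<close>: its product with
  \<open>y1 x - x1 y\<close> is \<open>y1^2 F(x, y)\<close> modulo \<open>F(x1, y1)\<close>.\<close>

lemma binary_form_dvd_conjugate:
  assumes "prime p" "\<not> p dvd y1" "p dvd binary_form a b c x1 y1" "p dvd a * y1 * x + (b * y1 + a * x1) * y"
  shows "p dvd binary_form a b c x y"
proof -
  have "y1^2 * binary_form a b c x y = (y1 * x - x1 * y) * (a * y1 * x + (b * y1 + a * x1) * y) + binary_form a b c x1 y1 * y^2"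
    by (simp add: binary_form_def algebra_simps power2_eq_square)
  then have "p dvd y1^2 * binary_form a b c x y" using assms(3,4) by simp
  then show ?thesis using assms(1,2) prime_dvd_power by (auto simp: prime_dvd_mult_iff)
qed

text \<open>The determinant of the two linear forms is \<open>y1 (2 a x1 + b y1)\<close>, and the
  square of \<open>2 a x1 + b y1\<close> is the discriminant times \<open>y1^2\<close> modulo
  \<open>F(x1, y1)\<close>. So the two roots are distinct modulo \<open>p\<close>.\<close>

lemma conjugate_forms_dvd:
  assumes p: "prime p" "\<not> p dvd y1" "\<not> p dvd b^2 - 4 * a * c" "p dvd binary_form a b c x1 y1"
    and 1: "p dvd y1 * x - x1 * y" and 2: "p dvd a * y1 * x + (b * y1 + a * x1) * y"
  shows "p dvd x \<and> p dvd y"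
proof -
  have "(2 * a * x1 + b * y1) * y = (a * y1 * x + (b * y1 + a * x1) * y) - a * (y1 * x - x1 * y)" by (simp add: algebra_simps)
  then have "p dvd (2 * a * x1 + b * y1) * y" using 1 2 by simp
  moreover have "\<not> p dvd 2 * a * x1 + b * y1"
  proof
    assume "p dvd 2 * a * x1 + b * y1"
    then have "p dvd (2 * a * x1 + b * y1) * (2 * a * x1 + b * y1) - 4 * a * binary_form a b c x1 y1" using p(4) by simp
    moreover have "(2 * a * x1 + b * y1) * (2 * a * x1 + b * y1) - 4 * a * binary_form a b c x1 y1 = (b^2 - 4 * a * c) * y1^2"
      by (simp add: binary_form_def algebra_simps power2_eq_square)
    ultimately show False using p prime_dvd_power by (auto simp: prime_dvd_mult_iff)
  qed
  ultimately have y: "p dvd y" using p(1) by (auto simp: prime_dvd_mult_iff)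
  then have "p dvd (y1 * x - x1 * y) + x1 * y" using 1 by (intro dvd_add) auto
  then have "p dvd x" using p(1,2) by (auto simp: prime_dvd_mult_iff)
  then show ?thesis using y by blast
qed

lemma abs_binary_form_le:
  assumes "x^2 \<le> n" "y^2 \<le> n"
  shows "\<bar>binary_form a b c x y\<bar> \<le> (\<bar>a\<bar> + \<bar>b\<bar> + \<bar>c\<bar>) * n"
proof -
  have "(\<bar>x\<bar> - \<bar>y\<bar>)^2 \<ge> 0" by simp
  then have "2 * (\<bar>x\<bar> * \<bar>y\<bar>) \<le> x^2 + y^2" by (simp add: power2_eq_square algebra_simps)
  then have xy: "\<bar>x\<bar> * \<bar>y\<bar> \<le> n" using assms by linarith
  have "\<bar>binary_form a b c x y\<bar> \<le> \<bar>a * x^2\<bar> + \<bar>b * x * y\<bar> + \<bar>c * y^2\<bar>" unfolding binary_form_def by linarith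
  also have "\<dots> = \<bar>a\<bar> * x^2 + \<bar>b\<bar> * (\<bar>x\<bar> * \<bar>y\<bar>) + \<bar>c\<bar> * y^2" by (simp add: abs_mult)
  also have "\<dots> \<le> \<bar>a\<bar> * n + \<bar>b\<bar> * n + \<bar>c\<bar> * n" using assms xy by (intro add_mono mult_left_mono) auto
  finally show ?thesis by (simp add: algebra_simps)
qed

lemma binary_form_scale: "binary_form a b c (g * x) (g * y) = g^2 * binary_form a b c x y"
  by (simp add: binary_form_def algebra_simps power2_eq_square)

text \<open>One linear congruence modulo \<open>n1\<close> is assembled from the root
  \<open>(x1 : y1)\<close> modulo \<open>e = n1 / \<Prod>I\<close> and the conjugate root modulo
  each prime of \<open>I\<close>; exact divisibility makes these moduli coprime. Thue's lemma gives
  a short solution, and there the form is divisible by \<open>n1\<close>.\<close>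

lemma primitive_small_multiples:
  fixes a b c x1 y1 n1 :: int and K I :: "int set"
  assumes n1: "n1 > 0" "binary_form a b c x1 y1 = n1" and cop: "coprime x1 y1"
    and K: "finite I" "\<And>p. p \<in> I \<Longrightarrow> prime p \<and> p dvd n1 \<and> \<not> p^2 dvd n1 \<and> \<not> p dvd y1"
  shows "\<exists>x y. (x \<noteq> 0 \<or> y \<noteq> 0) \<and> x^2 \<le> n1 \<and> y^2 \<le> n1 \<and> n1 dvd binary_form a b c x y \<and>
     (\<forall>p\<in>I. p dvd a * y1 * x + (b * y1 + a * x1) * y) \<and> (\<forall>p. prime p \<longrightarrow> p dvd n1 \<longrightarrow> p \<notin> I \<longrightarrow> p dvd y1 * x - x1 * y)"
proof -
  have "\<Prod>I dvd n1" using K by (intro prod_primes_dvd) auto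
  then obtain e where e: "n1 = \<Prod>I * e" by (elim dvdE)
  have P0: "\<Prod>I > 0" using K by (intro prod_pos) (auto simp: prime_gt_0_int)
  have e0: "e > 0" using n1(1) P0 unfolding e by (simp add: zero_less_mult_iff)
  have cope: "coprime e p" if p: "p \<in> I" for p
  proof -
    have "\<not> p dvd e"
    proof
      assume "p dvd e"
      moreover have "p dvd \<Prod>I" using K(1) p by (intro dvd_prodI)
      ultimately have "p * p dvd n1" unfolding e by (intro mult_dvd_mono)
      then show False using K(2)[OF p] by (simp add: power2_eq_square)
    qed
    then show ?thesis using K(2)[OF p] prime_imp_coprime[of p e] coprime_commute by blast
  qed
  have eI: "e \<notin> I"
  proof
    assume "e \<in> I"
    then have "prime e" "coprime e e" using K(2) cope by blast+
    then have "is_unit e" by simp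
    then show False using \<open>prime e\<close> not_prime_unit by blast
  qed
  \<comment> \<open>\<open>f m\<close> holds the two coefficients of the congruence modulo
    \<open>m\<close>; the index type \<open>bool\<close> stands for the two coordinates, so that
    \<open>chinese_remainder_vector\<close> applies.\<close>
  define f where "f m i = (if m \<in> I then (if i then a * y1 else b * y1 + a * x1) else (if i then y1 else - x1))" for m and i :: bool
  have "\<exists>l. \<forall>m\<in>insert e I. \<forall>i. [l i = f m i] (mod m)"
  proof (rule chinese_remainder_vector)
    show "finite (insert e I)" using K(1) by simp
    show "m > 0" if "m \<in> insert e I" for m using that e0 K(2) prime_gt_0_int by blast
    show "coprime m m'" if m: "m \<in> insert e I" "m' \<in> insert e I" "m \<noteq> m'" for m m'
    proof -
      consider "m = e" "m' \<in> I" | "m' = e" "m \<in> I" | "m \<in> I" "m' \<in> I" using m by blast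
      then show ?thesis
      proof cases
        case 1 then show ?thesis using cope by blast
      next
        case 2 then show ?thesis using cope[of m] coprime_commute by blast
      next
        case 3 then show ?thesis using K(2) m(3) by (intro primes_coprime) auto
      qed
    qed
  qed
  then obtain l where l: "\<And>m i. m \<in> insert e I \<Longrightarrow> [l i = f m i] (mod m)" by blast
  obtain x y where xy: "x \<noteq> 0 \<or> y \<noteq> 0" "x^2 \<le> n1" "y^2 \<le> n1" "n1 dvd l True * x + l False * y" using thue[OF n1(1)] by blast
  have form: "m dvd f m True * x + f m False * y" if m: "m \<in> insert e I" for m
  proof -
    have "m dvd n1" using m
    proof
      assume "m \<in> I"
      then show ?thesis using K(2) by blast
    qed (simp add: e)
    then have "m dvd l True * x + l False * y" using xy(4) dvd_trans by blast
    moreover have "[l True * x + l False * y = f m True * x + f m False * y] (mod m)"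
      by (intro cong_add cong_scalar_right l m)
    ultimately show ?thesis using cong_dvd_iff by blast
  qed
  have fe: "e dvd y1 * x - x1 * y" using form[of e] eI by (simp add: f_def)
  have fI: "p dvd a * y1 * x + (b * y1 + a * x1) * y" if "p \<in> I" for p using form[of p] that by (simp add: f_def)
  have "e dvd binary_form a b c x y" by (rule binary_form_dvd[OF cop _ fe]) (simp add: n1 e)
  moreover have "\<Prod>I dvd binary_form a b c x y"
  proof (rule prod_primes_dvd[OF K(1)])
    fix p assume p: "p \<in> I"
    show "p dvd binary_form a b c x y" by (rule binary_form_dvd_conjugate[OF _ _ _ fI[OF p]]) (use K(2)[OF p] n1 in auto)
  qed (use K(2) in blast)
  moreover have "coprime (\<Prod>I) e" using cope by (intro prod_coprime_left) (simp add: coprime_commute)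
  ultimately have "n1 dvd binary_form a b c x y" unfolding e using divides_mult by blast
  moreover have "p dvd y1 * x - x1 * y" if p: "prime p" "p dvd n1" "p \<notin> I" for p
  proof -
    have "\<not> p dvd \<Prod>I"
    proof
      assume "p dvd \<Prod>I"
      then obtain r where "r \<in> I" "p dvd r" using prime_dvd_prod_iff[OF K(1) p(1)] by auto
      then have "p = r" using p(1) K(2) primes_dvd_imp_eq by blast
      then show False using \<open>r \<in> I\<close> p(3) by blast
    qed
    then have "p dvd e" using p(1,2) unfolding e by (simp add: prime_dvd_mult_iff)
    then show ?thesis using fe dvd_trans by blast
  qed
  ultimately show ?thesis using xy fI by blast
qed

text \<open>Different subsets \<open>I\<close> give different points: at a common point, a prime
  \<open>p\<close> in one set but not in the other divides both coordinates, so \<open>p^2\<close>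
  divides the value \<open>n1 h\<close>. As \<open>p\<close> divides \<open>n1\<close> exactly once,
  it divides \<open>h\<close>; but \<open>0 < |h| <= |a| + |b| + |c| < p\<close>, where
  \<open>h\<close> is nonzero by anisotropy. The common factor \<open>g\<close> of \<open>x0\<close>
  and \<open>y0\<close> is removed first and restored at the end.\<close>

lemma many_small_multiples:
  fixes a b c x0 y0 n :: int and K :: "int set"
  assumes aniso: "\<And>x y. binary_form a b c x y = 0 \<Longrightarrow> x = 0 \<and> y = 0"
    and n: "n > 0" "binary_form a b c x0 y0 = n"
    and K: "finite K" "\<And>p. p \<in> K \<Longrightarrow> prime p \<and> p dvd n \<and> \<not> p^2 dvd n \<and> \<not> p dvd a \<and> \<not> p dvd b^2 - 4 * a * c \<and> p > \<bar>a\<bar> + \<bar>b\<bar> + \<bar>c\<bar>"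
  shows "2 ^ card K \<le> card {(x,y). x^2 \<le> n \<and> y^2 \<le> n \<and> binary_form a b c x y \<noteq> 0 \<and> n dvd binary_form a b c x y}" (is "_ \<le> card ?W")
proof -
  define g where "g = gcd x0 y0"
  have "x0 \<noteq> 0 \<or> y0 \<noteq> 0" using n by (auto simp: binary_form_def)
  then have g0: "g > 0" unfolding g_def by (simp add: gcd_pos_int)
  obtain x1 y1 where xy1: "x0 = g * x1" "y0 = g * y1" "coprime x1 y1"
    using gcd_coprime_exists[of x0 y0] g0 unfolding g_def by (auto simp: mult.commute)
  define n1 where "n1 = binary_form a b c x1 y1"
  have ng: "n = g^2 * n1" using n(2) unfolding xy1 binary_form_scale n1_def by simp
  have n10: "n1 > 0" using n(1) g0 unfolding ng by (simp add: zero_less_mult_iff)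
  have Kn1: "prime p \<and> p dvd n1 \<and> \<not> p^2 dvd n1 \<and> \<not> p dvd y1" if p: "p \<in> K" for p
  proof -
    have pg: "\<not> p dvd g"
    proof
      assume "p dvd g"
      then have "p^2 dvd g^2" by simp
      then show False using K(2)[OF p] ng by (simp add: dvd_mult2)
    qed
    then have 1: "p dvd n1" using K(2)[OF p] unfolding ng using prime_dvd_power[of p g 2] by (auto simp: prime_dvd_mult_iff)
    have 2: "\<not> p^2 dvd n1" using K(2)[OF p] unfolding ng by auto
    have "\<not> p dvd y1"
    proof
      assume y: "p dvd y1"
      have "a * x1^2 = n1 - y1 * (b * x1 + c * y1)" by (simp add: n1_def binary_form_def algebra_simps power2_eq_square)
      then have "p dvd a * x1^2" using 1 y by simp
      then have "p dvd x1" using K(2)[OF p] prime_dvd_power[of p x1 2] by (auto simp: prime_dvd_mult_iff)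
      then have "p dvd 1" using y xy1(3) coprime_common_divisor[of x1 y1 p] by blast
      then show False using K(2)[OF p] not_prime_unit by blast
    qed
    then show ?thesis using 1 2 K(2)[OF p] by blast
  qed
  have "\<exists>z. (fst z \<noteq> 0 \<or> snd z \<noteq> 0) \<and> fst z^2 \<le> n1 \<and> snd z^2 \<le> n1 \<and> n1 dvd binary_form a b c (fst z) (snd z) \<and>
     (\<forall>p\<in>I. p dvd a * y1 * fst z + (b * y1 + a * x1) * snd z) \<and> (\<forall>p. prime p \<longrightarrow> p dvd n1 \<longrightarrow> p \<notin> I \<longrightarrow> p dvd y1 * fst z - x1 * snd z)" if "I \<in> Pow K" for I
  proof -
    have "finite I" using that K(1) finite_subset by blast
    moreover have "prime p \<and> p dvd n1 \<and> \<not> p^2 dvd n1 \<and> \<not> p dvd y1" if p: "p \<in> I" for p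
      by (rule Kn1) (use p \<open>I \<in> Pow K\<close> in blast)
    ultimately have "\<exists>x y. (x \<noteq> 0 \<or> y \<noteq> 0) \<and> x^2 \<le> n1 \<and> y^2 \<le> n1 \<and> n1 dvd binary_form a b c x y \<and>
     (\<forall>p\<in>I. p dvd a * y1 * x + (b * y1 + a * x1) * y) \<and> (\<forall>p. prime p \<longrightarrow> p dvd n1 \<longrightarrow> p \<notin> I \<longrightarrow> p dvd y1 * x - x1 * y)"
      by (rule primitive_small_multiples[OF n10 n1_def[symmetric] xy1(3)])
    then show ?thesis unfolding split_paired_Ex fst_conv snd_conv .
  qed
  then have "\<exists>Z. \<forall>I\<in>Pow K. (fst (Z I) \<noteq> 0 \<or> snd (Z I) \<noteq> 0) \<and> fst (Z I)^2 \<le> n1 \<and> snd (Z I)^2 \<le> n1 \<and> n1 dvd binary_form a b c (fst (Z I)) (snd (Z I)) \<and>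
     (\<forall>p\<in>I. p dvd a * y1 * fst (Z I) + (b * y1 + a * x1) * snd (Z I)) \<and> (\<forall>p. prime p \<longrightarrow> p dvd n1 \<longrightarrow> p \<notin> I \<longrightarrow> p dvd y1 * fst (Z I) - x1 * snd (Z I))"
    by (intro bchoice ballI) blast
  then obtain Z where Z: "\<And>I. I \<in> Pow K \<Longrightarrow> fst (Z I) \<noteq> 0 \<or> snd (Z I) \<noteq> 0" "\<And>I. I \<in> Pow K \<Longrightarrow> fst (Z I)^2 \<le> n1" "\<And>I. I \<in> Pow K \<Longrightarrow> snd (Z I)^2 \<le> n1"
     "\<And>I. I \<in> Pow K \<Longrightarrow> n1 dvd binary_form a b c (fst (Z I)) (snd (Z I))"
     "\<And>I p. I \<in> Pow K \<Longrightarrow> p \<in> I \<Longrightarrow> p dvd a * y1 * fst (Z I) + (b * y1 + a * x1) * snd (Z I)"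
     "\<And>I p. I \<in> Pow K \<Longrightarrow> prime p \<Longrightarrow> p dvd n1 \<Longrightarrow> p \<notin> I \<Longrightarrow> p dvd y1 * fst (Z I) - x1 * snd (Z I)"
    by blast
  have sep: "Z I \<noteq> Z J" if IJ: "I \<in> Pow K" "J \<in> Pow K" "p \<in> I" "p \<notin> J" for I J p
  proof
    assume eq: "Z I = Z J"
    define x where "x = fst (Z I)"
    define y where "y = snd (Z I)"
    have pK: "p \<in> K" using IJ by blast
    have "p dvd x \<and> p dvd y"
    proof (rule conjugate_forms_dvd)
      show "p dvd a * y1 * x + (b * y1 + a * x1) * y" using Z(5)[OF IJ(1,3)] by (simp add: x_def y_def)
      show "p dvd y1 * x - x1 * y" using Z(6)[OF IJ(2) _ _ IJ(4)] Kn1[OF pK] by (simp add: x_def y_def eq)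
      show "p dvd binary_form a b c x1 y1" using Kn1[OF pK] by (simp add: n1_def)
    qed (use Kn1[OF pK] K(2)[OF pK] in auto)
    then obtain x' y' where xy': "x = p * x'" "y = p * y'" by (auto elim!: dvdE)
    obtain h where h: "binary_form a b c x y = n1 * h" using Z(4)[OF IJ(1)] unfolding x_def y_def by (elim dvdE)
    have h0: "h \<noteq> 0"
    proof
      assume "h = 0"
      then have "binary_form a b c x y = 0" using h by simp
      then have "x = 0 \<and> y = 0" by (rule aniso)
      then show False using Z(1)[OF IJ(1)] by (simp add: x_def y_def)
    qed
    have "p^2 dvd n1 * h" unfolding h[symmetric] xy' binary_form_scale by simp
    moreover obtain n2 where n2: "n1 = p * n2" using Kn1[OF pK] by (auto elim: dvdE)
    have "p > 0" using Kn1[OF pK] prime_gt_0_int by blast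
    ultimately have "p * p dvd p * (n2 * h)" unfolding n2 by (simp only: power2_eq_square mult.assoc)
    then have "p dvd n2 * h" using \<open>p > 0\<close> by (simp only: dvd_times_left_cancel_iff)
    moreover have "\<not> p dvd n2" using Kn1[OF pK] unfolding n2 by (metis dvd_refl mult_dvd_mono power2_eq_square)
    ultimately have "p dvd h" using Kn1[OF pK] by (auto simp: prime_dvd_mult_iff)
    then have "p \<le> \<bar>h\<bar>" using h0 \<open>p > 0\<close> dvd_imp_le_int[of h p] by simp
    moreover have "n1 * \<bar>h\<bar> \<le> n1 * (\<bar>a\<bar> + \<bar>b\<bar> + \<bar>c\<bar>)"
      using abs_binary_form_le[OF Z(2,3)[OF IJ(1)], of a b c] n10 h by (simp add: x_def y_def abs_mult mult.commute)
    then have "\<bar>h\<bar> \<le> \<bar>a\<bar> + \<bar>b\<bar> + \<bar>c\<bar>" using n10 by simp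
    ultimately show False using K(2)[OF pK] by linarith
  qed
  define Z' where "Z' I = (g * fst (Z I), g * snd (Z I))" for I
  have inj: "inj_on Z' (Pow K)"
  proof (rule inj_onI)
    fix I J assume IJ: "I \<in> Pow K" "J \<in> Pow K" "Z' I = Z' J"
    then have "Z I = Z J" using g0 by (simp add: Z'_def prod_eq_iff)
    then have "p \<in> J" if "p \<in> I" for p using sep[OF IJ(1,2) that] by blast
    moreover have "p \<in> I" if "p \<in> J" for p using sep[OF IJ(2,1) that] \<open>Z I = Z J\<close> by metis
    ultimately show "I = J" by blast
  qed
  have sub: "Z' ` Pow K \<subseteq> ?W"
  proof
    fix z assume "z \<in> Z' ` Pow K"
    then obtain I where I: "I \<in> Pow K" "z = Z' I" by blast
    have "(g * fst (Z I))^2 \<le> n" "(g * snd (Z I))^2 \<le> n" unfolding ng power_mult_distrib using Z(2,3)[OF I(1)] by (auto intro!: mult_left_mono)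
    moreover have "binary_form a b c (g * fst (Z I)) (g * snd (Z I)) \<noteq> 0"
      using aniso[of "g * fst (Z I)" "g * snd (Z I)"] Z(1)[OF I(1)] g0 by fastforce
    moreover have "n dvd binary_form a b c (g * fst (Z I)) (g * snd (Z I))"
      unfolding binary_form_scale ng using Z(4)[OF I(1)] by (rule mult_dvd_mono[OF dvd_refl])
    ultimately show "z \<in> ?W" by (simp add: I Z'_def)
  qed
  have fin: "finite ?W"
  proof (rule finite_subset)
    have sq: "\<bar>x\<bar> \<le> n" if "x^2 \<le> n" for x
    proof (rule ccontr)
      assume "\<not> \<bar>x\<bar> \<le> n"
      then have "n * 1 < \<bar>x\<bar> * \<bar>x\<bar>" using n(1) by (intro mult_less_le_imp_less) auto
      then show False using that by (simp add: power2_eq_square)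
    qed
    show "?W \<subseteq> {-n..n} \<times> {-n..n}"
    proof
      fix z assume "z \<in> ?W"
      then have "(fst z)^2 \<le> n" "(snd z)^2 \<le> n" by auto
      then have "\<bar>fst z\<bar> \<le> n" "\<bar>snd z\<bar> \<le> n" using sq by blast+
      then show "z \<in> {-n..n} \<times> {-n..n}" by (cases z) auto
    qed
  qed simp
  have "2 ^ card K = card (Pow K)" using K(1) by (simp add: card_Pow)
  also have "\<dots> = card (Z' ` Pow K)" by (rule card_image[OF inj, symmetric])
  also have "\<dots> \<le> card ?W" by (rule card_mono[OF fin sub])
  finally show ?thesis .
qed

text \<open>A triple \<open>(n, x, y)\<close> is recovered from the point and the quotient
  \<open>h\<close> of the value by \<open>n\<close>. The points lie in a square of side
  \<open>2 sqrt N\<close> and \<open>|h| <= |a| + |b| + |c|\<close>, so there are O(N) triples,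
  whereas each \<open>n\<close> in \<open>B\<close> occurs in at least \<open>2^k\<close> of
  them.\<close>

lemma card_small_multiples_le:
  fixes a b c :: int and B :: "nat set"
  assumes B: "B \<subseteq> {1..N}" and N: "N \<ge> 1"
    and W: "\<And>n. n \<in> B \<Longrightarrow> 2 ^ k \<le> card {(x,y). x^2 \<le> int n \<and> y^2 \<le> int n \<and> binary_form a b c x y \<noteq> 0 \<and> int n dvd binary_form a b c x y}"
  shows "2 ^ k * real (card B) \<le> 9 * (2 * (\<bar>a\<bar> + \<bar>b\<bar> + \<bar>c\<bar>) + 1) * N"
proof -
  define C where "C = \<bar>a\<bar> + \<bar>b\<bar> + \<bar>c\<bar>"
  have C0: "C \<ge> 0" by (simp add: C_def)
  define W' where "W' n = {(x,y). x^2 \<le> int n \<and> y^2 \<le> int n \<and> binary_form a b c x y \<noteq> 0 \<and> int n dvd binary_form a b c x y}" for n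
  have finB: "finite B" using B finite_subset by blast
  have finW: "finite (W' n)" if "n \<in> B" for n
  proof (rule card_ge_0_finite)
    have "(0::nat) < 2 ^ k" by simp
    also have "\<dots> \<le> card (W' n)" using W[OF that] by (simp only: W'_def)
    finally show "0 < card (W' n)" .
  qed
  define r where "r = \<lfloor>sqrt (real N)\<rfloor>"
  have r1: "r \<ge> 1" using N by (simp add: r_def le_floor_iff)
  have rN: "real_of_int r * real_of_int r \<le> real N"
  proof -
    have "real_of_int r \<le> sqrt (real N)" by (simp add: r_def)
    then have "real_of_int r * real_of_int r \<le> sqrt (real N) * sqrt (real N)" using r1 by (intro mult_mono) auto
    then show ?thesis by simp
  qed
  have sq: "z \<in> {-r..r}" if z: "z^2 \<le> int n" "n \<le> N" for z n
  proof -
    have "z^2 \<le> int N" using z by linarith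
    then have "real_of_int (z^2) \<le> real_of_int (int N)" by (simp only: of_int_le_iff)
    then have "(real_of_int z)^2 \<le> real N" by simp
    then have "\<bar>real_of_int z\<bar> \<le> sqrt (real N)" using real_sqrt_le_mono by fastforce
    then have "real_of_int \<bar>z\<bar> \<le> sqrt (real N)" by simp
    then have "\<bar>z\<bar> \<le> r" by (simp only: r_def le_floor_iff)
    then show ?thesis by auto
  qed
  define \<phi> where "\<phi> = (\<lambda>(n::nat, x, y). ((x, y), binary_form a b c x y div int n))"
  have mem: "n \<in> {1..N} \<and> x^2 \<le> int n \<and> y^2 \<le> int n \<and> binary_form a b c x y \<noteq> 0 \<and> binary_form a b c x y = int n * (binary_form a b c x y div int n)"
    if "(n, x, y) \<in> Sigma B W'" for n x y using that B by (auto simp: W'_def)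
  have inj: "inj_on \<phi> (Sigma B W')"
  proof (rule inj_onI)
    fix s t assume s: "s \<in> Sigma B W'" and t: "t \<in> Sigma B W'" and eq: "\<phi> s = \<phi> t"
    obtain n x y where S: "s = (n, x, y)" by (cases s) auto
    obtain n' x' y' where T: "t = (n', x', y')" by (cases t) auto
    have xy: "x' = x" "y' = y" and h: "binary_form a b c x y div int n = binary_form a b c x y div int n'" using eq unfolding S T \<phi>_def by auto
    have "binary_form a b c x y \<noteq> 0" "binary_form a b c x y = int n * (binary_form a b c x y div int n)" using mem[of n x y] s S by blast+
    moreover have "binary_form a b c x y = int n' * (binary_form a b c x y div int n)" using mem[of n' x' y'] t T h xy by metis
    ultimately have "int n = int n'" by (metis mult_cancel_right mult_zero_right)
    then show "s = t" using S T xy by simp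
  qed
  have sub: "\<phi> ` Sigma B W' \<subseteq> ({-r..r} \<times> {-r..r}) \<times> {-C..C}"
  proof
    fix w assume "w \<in> \<phi> ` Sigma B W'"
    then obtain n x y where s: "(n, x, y) \<in> Sigma B W'" "w = ((x, y), binary_form a b c x y div int n)" by (auto simp: \<phi>_def)
    define h where "h = binary_form a b c x y div int n"
    note m = mem[OF s(1)]
    have "x \<in> {-r..r}" "y \<in> {-r..r}" using m sq[of x n] sq[of y n] by auto
    moreover have "int n * \<bar>h\<bar> \<le> int n * C"
    proof -
      have "\<bar>binary_form a b c x y\<bar> \<le> C * int n" unfolding C_def using m by (intro abs_binary_form_le) auto
      moreover have "\<bar>binary_form a b c x y\<bar> = int n * \<bar>h\<bar>"
      proof -
        have "binary_form a b c x y = int n * h" using m unfolding h_def by blast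
        then show ?thesis by (simp add: abs_mult)
      qed
      ultimately show ?thesis by (simp add: mult.commute)
    qed
    then have "\<bar>h\<bar> \<le> C" using m by simp
    then have "h \<in> {-C..C}" by auto
    ultimately show "w \<in> ({-r..r} \<times> {-r..r}) \<times> {-C..C}" using s(2) by (simp add: h_def)
  qed
  have "2 ^ k * card B = (\<Sum>n\<in>B. 2 ^ k)" by simp
  also have "\<dots> \<le> (\<Sum>n\<in>B. card (W' n))" using W by (intro sum_mono) (simp only: W'_def)
  also have "\<dots> = card (Sigma B W')" using finB finW by simp
  also have "\<dots> \<le> card (({-r..r} \<times> {-r..r}) \<times> {-C..C})" by (rule card_inj_on_le[OF inj sub]) simp
  also have "\<dots> = nat (2 * r + 1) * nat (2 * r + 1) * nat (2 * C + 1)" by (simp add: card_cartesian_product algebra_simps)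
  finally have "real (2 ^ k * card B) \<le> real (nat (2 * r + 1) * nat (2 * r + 1) * nat (2 * C + 1))" by (simp only: of_nat_le_iff)
  also have "\<dots> = real_of_int (2 * r + 1) * real_of_int (2 * r + 1) * real_of_int (2 * C + 1)" using r1 C0 by simp
  also have "\<dots> \<le> (3 * real_of_int r) * (3 * real_of_int r) * real_of_int (2 * C + 1)"
    using r1 C0 by (intro mult_mono mult_nonneg_nonneg) auto
  also have "\<dots> = 9 * (real_of_int r * real_of_int r) * real_of_int (2 * C + 1)" by simp
  also have "\<dots> \<le> 9 * real N * real_of_int (2 * C + 1)" using rN C0 by (intro mult_right_mono) auto
  finally show ?thesis by (simp add: C_def mult_ac)
qed

text \<open>By the two preceding counts only O(N / 2^k) values up to \<open>N\<close> have at least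
  \<open>k\<close> exact prime divisors in \<open>P\<close>; by the variance argument the integers
  with fewer have density zero. Primes up to \<open>Q\<close> are left out so that those in
  \<open>P\<close> divide neither \<open>a\<close> nor the discriminant and exceed
  \<open>|a| + |b| + |c|\<close>.\<close>

lemma anisotropic_binary_zero_density:
  fixes a b c :: int
  assumes aniso: "\<And>x y. binary_form a b c x y = 0 \<Longrightarrow> x = 0 \<and> y = 0"
  shows "zero_density {d. d > 0 \<and> (\<exists>x y. int d = binary_form a b c x y)}"
proof -
  define D where "D = {d::nat. d > 0 \<and> (\<exists>x y. int d = binary_form a b c x y)}"
  have a0: "a \<noteq> 0" using aniso[of 1 0] by (auto simp: binary_form_def)
  \<comment> \<open>The point \<open>(- b, 2 a)\<close> detects a vanishing discriminant as a
    nontrivial zero.\<close>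
  have "binary_form a b c (- b) (2 * a) = - (a * (b^2 - 4 * a * c))" by (simp add: binary_form_def algebra_simps power2_eq_square)
  then have d0: "b^2 - 4 * a * c \<noteq> 0" using aniso[of "-b" "2 * a"] a0 by auto
  define Q where "Q = nat (\<bar>a\<bar> + \<bar>b\<bar> + \<bar>c\<bar> + \<bar>b^2 - 4 * a * c\<bar>)"
  define P where "P = {p. prime p \<and> p > Q}"
  have "{p. prime p} = P \<union> {p. prime p \<and> p \<le> Q}" by (auto simp: P_def)
  then have "divergent_reciprocals P \<or> divergent_reciprocals {p. prime p \<and> p \<le> Q}"
    using divergent_prime_reciprocals divergent_reciprocals_Un by simp
  moreover have "\<not> divergent_reciprocals {p. prime p \<and> p \<le> Q}" by (rule finite_not_divergent_reciprocals) simp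
  ultimately have div: "divergent_reciprocals P" by blast
  have big: "\<not> int p dvd a" "\<not> int p dvd b^2 - 4 * a * c" "int p > \<bar>a\<bar> + \<bar>b\<bar> + \<bar>c\<bar>" "prime p" if "p \<in> P" for p
  proof -
    have p: "int p > \<bar>a\<bar> + \<bar>b\<bar> + \<bar>c\<bar> + \<bar>b^2 - 4 * a * c\<bar>" and "prime p" using that by (auto simp: P_def Q_def)
    show "\<not> int p dvd a" using dvd_imp_le_int[OF a0, of "int p"] p by auto
    show "\<not> int p dvd b^2 - 4 * a * c" using dvd_imp_le_int[OF d0, of "int p"] p by auto
    show "int p > \<bar>a\<bar> + \<bar>b\<bar> + \<bar>c\<bar>" using p by linarith
    show "prime p" by fact
  qed
  define E where "E n = {p\<in>P. exactly_divides p n}" for n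
  have mult: "2 ^ k \<le> card {(x,y). x^2 \<le> int n \<and> y^2 \<le> int n \<and> binary_form a b c x y \<noteq> 0 \<and> int n dvd binary_form a b c x y}"
    if n: "n \<in> D" "k \<le> card (E n)" for n k
  proof -
    obtain x0 y0 where xy: "n > 0" "binary_form a b c x0 y0 = int n" using n(1) by (auto simp: D_def)
    have fin: "finite (E n)" by (rule finite_subset[of _ "{..n}"]) (use xy(1) in \<open>auto simp: E_def exactly_divides_def dvd_imp_le\<close>)
    have "(2::nat) ^ k \<le> 2 ^ card (int ` E n)" using n(2) by (intro power_increasing) (auto simp: card_image)
    also have "\<dots> \<le> card {(x,y). x^2 \<le> int n \<and> y^2 \<le> int n \<and> binary_form a b c x y \<noteq> 0 \<and> int n dvd binary_form a b c x y}"
    proof (rule many_small_multiples[OF _ _ xy(2)])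
      fix q assume "q \<in> int ` E n"
      then obtain p where p: "q = int p" "p \<in> P" "p dvd n" "\<not> p^2 dvd n" by (auto simp: E_def exactly_divides_def)
      have "\<not> q^2 dvd int n" using p(4) unfolding p(1) by (metis int_dvd_int_iff of_nat_power)
      then show "prime q \<and> q dvd int n \<and> \<not> q^2 dvd int n \<and> \<not> q dvd a \<and> \<not> q dvd b^2 - 4 * a * c \<and> q > \<bar>a\<bar> + \<bar>b\<bar> + \<bar>c\<bar>"
        using big[OF p(2)] p(3) unfolding p(1) by simp
    next
      fix x y assume "binary_form a b c x y = 0"
      then show "x = 0 \<and> y = 0" by (rule aniso)
    qed (use xy fin in auto)
    finally show ?thesis .
  qed
  define H where "H = real_of_int (9 * (2 * (\<bar>a\<bar> + \<bar>b\<bar> + \<bar>c\<bar>) + 1))"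
  have H0: "H > 0" by (simp add: H_def)
  show ?thesis unfolding D_def[symmetric] zero_density_def
  proof (intro allI impI)
    fix \<epsilon> :: real assume \<epsilon>: "\<epsilon> > 0"
    obtain k where k: "2 * H / \<epsilon> < 2 ^ k" using real_arch_pow[of 2 "2 * H / \<epsilon>"] by auto
    have e2: "\<epsilon> / 2 > 0" using \<epsilon> by simp
    have "zero_density {m. card (E m) < k}" unfolding E_def by (rule few_exact_divisors_zero_density[OF _ div]) (simp add: P_def)
    then obtain N0 where N0: "\<And>N. N \<ge> N0 \<Longrightarrow> real (card ({m. card (E m) < k} \<inter> {1..N})) \<le> \<epsilon> / 2 * real N"
      using e2 unfolding zero_density_def by blast
    have "real (card (D \<inter> {1..N})) \<le> \<epsilon> * real N" if N: "N \<ge> N0 + 1" for N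
    proof -
      define B where "B = {n \<in> D \<inter> {1..N}. k \<le> card (E n)}"
      have "2 ^ k * real (card B) \<le> 9 * (2 * (\<bar>a\<bar> + \<bar>b\<bar> + \<bar>c\<bar>) + 1) * N"
        by (rule card_small_multiples_le) (use N mult in \<open>auto simp: B_def\<close>)
      then have "2 ^ k * real (card B) \<le> H * real N" by (simp add: H_def)
      moreover have "2 * H / \<epsilon> * real (card B) \<le> 2 ^ k * real (card B)" using k by (intro mult_right_mono) auto
      ultimately have "2 * H / \<epsilon> * real (card B) \<le> H * real N" by linarith
      then have "H * real (card B) \<le> H * (\<epsilon> / 2 * real N)" using \<epsilon> by (simp add: field_simps)
      then have cB: "real (card B) \<le> \<epsilon> / 2 * real N" using H0 by (simp only: mult_le_cancel_left_pos)
      have "D \<inter> {1..N} \<subseteq> B \<union> ({m. card (E m) < k} \<inter> {1..N})" by (auto simp: B_def)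
      then have "card (D \<inter> {1..N}) \<le> card (B \<union> ({m. card (E m) < k} \<inter> {1..N}))" by (rule card_mono[rotated]) (simp add: B_def)
      also have "\<dots> \<le> card B + card ({m. card (E m) < k} \<inter> {1..N})" by (rule card_Un_le)
      finally have "real (card (D \<inter> {1..N})) \<le> real (card B) + real (card ({m. card (E m) < k} \<inter> {1..N}))" by linarith
      then show ?thesis using cB N0[of N] N by linarith
    qed
    then show "\<exists>N0. \<forall>N\<ge>N0. real (card (D \<inter> {1..N})) \<le> \<epsilon> * real N" by blast
  qed
qed

section \<open>Forms according to the number of variables\<close>

lemma zero_density_singleton_0: "zero_density {0}"
  by (simp add: zero_density_def)

text \<open>A primitive zero is completed to a basis of the lattice, in which the coefficient of its
  square vanishes. The discriminant is invariant, so it equals \<open>B^2\<close> and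
  \<open>B\<close> is nonzero.\<close>

lemma isotropic_binary_normal_form:
  fixes a b c :: int
  assumes iso: "binary_form a b c x0 y0 = 0" "x0 \<noteq> 0 \<or> y0 \<noteq> 0" and disc: "b^2 - 4 * a * c \<noteq> 0"
  shows "\<exists>A B. B \<noteq> 0 \<and> (\<forall>d. (\<exists>x y. d = binary_form a b c x y) \<longleftrightarrow> (\<exists>x y. d = x * (A * x + B * y)))"
proof -
  define g where "g = gcd x0 y0"
  have g0: "g \<noteq> 0" using iso(2) unfolding g_def by simp
  obtain x1 y1 where xy1: "x0 = g * x1" "y0 = g * y1" "coprime x1 y1"
    using gcd_coprime_exists[of x0 y0] g0 unfolding g_def by (auto simp: mult.commute)
  have z: "binary_form a b c x1 y1 = 0" using iso(1) g0 unfolding xy1 binary_form_scale by simp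
  obtain u v where uv: "u * x1 + v * y1 = 1" using xy1(3) bezout_int[of x1 y1] by auto
  define A where "A = binary_form a b c (- v) u"
  define B where "B = - 2 * a * x1 * v + b * (x1 * u - y1 * v) + 2 * c * y1 * u"
  have "B^2 = 4 * A * binary_form a b c x1 y1 + (b^2 - 4 * a * c) * (u * x1 + v * y1)^2"
    by (simp add: A_def B_def binary_form_def algebra_simps power2_eq_square)
  then have "B^2 = b^2 - 4 * a * c" using z uv by simp
  then have "B \<noteq> 0" using disc by auto
  have F: "binary_form a b c (Y * x1 - X * v) (Y * y1 + X * u) = X * (A * X + B * Y)" for X Y
  proof -
    have "binary_form a b c (Y * x1 - X * v) (Y * y1 + X * u) = X * (A * X + B * Y) + Y^2 * binary_form a b c x1 y1"
      by (simp add: A_def B_def binary_form_def algebra_simps power2_eq_square)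
    then show ?thesis using z by simp
  qed
  have inv: "\<exists>X Y. x = Y * x1 - X * v \<and> y = Y * y1 + X * u" for x y
  proof (intro exI conjI)
    have "(u * x + v * y) * x1 - (x1 * y - y1 * x) * v = x * (u * x1 + v * y1)" by (simp add: algebra_simps)
    then show "x = (u * x + v * y) * x1 - (x1 * y - y1 * x) * v" using uv by simp
    have "(u * x + v * y) * y1 + (x1 * y - y1 * x) * u = y * (u * x1 + v * y1)" by (simp add: algebra_simps)
    then show "y = (u * x + v * y) * y1 + (x1 * y - y1 * x) * u" using uv by simp
  qed
  have "(\<exists>x y. d = binary_form a b c x y) \<longleftrightarrow> (\<exists>x y. d = x * (A * x + B * y))" for d
  proof
    assume "\<exists>x y. d = binary_form a b c x y"
    then obtain x y where d: "d = binary_form a b c x y" by blast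
    obtain X Y where "x = Y * x1 - X * v" "y = Y * y1 + X * u" using inv[of x y] by blast
    then have "d = X * (A * X + B * Y)" using d F[of Y X] by simp
    then show "\<exists>x y. d = x * (A * x + B * y)" by blast
  next
    assume "\<exists>x y. d = x * (A * x + B * y)"
    then show "\<exists>x y. d = binary_form a b c x y" using F by metis
  qed
  then show ?thesis using \<open>B \<noteq> 0\<close> by blast
qed

definition pos_values :: "('n::finite \<Rightarrow> 'n \<Rightarrow> int) \<Rightarrow> nat set" where
  "pos_values q = {d. d > 0 \<and> int d \<in> range (qf q)}"

text \<open>The multiples \<open>q x^2\<close> of squares are among the values of the anisotropic
  binary form \<open>q (x^2 + y^2)\<close>, so the result on such forms applies.\<close>

lemma unary_density:
  fixes q :: "'n::finite \<Rightarrow> 'n \<Rightarrow> int"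
  assumes U: "(UNIV :: 'n set) = {i}"
  shows "zero_density (pos_values q)"
proof (cases "q i i = 0")
  case True
  then have "pos_values q = {}" by (auto simp: pos_values_def qf_def U)
  then show ?thesis by (simp add: zero_density_def)
next
  case False
  have "zero_density {d. d > 0 \<and> (\<exists>x y. int d = binary_form (q i i) 0 (q i i) x y)}"
  proof (rule anisotropic_binary_zero_density)
    fix x y assume "binary_form (q i i) 0 (q i i) x y = 0"
    then have "q i i * (x^2 + y^2) = 0" by (simp add: binary_form_def algebra_simps)
    then have "x^2 + y^2 = 0" using False by simp
    then show "x = 0 \<and> y = 0" by (simp add: sum_power2_eq_zero_iff)
  qed
  then show ?thesis
  proof (rule zero_density_subset)
    show "pos_values q \<subseteq> {d. d > 0 \<and> (\<exists>x y. int d = binary_form (q i i) 0 (q i i) x y)}"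
    proof
      fix d assume "d \<in> pos_values q"
      then obtain x where d: "d > 0" "int d = qf q x" by (auto simp: pos_values_def)
      have "int d = binary_form (q i i) 0 (q i i) (x i) 0" using d(2) by (simp add: qf_def U binary_form_def power2_eq_square mult.assoc)
      then show "d \<in> {d. d > 0 \<and> (\<exists>x y. int d = binary_form (q i i) 0 (q i i) x y)}" using d(1) by blast
    qed
  qed
qed

lemma binary_density:
  fixes q Rm :: "'n::finite \<Rightarrow> 'n \<Rightarrow> int" and \<Delta> :: int
  assumes U: "(UNIV :: 'n set) = {i, j}" "i \<noteq> j"
    and inv: "\<And>x i. \<Delta> * x i = (\<Sum>j\<in>UNIV. Rm i j * wv q x j)" "\<Delta> \<noteq> 0"
  shows "\<exists>\<delta>\<in>\<rat>. (\<lambda>N. real (card (pos_values q \<inter> {1..N})) / real N) \<longlonglongrightarrow> \<delta>"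
proof -
  define a b c where "a = q i i" and "b = q i j + q j i" and "c = q j j"
  have qf2: "qf q x = binary_form a b c (x i) (x j)" for x
    unfolding qf_def U(1) using U(2) by (simp add: a_def b_def c_def binary_form_def algebra_simps power2_eq_square)
  have wv2: "wv q x i = 2 * a * x i + b * x j" "wv q x j = b * x i + 2 * c * x j" for x
    unfolding wv_def U(1) using U(2) by (simp_all add: a_def b_def c_def algebra_simps)
  have range2: "(int d \<in> range (qf q)) \<longleftrightarrow> (\<exists>x y. int d = binary_form a b c x y)" for d
  proof
    assume "\<exists>x y. int d = binary_form a b c x y"
    then obtain x y where "int d = binary_form a b c x y" by blast
    then have "int d = qf q (\<lambda>k. if k = i then x else y)" unfolding qf2 using U(2) by simp
    then show "int d \<in> range (qf q)" by (simp only: rangeI)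
  qed (auto simp: qf2)
  have D: "pos_values q = {d. d > 0 \<and> (\<exists>x y. int d = binary_form a b c x y)}" unfolding pos_values_def range2 ..
  show ?thesis
  proof (cases "\<exists>x y. binary_form a b c x y = 0 \<and> (x \<noteq> 0 \<or> y \<noteq> 0)")
    case False
    then have "zero_density (pos_values q)" unfolding D by (intro anisotropic_binary_zero_density) blast
    then show ?thesis by (intro bexI[of _ 0] zero_density_tendsto) auto
  next
    case True
    then obtain x0 y0 where xy: "binary_form a b c x0 y0 = 0" "x0 \<noteq> 0 \<or> y0 \<noteq> 0" by blast
    have rad: "x i = 0 \<and> x j = 0" if "2 * a * x i + b * x j = 0" "b * x i + 2 * c * x j = 0" for x
    proof -
      have w: "(\<Sum>k\<in>UNIV. Rm l k * wv q x k) = 0" for l unfolding U(1) using U(2) that by (simp add: wv2)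
      show ?thesis using inv(1)[of x i] inv(1)[of x j] inv(2) unfolding w by simp
    qed
    have disc: "b^2 - 4 * a * c \<noteq> 0"
    proof
      assume d: "b^2 - 4 * a * c = 0"
      \<comment> \<open>If the discriminant vanishes, \<open>(- b, 2 a)\<close> lies in the radical,
        hence is zero; but then \<open>(1, 0)\<close> lies in the radical as well.\<close>
      have "- b = 0 \<and> 2 * a = 0" using rad[of "\<lambda>k. if k = i then - b else 2 * a"] U(2) d by (simp add: power2_eq_square algebra_simps)
      then show False using rad[of "\<lambda>k. if k = i then 1 else 0"] U(2) by simp
    qed
    obtain A B where AB: "B \<noteq> 0" "\<And>d. (\<exists>x y. d = binary_form a b c x y) \<longleftrightarrow> (\<exists>x y. d = x * (A * x + B * y))"
      using isotropic_binary_normal_form[OF xy disc] by blast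
    show ?thesis unfolding D AB(2) by (rule isotropic_binary_density[OF AB(1)])
  qed
qed

lemma many_variables_density:
  fixes q Rm :: "'n::finite \<Rightarrow> 'n \<Rightarrow> int" and \<Delta> :: int
  assumes n: "CARD('n) \<ge> 3"
    and inv: "\<And>x i. \<Delta> * x i = (\<Sum>j\<in>UNIV. Rm i j * wv q x j)" "\<Delta> \<noteq> 0"
  shows "\<exists>\<delta>\<in>\<rat>. (\<lambda>N. real (card (pos_values q \<inter> {1..N})) / real N) \<longlonglongrightarrow> \<delta>"
proof (rule rational_density_dichotomy)
  show "48 * nat \<bar>\<Delta>\<bar> > 0" using inv(2) by simp
  fix d p :: nat assume "d \<in> pos_values q" and p: "prime p"
  then obtain x where d: "d > 0" "int d = qf q x" by (auto simp: pos_values_def)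
  have "int (p^2 * d) = qf q (\<lambda>i. int p * x i)" unfolding qf_scale using d(2) by simp
  then have "int (p^2 * d) \<in> range (qf q)" by (simp only: rangeI)
  then show "p^2 * d \<in> pos_values q" using d(1) p by (simp add: pos_values_def prime_gt_0_nat)
next
  fix s k m0 :: nat
  assume s: "s > 0" "s dvd (48 * nat \<bar>\<Delta>\<bar>) ^ k" and m0: "m0 > 0" "coprime m0 (48 * nat \<bar>\<Delta>\<bar>)" and "s * m0 \<in> pos_values q"
  then obtain x0 where x0: "qf q x0 = int (s * m0)" by (auto simp: pos_values_def)
  have "zero_density ({m. [m = m0] (mod 48 * nat \<bar>\<Delta>\<bar>) \<and> int (s * m) \<notin> range (qf q)} \<union> {0})"
    by (rule zero_density_Un[OF almost_all_represented[OF n inv s m0 x0] zero_density_singleton_0])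
  then show "zero_density {m. [m = m0] (mod 48 * nat \<bar>\<Delta>\<bar>) \<and> s * m \<notin> pos_values q}"
    by (rule zero_density_subset) (use s(1) in \<open>auto simp: pos_values_def\<close>)
qed

lemma rational_density_pos_values:
  fixes q Rm :: "'n::finite \<Rightarrow> 'n \<Rightarrow> int" and \<Delta> :: int
  assumes inv: "\<And>x i. \<Delta> * x i = (\<Sum>j\<in>UNIV. Rm i j * wv q x j)" "\<Delta> \<noteq> 0"
  shows "\<exists>\<delta>\<in>\<rat>. (\<lambda>N. real (card (pos_values q \<inter> {1..N})) / real N) \<longlonglongrightarrow> \<delta>"
proof -
  have "CARD('n) > 0" by simp
  then consider "CARD('n) = 1" | "CARD('n) = 2" | "CARD('n) \<ge> 3" by linarith
  then show ?thesis
  proof cases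
    case 1
    then obtain i where "(UNIV :: 'n set) = {i}" by (auto simp: card_1_singleton_iff)
    then show ?thesis by (intro bexI[of _ 0] zero_density_tendsto unary_density) auto
  next
    case 2
    then obtain i j where "(UNIV :: 'n set) = {i, j}" "i \<noteq> j" by (auto simp: card_2_iff)
    then show ?thesis by (rule binary_density[OF _ _ inv])
  next
    case 3
    then show ?thesis by (rule many_variables_density[OF _ inv])
  qed
qed

section \<open>The Gram matrix\<close>

lemma monomial_degree_2:
  fixes m :: "'n::finite \<Rightarrow>\<^sub>0 nat"
  assumes "(\<Sum>i\<in>UNIV. Poly_Mapping.lookup m i) = 2"
  shows "\<exists>i j. \<forall>k. Poly_Mapping.lookup m k = of_bool (k = i) + of_bool (k = j)"
proof -
  define g where "g = Poly_Mapping.lookup m"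
  have g: "(\<Sum>i\<in>UNIV. g i) = 2" using assms by (simp add: g_def)
  have "\<exists>i. g i > 0"
  proof (rule ccontr)
    assume "\<not> ?thesis"
    then have "(\<Sum>i\<in>UNIV. g i) = 0" by simp
    then show False using g by simp
  qed
  then obtain i where i: "g i > 0" by blast
  \<comment> \<open>The truncated subtraction is exact because \<open>g i > 0\<close>.\<close>
  have split: "g k = of_bool (k = i) + (g k - of_bool (k = i))" for k using i by auto
  have "(\<Sum>k\<in>UNIV. g k) = (\<Sum>k\<in>UNIV. of_bool (k = i)) + (\<Sum>k\<in>UNIV. g k - of_bool (k = i))"
    by (subst sum.distrib[symmetric]) (rule sum.cong[OF refl split])
  moreover have "(\<Sum>k\<in>UNIV. of_bool (k = i)) = (1::nat)" by (simp add: of_bool_def)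
  ultimately have "(\<Sum>k\<in>UNIV. g k - of_bool (k = i)) = 1" using g by simp
  then obtain j where "g j - of_bool (j = i) = 1 \<and> (\<forall>k\<in>UNIV. j \<noteq> k \<longrightarrow> g k - of_bool (k = i) = 0)"
    unfolding sum_eq_1_iff[OF finite] by (elim bexE)
  then have j: "g j - of_bool (j = i) = 1" "\<And>k. k \<noteq> j \<Longrightarrow> g k - of_bool (k = i) = 0" by simp_all
  have "g k = of_bool (k = i) + of_bool (k = j)" for k
  proof (cases "k = j")
    case True
    then show ?thesis using split[of k] j(1) by simp
  next
    case False
    then show ?thesis using split[of k] j(2)[OF False] by simp
  qed
  then show ?thesis unfolding g_def by blast
qed

lemma prod_power_of_bool:
  fixes x :: "'a::comm_ring_1 ^ 'n::finite"
  shows "(\<Prod>k\<in>UNIV. (x $ k) ^ (of_bool (k = i) + of_bool (k = j))) = x $ i * x $ j"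
proof -
  have "(\<Prod>k\<in>UNIV. (x $ k) ^ of_bool (k = l)) = x $ l" for l
  proof -
    have "(\<Prod>k\<in>UNIV. (x $ k) ^ of_bool (k = l)) = (\<Prod>k\<in>UNIV. if k = l then x $ k else 1)" by (rule prod.cong) auto
    then show ?thesis by simp
  qed
  then show ?thesis by (simp add: power_add prod.distrib)
qed

text \<open>The ring is left arbitrary so that one integer matrix serves both the integer values and
  the rational polar form. \<open>h\<close> chooses an order of the two indices of each monomial, so
  the matrix is in general not symmetric.\<close>

lemma poly_eval_degree_2:
  fixes f :: "('n::finite \<Rightarrow>\<^sub>0 nat) \<Rightarrow>\<^sub>0 int" and x :: "'a::comm_ring_1 ^ 'n"
  assumes h: "\<And>m k. m \<in> Poly_Mapping.keys f \<Longrightarrow> Poly_Mapping.lookup m k = of_bool (k = fst (h m)) + of_bool (k = snd (h m))"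
    and q_def: "\<And>i j. q i j = (\<Sum>m\<in>Poly_Mapping.keys f. Poly_Mapping.lookup f m * (of_bool (i = fst (h m)) * of_bool (j = snd (h m))))"
  shows "poly_eval f x = (\<Sum>i\<in>UNIV. \<Sum>j\<in>UNIV. of_int (q i j) * (x $ i * x $ j))"
proof -
  have "(\<Sum>i\<in>UNIV. \<Sum>j\<in>UNIV. of_int (q i j) * (x $ i * x $ j)) =
     (\<Sum>i\<in>UNIV. \<Sum>j\<in>UNIV. \<Sum>m\<in>Poly_Mapping.keys f. of_int (Poly_Mapping.lookup f m) * (of_bool (i = fst (h m)) * of_bool (j = snd (h m))) * (x $ i * x $ j))"
    by (simp add: q_def sum_distrib_right)
  also have "\<dots> = (\<Sum>m\<in>Poly_Mapping.keys f. \<Sum>i\<in>UNIV. \<Sum>j\<in>UNIV. of_int (Poly_Mapping.lookup f m) * (of_bool (i = fst (h m)) * of_bool (j = snd (h m))) * (x $ i * x $ j))"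
    by (subst sum.swap[of _ "Poly_Mapping.keys f"], subst sum.swap[of _ "Poly_Mapping.keys f"]) simp
  also have "\<dots> = (\<Sum>m\<in>Poly_Mapping.keys f. of_int (Poly_Mapping.lookup f m) * (x $ fst (h m) * x $ snd (h m)))"
  proof (rule sum.cong[OF refl])
    fix m
    have "(\<Sum>i\<in>UNIV. \<Sum>j\<in>UNIV. of_int (Poly_Mapping.lookup f m) * (of_bool (i = fst (h m)) * of_bool (j = snd (h m))) * (x $ i * x $ j))
       = (\<Sum>i\<in>UNIV. \<Sum>j\<in>UNIV. if j = snd (h m) then (if i = fst (h m) then of_int (Poly_Mapping.lookup f m) * (x $ i * x $ j) else 0) else 0)"
      by (intro sum.cong refl) simp
    also have "\<dots> = of_int (Poly_Mapping.lookup f m) * (x $ fst (h m) * x $ snd (h m))" by simp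
    finally show "(\<Sum>i\<in>UNIV. \<Sum>j\<in>UNIV. of_int (Poly_Mapping.lookup f m) * (of_bool (i = fst (h m)) * of_bool (j = snd (h m))) * (x $ i * x $ j))
       = of_int (Poly_Mapping.lookup f m) * (x $ fst (h m) * x $ snd (h m))" .
  qed
  also have "\<dots> = poly_eval f x" unfolding poly_eval_def
  proof (rule sum.cong[OF refl])
    fix m assume m: "m \<in> Poly_Mapping.keys f"
    have "(\<Prod>k\<in>UNIV. (x $ k) ^ Poly_Mapping.lookup m k) = x $ fst (h m) * x $ snd (h m)"
      unfolding h[OF m] by (rule prod_power_of_bool)
    then show "of_int (Poly_Mapping.lookup f m) * (x $ fst (h m) * x $ snd (h m)) = of_int (Poly_Mapping.lookup f m) * (\<Prod>k\<in>UNIV. (x $ k) ^ Poly_Mapping.lookup m k)" by simp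
  qed
  finally show ?thesis by simp
qed

lemma quadratic_form_matrix:
  fixes f :: "('n::finite \<Rightarrow>\<^sub>0 nat) \<Rightarrow>\<^sub>0 int"
  assumes "quadratic_form f"
  shows "\<exists>q. (\<forall>x :: int ^ 'n. poly_eval f x = (\<Sum>i\<in>UNIV. \<Sum>j\<in>UNIV. of_int (q i j) * (x $ i * x $ j))) \<and>
    (\<forall>x :: rat ^ 'n. poly_eval f x = (\<Sum>i\<in>UNIV. \<Sum>j\<in>UNIV. of_int (q i j) * (x $ i * x $ j)))"
proof -
  have "\<forall>m\<in>Poly_Mapping.keys f. \<exists>h. \<forall>k. Poly_Mapping.lookup m k = of_bool (k = fst h) + of_bool (k = snd h)"
    using assms monomial_degree_2 unfolding quadratic_form_def by fastforce
  then obtain h where h: "\<And>m k. m \<in> Poly_Mapping.keys f \<Longrightarrow> Poly_Mapping.lookup m k = of_bool (k = fst (h m)) + of_bool (k = snd (h m))"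
    using bchoice by metis
  define q where "q i j = (\<Sum>m\<in>Poly_Mapping.keys f. Poly_Mapping.lookup f m * (of_bool (i = fst (h m)) * of_bool (j = snd (h m))))" for i j
  show ?thesis
    by (intro exI[of _ q] conjI allI; rule poly_eval_degree_2[OF h q_def])
qed

lemma common_denominator:
  fixes g :: "'b::finite \<Rightarrow> rat"
  obtains \<Delta> :: int and r where "\<Delta> \<noteq> 0" "\<And>i. of_int \<Delta> * g i = of_int (r i)"
proof -
  define \<Delta> where "\<Delta> = (\<Prod>i\<in>UNIV. snd (quotient_of (g i)))"
  have "\<exists>r. of_int \<Delta> * g i = of_int r" for i
  proof -
    obtain n d where nd: "quotient_of (g i) = (n, d)" by (cases "quotient_of (g i)") auto
    have d0: "d > 0" using quotient_of_denom_pos[OF nd] .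
    have "d dvd \<Delta>" unfolding \<Delta>_def using dvd_prodI[of UNIV i "\<lambda>i. snd (quotient_of (g i))"] nd by simp
    then obtain e where e: "\<Delta> = d * e" by (elim dvdE)
    have "of_int \<Delta> * g i = of_int (e * n)" unfolding quotient_of_div[OF nd] e using d0 by simp
    then show ?thesis by blast
  qed
  then obtain r where r: "\<And>i. of_int \<Delta> * g i = of_int (r i)" by metis
  have "snd (quotient_of (g i)) \<noteq> 0" for i using quotient_of_denom_pos'[of "g i"] by simp
  then have "\<Delta> \<noteq> 0" unfolding \<Delta>_def by simp
  then show ?thesis using that r by blast
qed

text \<open>By nondegeneracy the Gram matrix of the polar form has trivial kernel over the
  rationals, hence a left inverse, and clearing denominators makes it integral. Nondegeneracy enters
  the arguments above through this identity: it yields the injectivity of \<open>wv q\<close> and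
  nonsingularity modulo every prime that does not divide \<open>\<Delta>\<close>.\<close>

lemma nondegenerate_gram_inverse:
  fixes f :: "('n::finite \<Rightarrow>\<^sub>0 nat) \<Rightarrow>\<^sub>0 int" and q :: "'n \<Rightarrow> 'n \<Rightarrow> int"
  assumes nd: "nondegenerate f"
    and q: "\<And>x :: rat ^ 'n. poly_eval f x = (\<Sum>i\<in>UNIV. \<Sum>j\<in>UNIV. of_int (q i j) * (x $ i * x $ j))"
  shows "\<exists>\<Delta> Rm. \<Delta> \<noteq> 0 \<and> (\<forall>x i. \<Delta> * x i = (\<Sum>j\<in>UNIV. Rm i j * wv q x j))"
proof -
  define G :: "rat ^ 'n ^ 'n" where "G = (\<chi> j i. of_int (q i j + q j i))"
  have Gv: "(G *v x) $ j = (\<Sum>i\<in>UNIV. of_int (q i j + q j i) * x $ i)" for x j by (simp add: matrix_vector_mult_def G_def)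
  have pol: "polar_form f x y = (\<Sum>j\<in>UNIV. (G *v x) $ j * y $ j)" for x y
  proof -
    have "polar_form f x y = (\<Sum>i\<in>UNIV. \<Sum>j\<in>UNIV. of_int (q i j) * (x $ i * y $ j)) + (\<Sum>i\<in>UNIV. \<Sum>j\<in>UNIV. of_int (q i j) * (y $ i * x $ j))"
      unfolding polar_form_def q by (simp add: algebra_simps sum.distrib)
    also have "(\<Sum>i\<in>UNIV. \<Sum>j\<in>UNIV. of_int (q i j) * (x $ i * y $ j)) = (\<Sum>j\<in>UNIV. \<Sum>i\<in>UNIV. of_int (q i j) * (x $ i * y $ j))" by (rule sum.swap)
    finally have "polar_form f x y = (\<Sum>j\<in>UNIV. \<Sum>i\<in>UNIV. of_int (q i j + q j i) * x $ i * y $ j)"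
      by (simp add: sum.distrib[symmetric] algebra_simps)
    then show ?thesis unfolding Gv sum_distrib_right .
  qed
  have "\<forall>x. G *v x = 0 \<longrightarrow> x = 0"
  proof (intro allI impI)
    fix x assume "G *v x = 0"
    then have "\<forall>y. polar_form f x y = 0" by (simp add: pol)
    then show "x = 0" using nd unfolding nondegenerate_def by blast
  qed
  then obtain H where H: "H ** G = mat 1" unfolding matrix_left_invertible_ker[symmetric] by blast
  obtain \<Delta> r where r: "\<Delta> \<noteq> 0" "\<And>p. of_int \<Delta> * (case p of (i, j) \<Rightarrow> H $ i $ j) = of_int (r p)"
    using common_denominator[of "\<lambda>(i, j). H $ i $ j"] by blast
  have "\<Delta> * x i = (\<Sum>j\<in>UNIV. r (i, j) * wv q x j)" for x i
  proof -
    define X :: "rat ^ 'n" where "X = (\<chi> i. of_int (x i))"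
    have "H *v (G *v X) = X" by (simp add: matrix_vector_mul_assoc H)
    then have "of_int \<Delta> * X $ i = of_int \<Delta> * (H *v (G *v X)) $ i" by simp
    also have "\<dots> = (\<Sum>j\<in>UNIV. of_int \<Delta> * (H $ i $ j) * (G *v X) $ j)" by (simp add: matrix_vector_mult_def sum_distrib_left mult.assoc)
    also have "\<dots> = (\<Sum>j\<in>UNIV. of_int (r (i, j)) * of_int (wv q x j))"
    proof (rule sum.cong[OF refl])
      fix j
      have "(G *v X) $ j = of_int (wv q x j)" unfolding Gv wv_def by (simp add: X_def)
      moreover have "of_int \<Delta> * (H $ i $ j) = of_int (r (i, j))" using r(2)[of "(i, j)"] by simp
      ultimately show "of_int \<Delta> * (H $ i $ j) * (G *v X) $ j = of_int (r (i, j)) * of_int (wv q x j)" by simp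
    qed
    finally have "(of_int (\<Delta> * x i) :: rat) = of_int (\<Sum>j\<in>UNIV. r (i, j) * wv q x j)" by (simp add: X_def)
    then show ?thesis by (simp only: of_int_eq_iff)
  qed
  then show ?thesis using r(1) by (intro exI[of _ \<Delta>] exI[of _ "\<lambda>i j. r (i, j)"]) blast
qed

theorem theorem1p12:
  fixes f :: "('n::finite \<Rightarrow>\<^sub>0 nat) \<Rightarrow>\<^sub>0 int"
  assumes "quadratic_form f" and "nondegenerate f"
  shows "convergent (density_ratio (nonzero_values f)) \<and> form_density f \<in> \<rat>"
proof -
  obtain q :: "'n \<Rightarrow> 'n \<Rightarrow> int" where q: "\<And>x :: int ^ 'n. poly_eval f x = (\<Sum>i\<in>UNIV. \<Sum>j\<in>UNIV. of_int (q i j) * (x $ i * x $ j))"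
    "\<And>x :: rat ^ 'n. poly_eval f x = (\<Sum>i\<in>UNIV. \<Sum>j\<in>UNIV. of_int (q i j) * (x $ i * x $ j))"
    using quadratic_form_matrix[OF assms(1)] by blast
  obtain \<Delta> Rm where inv: "\<Delta> \<noteq> 0" "\<And>x i. \<Delta> * x i = (\<Sum>j\<in>UNIV. Rm i j * wv q x j)"
    using nondegenerate_gram_inverse[OF assms(2) q(2)] by blast
  define q' where "q' i j = - q i j" for i j
  have qf': "qf q' x = - qf q x" for x by (simp add: qf_def q'_def sum_negf)
  have wv': "wv q' x j = - wv q x j" for x j
  proof -
    have "wv q' x j = (\<Sum>i\<in>UNIV. - ((q i j + q j i) * x i))" unfolding wv_def q'_def by (rule sum.cong) (auto simp: algebra_simps)
    then show ?thesis by (simp add: wv_def sum_negf)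
  qed
  have inv': "\<Delta> * x i = (\<Sum>j\<in>UNIV. - Rm i j * wv q' x j)" for x i using inv(2)[of x i] by (simp add: wv')
  obtain \<delta> where \<delta>: "\<delta> \<in> \<rat>" "(\<lambda>N. real (card (pos_values q \<inter> {1..N})) / real N) \<longlonglongrightarrow> \<delta>"
    using rational_density_pos_values[OF inv(2,1)] by blast
  obtain \<delta>' where \<delta>': "\<delta>' \<in> \<rat>" "(\<lambda>N. real (card (pos_values q' \<inter> {1..N})) / real N) \<longlonglongrightarrow> \<delta>'"
    using rational_density_pos_values[OF inv' inv(1)] by blast
  define S where "S = nonzero_values f"
  have pq: "poly_eval f x = qf q (\<lambda>i. x $ i)" for x :: "int ^ 'n" unfolding q(1) qf_def by (simp add: mult.assoc)
  have S: "z \<in> S \<longleftrightarrow> z \<noteq> 0 \<and> z \<in> range (qf q)" for z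
  proof -
    have "z \<in> range (qf q)" if "z \<in> range (\<lambda>x :: int ^ 'n. poly_eval f x)" using that by (auto simp: pq)
    moreover have "z \<in> range (\<lambda>x :: int ^ 'n. poly_eval f x)" if z: "z \<in> range (qf q)"
    proof -
      obtain x where "z = qf q x" using z by blast
      then have "z = poly_eval f (vec_lambda x)" by (simp add: pq)
      then show ?thesis by blast
    qed
    ultimately show ?thesis unfolding S_def nonzero_values_def by blast
  qed
  have S0: "0 \<notin> S" by (simp add: S)
  have neg: "- z \<in> range (qf q) \<longleftrightarrow> z \<in> range (qf q')" for z
  proof
    assume "- z \<in> range (qf q)"
    then obtain x where "- z = qf q x" by blast
    then have "z = qf q' x" by (simp add: qf')
    then show "z \<in> range (qf q')" by blast
  qed (auto simp: qf')
  have pos: "card (S \<inter> {1..int N}) = card (pos_values q \<inter> {1..N})" for N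
  proof (rule bij_betw_same_card[symmetric])
    show "bij_betw int (pos_values q \<inter> {1..N}) (S \<inter> {1..int N})"
    proof (rule bij_betw_byWitness[where f' = nat])
      show "int ` (pos_values q \<inter> {1..N}) \<subseteq> S \<inter> {1..int N}" by (auto simp: pos_values_def S)
      show "nat ` (S \<inter> {1..int N}) \<subseteq> pos_values q \<inter> {1..N}" by (auto simp: pos_values_def S)
    qed auto
  qed
  have ngv: "card (S \<inter> {- int N..-1}) = card (pos_values q' \<inter> {1..N})" for N
  proof (rule bij_betw_same_card[symmetric])
    show "bij_betw (\<lambda>d. - int d) (pos_values q' \<inter> {1..N}) (S \<inter> {- int N..-1})"
    proof (rule bij_betw_byWitness[where f' = "\<lambda>z. nat (- z)"])
      show "(\<lambda>d. - int d) ` (pos_values q' \<inter> {1..N}) \<subseteq> S \<inter> {- int N..-1}"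
      proof
        fix z assume "z \<in> (\<lambda>d. - int d) ` (pos_values q' \<inter> {1..N})"
        then obtain d where d: "z = - int d" "d > 0" "int d \<in> range (qf q')" "d \<in> {1..N}" unfolding pos_values_def by blast
        have "z \<in> S" unfolding S d(1) neg using d by simp
        then show "z \<in> S \<inter> {- int N..-1}" using d by simp
      qed
      show "(\<lambda>z. nat (- z)) ` (S \<inter> {- int N..-1}) \<subseteq> pos_values q' \<inter> {1..N}"
      proof
        fix d assume "d \<in> (\<lambda>z. nat (- z)) ` (S \<inter> {- int N..-1})"
        then obtain z where z: "d = nat (- z)" "z \<in> S" "z \<in> {- int N..-1}" by blast
        have "int d = - z" using z by simp
        then have "int d \<in> range (qf q')" unfolding neg[symmetric] using z(2) S by simp
        moreover have "1 \<le> d \<and> d \<le> N" using z \<open>int d = - z\<close> by auto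
        ultimately show "d \<in> pos_values q' \<inter> {1..N}" by (simp add: pos_values_def)
      qed
    qed auto
  qed
  have both: "card (S \<inter> {- int N..int N}) = card (S \<inter> {1..int N}) + card (S \<inter> {- int N..-1})" for N
  proof -
    have "S \<inter> {- int N..int N} = (S \<inter> {1..int N}) \<union> (S \<inter> {- int N..-1})"
    proof
      show "S \<inter> {- int N..int N} \<subseteq> (S \<inter> {1..int N}) \<union> (S \<inter> {- int N..-1})"
      proof
        fix z assume z: "z \<in> S \<inter> {- int N..int N}"
        then have "z \<noteq> 0" using S0 by blast
        then show "z \<in> (S \<inter> {1..int N}) \<union> (S \<inter> {- int N..-1})" using z by auto
      qed
    qed auto
    then show ?thesis by (simp add: card_Un_disjoint[of "S \<inter> {1..int N}" "S \<inter> {- int N..-1}"] disjoint_iff)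
  qed
  have "\<exists>l\<in>\<rat>. density_ratio S \<longlonglongrightarrow> l"
  proof -
    consider "positive_set S" | "\<not> positive_set S" "negative_set S" | "\<not> positive_set S" "\<not> negative_set S" by blast
    then show ?thesis
    proof cases
      case 1
      have "density_ratio S = (\<lambda>N. real (card (pos_values q \<inter> {1..N})) / real N)" by (rule ext) (simp add: density_ratio_def 1 pos)
      then show ?thesis using \<delta> by auto
    next
      case 2
      have "density_ratio S = (\<lambda>N. real (card (pos_values q' \<inter> {1..N})) / real N)" by (rule ext) (simp add: density_ratio_def 2 ngv)
      then show ?thesis using \<delta>' by auto
    next
      case 3
      have "density_ratio S = (\<lambda>N. (real (card (pos_values q \<inter> {1..N})) / real N + real (card (pos_values q' \<inter> {1..N})) / real N) / 2)"
        by (rule ext) (simp add: density_ratio_def 3 both pos ngv add_divide_distrib)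
      moreover have "(\<lambda>N. (real (card (pos_values q \<inter> {1..N})) / real N + real (card (pos_values q' \<inter> {1..N})) / real N) / 2) \<longlonglongrightarrow> (\<delta> + \<delta>') / 2"
        by (intro tendsto_divide tendsto_add \<delta>(2) \<delta>'(2) tendsto_const) simp
      moreover have "(\<delta> + \<delta>') / 2 \<in> \<rat>" using \<delta>(1) \<delta>'(1) by simp
      ultimately show ?thesis by auto
    qed
  qed
  then obtain l where "l \<in> \<rat>" "density_ratio S \<longlonglongrightarrow> l" by blast
  then show ?thesis unfolding form_density_def int_density_def S_def[symmetric] using limI convergentI by blast
qed

end
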